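(* Let $(X,d)$ be a uniformly locally finite metric space, and let $\mathcal{G}=\mathcal{G}(X,d)$ be its coarse groupoid. The comparison map $\alpha_0 \colon H_0(\mathcal{G}; \mathbb{Z}) \to K_0(C^*_r(\mathcal{G}))$ is injective. Moreover, if $(X,d)$ is coarsely connected, then $\alpha_0$ is split injective (that is, it admits a left inverse group homomorphism).
   Context: A metric space $(X,d)$ is uniformly locally finite if for every $R\ge 0$ there is $N$ with $|B_R(x)|\le N$ for all $x\in X$. It is coarsely connected if there is $R\ge0$ such that any $x,y\in X$ are joined by a finite sequence $x=x_0,x_1,\dots,x_{n+1}=y$ in $X$ with $d(x_i,x_{i+1})\le R$ for all $i$. Coarse groupoid: call $E\subset X\times X$ an entourage if $\sup_{(x,y)\in E}d(x,y)<\infty$. Let $\overline{E}$ be the closure of $E$ in the Stone–Čech compactification $\beta(X\times X)$ of the discrete space $X \times X$. Then $\mathcal{G}(X,d)=\bigcup_E\overline{E}$ (union over all entourages) with the weak topology (a set is open iff its intersection with each $\overline{E}$ is open in $\overline{E}$); the operations of the pair groupoid $X\times X$ extend continuously and make $\mathcal{G}(X,d)$ a Hausdorff, principal, ample (étale with totally disconnected unit space) groupoid with compact unit space $\mathcal{G}^{(0)}=\beta X$. $C^*_r(\mathcal{G})$ is the reduced groupoid $C^*$-algebra; it is canonically isomorphic to the uniform Roe algebra $C^*_u(X)$, the norm closure in $\mathcal{B}(\ell^2(X))$ of the operators $T$ with $\sup\{d(x,y)\mid\langle T\delta_x,\delta_y\rangle\neq0\}<\infty$, in such a way that $C(\beta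 X)$ corresponds to the diagonal operators $\ell^\infty(X)$. $H_*(\mathcal{G};\mathbb{Z})$ denotes Crainic–Moerdijk groupoid homology; $H_0(\mathcal{G};\mathbb{Z})$ is the quotient of $C(\mathcal{G}^{(0)},\mathbb{Z})$ by the image of $s_*-r_*\colon C_c(\mathcal{G},\mathbb{Z})\to C(\mathcal{G}^{(0)},\mathbb{Z})$, where $s_*(f)(u)=\sum_{s(\gamma)=u}f(\gamma)$ and $r_*(f)(u)=\sum_{r(\gamma)=u}f(\gamma)$. Canonically, $H_0(\mathcal{G}(X,d);\mathbb{Z})$ is the uniformly finite homology group $H^{\mathrm{uf}}_0(X;\mathbb{Z})=\ell^\infty(X,\mathbb{Z})/\operatorname{im}\partial_1$, where $\partial_1(f)(x)=\sum_{y}f(y,x)-\sum_y f(x,y)$ for bounded $f\colon X\times X\to\mathbb{Z}$ supported on an entourage. The $0$th comparison map $\alpha_0\colon H_0(\mathcal{G};\mathbb{Z})\to K_0(C^*_r(\mathcal{G}))$ is the homomorphism induced on the quotient by the map $K_0(C(\mathcal{G}^{(0)}))=C(\mathcal{G}^{(0)},\mathbb{Z})\to K_0(C^*_r(\mathcal{G}))$ coming from the inclusion $C(\mathcal{G}^{(0)})\hookrightarrow C^*_r(\mathcal{G})$ (this map vanishes on the image of $s_*-r_*$). *)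

theory Defs
  imports "HOL-Analysis.Analysis" "HOL-Algebra.Coset" "HOL-Algebra.Ring"
begin

section \<open>Coarse geometry\<close>

definition uniformly_locally_finite :: "'a set \<Rightarrow> ('a \<Rightarrow> 'a \<Rightarrow> real) \<Rightarrow> bool" where
  "uniformly_locally_finite X d \<longleftrightarrow>
     (\<forall>R\<ge>0. \<exists>N::nat. \<forall>x\<in>X. finite (Metric_space.mcball X d x R) \<and> card (Metric_space.mcball X d x R) \<le> N)"

definition coarsely_connected :: "'a set \<Rightarrow> ('a \<Rightarrow> 'a \<Rightarrow> real) \<Rightarrow> bool" where
  "coarsely_connected X d \<longleftrightarrow>
     (\<exists>R\<ge>0. \<forall>x\<in>X. \<forall>y\<in>X. \<exists>(n::nat) (p::nat \<Rightarrow> 'a).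
        p 0 = x \<and> p (Suc n) = y \<and> (\<forall>i\<le>Suc n. p i \<in> X) \<and> (\<forall>i\<le>n. d (p i) (p (Suc i)) \<le> R))"

definition entourage :: "'a set \<Rightarrow> ('a \<Rightarrow> 'a \<Rightarrow> real) \<Rightarrow> ('a \<times> 'a) set \<Rightarrow> bool" where
  "entourage X d E \<longleftrightarrow> E \<subseteq> X \<times> X \<and> (\<exists>R. \<forall>(x, y)\<in>E. d x y \<le> R)"


section \<open>The Stone--Cech compactification of a discrete set\<close>

text \<open>The Stone--Cech compactification of a discrete set \<open>S\<close> is the space of ultrafilters on \<open>S\<close>.
  Ultrafilters on \<open>S\<close> are represented as filters on the ambient type below \<^term>\<open>principal S\<close>, and
  a point \<open>x\<close> of \<open>S\<close> is identified with \<^term>\<open>principal {x}\<close>.\<close>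

definition ultrafilter :: "'a filter \<Rightarrow> bool" where
  "ultrafilter F \<longleftrightarrow> F \<noteq> bot \<and> (\<forall>P. eventually P F \<or> eventually (\<lambda>x. \<not> P x) F)"

definition stone_cech :: "'a set \<Rightarrow> 'a filter topology" where
  "stone_cech S = topology_generated_by
     ((\<lambda>A. {F. ultrafilter F \<and> F \<le> principal S \<and> eventually (\<lambda>x. x \<in> A) F}) ` Pow S)"

lemma topspace_stone_cech: "topspace (stone_cech S) = {F. ultrafilter F \<and> F \<le> principal S}"
  unfolding stone_cech_def by (auto simp: le_principal)

lemma principal_in_stone_cech: "x \<in> S \<Longrightarrow> principal {x} \<in> topspace (stone_cech S)"
  by (auto simp: topspace_stone_cech ultrafilter_def eventually_principal principal_eq_bot_iff)


section \<open>Topological groupoids and homology in degree zero\<close>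

text \<open>The unit space is kept as a separate space, with \<open>gident\<close> embedding it into the arrows.
  A product \<open>gmult g h\<close> is meaningful when \<open>src g = rng h\<close>.\<close>

record ('g, 'u) top_groupoid =
  arrows :: "'g topology"
  unit_space :: "'u topology"
  rng :: "'g \<Rightarrow> 'u"
  src :: "'g \<Rightarrow> 'u"
  gmult :: "'g \<Rightarrow> 'g \<Rightarrow> 'g"
  ginv :: "'g \<Rightarrow> 'g"
  gident :: "'u \<Rightarrow> 'g"

text \<open>Functions on a space \<open>Y\<close> are total functions vanishing outside \<open>topspace Y\<close>.
  The type \<^typ>\<open>int\<close> carries the discrete topology.\<close>

definition cfun :: "'y topology \<Rightarrow> ('y \<Rightarrow> 'b::{topological_space, zero}) set" where
  "cfun Y = {f. continuous_map Y euclidean f \<and> (\<forall>y. y \<notin> topspace Y \<longrightarrow> f y = 0)}"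

definition cfun_c :: "'y topology \<Rightarrow> ('y \<Rightarrow> 'b::{topological_space, zero}) set" where
  "cfun_c Y = {f \<in> cfun Y. compactin Y (Y closure_of {y. f y \<noteq> 0})}"

definition cfun_group :: "'y topology \<Rightarrow> ('y \<Rightarrow> int) monoid" where
  "cfun_group Y = \<lparr>carrier = cfun Y, mult = (\<lambda>f g y. f y + g y), one = (\<lambda>_. 0)\<rparr>"

text \<open>Fibrewise summation along \<open>p\<close>, used for \<open>p = src G\<close> and \<open>p = rng G\<close>. For an etale groupoid and
  \<open>f \<in> cfun_c (arrows G)\<close> only finitely many summands are nonzero.\<close>

definition fibre_sum :: "('g, 'u) top_groupoid \<Rightarrow> ('g \<Rightarrow> 'u) \<Rightarrow> ('g \<Rightarrow> int) \<Rightarrow> 'u \<Rightarrow> int" where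
  "fibre_sum G p f u = (\<Sum>\<gamma> | \<gamma> \<in> topspace (arrows G) \<and> p \<gamma> = u \<and> f \<gamma> \<noteq> 0. f \<gamma>)"

definition H0_boundaries :: "('g, 'u) top_groupoid \<Rightarrow> ('u \<Rightarrow> int) set" where
  "H0_boundaries G =
     (\<lambda>f u. fibre_sum G (src G) f u - fibre_sum G (rng G) f u) ` cfun_c (arrows G)"

text \<open>\<open>H\<^sub>0(G; \<int>)\<close>, for a groupoid with compact unit space.\<close>

definition H0 :: "('g, 'u) top_groupoid \<Rightarrow> ('u \<Rightarrow> int) set monoid" where
  "H0 G = cfun_group (unit_space G) Mod H0_boundaries G"


section \<open>The coarse groupoid\<close>

definition entourage_closure :: "'a set \<Rightarrow> ('a \<times> 'a) set \<Rightarrow> ('a \<times> 'a) filter set" where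
  "entourage_closure X E = stone_cech (X \<times> X) closure_of ((\<lambda>e. principal {e}) ` E)"

definition coarse_arrows :: "'a set \<Rightarrow> ('a \<Rightarrow> 'a \<Rightarrow> real) \<Rightarrow> ('a \<times> 'a) filter topology" where
  "coarse_arrows X d = topology (\<lambda>U.
     U \<subseteq> (\<Union>E\<in>Collect (entourage X d). entourage_closure X E) \<and>
     (\<forall>E. entourage X d E \<longrightarrow>
        openin (subtopology (stone_cech (X \<times> X)) (entourage_closure X E)) (U \<inter> entourage_closure X E)))"

text \<open>Pushing ultrafilters forward along a map of discrete sets is its continuous extension. The
  product of \<open>g\<close> and \<open>h\<close> is the image, under the multiplication \<open>((x, y), (y, z)) \<mapsto> (x, z)\<close>, of the
  product filter of \<open>g\<close> and \<open>h\<close> restricted to the composable pairs; equivalently it is the filter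
  generated by the relational composites \<open>B O C\<close> with \<open>B\<close> in \<open>g\<close> and \<open>C\<close> in \<open>h\<close>.\<close>

definition coarse_groupoid ::
    "'a set \<Rightarrow> ('a \<Rightarrow> 'a \<Rightarrow> real) \<Rightarrow> (('a \<times> 'a) filter, 'a filter) top_groupoid" where
  "coarse_groupoid X d =
     \<lparr>arrows = coarse_arrows X d,
      unit_space = stone_cech X,
      rng = filtermap fst,
      src = filtermap snd,
      gmult = (\<lambda>g h. filtermap (\<lambda>((x, y), (y', z)). (x, z))
                 (inf (g \<times>\<^sub>F h) (principal {((x, y), (y', z)) | x y y' z. y = y'}))),
      ginv = filtermap prod.swap,
      gident = filtermap (\<lambda>x. (x, x))\<rparr>"

lemma openin_coarse_arrows:
  "openin (coarse_arrows X d) U \<longleftrightarrow>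
     U \<subseteq> (\<Union>E\<in>Collect (entourage X d). entourage_closure X E) \<and>
     (\<forall>E. entourage X d E \<longrightarrow>
        openin (subtopology (stone_cech (X \<times> X)) (entourage_closure X E)) (U \<inter> entourage_closure X E))"
    (is "_ \<longleftrightarrow> ?P U")
proof -
  have "istopology ?P"
    unfolding istopology_def
  proof (intro conjI allI impI)
    fix S T assume S: "?P S" and T: "?P T"
    show "S \<inter> T \<subseteq> (\<Union>E\<in>Collect (entourage X d). entourage_closure X E)"
      using S by blast
    fix E assume E: "entourage X d E"
    have "S \<inter> T \<inter> entourage_closure X E
        = (S \<inter> entourage_closure X E) \<inter> (T \<inter> entourage_closure X E)" by blast
    then show "openin (subtopology (stone_cech (X \<times> X)) (entourage_closure X E))
        (S \<inter> T \<inter> entourage_closure X E)"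
      using S T E by (metis openin_Int)
  next
    fix K assume K: "\<forall>S\<in>K. ?P S"
    show "\<Union>K \<subseteq> (\<Union>E\<in>Collect (entourage X d). entourage_closure X E)"
      using K by blast
    fix E assume E: "entourage X d E"
    have eq: "\<Union>K \<inter> entourage_closure X E = \<Union>((\<lambda>S. S \<inter> entourage_closure X E) ` K)" by blast
    show "openin (subtopology (stone_cech (X \<times> X)) (entourage_closure X E))
        (\<Union>K \<inter> entourage_closure X E)"
      unfolding eq by (rule openin_Union) (use K E in blast)
  qed
  then show ?thesis
    unfolding coarse_arrows_def by (simp add: topology_inverse')
qed

lemma coarse_groupoid_extends_pair_groupoid:
  "rng (coarse_groupoid X d) (principal {(x, y)}) = principal {x}"
  "src (coarse_groupoid X d) (principal {(x, y)}) = principal {y}"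
  "gmult (coarse_groupoid X d) (principal {(x, y)}) (principal {(y, z)}) = principal {(x, z)}"
  "ginv (coarse_groupoid X d) (principal {(x, y)}) = principal {(y, x)}"
  "gident (coarse_groupoid X d) (principal {x}) = principal {(x, x)}"
  by (auto simp: coarse_groupoid_def filtermap_principal principal_prod_principal)


section \<open>The Hilbert space of square-summable functions\<close>

typedef 'i ell2 = "{f :: 'i \<Rightarrow> complex. (\<lambda>i. (norm (f i))\<^sup>2) summable_on UNIV}"
  morphisms ell2_apply Abs_ell2
  by (rule exI[of _ "\<lambda>_. 0"]) simp

setup_lifting type_definition_ell2

lemma ell2_inner_summable:
  fixes f g :: "'i \<Rightarrow> complex"
  assumes "(\<lambda>i. (norm (f i))\<^sup>2) summable_on UNIV" "(\<lambda>i. (norm (g i))\<^sup>2) summable_on UNIV"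
  shows "(\<lambda>i. f i \<bullet> g i) summable_on UNIV"
proof -
  have "(\<lambda>i. (norm (f i))\<^sup>2 + (norm (g i))\<^sup>2) summable_on UNIV"
    using assms by (rule summable_on_add)
  then have "(\<lambda>i. norm (f i \<bullet> g i)) summable_on UNIV"
  proof (rule summable_on_comparison_test)
    fix i
    have "norm (f i \<bullet> g i) \<le> norm (f i) * norm (g i)"
      by (simp add: Cauchy_Schwarz_ineq2)
    also have "\<dots> \<le> (norm (f i))\<^sup>2 + (norm (g i))\<^sup>2"
      using sum_squares_bound[of "norm (f i)" "norm (g i)"]
        mult_nonneg_nonneg[OF norm_ge_zero norm_ge_zero, of "f i" "g i"] by linarith
    finally show "norm (f i \<bullet> g i) \<le> (norm (f i))\<^sup>2 + (norm (g i))\<^sup>2" .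
  qed simp
  then show ?thesis
    by (rule abs_summable_summable)
qed

lemma ell2_add_summable:
  fixes f g :: "'i \<Rightarrow> complex"
  assumes "(\<lambda>i. (norm (f i))\<^sup>2) summable_on UNIV" "(\<lambda>i. (norm (g i))\<^sup>2) summable_on UNIV"
  shows "(\<lambda>i. (norm (f i + g i))\<^sup>2) summable_on UNIV"
proof -
  have "(\<lambda>i. (norm (f i))\<^sup>2 + (norm (g i))\<^sup>2 + 2 * (f i \<bullet> g i)) summable_on UNIV"
    by (intro summable_on_add summable_on_cmult_right ell2_inner_summable assms)
  moreover have "(norm (f i + g i))\<^sup>2 = (norm (f i))\<^sup>2 + (norm (g i))\<^sup>2 + 2 * (f i \<bullet> g i)" for i
    using dot_norm[of "f i" "g i"] by argo
  ultimately show ?thesis by simp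
qed

instantiation ell2 :: (type) real_vector
begin

lift_definition zero_ell2 :: "'a ell2" is "\<lambda>_. 0" by simp

lift_definition plus_ell2 :: "'a ell2 \<Rightarrow> 'a ell2 \<Rightarrow> 'a ell2" is "\<lambda>f g i. f i + g i"
  by (simp add: ell2_add_summable)

lift_definition uminus_ell2 :: "'a ell2 \<Rightarrow> 'a ell2" is "\<lambda>f i. - f i" by simp

lift_definition minus_ell2 :: "'a ell2 \<Rightarrow> 'a ell2 \<Rightarrow> 'a ell2" is "\<lambda>f g i. f i - g i"
  subgoal for f g
    using ell2_add_summable[of f "\<lambda>i. - g i"] by simp
  done

lift_definition scaleR_ell2 :: "real \<Rightarrow> 'a ell2 \<Rightarrow> 'a ell2" is "\<lambda>r f i. r *\<^sub>R f i"
  by (simp add: power_mult_distrib summable_on_cmult_right)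

instance
  by standard (transfer; simp add: algebra_simps)+

end

instantiation ell2 :: (type) real_inner
begin

lift_definition inner_ell2 :: "'a ell2 \<Rightarrow> 'a ell2 \<Rightarrow> real" is "\<lambda>f g. \<Sum>\<^sub>\<infinity>i. f i \<bullet> g i" .

definition norm_ell2 :: "'a ell2 \<Rightarrow> real" where "norm_ell2 x = sqrt (x \<bullet> x)"

definition dist_ell2 :: "'a ell2 \<Rightarrow> 'a ell2 \<Rightarrow> real" where "dist_ell2 x y = norm (x - y)"

definition sgn_ell2 :: "'a ell2 \<Rightarrow> 'a ell2" where "sgn_ell2 x = x /\<^sub>R norm x"

definition uniformity_ell2 :: "('a ell2 \<times> 'a ell2) filter" where
  "uniformity_ell2 = (INF e\<in>{0<..}. principal {(x, y). dist x y < e})"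

definition open_ell2 :: "'a ell2 set \<Rightarrow> bool" where
  "open_ell2 U \<longleftrightarrow> (\<forall>x\<in>U. \<forall>\<^sub>F (x', y) in uniformity. x' = x \<longrightarrow> y \<in> U)"

instance
proof
  fix x y z :: "'a ell2" and r :: real
  show "dist x y = norm (x - y)" by (rule dist_ell2_def)
  show "sgn x = x /\<^sub>R norm x" by (rule sgn_ell2_def)
  show "norm x = sqrt (x \<bullet> x)" by (rule norm_ell2_def)
  show "(uniformity :: ('a ell2 \<times> 'a ell2) filter) = (INF e\<in>{0<..}. principal {(x, y). dist x y < e})"
    by (rule uniformity_ell2_def)
  show "open U \<longleftrightarrow> (\<forall>x\<in>U. \<forall>\<^sub>F (x', y) in uniformity. x' = x \<longrightarrow> y \<in> U)" for U :: "'a ell2 set"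
    by (rule open_ell2_def)
  show "x \<bullet> y = y \<bullet> x" by transfer (simp add: inner_commute)
  show "(x + y) \<bullet> z = x \<bullet> z + y \<bullet> z"
    by transfer (simp add: inner_add_left infsum_add ell2_inner_summable)
  show "(r *\<^sub>R x) \<bullet> y = r * (x \<bullet> y)"
    by transfer (simp add: infsum_cmult_right')
  show "0 \<le> x \<bullet> x" by transfer (simp add: infsum_nonneg)
  show "x \<bullet> x = 0 \<longleftrightarrow> x = 0"
  proof
    have s: "(\<lambda>i. ell2_apply x i \<bullet> ell2_apply x i) summable_on UNIV"
      using ell2_apply[of x] by (simp add: power2_norm_eq_inner)
    assume "x \<bullet> x = 0"
    then have "(\<Sum>\<^sub>\<infinity>i. ell2_apply x i \<bullet> ell2_apply x i) = 0"
      by (simp add: inner_ell2.rep_eq)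
    then have "ell2_apply x i \<bullet> ell2_apply x i = 0" for i
      using nonneg_infsum_le_0D[OF _ s] by simp
    then have "ell2_apply x = ell2_apply 0"
      by (simp add: zero_ell2.rep_eq fun_eq_iff)
    then show "x = 0"
      by (simp add: ell2_apply_inject)
  next
    assume "x = 0"
    then show "x \<bullet> x = 0"
      by (simp add: inner_ell2.rep_eq zero_ell2.rep_eq)
  qed
qed

end

text \<open>The inner product of the class \<^class>\<open>real_inner\<close> is the real part of the complex one.\<close>

definition cinner_ell2 :: "'i ell2 \<Rightarrow> 'i ell2 \<Rightarrow> complex" where
  "cinner_ell2 \<xi> \<eta> = (\<Sum>\<^sub>\<infinity>i. ell2_apply \<xi> i * cnj (ell2_apply \<eta> i))"

definition adjoint_op :: "('i ell2 \<Rightarrow>\<^sub>L 'i ell2) \<Rightarrow> 'i ell2 \<Rightarrow>\<^sub>L 'i ell2" where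
  "adjoint_op T = (THE S :: 'i ell2 \<Rightarrow>\<^sub>L 'i ell2. \<forall>\<xi> \<eta>. cinner_ell2 (T \<xi>) \<eta> = cinner_ell2 \<xi> (S \<eta>))"


section \<open>Algebras with involution and the reduced groupoid algebra\<close>

record 'a star_ring = "'a ring" +
  star :: "'a \<Rightarrow> 'a"

definition cfun_algebra :: "'y topology \<Rightarrow> ('y \<Rightarrow> complex) star_ring" where
  "cfun_algebra Y =
     \<lparr>carrier = cfun Y, mult = (\<lambda>f g y. f y * g y), one = (\<lambda>y. if y \<in> topspace Y then 1 else 0),
      zero = (\<lambda>_. 0), add = (\<lambda>f g y. f y + g y), star = (\<lambda>f y. cnj (f y))\<rparr>"

text \<open>The regular representations on the source fibres \<open>\<ell>\<^sup>2(G\<^sub>u)\<close> are assembled into a single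
  representation on \<open>\<ell>\<^sup>2(G)\<close>, the direct sum of all \<open>\<ell>\<^sup>2(G\<^sub>u)\<close>; its operator norm is the supremum over
  all units \<open>u\<close> of the norms on the fibres. Here \<open>\<ell>\<^sup>2(G)\<close> is the subspace of the square-summable
  functions on the ambient type that are supported on the arrows, and all operators below vanish
  on its orthogonal complement. For an etale groupoid and \<open>f \<in> cfun_c (arrows G)\<close> the sum has
  only finitely many nonzero terms.\<close>

definition regular_rep :: "('g, 'u) top_groupoid \<Rightarrow> ('g \<Rightarrow> complex) \<Rightarrow> 'g ell2 \<Rightarrow>\<^sub>L 'g ell2" where
  "regular_rep G f = Blinfun (\<lambda>\<xi>. Abs_ell2 (\<lambda>\<gamma>.
     if \<gamma> \<in> topspace (arrows G)
     then \<Sum>\<^sub>\<infinity>\<eta>\<in>{\<eta> \<in> topspace (arrows G). src G \<eta> = src G \<gamma>}. f (gmult G \<gamma> (ginv G \<eta>)) * ell2_apply \<xi> \<eta>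
     else 0))"

definition unit_extension :: "('g, 'u) top_groupoid \<Rightarrow> ('u \<Rightarrow> complex) \<Rightarrow> 'g \<Rightarrow> complex" where
  "unit_extension G h \<gamma> = (if \<gamma> \<in> gident G ` topspace (unit_space G) then h (src G \<gamma>) else 0)"

text \<open>The inclusion of the continuous functions on the (compact) unit space.\<close>

definition unit_inclusion :: "('g, 'u) top_groupoid \<Rightarrow> ('u \<Rightarrow> complex) \<Rightarrow> 'g ell2 \<Rightarrow>\<^sub>L 'g ell2" where
  "unit_inclusion G h = regular_rep G (unit_extension G h)"

definition reduced_algebra :: "('g, 'u) top_groupoid \<Rightarrow> ('g ell2 \<Rightarrow>\<^sub>L 'g ell2) star_ring" where
  "reduced_algebra G =
     \<lparr>carrier = closure (regular_rep G ` cfun_c (arrows G)),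
      mult = (\<lambda>S T. S o\<^sub>L T),
      one = unit_inclusion G (\<lambda>u. if u \<in> topspace (unit_space G) then 1 else 0),
      zero = 0, add = (\<lambda>S T. S + T), star = adjoint_op\<rparr>"


section \<open>\<open>K\<^sub>0\<close> of a unital \<open>C\<^sup>*\<close>-algebra\<close>

text \<open>Matrices of size \<open>m\<close> by \<open>n\<close> vanish outside the index range. A projection of size \<open>n\<close> is a pair
  of \<open>n\<close> and a matrix.\<close>

definition mats :: "('a, 'b) star_ring_scheme \<Rightarrow> nat \<Rightarrow> nat \<Rightarrow> (nat \<Rightarrow> nat \<Rightarrow> 'a) set" where
  "mats R m n = {a. (\<forall>i<m. \<forall>j<n. a i j \<in> carrier R) \<and> (\<forall>i j. \<not> (i < m \<and> j < n) \<longrightarrow> a i j = \<zero>\<^bsub>R\<^esub>)}"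

definition mat_mul ::
    "('a, 'b) star_ring_scheme \<Rightarrow> nat \<Rightarrow> (nat \<Rightarrow> nat \<Rightarrow> 'a) \<Rightarrow> (nat \<Rightarrow> nat \<Rightarrow> 'a) \<Rightarrow> nat \<Rightarrow> nat \<Rightarrow> 'a" where
  "mat_mul R n a b = (\<lambda>i j. finsum R (\<lambda>k. a i k \<otimes>\<^bsub>R\<^esub> b k j) {..<n})"

definition mat_star :: "('a, 'b) star_ring_scheme \<Rightarrow> (nat \<Rightarrow> nat \<Rightarrow> 'a) \<Rightarrow> nat \<Rightarrow> nat \<Rightarrow> 'a" where
  "mat_star R a = (\<lambda>i j. star R (a j i))"

definition projections :: "('a, 'b) star_ring_scheme \<Rightarrow> (nat \<times> (nat \<Rightarrow> nat \<Rightarrow> 'a)) set" where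
  "projections R = {(n, p). p \<in> mats R n n \<and> mat_star R p = p \<and> mat_mul R n p p = p}"

text \<open>Murray--von Neumann equivalence: \<open>p = v\<^sup>*v\<close> and \<open>q = vv\<^sup>*\<close> for a rectangular matrix \<open>v\<close>.\<close>

definition mvn_rel ::
    "('a, 'b) star_ring_scheme \<Rightarrow> ((nat \<times> (nat \<Rightarrow> nat \<Rightarrow> 'a)) \<times> (nat \<times> (nat \<Rightarrow> nat \<Rightarrow> 'a))) set" where
  "mvn_rel R = {((n, p), (m, q)). (n, p) \<in> projections R \<and> (m, q) \<in> projections R \<and>
     (\<exists>v\<in>mats R m n. p = mat_mul R m (mat_star R v) v \<and> q = mat_mul R n v (mat_star R v))}"

fun dsum ::
    "('a, 'b) star_ring_scheme \<Rightarrow> nat \<times> (nat \<Rightarrow> nat \<Rightarrow> 'a) \<Rightarrow> nat \<times> (nat \<Rightarrow> nat \<Rightarrow> 'a) \<Rightarrow> nat \<times> (nat \<Rightarrow> nat \<Rightarrow> 'a)" where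
  "dsum R (n, p) (m, q) =
     (n + m, \<lambda>i j. if i < n \<and> j < n then p i j else if n \<le> i \<and> n \<le> j then q (i - n) (j - n) else \<zero>\<^bsub>R\<^esub>)"

definition proj_monoid :: "('a, 'b) star_ring_scheme \<Rightarrow> (nat \<times> (nat \<Rightarrow> nat \<Rightarrow> 'a)) set monoid" where
  "proj_monoid R =
     \<lparr>carrier = projections R // mvn_rel R,
      mult = (\<lambda>A B. \<Union>a\<in>A. \<Union>b\<in>B. mvn_rel R `` {dsum R a b}),
      one = mvn_rel R `` {(0, \<lambda>_ _. \<zero>\<^bsub>R\<^esub>)}\<rparr>"

text \<open>The Grothendieck group of a commutative monoid; the class of \<open>(a, b)\<close> is the formal
  difference of \<open>a\<close> and \<open>b\<close>.\<close>

definition groth_rel :: "('m, 'b) monoid_scheme \<Rightarrow> (('m \<times> 'm) \<times> ('m \<times> 'm)) set" where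
  "groth_rel M = {((a, b), (a', b')).
     a \<in> carrier M \<and> b \<in> carrier M \<and> a' \<in> carrier M \<and> b' \<in> carrier M \<and>
     (\<exists>c\<in>carrier M. a \<otimes>\<^bsub>M\<^esub> b' \<otimes>\<^bsub>M\<^esub> c = a' \<otimes>\<^bsub>M\<^esub> b \<otimes>\<^bsub>M\<^esub> c)}"

definition grothendieck_group :: "('m, 'b) monoid_scheme \<Rightarrow> ('m \<times> 'm) set monoid" where
  "grothendieck_group M =
     \<lparr>carrier = (carrier M \<times> carrier M) // groth_rel M,
      mult = (\<lambda>A B. \<Union>(a, b)\<in>A. \<Union>(a', b')\<in>B. groth_rel M `` {(a \<otimes>\<^bsub>M\<^esub> a', b \<otimes>\<^bsub>M\<^esub> b')}),
      one = groth_rel M `` {(\<one>\<^bsub>M\<^esub>, \<one>\<^bsub>M\<^esub>)}\<rparr>"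

definition K0 ::
    "('a, 'b) star_ring_scheme \<Rightarrow> ((nat \<times> (nat \<Rightarrow> nat \<Rightarrow> 'a)) set \<times> (nat \<times> (nat \<Rightarrow> nat \<Rightarrow> 'a)) set) set monoid" where
  "K0 R = grothendieck_group (proj_monoid R)"

text \<open>Functoriality of \<open>K\<^sub>0\<close> for a homomorphism \<open>\<phi>\<close> from \<open>R\<close> to \<open>S\<close>. On equivalence classes, the
  unions range over a single class.\<close>

definition proj_monoid_map ::
    "('c, 'd) star_ring_scheme \<Rightarrow> ('a \<Rightarrow> 'c) \<Rightarrow> (nat \<times> (nat \<Rightarrow> nat \<Rightarrow> 'a)) set \<Rightarrow> (nat \<times> (nat \<Rightarrow> nat \<Rightarrow> 'c)) set" where
  "proj_monoid_map S \<phi> A =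
     (\<Union>(n, p)\<in>A. mvn_rel S `` {(n, \<lambda>i j. if i < n \<and> j < n then \<phi> (p i j) else \<zero>\<^bsub>S\<^esub>)})"

definition K0_map ::
    "('c, 'd) star_ring_scheme \<Rightarrow> ('a \<Rightarrow> 'c) \<Rightarrow>
     ((nat \<times> (nat \<Rightarrow> nat \<Rightarrow> 'a)) set \<times> (nat \<times> (nat \<Rightarrow> nat \<Rightarrow> 'a)) set) set \<Rightarrow>
     ((nat \<times> (nat \<Rightarrow> nat \<Rightarrow> 'c)) set \<times> (nat \<times> (nat \<Rightarrow> nat \<Rightarrow> 'c)) set) set" where
  "K0_map S \<phi> C =
     (\<Union>(A, B)\<in>C. groth_rel (proj_monoid S) `` {(proj_monoid_map S \<phi> A, proj_monoid_map S \<phi> B)})"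


section \<open>The comparison map\<close>

text \<open>For \<open>Y\<close> compact and totally disconnected, the canonical isomorphism from \<open>C(Y, \<int>)\<close> to
  \<open>K\<^sub>0(C(Y))\<close> sends a nonnegative \<open>f\<close> to the class of a projection whose rank at each \<open>y\<close> is \<open>f y\<close>;
  in particular the indicator function of a clopen set is sent to the class of that indicator.
  For general \<open>f\<close> one takes the difference of the positive and negative parts. The projection
  below is diagonal, with the indicators of \<open>{f \<ge> 1}\<close>, \<open>{f \<ge> 2}\<close>, up to \<open>{f \<ge> max f}\<close> as entries;
  its rank at \<open>y\<close> is \<open>nat (f y)\<close>.\<close>

definition rank_proj :: "'y topology \<Rightarrow> ('y \<Rightarrow> int) \<Rightarrow> nat \<times> (nat \<Rightarrow> nat \<Rightarrow> 'y \<Rightarrow> complex)" where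
  "rank_proj Y f =
     (let n = Max (insert 0 ((\<lambda>y. nat (f y)) ` topspace Y))
      in (n, \<lambda>i j y. if i = j \<and> i < n \<and> y \<in> topspace Y \<and> int i < f y then 1 else 0))"

definition cfun_to_K0 ::
    "'y topology \<Rightarrow> ('y \<Rightarrow> int) \<Rightarrow>
     ((nat \<times> (nat \<Rightarrow> nat \<Rightarrow> 'y \<Rightarrow> complex)) set \<times> (nat \<times> (nat \<Rightarrow> nat \<Rightarrow> 'y \<Rightarrow> complex)) set) set" where
  "cfun_to_K0 Y f = groth_rel (proj_monoid (cfun_algebra Y)) ``
     {(mvn_rel (cfun_algebra Y) `` {rank_proj Y f},
       mvn_rel (cfun_algebra Y) `` {rank_proj Y (\<lambda>y. - f y)})}"

text \<open>The map induced on the quotient group \<open>H0 G\<close>, whose elements are cosets \<open>c\<close>.\<close>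

definition comparison_map ::
    "('g, 'u) top_groupoid \<Rightarrow> ('u \<Rightarrow> int) set \<Rightarrow>
     ((nat \<times> (nat \<Rightarrow> nat \<Rightarrow> 'g ell2 \<Rightarrow>\<^sub>L 'g ell2)) set \<times> (nat \<times> (nat \<Rightarrow> nat \<Rightarrow> 'g ell2 \<Rightarrow>\<^sub>L 'g ell2)) set) set" where
  "comparison_map G c =
     the_elem ((\<lambda>f. K0_map (reduced_algebra G) (unit_inclusion G) (cfun_to_K0 (unit_space G) f)) ` c)"

end

theory Submission
  imports Defs "HOL-Algebra.Generated_Groups"
begin

text \<open>The group \<open>H0\<close> is \<open>\<int>\<close>-valued bounded functions on \<open>X\<close> modulo boundaries of bounded chains
  of finite width. A function \<open>v \<ge> 0\<close> corresponds to the diagonal projection supported on its level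
  set \<open>{(x, i). i < v x}\<close>. Suppose a partial isometry over the reduced algebra carries one such
  projection to another. Approximating it by a band matrix that is still injective and counting
  dimensions gives Hall's condition, first in one direction and then in the other, and the
  Cantor-Bernstein argument yields a bijection of the level sets with bounded displacement. Its
  displacement chain shows that the two functions are homologous; hence the comparison map is
  injective.

  If \<open>X\<close> is infinite and coarsely connected, any point mass is pushed outside a given finite set, so
  by compactness every bounded function is divisible by every \<open>n > 0\<close> modulo boundaries. Thus the
  image of \<open>H0\<close> is a divisible subgroup, which is a direct summand. If \<open>X\<close> is finite and nonempty,
  \<open>H0\<close> is \<open>\<int>\<close> and the matrix trace is a left inverse.\<close>

section \<open>The Grothendieck group of projections over a ring with involution\<close>

text \<open>Equality in \<open>K0\<close> is only stable: two diagonal projections become equivalent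
  after an unknown projection is added. Adding the complement of that projection turns the unknown
  summand into an identity matrix, which is again diagonal (the level set of a constant), and
  constants cancel in homology. So everything reduces to an honest equivalence of diagonal
  projections. The obstacle there is that the implementing partial isometry is merely a norm limit
  of operators of finite width and may move basis vectors arbitrarily far. Hall's theorem needs only
  the injectivity of an approximant, at the price of two injections in place of one bijection.

  Conversely, homologous functions have equal classes, so the kernel of the map from C(\<beta>X, Z)
  to \<open>K0\<close> is exactly the group of boundaries.

  Ultrafilters are reduced to points in a uniform way: by uniform local finiteness every arrow with
  source u is the germ at u of a map x -> t x, so each groupoid formula is the limit along u of a
  formula for matrices over X. The source fibre over a single point of X is a copy of X, on which
  the regular representation is the band matrix itself.\<close>

locale star_algebra = ring R for R :: "('a, 'b) star_ring_scheme" (structure) +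
  assumes star_closed [simp]: "a \<in> carrier R \<Longrightarrow> star R a \<in> carrier R"
    and star_star [simp]: "a \<in> carrier R \<Longrightarrow> star R (star R a) = a"
    and star_add: "a \<in> carrier R \<Longrightarrow> b \<in> carrier R \<Longrightarrow> star R (a \<oplus> b) = star R a \<oplus> star R b"
    and star_mult: "a \<in> carrier R \<Longrightarrow> b \<in> carrier R \<Longrightarrow> star R (a \<otimes> b) = star R b \<otimes> star R a"
begin

lemma star_zero [simp]: "star R \<zero> = \<zero>"
  by (metis add.r_cancel_one' star_add star_closed zero_closed r_zero)

lemma star_one [simp]: "star R \<one> = \<one>"
  by (metis one_closed r_one star_closed star_mult star_star)

lemma star_uminus: "a \<in> carrier R \<Longrightarrow> star R (\<ominus> a) = \<ominus> star R a"
  by (metis a_inv_closed minus_equality l_neg star_add star_closed star_zero)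

lemma star_finsum:
  assumes "finite A" "\<And>i. i \<in> A \<Longrightarrow> f i \<in> carrier R"
  shows "star R (\<Oplus>i\<in>A. f i) = (\<Oplus>i\<in>A. star R (f i))"
  using assms
proof (induction A rule: finite_induct)
  case (insert x F)
  then show ?case by (subst finsum_insert; (subst finsum_insert)?; auto simp: star_add)
qed simp

lemma finsum_swap:
  assumes "finite A" "finite B" "\<And>i j. i \<in> A \<Longrightarrow> j \<in> B \<Longrightarrow> f i j \<in> carrier R"
  shows "(\<Oplus>i\<in>A. \<Oplus>j\<in>B. f i j) = (\<Oplus>j\<in>B. \<Oplus>i\<in>A. f i j)"
  using assms(1,3)
proof (induction A rule: finite_induct)
  case (insert x F)
  have "(\<Oplus>j\<in>B. \<Oplus>i\<in>insert x F. f i j) = (\<Oplus>j\<in>B. f x j \<oplus> (\<Oplus>i\<in>F. f i j))"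
    using insert by (intro finsum_cong') (auto intro!: finsum_closed)
  also have "\<dots> = (\<Oplus>j\<in>B. f x j) \<oplus> (\<Oplus>j\<in>B. \<Oplus>i\<in>F. f i j)"
    using insert by (intro finsum_addf) (auto intro!: finsum_closed)
  finally show ?case
    using insert by (subst finsum_insert) (auto intro!: finsum_closed)
qed simp

section \<open>Rectangular matrices and Murray-von Neumann equivalence over a ring with
  involution\<close>

lemma mats_closed: "a \<in> mats R m n \<Longrightarrow> a i j \<in> carrier R"
  unfolding mats_def by (cases "i < m \<and> j < n") auto

lemma mats_zero: "a \<in> mats R m n \<Longrightarrow> \<not> (i < m \<and> j < n) \<Longrightarrow> a i j = \<zero>"
  unfolding mats_def by auto

lemma mats_eqI:
  assumes "a \<in> mats R m n" "b \<in> mats R m n" "\<And>i j. i < m \<Longrightarrow> j < n \<Longrightarrow> a i j = b i j"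
  shows "a = b"
proof (intro ext)
  fix i j show "a i j = b i j"
    using assms by (cases "i < m \<and> j < n") (auto simp: mats_zero)
qed

lemma mat_mul_mats:
  assumes "a \<in> mats R m n" "b \<in> mats R n k" shows "mat_mul R n a b \<in> mats R m k"
proof -
  have "mat_mul R n a b i j \<in> carrier R" for i j
    unfolding mat_mul_def using assms[THEN mats_closed] by (auto intro!: finsum_closed)
  moreover have "mat_mul R n a b i j = \<zero>" if "\<not> (i < m \<and> j < k)" for i j
    unfolding mat_mul_def using that assms
    by (intro add.finprod_one_eqI) (auto simp: mats_zero mats_closed)
  ultimately show ?thesis unfolding mats_def by blast
qed

lemma mat_star_mats: "a \<in> mats R m n \<Longrightarrow> mat_star R a \<in> mats R n m"
  unfolding mats_def mat_star_def by auto

lemma mat_star_star: "a \<in> mats R m n \<Longrightarrow> mat_star R (mat_star R a) = a"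
  unfolding mat_star_def by (auto simp: mats_closed)

lemma mat_star_mul:
  assumes "a \<in> mats R m n" "b \<in> mats R n k"
  shows "mat_star R (mat_mul R n a b) = mat_mul R n (mat_star R b) (mat_star R a)"
  unfolding mat_star_def mat_mul_def using assms
  by (auto intro!: ext finsum_cong' simp: star_finsum star_mult mats_closed)

lemma mat_mul_assoc:
  assumes a: "a \<in> mats R m n" and b: "b \<in> mats R n k" and c: "c \<in> mats R k l"
  shows "mat_mul R k (mat_mul R n a b) c = mat_mul R n a (mat_mul R k b c)"
proof (intro ext)
  fix i j
  note cl = mats_closed[OF a] mats_closed[OF b] mats_closed[OF c]
  have "mat_mul R k (mat_mul R n a b) c i j = (\<Oplus>s\<in>{..<k}. \<Oplus>r\<in>{..<n}. a i r \<otimes> b r s \<otimes> c s j)"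
    unfolding mat_mul_def using cl by (intro finsum_cong') (auto simp: finsum_ldistr)
  also have "\<dots> = (\<Oplus>r\<in>{..<n}. \<Oplus>s\<in>{..<k}. a i r \<otimes> b r s \<otimes> c s j)"
    using cl by (intro finsum_swap) auto
  also have "\<dots> = mat_mul R n a (mat_mul R k b c) i j"
    unfolding mat_mul_def using cl by (intro finsum_cong') (auto simp: finsum_rdistr m_assoc)
  finally show "mat_mul R k (mat_mul R n a b) c i j = mat_mul R n a (mat_mul R k b c) i j" .
qed

lemma projectionsD:
  assumes "(n, p) \<in> projections R"
  shows "p \<in> mats R n n" "mat_star R p = p" "mat_mul R n p p = p"
  using assms unfolding projections_def by auto

lemma mvn_relI:
  assumes "(n, p) \<in> projections R" "(m, q) \<in> projections R" "v \<in> mats R m n"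
    "p = mat_mul R m (mat_star R v) v" "q = mat_mul R n v (mat_star R v)"
  shows "((n, p), (m, q)) \<in> mvn_rel R"
  using assms unfolding mvn_rel_def by auto

text \<open>In a general ring with involution, star(v) v = p and v star(v) = q do not by themselves
  give v p = v; in a C*-algebra the norm gives it. Replacing v by v p repairs this: the new matrix
  implements the same equivalence and is supported on p and q, which is what makes composites
  collapse.\<close>

lemma mvn_relE:
  assumes "((n, p), (m, q)) \<in> mvn_rel R"
  obtains v where "(n, p) \<in> projections R" "(m, q) \<in> projections R" "v \<in> mats R m n"
    "p = mat_mul R m (mat_star R v) v" "q = mat_mul R n v (mat_star R v)"
    "mat_mul R n v p = v" "mat_mul R m q v = v"
proof -
  obtain v where v: "(n, p) \<in> projections R" "(m, q) \<in> projections R" "v \<in> mats R m n"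
    "p = mat_mul R m (mat_star R v) v" "q = mat_mul R n v (mat_star R v)"
    using assms unfolding mvn_rel_def by auto
  note M = mat_mul_mats mat_star_mats v(3)
  define w where "w = mat_mul R n v p"
  have p: "p \<in> mats R n n" "mat_star R p = p" "mat_mul R n p p = p" using v(1) projectionsD by auto
  have q: "q \<in> mats R m m" "mat_star R q = q" "mat_mul R m q q = q" using v(2) projectionsD by auto
  have w: "w \<in> mats R m n" unfolding w_def by (rule mat_mul_mats[OF v(3) p(1)])
  have ws: "mat_star R w = mat_mul R n p (mat_star R v)"
    unfolding w_def using mat_star_mul[OF v(3) p(1)] p(2) by simp
  have vs: "mat_star R v \<in> mats R n m" by (rule mat_star_mats[OF v(3)])
  have wp: "mat_mul R n w p = w"
    unfolding w_def using mat_mul_assoc[OF v(3) p(1) p(1)] p(3) by simp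
  \<comment> \<open>Both sides are v star(v) v, bracketed in the two possible ways.\<close>
  have qw: "mat_mul R n v p = mat_mul R m q v"
    using mat_mul_assoc[OF v(3) vs v(3)] v(4,5) by simp
  have qw2: "mat_mul R m q w = w"
    unfolding w_def qw using mat_mul_assoc[OF q(1) q(1) v(3)] q(3) by simp
  have "mat_mul R m (mat_star R w) w = mat_mul R n p (mat_mul R m (mat_star R v) w)"
    unfolding ws using mat_mul_assoc[OF p(1) vs w] .
  also have "mat_mul R m (mat_star R v) w = mat_mul R n p p"
    unfolding w_def using mat_mul_assoc[OF vs v(3) p(1)] v(4) by simp
  finally have 1: "mat_mul R m (mat_star R w) w = p" using p by simp
  have "mat_mul R n w (mat_star R w) = mat_mul R n (mat_mul R n w p) (mat_star R v)"
    unfolding ws using mat_mul_assoc[OF w p(1) vs] by simp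
  also have "\<dots> = mat_mul R m q q"
    unfolding wp unfolding w_def qw using mat_mul_assoc[OF q(1) v(3) vs] v(5) by simp
  finally have 2: "mat_mul R n w (mat_star R w) = q" using q by simp
  show ?thesis by (rule that[OF v(1,2) w 1[symmetric] 2[symmetric] wp qw2])
qed

lemma mvn_refl:
  assumes "a \<in> projections R" shows "(a, a) \<in> mvn_rel R"
proof -
  obtain n p where a: "a = (n, p)" by force
  show ?thesis using assms unfolding a
    by (intro mvn_relI[where v = p]) (auto simp: projectionsD)
qed

lemma mvn_sym:
  assumes "(a, b) \<in> mvn_rel R" shows "(b, a) \<in> mvn_rel R"
proof -
  obtain n p m q where ab: "a = (n, p)" "b = (m, q)" by force
  from assms obtain v where v: "(n, p) \<in> projections R" "(m, q) \<in> projections R" "v \<in> mats R m n"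
    "p = mat_mul R m (mat_star R v) v" "q = mat_mul R n v (mat_star R v)"
    unfolding ab by (rule mvn_relE)
  show ?thesis unfolding ab
    by (rule mvn_relI[OF v(2,1) mat_star_mats[OF v(3)]]) (simp_all add: mat_star_star[OF v(3)] v(4,5)[symmetric])
qed

text \<open>The composite w v implements the equivalence; the supports provided by
  \<open>mvn_relE\<close> give star(w) w v = q v = v and w q star(w) = w star(w) = r.\<close>

lemma mvn_trans:
  assumes "(a, b) \<in> mvn_rel R" "(b, c) \<in> mvn_rel R" shows "(a, c) \<in> mvn_rel R"
proof -
  obtain n p m q l r where abc: "a = (n, p)" "b = (m, q)" "c = (l, r)"
    by (metis surj_pair)
  from assms(1) obtain v where v: "(n, p) \<in> projections R" "(m, q) \<in> projections R" "v \<in> mats R m n"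
    "p = mat_mul R m (mat_star R v) v" "q = mat_mul R n v (mat_star R v)" "mat_mul R n v p = v" "mat_mul R m q v = v"
    unfolding abc by (rule mvn_relE)
  from assms(2) obtain w where w: "(m, q) \<in> projections R" "(l, r) \<in> projections R" "w \<in> mats R l m"
    "q = mat_mul R l (mat_star R w) w" "r = mat_mul R m w (mat_star R w)" "mat_mul R m w q = w" "mat_mul R l r w = w"
    unfolding abc by (rule mvn_relE)
  note vs = mat_star_mats[OF v(3)] note ws = mat_star_mats[OF w(3)]
  note wv = mat_mul_mats[OF w(3) v(3)]
  have st: "mat_star R (mat_mul R m w v) = mat_mul R m (mat_star R v) (mat_star R w)"
    by (rule mat_star_mul[OF w(3) v(3)])
  have "mat_mul R l (mat_mul R m (mat_star R v) (mat_star R w)) (mat_mul R m w v)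
      = mat_mul R m (mat_star R v) (mat_mul R l (mat_star R w) (mat_mul R m w v))"
    by (rule mat_mul_assoc[OF vs ws wv])
  also have "mat_mul R l (mat_star R w) (mat_mul R m w v) = v"
    using mat_mul_assoc[OF ws w(3) v(3)] w(4) v(7) by simp
  finally have 1: "p = mat_mul R l (mat_star R (mat_mul R m w v)) (mat_mul R m w v)"
    using v(4) st by simp
  have "mat_mul R n (mat_mul R m w v) (mat_mul R m (mat_star R v) (mat_star R w))
      = mat_mul R m w (mat_mul R n v (mat_mul R m (mat_star R v) (mat_star R w)))"
    by (rule mat_mul_assoc[OF w(3) v(3) mat_mul_mats[OF vs ws]])
  also have "mat_mul R n v (mat_mul R m (mat_star R v) (mat_star R w)) = mat_mul R m q (mat_star R w)"
    using mat_mul_assoc[OF v(3) vs ws] v(5) by simp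
  also have "mat_mul R m w (mat_mul R m q (mat_star R w)) = r"
    using mat_mul_assoc[OF w(3) projectionsD(1)[OF v(2)] ws] w(5,6) by simp
  finally have 2: "r = mat_mul R n (mat_mul R m w v) (mat_star R (mat_mul R m w v))"
    using st by simp
  show ?thesis unfolding abc by (rule mvn_relI[OF v(1) w(2) wv 1 2])
qed

lemma mvn_projections: "(a, b) \<in> mvn_rel R \<Longrightarrow> a \<in> projections R \<and> b \<in> projections R"
  unfolding mvn_rel_def by auto

lemma mvn_equiv: "equiv (projections R) (mvn_rel R)"
  by (rule equivI) (auto simp: refl_on_def sym_def trans_def dest: mvn_projections mvn_refl mvn_sym intro: mvn_trans)

text \<open>Unlike in \<open>dsum\<close>, the cut may sit at different row and column indices,
  because partial isometries between projections of different sizes are rectangular.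
  \<open>dsum\<close> is the case of square corners.\<close>

definition block :: "nat \<Rightarrow> nat \<Rightarrow> (nat \<Rightarrow> nat \<Rightarrow> 'a) \<Rightarrow> (nat \<Rightarrow> nat \<Rightarrow> 'a) \<Rightarrow> nat \<Rightarrow> nat \<Rightarrow> 'a" where
  "block m n a b = (\<lambda>i j. if i < m \<and> j < n then a i j
     else if m \<le> i \<and> n \<le> j then b (i - m) (j - n) else \<zero>)"

lemma dsum_block: "dsum R (n, p) (m, q) = (n + m, block n n p q)"
  by (simp add: block_def)

lemma block_mats:
  assumes "a \<in> mats R m n" "b \<in> mats R m' n'" shows "block m n a b \<in> mats R (m + m') (n + n')"
proof -
  have "block m n a b i j \<in> carrier R" for i j
    unfolding block_def using assms by (auto simp: mats_closed)
  moreover have "block m n a b i j = \<zero>" if "\<not> (i < m + m' \<and> j < n + n')" for i j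
    unfolding block_def using that by (auto intro!: mats_zero[OF assms(2)])
  ultimately show ?thesis unfolding mats_def by auto
qed

lemma finsum_split:
  assumes "\<And>i. f i \<in> carrier R"
  shows "(\<Oplus>i\<in>{..<n + k :: nat}. f i) = (\<Oplus>i\<in>{..<n}. f i) \<oplus> (\<Oplus>i\<in>{..<k}. f (n + i))"
proof -
  have "{..<n + k} = {..<n} \<union> (+) n ` {..<k}"
    unfolding image_add_atLeastLessThan lessThan_atLeast0 by auto
  then have "(\<Oplus>i\<in>{..<n + k}. f i) = (\<Oplus>i\<in>{..<n}. f i) \<oplus> (\<Oplus>i\<in>(+) n ` {..<k}. f i)"
    by (simp only:) (rule finsum_Un_disjoint; use assms in auto)
  also have "(\<Oplus>i\<in>(+) n ` {..<k}. f i) = (\<Oplus>i\<in>{..<k}. f (n + i))"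
    by (rule finsum_reindex) (auto simp: assms)
  finally show ?thesis .
qed

lemma block_mul:
  assumes "a \<in> mats R m n" "b \<in> mats R m' n'" "c \<in> mats R n k" "e \<in> mats R n' k'"
  shows "mat_mul R (n + n') (block m n a b) (block n k c e) = block m k (mat_mul R n a c) (mat_mul R n' b e)"
proof (intro ext)
  fix i j
  note cl = assms[THEN mats_closed]
  have B: "block m n a b i j \<in> carrier R" "block n k c e i j \<in> carrier R" for i j
    using cl by (auto simp: block_def)
  have "mat_mul R (n + n') (block m n a b) (block n k c e) i j
     = (\<Oplus>r\<in>{..<n}. block m n a b i r \<otimes> block n k c e r j)
     \<oplus> (\<Oplus>r\<in>{..<n'}. block m n a b i (n + r) \<otimes> block n k c e (n + r) j)"
    unfolding mat_mul_def by (rule finsum_split) (use B in auto)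
  also have "(\<Oplus>r\<in>{..<n}. block m n a b i r \<otimes> block n k c e r j)
      = (\<Oplus>r\<in>{..<n}. if i < m \<and> j < k then a i r \<otimes> c r j else \<zero>)"
    by (rule finsum_cong') (use cl in \<open>auto simp: block_def\<close>)
  also have "(\<Oplus>r\<in>{..<n'}. block m n a b i (n + r) \<otimes> block n k c e (n + r) j)
      = (\<Oplus>r\<in>{..<n'}. if m \<le> i \<and> k \<le> j then b (i - m) r \<otimes> e r (j - k) else \<zero>)"
    by (rule finsum_cong') (use cl in \<open>auto simp: block_def\<close>)
  finally show "mat_mul R (n + n') (block m n a b) (block n k c e) i j
      = block m k (mat_mul R n a c) (mat_mul R n' b e) i j"
    using cl unfolding block_def mat_mul_def by auto
qed

lemma block_star:
  assumes "a \<in> mats R m n" "b \<in> mats R m' n'"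
  shows "mat_star R (block m n a b) = block n m (mat_star R a) (mat_star R b)"
  unfolding mat_star_def block_def using assms by (auto simp: fun_eq_iff)

lemma dsum_projections:
  assumes "a \<in> projections R" "b \<in> projections R" shows "dsum R a b \<in> projections R"
proof -
  obtain n p m q where ab: "a = (n, p)" "b = (m, q)" by force
  note p = projectionsD[OF assms(1)[unfolded ab]] note q = projectionsD[OF assms(2)[unfolded ab]]
  have "mat_mul R (n + m) (block n n p q) (block n n p q) = block n n p q"
    using block_mul[OF p(1) q(1) p(1) q(1)] p q by simp
  then show ?thesis
    unfolding ab dsum_block projections_def
    using block_mats[OF p(1) q(1)] block_star[OF p(1) q(1)] p q by simp
qed

lemma dsum_mvn:
  assumes "(a, a') \<in> mvn_rel R" "(b, b') \<in> mvn_rel R"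
  shows "(dsum R a b, dsum R a' b') \<in> mvn_rel R"
proof -
  obtain n p m q n' p' m' q' where ab: "a = (n, p)" "b = (m, q)" "a' = (n', p')" "b' = (m', q')"
    by (metis surj_pair)
  from assms(1) obtain v where v: "v \<in> mats R n' n"
    "p = mat_mul R n' (mat_star R v) v" "p' = mat_mul R n v (mat_star R v)"
    unfolding ab by (rule mvn_relE)
  from assms(2) obtain w where w: "w \<in> mats R m' m"
    "q = mat_mul R m' (mat_star R w) w" "q' = mat_mul R m w (mat_star R w)"
    unfolding ab by (rule mvn_relE)
  note vs = mat_star_mats[OF v(1)] note ws = mat_star_mats[OF w(1)]
  have pr: "dsum R a b \<in> projections R" "dsum R a' b' \<in> projections R"
    using assms[THEN mvn_projections] by (auto intro: dsum_projections)
  show ?thesis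
    using pr unfolding ab dsum_block
  proof (rule mvn_relI)
    show "block n' n v w \<in> mats R (n' + m') (n + m)" by (rule block_mats[OF v(1) w(1)])
    show "block n n p q = mat_mul R (n' + m') (mat_star R (block n' n v w)) (block n' n v w)"
      using block_mul[OF vs ws v(1) w(1)] block_star[OF v(1) w(1)] v w by simp
    show "block n' n' p' q' = mat_mul R (n + m) (block n' n v w) (mat_star R (block n' n v w))"
      using block_mul[OF v(1) w(1) vs ws] block_star[OF v(1) w(1)] v w by simp
  qed
qed

lemma dsum_assoc: "dsum R (dsum R a b) c = dsum R a (dsum R b c)"
proof -
  obtain n p m q l r where abc: "a = (n, p)" "b = (m, q)" "c = (l, r)"
    by (metis surj_pair)
  show ?thesis unfolding abc by (auto simp: fun_eq_iff)
qed

lemma dsum_zero: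
  assumes "a \<in> projections R" shows "dsum R a (0, \<lambda>_ _. \<zero>) = a"
proof -
  obtain n p where a: "a = (n, p)" by force
  note p = projectionsD[OF assms[unfolded a]]
  show ?thesis unfolding a using p(1) by (auto simp: fun_eq_iff mats_zero)
qed

lemma zero_projection: "(0, \<lambda>_ _. \<zero>) \<in> projections R"
  unfolding projections_def mats_def mat_star_def mat_mul_def by simp

text \<open>The equivalence is implemented by p with its rows permuted, that is by u p for the
  permutation matrix u of \<sigma>: its source projection is p, and its range projection is p
  conjugated by u.\<close>

lemma mvn_reindex:
  assumes p: "(n, p) \<in> projections R" and \<sigma>: "bij_betw \<sigma> {..<n} {..<n}"
  shows "((n, p), (n, \<lambda>i j. if i < n \<and> j < n then p (\<sigma> i) (\<sigma> j) else \<zero>)) \<in> mvn_rel R"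
proof -
  note P = projectionsD[OF p]
  note cl = mats_closed[OF P(1)]
  have pp: "(\<Oplus>k\<in>{..<n}. p i k \<otimes> p k j) = p i j" for i j
    using P(3) unfolding mat_mul_def by (auto simp: fun_eq_iff)
  have sp: "star R (p i j) = p j i" for i j
    using P(2) unfolding mat_star_def by (auto simp: fun_eq_iff)
  have ri: "(\<Oplus>k\<in>{..<n}. f (\<sigma> k)) = (\<Oplus>k\<in>{..<n}. f k)" if "\<And>i. f i \<in> carrier R" for f
    using finsum_reindex[of f \<sigma> "{..<n}"] that \<sigma> by (auto simp: bij_betw_def)
  define v where "v = (\<lambda>i j. if i < n then p (\<sigma> i) j else \<zero>)"
  define q where "q = (\<lambda>i j. if i < n \<and> j < n then p (\<sigma> i) (\<sigma> j) else \<zero>)"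
  have vm: "v \<in> mats R n n" using P(1) cl unfolding v_def mats_def by auto
  have qm: "q \<in> mats R n n" using cl unfolding q_def mats_def by auto
  have 1: "p = mat_mul R n (mat_star R v) v"
  proof (rule mats_eqI[OF P(1)])
    show "mat_mul R n (mat_star R v) v \<in> mats R n n"
      by (rule mat_mul_mats[OF mat_star_mats[OF vm] vm])
    fix i j assume "i < n" "j < n"
    have "mat_mul R n (mat_star R v) v i j = (\<Oplus>k\<in>{..<n}. p i (\<sigma> k) \<otimes> p (\<sigma> k) j)"
      unfolding mat_mul_def mat_star_def v_def using cl sp by (intro finsum_cong') auto
    also have "\<dots> = p i j" using ri[of "\<lambda>k. p i k \<otimes> p k j"] pp cl by auto
    finally show "p i j = mat_mul R n (mat_star R v) v i j" by simp
  qed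
  have 2: "q = mat_mul R n v (mat_star R v)"
  proof (rule mats_eqI[OF qm])
    show "mat_mul R n v (mat_star R v) \<in> mats R n n"
      by (rule mat_mul_mats[OF vm mat_star_mats[OF vm]])
    fix i j assume "i < n" "j < n"
    then have "mat_mul R n v (mat_star R v) i j = (\<Oplus>k\<in>{..<n}. p (\<sigma> i) k \<otimes> p k (\<sigma> j))"
      unfolding mat_mul_def mat_star_def v_def using cl sp by (intro finsum_cong') auto
    then show "q i j = mat_mul R n v (mat_star R v) i j"
      using pp \<open>i < n\<close> \<open>j < n\<close> by (simp add: q_def)
  qed
  have sq: "mat_star R q = q"
    using mat_star_mul[OF vm mat_star_mats[OF vm]] mat_star_star[OF vm] 2 by simp
  have "mat_mul R n q q = q"
  proof (rule mats_eqI[OF mat_mul_mats[OF qm qm] qm])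
    fix i j assume ij: "i < n" "j < n"
    have "mat_mul R n q q i j = (\<Oplus>k\<in>{..<n}. p (\<sigma> i) (\<sigma> k) \<otimes> p (\<sigma> k) (\<sigma> j))"
      unfolding mat_mul_def q_def using cl ij by (intro finsum_cong') auto
    also have "\<dots> = p (\<sigma> i) (\<sigma> j)" using ri[of "\<lambda>k. p (\<sigma> i) k \<otimes> p k (\<sigma> j)"] pp cl by auto
    finally show "mat_mul R n q q i j = q i j" using ij by (simp add: q_def)
  qed
  then have "(n, q) \<in> projections R" using qm sq unfolding projections_def by auto
  from mvn_relI[OF p this vm 1 2] show ?thesis unfolding q_def .
qed

lemma dsum_commute:
  assumes "a \<in> projections R" "b \<in> projections R"
  shows "(dsum R a b, dsum R b a) \<in> mvn_rel R"
proof -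
  obtain n p m q where ab: "a = (n, p)" "b = (m, q)" by force
  note p = projectionsD[OF assms(1)[unfolded ab]] note q = projectionsD[OF assms(2)[unfolded ab]]
  \<comment> \<open>The first m indices are sent to the block of q, the remaining n to the block of
    p.\<close>
  define \<sigma> where "\<sigma> i = (if i < m then n + i else i - m)" for i
  have bij: "bij_betw \<sigma> {..<n + m} {..<n + m}"
    by (rule bij_betw_byWitness[where f' = "\<lambda>i. if i < n then m + i else i - n"]) (auto simp: \<sigma>_def)
  have "(n + m, block n n p q) \<in> projections R"
    using dsum_projections[OF assms] unfolding ab dsum_block .
  from mvn_reindex[OF this bij]
  have *: "((n + m, block n n p q), (n + m, \<lambda>i j. if i < n + m \<and> j < n + m then block n n p q (\<sigma> i) (\<sigma> j) else \<zero>)) \<in> mvn_rel R" .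
  have "(\<lambda>i j. if i < n + m \<and> j < n + m then block n n p q (\<sigma> i) (\<sigma> j) else \<zero>) = block m m q p"
  proof (intro ext)
    fix i j show "(if i < n + m \<and> j < n + m then block n n p q (\<sigma> i) (\<sigma> j) else \<zero>) = block m m q p i j"
      using mats_zero[OF p(1)] by (auto simp: block_def \<sigma>_def)
  qed
  then show ?thesis using * unfolding ab dsum_block by (simp add: add.commute)
qed

definition mat_one :: "nat \<Rightarrow> nat \<Rightarrow> nat \<Rightarrow> 'a" where
  "mat_one n = (\<lambda>i j. if i = j \<and> i < n then \<one> else \<zero>)"

lemma mat_one_mats: "mat_one n \<in> mats R n n"
  unfolding mat_one_def mats_def by auto

lemma mat_mul_one:
  assumes "a \<in> mats R n m" shows "mat_mul R n (mat_one n) a = a"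
proof (rule mats_eqI[OF mat_mul_mats[OF mat_one_mats assms] assms])
  fix i j assume "i < n" "j < m"
  have "mat_mul R n (mat_one n) a i j = (\<Oplus>k\<in>{..<n}. if i = k then a k j else \<zero>)"
    unfolding mat_mul_def mat_one_def using mats_closed[OF assms] by (intro finsum_cong') auto
  also have "\<dots> = a i j"
    using finsum_singleton[of i "{..<n}" "\<lambda>k. a k j"] \<open>i < n\<close> mats_closed[OF assms] by auto
  finally show "mat_mul R n (mat_one n) a i j = a i j" .
qed

lemma mat_one_star: "mat_star R (mat_one n) = mat_one n"
  unfolding mat_star_def mat_one_def by (auto simp: fun_eq_iff)

lemma mat_mul_one_right:
  assumes "a \<in> mats R m n" shows "mat_mul R n a (mat_one n) = a"
  using mat_mul_one[OF mat_star_mats[OF assms]] mat_star_mul[OF mat_one_mats mat_star_mats[OF assms]]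
  by (metis assms mat_one_star mat_star_star)

lemma mat_one_projection: "(n, mat_one n) \<in> projections R"
  unfolding projections_def using mat_one_mats mat_one_star mat_mul_one[OF mat_one_mats] by auto

text \<open>With q = 1 - p, the n by 2n row matrix v = (p q) does it: v star(v) = p + q = 1, and
  star(v) v is the block sum of p and q because p q = q p = 0.\<close>

lemma complement_mvn_one:
  assumes p: "(n, p) \<in> projections R"
  shows "\<exists>q. (n, q) \<in> projections R \<and> (dsum R (n, p) (n, q), (n, mat_one n)) \<in> mvn_rel R"
proof -
  note P = projectionsD[OF p]
  note cl = mats_closed[OF P(1)] mats_closed[OF mat_one_mats]
  define q where "q = (\<lambda>i j. mat_one n i j \<oplus> \<ominus> p i j)"
  have qm: "q \<in> mats R n n"
    using cl P(1) mat_one_mats[of n] unfolding q_def mats_def by (auto simp: mat_one_def)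
  have sp: "star R (p i j) = p j i" for i j
    using P(2) unfolding mat_star_def by (auto simp: fun_eq_iff)
  have sq: "mat_star R q = q"
    using mat_one_star cl sp unfolding q_def mat_star_def by (auto simp: fun_eq_iff star_add star_uminus)
  have neg: "(\<Oplus>k\<in>A. \<ominus> f k) = \<ominus> (\<Oplus>k\<in>A. f k)" if "finite A" "\<And>i. f i \<in> carrier R" for f :: "nat \<Rightarrow> 'a" and A
    using that by (induction A rule: finite_induct) (auto simp: minus_add)
  have aq: "mat_mul R n a q = (\<lambda>i j. a i j \<oplus> \<ominus> mat_mul R n a p i j)" if a: "a \<in> mats R n n" for a
  proof (intro ext)
    fix i j
    note ac = mats_closed[OF a]
    have "mat_mul R n a q i j = (\<Oplus>k\<in>{..<n}. a i k \<otimes> mat_one n k j \<oplus> \<ominus> (a i k \<otimes> p k j))"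
      unfolding mat_mul_def q_def using cl ac by (intro finsum_cong') (auto simp: r_distr r_minus)
    also have "\<dots> = mat_mul R n a (mat_one n) i j \<oplus> \<ominus> mat_mul R n a p i j"
      unfolding mat_mul_def using cl ac by (subst finsum_addf) (auto simp: neg)
    finally show "mat_mul R n a q i j = a i j \<oplus> \<ominus> mat_mul R n a p i j"
      by (simp add: mat_mul_one_right[OF a])
  qed
  have pq: "mat_mul R n p q = (\<lambda>_ _. \<zero>)"
    unfolding aq[OF P(1)] using P(3) cl by (auto simp: r_neg)
  have z: "(\<lambda>_ _. \<zero>) \<in> mats R n n" for n unfolding mats_def by auto
  have qp: "mat_mul R n q p = (\<lambda>_ _. \<zero>)"
    using mat_star_mul[OF P(1) qm] pq P(2) sq by (simp add: mat_star_def)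
  have qq: "mat_mul R n q q = q"
    unfolding aq[OF qm] qp using mats_closed[OF qm] by (auto simp: fun_eq_iff)
  have qpr: "(n, q) \<in> projections R" using qm sq qq unfolding projections_def by auto
  define v where "v = (\<lambda>i j. if j < n then p i j else q i (j - n))"
  have vm: "v \<in> mats R n (n + n)"
  proof -
    have "q i (j - n) = \<zero>" if "\<not> j < n + n" for i j using that by (intro mats_zero[OF qm]) auto
    then show ?thesis
      using P(1) mats_closed[OF P(1)] mats_closed[OF qm] mats_zero[OF qm] unfolding v_def mats_def by auto
  qed
  have vs: "mat_star R v = (\<lambda>i j. if i < n then p i j else q (i - n) j)"
    using P(2) sq unfolding v_def mat_star_def by (auto simp: fun_eq_iff)
  have v1: "v i k = p i k" "mat_star R v k j = p k j" if "k < n" for i j k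
    using that unfolding vs by (auto simp: v_def)
  have v2: "v i (n + k) = q i k" "mat_star R v (n + k) j = q k j" for i j k
    unfolding vs by (auto simp: v_def)
  have "mat_mul R (n + n) v (mat_star R v) = (\<lambda>i j. mat_mul R n p p i j \<oplus> mat_mul R n q q i j)"
  proof (intro ext)
    fix i j
    have "mat_mul R (n + n) v (mat_star R v) i j
       = (\<Oplus>k\<in>{..<n}. v i k \<otimes> mat_star R v k j) \<oplus> (\<Oplus>k\<in>{..<n}. v i (n + k) \<otimes> mat_star R v (n + k) j)"
      unfolding mat_mul_def by (rule finsum_split) (use mats_closed[OF vm] mats_closed[OF mat_star_mats[OF vm]] in auto)
    also have "(\<Oplus>k\<in>{..<n}. v i k \<otimes> mat_star R v k j) = mat_mul R n p p i j"
      unfolding mat_mul_def using cl by (intro finsum_cong') (auto simp: v1)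
    also have "(\<Oplus>k\<in>{..<n}. v i (n + k) \<otimes> mat_star R v (n + k) j) = mat_mul R n q q i j"
      unfolding mat_mul_def using mats_closed[OF qm] by (intro finsum_cong') (auto simp: v2)
    finally show "mat_mul R (n + n) v (mat_star R v) i j = mat_mul R n p p i j \<oplus> mat_mul R n q q i j" .
  qed
  also have "\<dots> = mat_one n"
    unfolding P(3) qq unfolding q_def
  proof (intro ext)
    fix i j
    have "p i j \<oplus> (mat_one n i j \<oplus> \<ominus> p i j) = mat_one n i j \<oplus> (p i j \<oplus> \<ominus> p i j)"
      using cl by (intro add.m_lcomm) auto
    then show "p i j \<oplus> (mat_one n i j \<oplus> \<ominus> p i j) = mat_one n i j" using cl by (auto simp: r_neg)
  qed
  finally have 1: "mat_one n = mat_mul R (n + n) v (mat_star R v)" by simp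
  have 2: "block n n p q = mat_mul R n (mat_star R v) v"
  proof (rule mats_eqI[OF block_mats[OF P(1) qm] mat_mul_mats[OF mat_star_mats[OF vm] vm]])
    fix i j assume "i < n + n" "j < n + n"
    let ?f = "if i < n then p else q" let ?g = "if j < n then p else q"
    let ?i = "if i < n then i else i - n" let ?j = "if j < n then j else j - n"
    have "mat_mul R n (mat_star R v) v i j = mat_mul R n ?f ?g ?i ?j"
      unfolding vs unfolding v_def mat_mul_def using cl mats_closed[OF qm] by (intro finsum_cong') auto
    also have "\<dots> = block n n p q i j"
      unfolding block_def using pq qp P(3) qq by (auto simp: fun_eq_iff)
    finally show "block n n p q i j = mat_mul R n (mat_star R v) v i j" by simp
  qed
  have "(dsum R (n, p) (n, q), (n, mat_one n)) \<in> mvn_rel R"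
    using dsum_projections[OF p qpr] unfolding dsum_block
    by (intro mvn_relI[OF _ mat_one_projection vm 2 1])
  with qpr show ?thesis by blast
qed

abbreviation pclass :: "nat \<times> (nat \<Rightarrow> nat \<Rightarrow> 'a) \<Rightarrow> (nat \<times> (nat \<Rightarrow> nat \<Rightarrow> 'a)) set" where
  "pclass a \<equiv> mvn_rel R `` {a}"

lemma pclass_eq_iff:
  "a \<in> projections R \<Longrightarrow> b \<in> projections R \<Longrightarrow> pclass a = pclass b \<longleftrightarrow> (a, b) \<in> mvn_rel R"
  by (rule eq_equiv_class_iff[OF mvn_equiv])

lemma pclass_carrier: "a \<in> projections R \<Longrightarrow> pclass a \<in> carrier (proj_monoid R)"
  unfolding proj_monoid_def by (auto intro: quotientI)

lemma proj_monoid_cases: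
  assumes "A \<in> carrier (proj_monoid R)" obtains a where "a \<in> projections R" "A = pclass a"
  using assms unfolding proj_monoid_def by (auto elim: quotientE)

text \<open>The multiplication of \<open>proj_monoid\<close> is a union over all representatives. By
  \<open>dsum_mvn\<close> each of them contributes the same class, and reflexivity makes the union
  nonempty.\<close>

lemma pclass_mult:
  assumes a: "a \<in> projections R" and b: "b \<in> projections R"
  shows "pclass a \<otimes>\<^bsub>proj_monoid R\<^esub> pclass b = pclass (dsum R a b)"
proof -
  have "pclass (dsum R a' b') = pclass (dsum R a b)" if "(a, a') \<in> mvn_rel R" "(b, b') \<in> mvn_rel R" for a' b'
    using dsum_mvn[OF that] equiv_class_eq[OF mvn_equiv] by metis
  then have "pclass (dsum R x y) = pclass (dsum R a b)" if "x \<in> pclass a" "y \<in> pclass b" for x y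
    using that by blast
  moreover have "a \<in> pclass a" "b \<in> pclass b" using a b by (auto intro: mvn_refl)
  ultimately have "(\<Union>x\<in>pclass a. \<Union>y\<in>pclass b. pclass (dsum R x y)) = pclass (dsum R a b)"
    by blast
  then show ?thesis unfolding proj_monoid_def by simp
qed

lemma pclass_one: "\<one>\<^bsub>proj_monoid R\<^esub> = pclass (0, \<lambda>_ _. \<zero>)"
  unfolding proj_monoid_def by simp

lemma proj_monoid_comm_monoid: "comm_monoid (proj_monoid R)"
proof (rule comm_monoidI)
  fix A B assume "A \<in> carrier (proj_monoid R)" "B \<in> carrier (proj_monoid R)"
  then obtain a b where ab: "a \<in> projections R" "A = pclass a" "b \<in> projections R" "B = pclass b"
    by (metis proj_monoid_cases)
  show "A \<otimes>\<^bsub>proj_monoid R\<^esub> B \<in> carrier (proj_monoid R)"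
    using ab by (simp add: pclass_mult pclass_carrier dsum_projections)
  show "A \<otimes>\<^bsub>proj_monoid R\<^esub> B = B \<otimes>\<^bsub>proj_monoid R\<^esub> A"
    using ab by (simp add: pclass_mult pclass_eq_iff dsum_projections dsum_commute)
  fix C assume "C \<in> carrier (proj_monoid R)"
  then obtain c where c: "c \<in> projections R" "C = pclass c" by (rule proj_monoid_cases)
  show "A \<otimes>\<^bsub>proj_monoid R\<^esub> B \<otimes>\<^bsub>proj_monoid R\<^esub> C = A \<otimes>\<^bsub>proj_monoid R\<^esub> (B \<otimes>\<^bsub>proj_monoid R\<^esub> C)"
    using ab c by (simp add: pclass_mult dsum_projections dsum_assoc)
next
  show "\<one>\<^bsub>proj_monoid R\<^esub> \<in> carrier (proj_monoid R)"
    by (simp add: pclass_one pclass_carrier zero_projection)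
  fix A assume "A \<in> carrier (proj_monoid R)"
  then obtain a where a: "a \<in> projections R" "A = pclass a" by (rule proj_monoid_cases)
  have "(dsum R (0, \<lambda>_ _. \<zero>) a, a) \<in> mvn_rel R"
    using dsum_commute[OF zero_projection a(1)] dsum_zero[OF a(1)] by simp
  then show "\<one>\<^bsub>proj_monoid R\<^esub> \<otimes>\<^bsub>proj_monoid R\<^esub> A = A"
    using a by (simp add: pclass_one pclass_mult zero_projection pclass_eq_iff dsum_projections)
qed

end

section \<open>The Grothendieck group of a commutative monoid\<close>

context comm_monoid
begin

lemma groth_equiv: "equiv (carrier G \<times> carrier G) (groth_rel G)"
proof (rule equivI)
  show "groth_rel G \<subseteq> (carrier G \<times> carrier G) \<times> (carrier G \<times> carrier G)"
    unfolding groth_rel_def by auto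
  show "refl_on (carrier G \<times> carrier G) (groth_rel G)"
    unfolding groth_rel_def refl_on_def by (auto intro!: bexI[of _ \<one>])
  show "sym (groth_rel G)"
  proof (rule symI)
    fix x y assume "(x, y) \<in> groth_rel G"
    then obtain a b a' b' c where "x = (a, b)" "y = (a', b')" "c \<in> carrier G"
      "a \<in> carrier G" "b \<in> carrier G" "a' \<in> carrier G" "b' \<in> carrier G" "a' \<otimes> b \<otimes> c = a \<otimes> b' \<otimes> c"
      unfolding groth_rel_def by auto
    then show "(y, x) \<in> groth_rel G" unfolding groth_rel_def by blast
  qed
  show "trans (groth_rel G)"
  proof (rule transI)
    fix x y z assume "(x, y) \<in> groth_rel G" "(y, z) \<in> groth_rel G"
    then obtain a b a' b' a'' b'' c c' where x: "x = (a, b)" and y: "y = (a', b')" and z: "z = (a'', b'')"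
      and cl: "a \<in> carrier G" "b \<in> carrier G" "a' \<in> carrier G" "b' \<in> carrier G" "a'' \<in> carrier G" "b'' \<in> carrier G"
      "c \<in> carrier G" "c' \<in> carrier G"
      and 1: "a \<otimes> b' \<otimes> c = a' \<otimes> b \<otimes> c" and 2: "a' \<otimes> b'' \<otimes> c' = a'' \<otimes> b' \<otimes> c'"
      unfolding groth_rel_def by auto
    \<comment> \<open>The middle component b' joins the two cancelling elements: it is the factor
      that lets the two hypotheses be applied one after the other.\<close>
    have "a \<otimes> b'' \<otimes> (b' \<otimes> c \<otimes> c') = (a \<otimes> b' \<otimes> c) \<otimes> (b'' \<otimes> c')"
      using cl by (simp add: m_ac)
    also have "\<dots> = (a' \<otimes> b'' \<otimes> c') \<otimes> (b \<otimes> c)" unfolding 1 using cl by (simp add: m_ac)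
    also have "\<dots> = a'' \<otimes> b \<otimes> (b' \<otimes> c \<otimes> c')" unfolding 2 using cl by (simp add: m_ac)
    finally show "(x, z) \<in> groth_rel G"
      unfolding groth_rel_def x z using cl by auto
  qed
qed

abbreviation gclass :: "'a \<Rightarrow> 'a \<Rightarrow> ('a \<times> 'a) set" where
  "gclass a b \<equiv> groth_rel G `` {(a, b)}"

lemma gclass_eq_iff:
  assumes "a \<in> carrier G" "b \<in> carrier G" "a' \<in> carrier G" "b' \<in> carrier G"
  shows "gclass a b = gclass a' b' \<longleftrightarrow> (\<exists>c\<in>carrier G. a \<otimes> b' \<otimes> c = a' \<otimes> b \<otimes> c)"
proof -
  have "gclass a b = gclass a' b' \<longleftrightarrow> ((a, b), (a', b')) \<in> groth_rel G"
    using assms by (intro eq_equiv_class_iff[OF groth_equiv]) auto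
  then show ?thesis using assms by (auto simp: groth_rel_def)
qed

lemma gclass_carrier:
  "a \<in> carrier G \<Longrightarrow> b \<in> carrier G \<Longrightarrow> gclass a b \<in> carrier (grothendieck_group G)"
  unfolding grothendieck_group_def by (auto intro: quotientI)

lemma grothendieck_group_cases:
  assumes "x \<in> carrier (grothendieck_group G)"
  obtains a b where "a \<in> carrier G" "b \<in> carrier G" "x = gclass a b"
  using assms unfolding grothendieck_group_def by (auto elim!: quotientE)

lemma groth_rel_mult:
  assumes "((a, b), (c, d)) \<in> groth_rel G" "((a', b'), (c', d')) \<in> groth_rel G"
  shows "((a \<otimes> a', b \<otimes> b'), (c \<otimes> c', d \<otimes> d')) \<in> groth_rel G"
proof -
  obtain s s' where cl: "a \<in> carrier G" "b \<in> carrier G" "c \<in> carrier G" "d \<in> carrier G"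
    "a' \<in> carrier G" "b' \<in> carrier G" "c' \<in> carrier G" "d' \<in> carrier G" "s \<in> carrier G" "s' \<in> carrier G"
    and s: "a \<otimes> d \<otimes> s = c \<otimes> b \<otimes> s" "a' \<otimes> d' \<otimes> s' = c' \<otimes> b' \<otimes> s'"
    using assms unfolding groth_rel_def by auto
  have "(a \<otimes> a') \<otimes> (d \<otimes> d') \<otimes> (s \<otimes> s') = (a \<otimes> d \<otimes> s) \<otimes> (a' \<otimes> d' \<otimes> s')"
    using cl by (simp add: m_ac)
  also have "\<dots> = (c \<otimes> c') \<otimes> (b \<otimes> b') \<otimes> (s \<otimes> s')"
    unfolding s using cl by (simp add: m_ac)
  finally show ?thesis unfolding groth_rel_def using cl by auto
qed

lemma gclass_mult:
  assumes "a \<in> carrier G" "b \<in> carrier G" "a' \<in> carrier G" "b' \<in> carrier G"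
  shows "gclass a b \<otimes>\<^bsub>grothendieck_group G\<^esub> gclass a' b' = gclass (a \<otimes> a') (b \<otimes> b')"
proof -
  have *: "gclass (c \<otimes> c') (d \<otimes> d') = gclass (a \<otimes> a') (b \<otimes> b')"
    if "((a, b), (c, d)) \<in> groth_rel G" "((a', b'), (c', d')) \<in> groth_rel G" for c d c' d'
    using groth_rel_mult[OF that] equiv_class_eq[OF groth_equiv] by metis
  have **: "gclass (fst x \<otimes> fst y) (snd x \<otimes> snd y) = gclass (a \<otimes> a') (b \<otimes> b')"
    if "x \<in> gclass a b" "y \<in> gclass a' b'" for x y
    by (rule *) (use that in simp_all)
  have "(a, b) \<in> gclass a b" "(a', b') \<in> gclass a' b'"
    using equiv_class_self[OF groth_equiv] assms by blast+
  with ** have "(\<Union>x\<in>gclass a b. \<Union>y\<in>gclass a' b'. gclass (fst x \<otimes> fst y) (snd x \<otimes> snd y))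
      = gclass (a \<otimes> a') (b \<otimes> b')"
    by blast
  then show ?thesis unfolding grothendieck_group_def by (simp add: case_prod_beta)
qed

lemma grothendieck_group_comm_group: "comm_group (grothendieck_group G)"
proof (rule comm_groupI)
  note [simp] = gclass_mult gclass_carrier
  have one: "\<one>\<^bsub>grothendieck_group G\<^esub> = gclass \<one> \<one>" unfolding grothendieck_group_def by simp
  show "\<one>\<^bsub>grothendieck_group G\<^esub> \<in> carrier (grothendieck_group G)" by (simp add: one)
  fix x assume "x \<in> carrier (grothendieck_group G)"
  then obtain a b where x: "a \<in> carrier G" "b \<in> carrier G" "x = gclass a b" by (rule grothendieck_group_cases)
  show "\<one>\<^bsub>grothendieck_group G\<^esub> \<otimes>\<^bsub>grothendieck_group G\<^esub> x = x" using x by (simp add: one)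
  have "gclass (b \<otimes> a) (a \<otimes> b) = gclass \<one> \<one>"
    using x by (subst gclass_eq_iff) (auto simp: m_ac)
  then show "\<exists>y\<in>carrier (grothendieck_group G). y \<otimes>\<^bsub>grothendieck_group G\<^esub> x = \<one>\<^bsub>grothendieck_group G\<^esub>"
    using x by (intro bexI[of _ "gclass b a"]) (simp_all add: one)
  fix y assume "y \<in> carrier (grothendieck_group G)"
  then obtain c d where y: "c \<in> carrier G" "d \<in> carrier G" "y = gclass c d" by (rule grothendieck_group_cases)
  show "x \<otimes>\<^bsub>grothendieck_group G\<^esub> y \<in> carrier (grothendieck_group G)" using x y by simp
  show "x \<otimes>\<^bsub>grothendieck_group G\<^esub> y = y \<otimes>\<^bsub>grothendieck_group G\<^esub> x" using x y by (simp add: m_comm)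
  fix z assume "z \<in> carrier (grothendieck_group G)"
  then obtain e f where z: "e \<in> carrier G" "f \<in> carrier G" "z = gclass e f" by (rule grothendieck_group_cases)
  show "x \<otimes>\<^bsub>grothendieck_group G\<^esub> y \<otimes>\<^bsub>grothendieck_group G\<^esub> z = x \<otimes>\<^bsub>grothendieck_group G\<^esub> (y \<otimes>\<^bsub>grothendieck_group G\<^esub> z)"
    using x y z by (simp add: m_assoc)
qed

end

section \<open>Elements of \<open>K0\<close> as formal differences of projections\<close>

context star_algebra
begin

definition K0class :: "nat \<times> (nat \<Rightarrow> nat \<Rightarrow> 'a) \<Rightarrow> nat \<times> (nat \<Rightarrow> nat \<Rightarrow> 'a) \<Rightarrow>
    ((nat \<times> (nat \<Rightarrow> nat \<Rightarrow> 'a)) set \<times> (nat \<times> (nat \<Rightarrow> nat \<Rightarrow> 'a)) set) set" where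
  "K0class a b = groth_rel (proj_monoid R) `` {(pclass a, pclass b)}"

lemma K0_comm_group: "comm_group (K0 R)"
  unfolding K0_def by (rule comm_monoid.grothendieck_group_comm_group[OF proj_monoid_comm_monoid])

lemma K0class_carrier:
  "a \<in> projections R \<Longrightarrow> b \<in> projections R \<Longrightarrow> K0class a b \<in> carrier (K0 R)"
  unfolding K0_def K0class_def
  by (intro comm_monoid.gclass_carrier[OF proj_monoid_comm_monoid] pclass_carrier)

lemma K0_cases:
  assumes "x \<in> carrier (K0 R)"
  obtains a b where "a \<in> projections R" "b \<in> projections R" "x = K0class a b"
proof -
  obtain A B where AB: "A \<in> carrier (proj_monoid R)" "B \<in> carrier (proj_monoid R)"
    "x = groth_rel (proj_monoid R) `` {(A, B)}"
    using assms unfolding K0_def by (rule comm_monoid.grothendieck_group_cases[OF proj_monoid_comm_monoid])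
  obtain a b where "a \<in> projections R" "b \<in> projections R" "A = pclass a" "B = pclass b"
    using AB by (metis proj_monoid_cases)
  with AB that show ?thesis unfolding K0class_def by blast
qed

lemma K0class_mult:
  assumes "a \<in> projections R" "b \<in> projections R" "a' \<in> projections R" "b' \<in> projections R"
  shows "K0class a b \<otimes>\<^bsub>K0 R\<^esub> K0class a' b' = K0class (dsum R a a') (dsum R b b')"
  using assms unfolding K0_def K0class_def
  by (simp add: comm_monoid.gclass_mult[OF proj_monoid_comm_monoid] pclass_carrier pclass_mult)

lemma K0class_eq_iff:
  assumes "a \<in> projections R" "b \<in> projections R" "a' \<in> projections R" "b' \<in> projections R"
  shows "K0class a b = K0class a' b' \<longleftrightarrow>
    (\<exists>c\<in>projections R. (dsum R (dsum R a b') c, dsum R (dsum R a' b) c) \<in> mvn_rel R)"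
proof -
  have "K0class a b = K0class a' b' \<longleftrightarrow> (\<exists>C\<in>carrier (proj_monoid R).
     pclass a \<otimes>\<^bsub>proj_monoid R\<^esub> pclass b' \<otimes>\<^bsub>proj_monoid R\<^esub> C = pclass a' \<otimes>\<^bsub>proj_monoid R\<^esub> pclass b \<otimes>\<^bsub>proj_monoid R\<^esub> C)"
    unfolding K0class_def using assms
    by (intro comm_monoid.gclass_eq_iff[OF proj_monoid_comm_monoid] pclass_carrier)
  also have "\<dots> \<longleftrightarrow> (\<exists>c\<in>projections R.
     pclass a \<otimes>\<^bsub>proj_monoid R\<^esub> pclass b' \<otimes>\<^bsub>proj_monoid R\<^esub> pclass c = pclass a' \<otimes>\<^bsub>proj_monoid R\<^esub> pclass b \<otimes>\<^bsub>proj_monoid R\<^esub> pclass c)"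
    by (metis pclass_carrier proj_monoid_cases)
  also have "\<dots> \<longleftrightarrow> (\<exists>c\<in>projections R. (dsum R (dsum R a b') c, dsum R (dsum R a' b) c) \<in> mvn_rel R)"
    using assms by (intro bex_cong) (simp_all add: pclass_mult dsum_projections pclass_eq_iff)
  finally show ?thesis .
qed

text \<open>The cancelling projection c from \<open>K0class_eq_iff\<close> is enlarged by its
  complement to an identity matrix. This keeps stabilisation inside the diagonal projections, to
  which the combinatorial argument applies.\<close>

lemma K0class_eq_mat_one:
  assumes "a \<in> projections R" "b \<in> projections R" "a' \<in> projections R" "b' \<in> projections R"
    and eq: "K0class a b = K0class a' b'"
  obtains k where "(dsum R (dsum R a b') (k, mat_one k), dsum R (dsum R a' b) (k, mat_one k)) \<in> mvn_rel R"
proof -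
  obtain c where c: "c \<in> projections R" "(dsum R (dsum R a b') c, dsum R (dsum R a' b) c) \<in> mvn_rel R"
    using eq K0class_eq_iff[OF assms(1-4)] by blast
  obtain k r where k: "c = (k, r)" by force
  obtain q where q: "(k, q) \<in> projections R" "(dsum R c (k, q), (k, mat_one k)) \<in> mvn_rel R"
    using complement_mvn_one c(1) unfolding k by blast
  have *: "(dsum R (dsum R s c) (k, q), dsum R s (k, mat_one k)) \<in> mvn_rel R" if "s \<in> projections R" for s
    unfolding dsum_assoc by (intro dsum_mvn mvn_refl that q)
  have "(dsum R (dsum R (dsum R a b') c) (k, q), dsum R (dsum R (dsum R a' b) c) (k, q)) \<in> mvn_rel R"
    using dsum_mvn[OF c(2) mvn_refl[OF q(1)]] .
  moreover have "dsum R a b' \<in> projections R" "dsum R a' b \<in> projections R"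
    using assms by (simp_all add: dsum_projections)
  ultimately show ?thesis
    by (intro that) (rule mvn_trans[OF mvn_sym[OF *] mvn_trans[OF _ *]])
qed

end

section \<open>Functoriality of \<open>K0\<close> for homomorphisms of rings with involution\<close>

locale star_hom = A: star_algebra A + B: star_algebra B
  for A :: "('a, 'c) star_ring_scheme" and B :: "('b, 'd) star_ring_scheme" and h :: "'a \<Rightarrow> 'b" +
  assumes hom_closed: "x \<in> carrier A \<Longrightarrow> h x \<in> carrier B"
    and hom_add: "x \<in> carrier A \<Longrightarrow> y \<in> carrier A \<Longrightarrow> h (x \<oplus>\<^bsub>A\<^esub> y) = h x \<oplus>\<^bsub>B\<^esub> h y"
    and hom_mult: "x \<in> carrier A \<Longrightarrow> y \<in> carrier A \<Longrightarrow> h (x \<otimes>\<^bsub>A\<^esub> y) = h x \<otimes>\<^bsub>B\<^esub> h y"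
    and hom_star: "x \<in> carrier A \<Longrightarrow> h (star A x) = star B (h x)"
begin

lemma hom_zero: "h \<zero>\<^bsub>A\<^esub> = \<zero>\<^bsub>B\<^esub>"
  by (metis A.l_zero A.zero_closed B.add.r_cancel_one' hom_add hom_closed)

lemma hom_finsum:
  assumes "finite I" "\<And>i. i \<in> I \<Longrightarrow> f i \<in> carrier A"
  shows "h (finsum A f I) = finsum B (\<lambda>i. h (f i)) I"
  using assms
proof (induction I rule: finite_induct)
  case (insert x F)
  then show ?case
    by (subst A.finsum_insert; (subst B.finsum_insert)?; auto simp: hom_add hom_closed)
qed (simp add: hom_zero)

definition mat_map :: "(nat \<Rightarrow> nat \<Rightarrow> 'a) \<Rightarrow> nat \<Rightarrow> nat \<Rightarrow> 'b" where
  "mat_map a = (\<lambda>i j. h (a i j))"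

lemma mat_map_mats: "a \<in> mats A m n \<Longrightarrow> mat_map a \<in> mats B m n"
  unfolding mats_def mat_map_def by (auto simp: hom_closed hom_zero)

lemma mat_map_mul:
  assumes "a \<in> mats A m n" "b \<in> mats A n k"
  shows "mat_map (mat_mul A n a b) = mat_mul B n (mat_map a) (mat_map b)"
  using assms[THEN A.mats_closed] unfolding mat_map_def mat_mul_def
  by (auto intro!: ext B.finsum_cong' simp: hom_finsum hom_mult hom_closed)

lemma mat_map_star:
  assumes "a \<in> mats A m n" shows "mat_map (mat_star A a) = mat_star B (mat_map a)"
  using A.mats_closed[OF assms] unfolding mat_map_def mat_star_def by (auto simp: hom_star)

lemma mat_map_projections: "(n, p) \<in> projections A \<Longrightarrow> (n, mat_map p) \<in> projections B"
  using mat_map_mats[of p n n] mat_map_mul[of p n n p n] mat_map_star[of p n n]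
  unfolding projections_def by auto

lemma mat_map_mvn:
  assumes "((n, p), (m, q)) \<in> mvn_rel A" shows "((n, mat_map p), (m, mat_map q)) \<in> mvn_rel B"
proof -
  from assms obtain v where v: "(n, p) \<in> projections A" "(m, q) \<in> projections A" "v \<in> mats A m n"
    "p = mat_mul A m (mat_star A v) v" "q = mat_mul A n v (mat_star A v)"
    by (rule A.mvn_relE)
  show ?thesis
    using mat_map_mul[OF A.mat_star_mats v(3), OF v(3)] mat_map_mul[OF v(3) A.mat_star_mats, OF v(3)]
      mat_map_star[OF v(3)] v(4,5)
    by (intro B.mvn_relI[where v = "mat_map v"] mat_map_projections v mat_map_mats) auto
qed

text \<open>\<open>mat_map\<close> carries no range guard. The guarded matrix in
  \<open>proj_monoid_map\<close> agrees with it because a projection vanishes outside its range and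
  h maps zero to zero.\<close>

lemma proj_monoid_map_pclass:
  assumes "(n, p) \<in> projections A"
  shows "proj_monoid_map B h (A.pclass (n, p)) = B.pclass (n, mat_map p)"
proof -
  have *: "(\<lambda>i j. if i < m \<and> j < m then h (q i j) else \<zero>\<^bsub>B\<^esub>) = mat_map q" if "(m, q) \<in> projections A" for m q
    using A.mats_zero[OF A.projectionsD(1)[OF that]] by (auto simp: mat_map_def fun_eq_iff hom_zero)
  have **: "B.pclass (m, \<lambda>i j. if i < m \<and> j < m then h (q i j) else \<zero>\<^bsub>B\<^esub>) = B.pclass (n, mat_map p)"
    if "((n, p), (m, q)) \<in> mvn_rel A" for m q
  proof -
    have "(m, q) \<in> projections A" using A.mvn_projections[OF that] by blast
    then show ?thesis unfolding *[OF \<open>(m, q) \<in> projections A\<close>]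
      using equiv_class_eq[OF B.mvn_equiv mat_map_mvn[OF that]] by simp
  qed
  have "((n, p), (n, p)) \<in> mvn_rel A" by (rule A.mvn_refl[OF assms])
  show ?thesis unfolding proj_monoid_map_def
  proof (intro equalityI subsetI)
    fix x assume "x \<in> (\<Union>(m, q)\<in>A.pclass (n, p). B.pclass (m, \<lambda>i j. if i < m \<and> j < m then h (q i j) else \<zero>\<^bsub>B\<^esub>))"
    then obtain m q where "((n, p), (m, q)) \<in> mvn_rel A"
      "x \<in> B.pclass (m, \<lambda>i j. if i < m \<and> j < m then h (q i j) else \<zero>\<^bsub>B\<^esub>)" by auto
    then show "x \<in> B.pclass (n, mat_map p)" using ** by blast
  next
    fix x assume "x \<in> B.pclass (n, mat_map p)"
    then show "x \<in> (\<Union>(m, q)\<in>A.pclass (n, p). B.pclass (m, \<lambda>i j. if i < m \<and> j < m then h (q i j) else \<zero>\<^bsub>B\<^esub>))"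
      using **[OF \<open>((n, p), (n, p)) \<in> mvn_rel A\<close>] \<open>((n, p), (n, p)) \<in> mvn_rel A\<close> by blast
  qed
qed

lemma proj_monoid_map_mult:
  assumes "a \<in> carrier (proj_monoid A)" "b \<in> carrier (proj_monoid A)"
  shows "proj_monoid_map B h (a \<otimes>\<^bsub>proj_monoid A\<^esub> b) = proj_monoid_map B h a \<otimes>\<^bsub>proj_monoid B\<^esub> proj_monoid_map B h b"
    "proj_monoid_map B h a \<in> carrier (proj_monoid B)"
proof -
  obtain n p m q where a: "(n, p) \<in> projections A" "a = A.pclass (n, p)"
    and b: "(m, q) \<in> projections A" "b = A.pclass (m, q)"
    using assms by (metis A.proj_monoid_cases surj_pair)
  have "mat_map (A.block n n p q) = B.block n n (mat_map p) (mat_map q)"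
    by (auto simp: fun_eq_iff mat_map_def A.block_def B.block_def hom_zero)
  then show "proj_monoid_map B h (a \<otimes>\<^bsub>proj_monoid A\<^esub> b) = proj_monoid_map B h a \<otimes>\<^bsub>proj_monoid B\<^esub> proj_monoid_map B h b"
    using A.dsum_projections[OF a(1) b(1)]
    by (simp only: a b A.pclass_mult A.dsum_block proj_monoid_map_pclass B.pclass_mult B.dsum_block mat_map_projections)
  show "proj_monoid_map B h a \<in> carrier (proj_monoid B)"
    by (simp add: a proj_monoid_map_pclass B.pclass_carrier mat_map_projections)
qed

text \<open>As for products, the union over representatives is constant: a cancelling element C in
  the source is mapped by \<open>proj_monoid_map\<close> to a cancelling element in the
  target.\<close>

lemma K0_map_K0class:
  assumes p: "(n, p) \<in> projections A" and q: "(m, q) \<in> projections A"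
  shows "K0_map B h (A.K0class (n, p) (m, q)) = B.K0class (n, mat_map p) (m, mat_map q)"
proof -
  note MA = A.proj_monoid_comm_monoid note MB = B.proj_monoid_comm_monoid
  let ?f = "proj_monoid_map B h"
  let ?P = "A.pclass (n, p)" let ?Q = "A.pclass (m, q)"
  have PQ: "?P \<in> carrier (proj_monoid A)" "?Q \<in> carrier (proj_monoid A)"
    using p q by (auto intro: A.pclass_carrier)
  have rel: "groth_rel (proj_monoid B) `` {(?f U, ?f V)} = groth_rel (proj_monoid B) `` {(?f ?P, ?f ?Q)}"
    if "((?P, ?Q), (U, V)) \<in> groth_rel (proj_monoid A)" for U V
  proof -
    obtain C where C: "C \<in> carrier (proj_monoid A)" "U \<in> carrier (proj_monoid A)" "V \<in> carrier (proj_monoid A)"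
      "?P \<otimes>\<^bsub>proj_monoid A\<^esub> V \<otimes>\<^bsub>proj_monoid A\<^esub> C = U \<otimes>\<^bsub>proj_monoid A\<^esub> ?Q \<otimes>\<^bsub>proj_monoid A\<^esub> C"
      using \<open>((?P, ?Q), (U, V)) \<in> groth_rel (proj_monoid A)\<close> unfolding groth_rel_def by auto
    note cl = monoid.m_closed[OF comm_monoid.axioms(1)[OF MA]]
    have "?f ?P \<otimes>\<^bsub>proj_monoid B\<^esub> ?f V \<otimes>\<^bsub>proj_monoid B\<^esub> ?f C = ?f U \<otimes>\<^bsub>proj_monoid B\<^esub> ?f ?Q \<otimes>\<^bsub>proj_monoid B\<^esub> ?f C"
      using arg_cong[OF C(4), of ?f] C(1-3) PQ by (simp add: proj_monoid_map_mult cl)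
    then show ?thesis
      using C PQ by (subst comm_monoid.gclass_eq_iff[OF MB]) (auto simp: proj_monoid_map_mult(2) intro!: bexI[of _ "?f C"])
  qed
  have self: "((?P, ?Q), (?P, ?Q)) \<in> groth_rel (proj_monoid A)"
    using comm_monoid.groth_equiv[OF MA] PQ unfolding equiv_def refl_on_def by auto
  have "K0_map B h (A.K0class (n, p) (m, q)) = groth_rel (proj_monoid B) `` {(?f ?P, ?f ?Q)}"
    unfolding K0_map_def A.K0class_def
  proof (intro equalityI subsetI)
    fix x assume "x \<in> (\<Union>(U, V)\<in>groth_rel (proj_monoid A) `` {(?P, ?Q)}. groth_rel (proj_monoid B) `` {(?f U, ?f V)})"
    then obtain U V where "((?P, ?Q), (U, V)) \<in> groth_rel (proj_monoid A)"
      "x \<in> groth_rel (proj_monoid B) `` {(?f U, ?f V)}" by auto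
    then show "x \<in> groth_rel (proj_monoid B) `` {(?f ?P, ?f ?Q)}" using rel by blast
  next
    fix x assume "x \<in> groth_rel (proj_monoid B) `` {(?f ?P, ?f ?Q)}"
    then show "x \<in> (\<Union>(U, V)\<in>groth_rel (proj_monoid A) `` {(?P, ?Q)}. groth_rel (proj_monoid B) `` {(?f U, ?f V)})"
      using self by blast
  qed
  then show ?thesis
    by (simp add: B.K0class_def proj_monoid_map_pclass[OF p] proj_monoid_map_pclass[OF q])
qed

end

section \<open>Combinatorics, linear algebra and divisible groups\<close>

text \<open>Gaussian elimination by induction on the equations. A pivot variable s0 of the new
  equation is eliminated from the others, which leaves one equation and one unknown fewer; the value
  at s0 is then found by back-substitution.\<close>

lemma homogeneous_system_nontrivial:
  fixes a :: "'t \<Rightarrow> 's \<Rightarrow> 'f::field"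
  assumes "finite T" "finite S" "card T < card S"
  shows "\<exists>c. (\<exists>s\<in>S. c s \<noteq> 0) \<and> (\<forall>t\<in>T. (\<Sum>s\<in>S. a t s * c s) = 0)"
  using assms
proof (induction T arbitrary: S a rule: finite_induct)
  case empty
  then obtain s where "s \<in> S" by (metis card.empty card_gt_0_iff ex_in_conv)
  then show ?case by (intro exI[of _ "\<lambda>_. 1"]) auto
next
  case (insert t T)
  show ?case
  proof (cases "\<forall>s\<in>S. a t s = 0")
    case True
    obtain c where "\<exists>s\<in>S. c s \<noteq> 0" "\<forall>t\<in>T. (\<Sum>s\<in>S. a t s * c s) = 0"
      using insert.IH[of S a] insert.hyps insert.prems by (metis card_insert_disjoint Suc_lessD)
    with True show ?thesis by (intro exI[of _ c]) auto
  next
    case False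
    then obtain s0 where s0: "s0 \<in> S" "a t s0 \<noteq> 0" by blast
    \<comment> \<open>Row reduction: the multiple of row t that clears column s0 is subtracted from
      each row.\<close>
    define a' where "a' t' s = a t' s - a t' s0 * a t s / a t s0" for t' s
    have "card T < card (S - {s0})" using insert s0 by simp
    then obtain c where c: "\<exists>s\<in>S - {s0}. c s \<noteq> 0" "\<forall>t\<in>T. (\<Sum>s\<in>S - {s0}. a' t s * c s) = 0"
      using insert.IH[of "S - {s0}" a'] insert.prems by (metis finite_Diff)
    define m where "m = (\<Sum>s\<in>S - {s0}. a t s * c s)"
    define e where "e = c(s0 := - m / a t s0)"
    have sum_e: "(\<Sum>s\<in>S. a t' s * e s) = a t' s0 * (- m / a t s0) + (\<Sum>s\<in>S - {s0}. a t' s * c s)" for t'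
      using s0 insert.prems(1) unfolding e_def
      by (subst sum.remove[of S s0]) (auto intro!: sum.cong)
    have "(\<Sum>s\<in>S. a t' s * e s) = 0" if "t' \<in> T" for t'
    proof -
      have "(\<Sum>s\<in>S - {s0}. a' t' s * c s) = (\<Sum>s\<in>S - {s0}. a t' s * c s - a t' s0 / a t s0 * (a t s * c s))"
        by (rule sum.cong) (auto simp: a'_def algebra_simps)
      also have "\<dots> = (\<Sum>s\<in>S - {s0}. a t' s * c s) - a t' s0 / a t s0 * m"
        unfolding m_def by (simp add: sum_subtractf sum_distrib_left)
      finally show ?thesis using c(2) that sum_e[of t'] by simp
    qed
    moreover have "(\<Sum>s\<in>S. a t s * e s) = 0" using sum_e[of t] s0 by (simp add: m_def)
    moreover have "\<exists>s\<in>S. e s \<noteq> 0" using c(1) by (auto simp: e_def)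
    ultimately show ?thesis by (intro exI[of _ e]) auto
  qed
qed

text \<open>Rado's argument: in a minimal relation satisfying Hall's condition every image is a singleton.\<close>

lemma hall_marriage:
  fixes F :: "'i \<Rightarrow> 'b set"
  assumes fin: "\<And>i. i \<in> I \<Longrightarrow> finite (F i)"
    and hall: "\<And>J. finite J \<Longrightarrow> J \<subseteq> I \<Longrightarrow> card J \<le> card (\<Union>i\<in>J. F i)"
  shows "\<exists>f. inj_on f I \<and> (\<forall>i\<in>I. f i \<in> F i)"
proof -
  define H where "H M \<longleftrightarrow> (\<forall>J. finite J \<longrightarrow> J \<subseteq> I \<longrightarrow> card J \<le> card (M `` J))" for M :: "('i \<times> 'b) set"
  \<comment> \<open>Zorn's lemma is applied to the sets N of deleted edges, so that chains are
    bounded by unions and a maximal N leaves a minimal relation.\<close>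
  define A where "A = {N. N \<subseteq> Sigma I F \<and> H (Sigma I F - N)}"
  have "\<exists>N\<in>A. \<forall>N'\<in>A. N \<subseteq> N' \<longrightarrow> N' = N"
  proof (rule subset_Zorn')
    fix C assume C: "subset.chain A C"
    have sub: "\<Union>C \<subseteq> Sigma I F" using C unfolding subset.chain_def A_def by blast
    have "card J \<le> card ((Sigma I F - \<Union>C) `` J)" if J: "finite J" "J \<subseteq> I" for J
    proof (cases "C = {}")
      case True
      have "(Sigma I F) `` J = (\<Union>i\<in>J. F i)" using J by auto
      then show ?thesis using hall[OF J] True by simp
    next
      case False
      \<comment> \<open>Only finitely many edges start in the finite set J, so a single member of
        the chain already deletes every edge at J that the union deletes. Hall's condition at J is
        inherited from that member.\<close>
      have "finite (Sigma J F)" using J fin by (intro finite_SigmaI) auto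
      then have "finite (\<Union>C \<inter> Sigma J F)" by blast
      then obtain N where N: "N \<in> C" "\<Union>C \<inter> Sigma J F \<subseteq> N"
        using finite_subset_Union_chain[of "\<Union>C \<inter> Sigma J F" C A] False C by auto
      have "(Sigma I F - N) `` J \<subseteq> (Sigma I F - \<Union>C) `` J"
        using N by blast
      moreover have "(Sigma I F - \<Union>C) `` J \<subseteq> (Sigma I F - N) `` J" using N by blast
      ultimately have "(Sigma I F - N) `` J = (Sigma I F - \<Union>C) `` J" by blast
      moreover have "N \<in> A" using C N unfolding subset.chain_def by blast
      ultimately have "H (Sigma I F - N)" "(Sigma I F - N) `` J = (Sigma I F - \<Union>C) `` J"
        unfolding A_def by simp_all
      moreover from this(1) have "card J \<le> card ((Sigma I F - N) `` J)"
        using J unfolding H_def by blast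
      ultimately show ?thesis by metis
    qed
    then show "\<Union>C \<in> A" unfolding A_def H_def using sub by blast
  qed
  then obtain N where N: "N \<in> A" "\<And>N'. N' \<in> A \<Longrightarrow> N \<subseteq> N' \<Longrightarrow> N' = N" by blast
  define M where "M = Sigma I F - N"
  have HM: "H M" and MS: "M \<subseteq> Sigma I F" using N(1) unfolding A_def M_def by auto
  have finM: "finite (M `` J)" if "finite J" for J
  proof (rule finite_subset)
    show "M `` J \<subseteq> (\<Union>i\<in>J \<inter> I. F i)" using MS by auto
    show "finite (\<Union>i\<in>J \<inter> I. F i)" using that fin by auto
  qed
  \<comment> \<open>Minimality: deleting an edge (i, x) breaks Hall's condition, and this can only
    happen at a set J that contains i.\<close>
  have drop: "\<exists>J. finite J \<and> J \<subseteq> I \<and> i \<in> J \<and> card ((M - {(i, x)}) `` J) < card J"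
    if "(i, x) \<in> M" for i x
  proof -
    have "insert (i, x) N \<notin> A" using N(2)[of "insert (i, x) N"] that unfolding M_def by blast
    moreover have "Sigma I F - insert (i, x) N = M - {(i, x)}" unfolding M_def by blast
    moreover have "insert (i, x) N \<subseteq> Sigma I F" using N(1) that MS unfolding A_def by blast
    ultimately have "\<not> H (M - {(i, x)})" unfolding A_def by simp
    then obtain J where J: "finite J" "J \<subseteq> I" "card ((M - {(i, x)}) `` J) < card J"
      unfolding H_def by (auto simp: not_le)
    have "i \<in> J"
    proof (rule ccontr)
      assume "i \<notin> J"
      then have "(M - {(i, x)}) `` J = M `` J" by blast
      then show False using J HM unfolding H_def by (metis not_le)
    qed
    with J show ?thesis by blast
  qed
  have uniq: "x = y" if xy: "(i, x) \<in> M" "(i, y) \<in> M" for i x y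
  proof (rule ccontr)
    assume "x \<noteq> y"
    obtain J where J: "finite J" "J \<subseteq> I" "i \<in> J" "card ((M - {(i, x)}) `` J) < card J"
      using drop[OF xy(1)] by blast
    obtain K where K: "finite K" "K \<subseteq> I" "i \<in> K" "card ((M - {(i, y)}) `` K) < card K"
      using drop[OF xy(2)] by blast
    let ?P = "(M - {(i, x)}) `` J" let ?Q = "(M - {(i, y)}) `` K"
    have fin: "finite ?P" "finite ?Q"
      using finM[OF J(1)] finM[OF K(1)] by (auto elim: rev_finite_subset)
    \<comment> \<open>Since x \<noteq> y, ?P and ?Q together still contain all neighbours of J
      \<union> K. Hall's condition for the union and for the intersection without i gives card ?P +
      card ?Q \<ge> card J + card K - 1, whereas the choice of J and K makes the left side at most
      card J + card K - 2.\<close>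
    have "M `` (J \<union> K) \<subseteq> ?P \<union> ?Q" using J K \<open>x \<noteq> y\<close> by blast
    then have 1: "card (J \<union> K) \<le> card (?P \<union> ?Q)"
      using HM J K fin unfolding H_def
      by (meson Un_least card_mono finite_UnI order_trans)
    have "M `` (J \<inter> K - {i}) \<subseteq> ?P \<inter> ?Q" by blast
    moreover have "finite (J \<inter> K - {i})" "J \<inter> K - {i} \<subseteq> I" using J K by auto
    ultimately have 2: "card (J \<inter> K - {i}) \<le> card (?P \<inter> ?Q)"
      using HM fin unfolding H_def by (meson card_mono finite_Int order_trans)
    have "card (J \<inter> K - {i}) = card (J \<inter> K) - 1" "card (J \<inter> K) \<ge> 1"
      using J K by (auto simp: card_gt_0_iff Suc_le_eq)
    moreover have "card ?P + card ?Q = card (?P \<union> ?Q) + card (?P \<inter> ?Q)"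
      using fin by (rule card_Un_Int)
    moreover have "card J + card K = card (J \<union> K) + card (J \<inter> K)"
      using J K by (intro card_Un_Int) auto
    ultimately show False using 1 2 J(4) K(4) by linarith
  qed
  have ex: "\<exists>x. (i, x) \<in> M" if "i \<in> I" for i
  proof -
    have "card {i} \<le> card (M `` {i})"
      using HM[unfolded H_def, rule_format, of "{i}"] that by simp
    then have "M `` {i} \<noteq> {}" by auto
    then show ?thesis by blast
  qed
  then obtain f where f: "\<And>i. i \<in> I \<Longrightarrow> (i, f i) \<in> M" by metis
  have "inj_on f I"
  proof (rule inj_onI, rule ccontr)
    fix i j assume ij: "i \<in> I" "j \<in> I" "f i = f j" "i \<noteq> j"
    have "M `` {i, j} \<subseteq> {f i}" using f[OF ij(1)] f[OF ij(2)] ij uniq by auto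
    then have "card (M `` {i, j}) \<le> 1" using card_mono[of "{f i}"] by fastforce
    moreover have "card {i, j} \<le> card (M `` {i, j})" using HM[unfolded H_def, rule_format, of "{i, j}"] ij by simp
    ultimately show False using ij by simp
  qed
  moreover have "\<forall>i\<in>I. f i \<in> F i" using f MS by blast
  ultimately show ?thesis by blast
qed

text \<open>The disjunction in the conclusion is what the usual statement lacks: each point moves
  either along f or backwards along g, so a bound on the displacements of f and g is also a bound
  for h.\<close>

lemma cantor_schroeder_bernstein_explicit:
  assumes f: "inj_on f A" "f ` A \<subseteq> B" and g: "inj_on g B" "g ` B \<subseteq> A"
  shows "\<exists>h. bij_betw h A B \<and> (\<forall>x\<in>A. h x = f x \<or> g (h x) = x)"
proof -
  \<comment> \<open>The points reached from A outside the range of g by iterating g after f. On C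
    the map f is used, elsewhere the inverse of g.\<close>
  define C where "C = lfp (\<lambda>C. (A - g ` B) \<union> g ` f ` C)"
  have C: "C = (A - g ` B) \<union> g ` f ` C"
    unfolding C_def by (rule lfp_unfold) (auto intro!: monoI)
  have "C \<subseteq> A"
    unfolding C_def by (rule lfp_lowerbound) (use f g in blast)
  define h where "h x = (if x \<in> C then f x else inv_into B g x)" for x
  have nC: "inv_into B g x \<in> B \<and> g (inv_into B g x) = x" if "x \<in> A" "x \<notin> C" for x
  proof -
    have "x \<in> g ` B" using that C by blast
    then show ?thesis by (simp add: inv_into_into f_inv_into_f)
  qed
  have disj: "inv_into B g x \<noteq> f c" if "x \<in> A" "x \<notin> C" "c \<in> C" for x c
  proof
    assume "inv_into B g x = f c"
    then have "x = g (f c)" using nC[OF that(1,2)] by simp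
    then have "x \<in> (A - g ` B) \<union> g ` f ` C" using that(3) by blast
    then show False using that(2) C by blast
  qed
  have "inj_on h A"
  proof (rule inj_onI)
    fix x y assume xy: "x \<in> A" "y \<in> A" "h x = h y"
    show "x = y"
    proof (cases "x \<in> C"; cases "y \<in> C")
      assume "x \<in> C" "y \<in> C" then show ?thesis using xy f by (auto simp: h_def inj_on_def)
    next
      assume "x \<in> C" "y \<notin> C" then show ?thesis using xy disj[of y x] by (auto simp: h_def)
    next
      assume "x \<notin> C" "y \<in> C" then show ?thesis using xy disj[of x y] by (auto simp: h_def)
    next
      assume "x \<notin> C" "y \<notin> C" then show ?thesis using xy nC[of x] nC[of y] by (metis h_def)
    qed
  qed
  moreover have "h ` A = B"
  proof (intro equalityI subsetI)
    fix b assume "b \<in> h ` A"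
    then obtain x where "x \<in> A" "b = h x" by blast
    then show "b \<in> B" using f(2) nC[of x] unfolding h_def by (cases "x \<in> C") auto
  next
    fix b assume b: "b \<in> B"
    show "b \<in> h ` A"
    proof (cases "g b \<in> C")
      case True
      then have "g b \<in> g ` f ` C" using C b by blast
      then obtain c where c: "c \<in> C" "g b = g (f c)" by blast
      then have "b = f c" using g(1) b f \<open>C \<subseteq> A\<close> by (meson imageI inj_onD subsetD)
      then show ?thesis using c \<open>C \<subseteq> A\<close> by (auto simp: h_def)
    next
      case False
      then have "h (g b) = b" using g(1) b by (simp add: h_def)
      moreover have "g b \<in> A" using g(2) b by blast
      ultimately show ?thesis by (metis imageI)
    qed
  qed
  moreover have "\<forall>x\<in>A. h x = f x \<or> g (h x) = x" using nC by (metis h_def)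
  ultimately show ?thesis unfolding bij_betw_def by blast
qed

text \<open>One dimension is split off at a time: while some diagonal entry is nonzero, a rank-one
  projection below p is subtracted and the trace drops by exactly one. Projections have nonnegative
  trace, so the descent, an induction on an integer bound for the trace, stops.\<close>

lemma trace_projection_nat:
  fixes p :: "'i \<Rightarrow> 'i \<Rightarrow> complex"
  assumes fin: "finite I"
    and sa: "\<And>i j. i \<in> I \<Longrightarrow> j \<in> I \<Longrightarrow> p i j = cnj (p j i)"
    and id: "\<And>i j. i \<in> I \<Longrightarrow> j \<in> I \<Longrightarrow> (\<Sum>k\<in>I. p i k * p k j) = p i j"
  shows "\<exists>n::nat. (\<Sum>i\<in>I. p i i) = of_nat n"
proof -
  have "Re (\<Sum>i\<in>I. p i i) < real N \<Longrightarrow> \<exists>n::nat. (\<Sum>i\<in>I. p i i) = of_nat n" for N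
    using sa id
  proof (induction N arbitrary: p)
    case (0 p)
    have "Re (p i i) \<ge> 0" if "i \<in> I" for i
    proof -
      have "p i i = (\<Sum>k\<in>I. p i k * p k i)" using 0(3)[OF that that] by simp
      also have "\<dots> = (\<Sum>k\<in>I. of_real ((cmod (p i k))\<^sup>2))"
        using 0(2)[OF _ that] by (intro sum.cong refl) (simp only: complex_norm_square)
      also have "Re \<dots> \<ge> 0" by (simp add: sum_nonneg)
      finally show ?thesis .
    qed
    then have "Re (\<Sum>i\<in>I. p i i) \<ge> 0" by (simp add: sum_nonneg)
    with 0(1) show ?case by simp
  next
    case (Suc N p)
    note sa = Suc.prems(2) and id = Suc.prems(3)
    have diag: "p j j = of_real (\<Sum>k\<in>I. (cmod (p k j))\<^sup>2)" if "j \<in> I" for j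
    proof -
      have "p j j = (\<Sum>k\<in>I. p j k * p k j)" using id that by simp
      also have "\<dots> = (\<Sum>k\<in>I. of_real ((cmod (p k j))\<^sup>2))"
        using sa[OF that] by (intro sum.cong refl) (simp only: complex_norm_square mult.commute)
      finally show ?thesis by simp
    qed
    show ?case
    proof (cases "\<forall>j\<in>I. p j j = 0")
      case True
      then show ?thesis by (intro exI[of _ 0]) simp
    next
      case False
      then obtain j where j: "j \<in> I" "p j j \<noteq> 0" by blast
      define c where "c = p j j"
      have "c = of_real (Re c)" using diag[OF j(1)] unfolding c_def by (metis Re_complex_of_real)
      then have cc: "cnj c = c" by (metis complex_cnj_complex_of_real)
      have c0: "c \<noteq> 0" using j c_def by simp
      \<comment> \<open>The j-th column of p has squared norm c = p j j, so the subtracted matrix is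
        the orthogonal projection onto that column, which lies in the range of p.\<close>
      define q where "q a b = p a b - p a j * p j b / c" for a b
      have qsa: "q a b = cnj (q b a)" if "a \<in> I" "b \<in> I" for a b
        using sa[OF that] sa[OF that(1) j(1)] sa[OF j(1) that(2)] cc by (simp add: q_def)
      have qid: "(\<Sum>k\<in>I. q a k * q k b) = q a b" if ab: "a \<in> I" "b \<in> I" for a b
      proof -
        have "(\<Sum>k\<in>I. q a k * q k b)
          = (\<Sum>k\<in>I. p a k * p k b - (p a k * p k j) * (p j b / c) - (p a j / c) * (p j k * p k b)
              + (p a j * p j b / c\<^sup>2) * (p j k * p k j))"
          by (rule sum.cong) (auto simp: q_def algebra_simps power2_eq_square divide_simps c0)
        also have "\<dots> = p a b - p a j * (p j b / c) - (p a j / c) * p j b + (p a j * p j b / c\<^sup>2) * c"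
          unfolding sum.distrib sum_subtractf
            sum_distrib_left[symmetric] sum_distrib_right[symmetric]
            id[OF ab] id[OF ab(1) j(1)] id[OF j(1) ab(2)] id[OF j(1) j(1)] c_def ..
        also have "\<dots> = q a b" using c0 by (simp add: q_def power2_eq_square)
        finally show ?thesis .
      qed
      have "(\<Sum>a\<in>I. q a a) = (\<Sum>a\<in>I. p a a - p j a * p a j / c)"
        by (rule sum.cong) (auto simp: q_def mult.commute)
      also have "\<dots> = (\<Sum>a\<in>I. p a a) - (\<Sum>a\<in>I. p j a * p a j) / c"
        by (simp add: sum_subtractf sum_divide_distrib)
      also have "\<dots> = (\<Sum>a\<in>I. p a a) - 1" using id[OF j(1) j(1)] c0 c_def by simp
      finally have tr: "(\<Sum>a\<in>I. q a a) = (\<Sum>a\<in>I. p a a) - 1" .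
      have "Re (\<Sum>a\<in>I. q a a) < real N" using Suc.prems(1) unfolding tr by simp
      then obtain n :: nat where "(\<Sum>a\<in>I. q a a) = of_nat n"
        using Suc.IH[OF _ qsa qid] by blast
      then have "(\<Sum>a\<in>I. p a a) = of_nat (Suc n)" unfolding tr by (simp add: algebra_simps)
      then show ?thesis by blast
    qed
  qed
  moreover obtain N :: nat where "Re (\<Sum>i\<in>I. p i i) < real N" using reals_Archimedean2 by blast
  ultimately show ?thesis by blast
qed

text \<open>Divisible abelian groups are injective. A subgroup L that is maximal with trivial
  intersection with A is a complement of A: if L A missed some x, divisibility would allow x to be
  corrected by an element of A so that L could be enlarged by it. The retraction is the projection
  along L.\<close>

lemma (in comm_group) divisible_subgroup_retract:
  assumes A: "subgroup A G"
    and div: "\<And>a n. a \<in> A \<Longrightarrow> 0 < (n::nat) \<Longrightarrow> \<exists>b\<in>A. b [^] n = a"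
  shows "\<exists>r\<in>hom G G. (\<forall>x\<in>carrier G. r x \<in> A) \<and> (\<forall>a\<in>A. r a = a)"
proof -
  interpret A: subgroup A G by (rule A)
  have Ac: "a \<in> A \<Longrightarrow> a \<in> carrier G" for a by (rule A.mem_carrier)
  define \<A> where "\<A> = {L. subgroup L G \<and> L \<inter> A = {\<one>}}"
  have "\<exists>L\<in>\<A>. \<forall>L'\<in>\<A>. L \<subseteq> L' \<longrightarrow> L' = L"
  proof (rule subset_Zorn_nonempty)
    show "\<A> \<noteq> {}" using triv_subgroup A.one_closed unfolding \<A>_def by blast
    fix C assume C: "C \<noteq> {}" "subset.chain \<A> C"
    have sg: "subgroup L G" "L \<inter> A = {\<one>}" if "L \<in> C" for L
      using C(2) that unfolding subset.chain_def \<A>_def by auto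
    have "subgroup (\<Union>C) G"
    proof (rule subgroupI)
      show "\<Union>C \<subseteq> carrier G" using sg subgroup.subset by blast
      show "\<Union>C \<noteq> {}" using C(1) sg subgroup.one_closed by blast
      show "inv a \<in> \<Union>C" if "a \<in> \<Union>C" for a
        using that subgroup.m_inv_closed[OF sg(1)] by (elim UnionE) (rule UnionI)
      fix a b assume "a \<in> \<Union>C" "b \<in> \<Union>C"
      then obtain K L where KL: "K \<in> C" "L \<in> C" "a \<in> K" "b \<in> L" by blast
      then have "K \<subseteq> L \<or> L \<subseteq> K" using C(2) unfolding subset.chain_def by blast
      then consider "a \<in> L" | "b \<in> K" using KL by blast
      then show "a \<otimes> b \<in> \<Union>C"
      proof cases
        case 1
        then show ?thesis using subgroup.m_closed[OF sg(1)[OF KL(2)] 1 KL(4)] KL(2) by blast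
      next
        case 2
        then show ?thesis using subgroup.m_closed[OF sg(1)[OF KL(1)] KL(3) 2] KL(1) by blast
      qed
    qed
    moreover have "\<Union>C \<inter> A = {\<one>}" using sg C(1) by blast
    ultimately show "\<Union>C \<in> \<A>" unfolding \<A>_def by blast
  qed
  then obtain L where L\<A>: "L \<in> \<A>" and maximal: "\<forall>L'\<in>\<A>. L \<subseteq> L' \<longrightarrow> L' = L" by blast
  have L: "subgroup L G" "L \<inter> A = {\<one>}" using L\<A> unfolding \<A>_def by simp_all
  have max: "L' = L" if "subgroup L' G" "L' \<inter> A = {\<one>}" "L \<subseteq> L'" for L'
    using maximal that unfolding \<A>_def by simp
  interpret L: subgroup L G by (rule L(1))
  have Lc: "a \<in> L \<Longrightarrow> a \<in> carrier G" for a by (rule L.mem_carrier)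
  define S where "S = {l \<otimes> a | l a. l \<in> L \<and> a \<in> A}"
  have Sm: "x \<otimes> y \<in> S" if "x \<in> S" "y \<in> S" for x y
  proof -
    from that obtain l a l' a' where "x = l \<otimes> a" "y = l' \<otimes> a'" "l \<in> L" "l' \<in> L" "a \<in> A" "a' \<in> A"
      unfolding S_def by blast
    moreover from this have "x \<otimes> y = (l \<otimes> l') \<otimes> (a \<otimes> a')" using Lc Ac by (simp add: m_ac)
    ultimately show ?thesis unfolding S_def by blast
  qed
  have Si: "inv x \<in> S" if "x \<in> S" for x
  proof -
    from that obtain l a where "x = l \<otimes> a" "l \<in> L" "a \<in> A" unfolding S_def by blast
    moreover from this have "inv x = inv l \<otimes> inv a" using Lc Ac by (simp add: inv_mult)
    ultimately show ?thesis unfolding S_def by blast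
  qed
  have LS: "L \<subseteq> S"
  proof
    fix l assume "l \<in> L"
    then have "l = l \<otimes> \<one>" "\<one> \<in> A" using Lc by auto
    then show "l \<in> S" using \<open>l \<in> L\<close> unfolding S_def by blast
  qed
  have AS: "A \<subseteq> S"
  proof
    fix a assume "a \<in> A"
    then have "a = \<one> \<otimes> a" "\<one> \<in> L" using Ac by auto
    then show "a \<in> S" using \<open>a \<in> A\<close> unfolding S_def by blast
  qed
  have Sc: "S \<subseteq> carrier G" using Lc Ac unfolding S_def by blast
  have Ssub: "subgroup S G"
  proof (rule subgroupI)
    show "S \<noteq> {}" using LS L.one_closed by blast
  qed (use Sc Sm Si in auto)
  have Sp: "x [^] (k::int) \<in> S" if "x \<in> S" for x k
    using subgroup_int_pow_closed[OF Ssub that] .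
  have full: "x \<in> S" if x: "x \<in> carrier G" for x
  proof (rule ccontr)
    assume xS: "x \<notin> S"
    \<comment> \<open>It suffices that the cyclic group of x b meets L A only inside L: then L
      together with x b still meets A trivially, against maximality.\<close>
    have "\<exists>b\<in>A. \<forall>k::int. (x \<otimes> b) [^] k \<in> S \<longrightarrow> (x \<otimes> b) [^] k \<in> L"
    proof (cases "\<exists>n>0. x [^] (n::nat) \<in> S")
      case False
      have "x [^] k \<in> L" if k: "x [^] (k::int) \<in> S" for k
      proof -
        have "k = 0"
        proof (rule ccontr)
          assume "k \<noteq> 0"
          have "x [^] \<bar>k\<bar> \<in> S"
          proof (cases "k \<ge> 0")
            case False
            then show ?thesis using Si[OF k] x by (simp add: int_pow_neg)
          qed (use k in simp)
          then have "x [^] nat \<bar>k\<bar> \<in> S" by (metis abs_ge_zero int_nat_eq int_pow_int)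
          then show False using False \<open>k \<noteq> 0\<close> by (metis zero_less_abs_iff zero_less_nat_eq)
        qed
        then show ?thesis by simp
      qed
      then show ?thesis using x by (intro bexI[of _ \<one>]) auto
    next
      case True
      \<comment> \<open>The least positive exponent with x^n in S. Writing x^n = l a with a = b^n,
        the element y = x b^-1 has y^n = l. A power of y in S has exponent divisible by n, by
        division with remainder, and is therefore a power of l.\<close>
      define n where "n = (LEAST n. 0 < n \<and> x [^] (n::nat) \<in> S)"
      have n: "0 < n" "x [^] n \<in> S"
        using LeastI_ex[OF True] unfolding n_def by auto
      have nmin: "n \<le> m" if "0 < m" "x [^] m \<in> S" for m
        unfolding n_def by (rule Least_le) (use that in auto)
      obtain l a where la: "l \<in> L" "a \<in> A" "x [^] n = l \<otimes> a" using n unfolding S_def by blast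
      obtain b where b: "b \<in> A" "b [^] n = a" using div[OF la(2) n(1)] by blast
      define y where "y = x \<otimes> inv b"
      have yc: "y \<in> carrier G" and bc: "b \<in> carrier G" using x Ac b unfolding y_def by auto
      have "y [^] n = l \<otimes> a \<otimes> inv a"
        unfolding y_def using x bc by (simp add: nat_pow_distrib nat_pow_inv la(3) b(2))
      also have "\<dots> = l" using Lc Ac la by (simp add: m_assoc)
      finally have yn: "y [^] n = l" .
      have "y [^] k \<in> L" if k: "y [^] (k::int) \<in> S" for k
      proof -
        have "x [^] k = y [^] k \<otimes> b [^] k"
        proof -
          have "x = y \<otimes> b" unfolding y_def using x bc by (simp add: m_assoc)
          then show ?thesis using yc bc by (metis int_pow_distrib)
        qed
        then have xk: "x [^] k \<in> S" using Sm[OF k] Sp[of b] b(1) AS by auto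
        have "x [^] k = x [^] (int n * (k div int n)) \<otimes> x [^] (k mod int n)"
          using x by (simp flip: int_pow_mult)
        then have "x [^] (k mod int n) = inv (x [^] (int n * (k div int n))) \<otimes> x [^] k"
          using x by (simp flip: m_assoc)
        moreover have "x [^] (int n * (k div int n)) \<in> S"
          using Sp[OF n(2)] x by (metis int_pow_int int_pow_pow)
        ultimately have "x [^] (k mod int n) \<in> S" using Sm Si xk by simp
        moreover define m where "m = nat (k mod int n)"
        moreover have km: "int m = k mod int n" using n(1) unfolding m_def by simp
        ultimately have "x [^] m \<in> S" by (metis int_pow_int)
        moreover have "m < n" using pos_mod_bound[of "int n" k] n(1) km by linarith
        ultimately have "m = 0" using nmin[of m] by (cases "m = 0") auto
        then have "k mod int n = 0" using km by simp
        then have "k = int n * (k div int n)" by auto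
        then have "y [^] k = l [^] (k div int n)"
          using yc yn by (metis int_pow_int int_pow_pow)
        then show ?thesis using subgroup_int_pow_closed[OF L(1) la(1)] by simp
      qed
      then show ?thesis unfolding y_def using b by (intro bexI[of _ "inv b"]) auto
    qed
    then obtain b where b: "b \<in> A" and y: "\<And>k::int. (x \<otimes> b) [^] k \<in> S \<Longrightarrow> (x \<otimes> b) [^] k \<in> L" by blast
    define y where "y = x \<otimes> b"
    have yc: "y \<in> carrier G" using x b Ac unfolding y_def by auto
    define L' where "L' = {l \<otimes> y [^] k | l k. l \<in> L \<and> k \<in> (UNIV :: int set)}"
    have "subgroup L' G"
    proof (rule subgroupI)
      show "L' \<subseteq> carrier G" using Lc yc unfolding L'_def by auto
      show "L' \<noteq> {}" using L.one_closed unfolding L'_def by blast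
      fix a assume "a \<in> L'"
      then obtain l k where "a = l \<otimes> y [^] (k::int)" "l \<in> L" unfolding L'_def by blast
      moreover from this have "inv a = inv l \<otimes> y [^] (- k)" using Lc yc by (simp add: inv_mult int_pow_neg)
      ultimately show "inv a \<in> L'" unfolding L'_def by blast
      fix a' assume "a' \<in> L'"
      then obtain l' k' where "a' = l' \<otimes> y [^] (k'::int)" "l' \<in> L" unfolding L'_def by blast
      moreover from this \<open>a = l \<otimes> y [^] k\<close> \<open>l \<in> L\<close> have "a \<otimes> a' = (l \<otimes> l') \<otimes> y [^] (k + k')"
        using Lc yc by (simp add: m_ac int_pow_mult[symmetric] add.commute)
      ultimately show "a \<otimes> a' \<in> L'" using \<open>l \<in> L\<close> unfolding L'_def by blast
    qed
    moreover have "L' \<inter> A = {\<one>}"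
    proof (intro equalityI subsetI)
      fix a assume a: "a \<in> L' \<inter> A"
      then obtain l k where lk: "a = l \<otimes> y [^] (k::int)" "l \<in> L" unfolding L'_def by blast
      then have "y [^] k = inv l \<otimes> a" using Lc yc by (simp flip: m_assoc)
      then have "y [^] k \<in> S" using a lk unfolding S_def by blast
      then have "y [^] k \<in> L" using y unfolding y_def by blast
      then have "a \<in> L" using lk by simp
      then show "a \<in> {\<one>}" using a L(2) by blast
    next
      fix a assume "a \<in> {\<one>}"
      moreover have "\<one> = \<one> \<otimes> y [^] (0::int)" using yc by simp
      ultimately show "a \<in> L' \<inter> A" using L.one_closed A.one_closed unfolding L'_def by blast
    qed
    moreover have "L \<subseteq> L'"
    proof
      fix l assume l: "l \<in> L"
      then have "l = l \<otimes> y [^] (0::int)" using yc Lc by simp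
      then show "l \<in> L'" using l unfolding L'_def by blast
    qed
    ultimately have "L' = L" by (rule max)
    moreover have "y = \<one> \<otimes> y [^] (1::int)" using yc by simp
    then have "y \<in> L'" using L.one_closed unfolding L'_def by blast
    ultimately have "y \<in> S" using LS by blast
    moreover have "x = y \<otimes> inv b" unfolding y_def using x b Ac by (simp add: m_assoc)
    ultimately have "x \<in> S" using Sm AS b by (metis A.m_inv_closed subsetD)
    with xS show False by contradiction
  qed
  have "\<exists>!a. a \<in> A \<and> (\<exists>l\<in>L. x = l \<otimes> a)" if x: "x \<in> carrier G" for x
  proof (rule ex_ex1I)
    show "\<exists>a. a \<in> A \<and> (\<exists>l\<in>L. x = l \<otimes> a)" using full[OF x] unfolding S_def by blast
    fix a a' assume "a \<in> A \<and> (\<exists>l\<in>L. x = l \<otimes> a)" "a' \<in> A \<and> (\<exists>l\<in>L. x = l \<otimes> a')"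
    then obtain l l' where h: "a \<in> A" "a' \<in> A" "l \<in> L" "l' \<in> L" "l \<otimes> a = l' \<otimes> a'" by metis
    note c = Lc[OF h(3)] Lc[OF h(4)] Ac[OF h(1)] Ac[OF h(2)]
    have "a \<otimes> inv a' = inv l \<otimes> (l \<otimes> a) \<otimes> inv a'" using c by (simp flip: m_assoc)
    also have "\<dots> = inv l \<otimes> l'" unfolding h(5) using c by (simp add: m_assoc)
    finally have e: "a \<otimes> inv a' = inv l \<otimes> l'" .
    have "a \<otimes> inv a' \<in> A" using h by blast
    moreover have "a \<otimes> inv a' \<in> L" unfolding e using h by blast
    ultimately have "a \<otimes> inv a' = \<one>" using L(2) by blast
    moreover have "a = (a \<otimes> inv a') \<otimes> a'" using c by (simp add: m_assoc)
    ultimately show "a = a'" using c by simp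
  qed
  then obtain r where r: "\<And>x. x \<in> carrier G \<Longrightarrow> r x \<in> A \<and> (\<exists>l\<in>L. x = l \<otimes> r x)"
    and runiq: "\<And>x a l. x \<in> carrier G \<Longrightarrow> a \<in> A \<Longrightarrow> l \<in> L \<Longrightarrow> x = l \<otimes> a \<Longrightarrow> a = r x"
    by metis
  have "r \<in> hom G G"
  proof (rule homI)
    fix x y assume xy: "x \<in> carrier G" "y \<in> carrier G"
    show "r x \<in> carrier G" using r[OF xy(1)] Ac by blast
    obtain l l' where l: "l \<in> L" "x = l \<otimes> r x" "l' \<in> L" "y = l' \<otimes> r y" using r xy by blast
    have c: "r x \<in> carrier G" "r y \<in> carrier G" "l \<in> carrier G" "l' \<in> carrier G"
      using r[OF xy(1)] r[OF xy(2)] Ac Lc l by auto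
    have "x \<otimes> y = (l \<otimes> r x) \<otimes> (l' \<otimes> r y)" using l by simp
    also have "\<dots> = (l \<otimes> l') \<otimes> (r x \<otimes> r y)" using c by (simp add: m_ac)
    finally show "r (x \<otimes> y) = r x \<otimes> r y"
      using runiq[of "x \<otimes> y" "r x \<otimes> r y" "l \<otimes> l'"] r xy l by (simp add: r)
  qed
  moreover have "r a = a" if "a \<in> A" for a
    using runiq[of a a \<one>] that Ac by auto
  ultimately show ?thesis using r by blast
qed

section \<open>Ultrafilters and the Stone-Cech compactification\<close>

text \<open>Extension to the Stone-Cech compactification is proved for regular target spaces; this
  instance lets the same proof serve integer and complex values.\<close>

instance int :: t3_space
proof
  fix S :: "int set" and y assume "closed S" "y \<notin> S"
  then show "\<exists>U V. open U \<and> open V \<and> y \<in> U \<and> S \<subseteq> V \<and> U \<inter> V = {}"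
    by (intro exI[of _ "{y}"] exI[of _ S]) (auto simp: open_discrete)
qed

lemma t3_shrink:
  fixes l :: "'b::t3_space"
  assumes "open U" "l \<in> U"
  obtains V where "open V" "l \<in> V" "closure V \<subseteq> U"
proof -
  obtain V W where VW: "open V" "open W" "l \<in> V" "- U \<subseteq> W" "V \<inter> W = {}"
    using t3_space[of "- U" l] assms by auto
  have "closure V \<subseteq> - W" using VW by (intro closure_minimal) auto
  then show ?thesis using VW by (intro that[of V]) auto
qed

text \<open>Zorn's lemma in the reversed order: a minimal proper filter is an ultrafilter, since
  restricting it to P either changes nothing or makes it improper.\<close>

lemma ultrafilter_exists:
  assumes "F \<noteq> bot"
  shows "\<exists>U. ultrafilter U \<and> U \<le> F"
proof -
  define A where "A = {G. G \<noteq> bot \<and> G \<le> F}"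
  have "\<exists>m\<in>A. \<forall>a\<in>A. a \<le> m \<longrightarrow> a = m"
  proof -
    have po: "partial_order_on A (relation_of (\<lambda>x y. y \<le> x) A)"
      by (rule partial_order_on_relation_ofI) auto
    have "\<exists>m\<in>A. \<forall>a\<in>A. m \<ge> a \<longrightarrow> a = m"
    proof (rule predicate_Zorn[OF po])
      fix C assume C: "C \<in> Chains (relation_of (\<lambda>x y. y \<le> x) A)"
      then have CA: "C \<subseteq> A" and lin: "\<And>G H. G \<in> C \<Longrightarrow> H \<in> C \<Longrightarrow> G \<le> H \<or> H \<le> G"
        unfolding Chains_def relation_of_def by auto
      show "\<exists>u\<in>A. \<forall>a\<in>C. u \<le> a"
      proof (cases "C = {}")
        case True
        then show ?thesis using assms unfolding A_def by blast
      next
        case False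
        \<comment> \<open>Along a nonempty chain the infimum has no more sets than the members
          together, so it remains proper.\<close>
        have "eventually P (Inf C) \<longleftrightarrow> (\<exists>G\<in>C. eventually P G)" for P
        proof (rule eventually_Inf_base[OF False])
          fix G H assume "G \<in> C" "H \<in> C"
          then show "\<exists>x\<in>C. x \<le> inf G H" using lin[of G H] by auto
        qed
        from this[of "\<lambda>_. False"] have "Inf C \<noteq> bot"
          using CA unfolding A_def by (auto simp: trivial_limit_def)
        moreover have "Inf C \<le> F" using False CA unfolding A_def
          by (metis (no_types, lifting) Inf_lower2 all_not_in_conv mem_Collect_eq subsetD)
        ultimately show ?thesis unfolding A_def by (intro bexI[of _ "Inf C"]) (auto intro: Inf_lower)
      qed
    qed
    then show ?thesis .
  qed
  then obtain U where U: "U \<in> A" "\<And>V. V \<in> A \<Longrightarrow> V \<le> U \<Longrightarrow> V = U" by blast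
  have "eventually P U \<or> eventually (\<lambda>x. \<not> P x) U" for P
  proof (cases "inf U (principal {x. P x}) = bot")
    case True
    then show ?thesis by (simp add: trivial_limit_def eventually_inf_principal)
  next
    case False
    then have "inf U (principal {x. P x}) = U" using U unfolding A_def by (auto intro: le_infI1)
    then have "U \<le> principal {x. P x}" by (simp add: inf.absorb_iff1)
    then show ?thesis by (simp add: le_principal)
  qed
  then show ?thesis using U(1) unfolding ultrafilter_def A_def by auto
qed

lemma ultrafilter_not:
  assumes "ultrafilter U" shows "eventually (\<lambda>x. \<not> P x) U \<longleftrightarrow> \<not> eventually P U"
proof
  assume "eventually (\<lambda>x. \<not> P x) U"
  show "\<not> eventually P U"
  proof
    assume "eventually P U"
    with \<open>eventually (\<lambda>x. \<not> P x) U\<close> have "eventually (\<lambda>x. False) U"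
      by (rule eventually_elim2) simp
    then show False using assms unfolding ultrafilter_def by (simp add: trivial_limit_def)
  qed
next
  assume "\<not> eventually P U" then show "eventually (\<lambda>x. \<not> P x) U"
    using assms unfolding ultrafilter_def by blast
qed

lemma ultrafilter_bex:
  assumes U: "ultrafilter U" and "finite I" "eventually (\<lambda>x. \<exists>i\<in>I. P i x) U"
  shows "\<exists>i\<in>I. eventually (P i) U"
proof (rule ccontr)
  assume "\<not> ?thesis"
  then have "\<forall>i\<in>I. eventually (\<lambda>x. \<not> P i x) U" using ultrafilter_not[OF U] by blast
  then have "eventually (\<lambda>x. \<forall>i\<in>I. \<not> P i x) U" using assms(2) by (simp add: eventually_ball_finite)
  then have "eventually (\<lambda>x. \<not> (\<exists>i\<in>I. P i x)) U" by simp
  then show False using ultrafilter_not[OF U] assms(3) by blast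
qed

lemma ultrafilter_not_bot: "ultrafilter U \<Longrightarrow> U \<noteq> bot"
  unfolding ultrafilter_def by blast

lemma ultrafilter_ex: "ultrafilter U \<Longrightarrow> eventually P U \<Longrightarrow> \<exists>x. P x"
  using eventually_happens' ultrafilter_not_bot by blast

lemma ultrafilter_filtermap: "ultrafilter U \<Longrightarrow> ultrafilter (filtermap f U)"
  unfolding ultrafilter_def by (auto simp: filtermap_bot_iff eventually_filtermap)

lemma ultrafilter_principal: "ultrafilter (principal {x})"
  unfolding ultrafilter_def by (auto simp: eventually_principal principal_eq_bot_iff)

text \<open>Compactness provides a cluster point, and along an ultrafilter every cluster point is a
  limit.\<close>

lemma ultrafilter_tendsto_compact:
  assumes U: "ultrafilter U" and C: "compact C" and ev: "eventually (\<lambda>x. f x \<in> C) U"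
  obtains l where "l \<in> C" "(f \<longlongrightarrow> l) U"
proof -
  have "filtermap f U \<noteq> bot" using ultrafilter_not_bot[OF U] by (simp add: filtermap_bot_iff)
  moreover have "eventually (\<lambda>x. x \<in> C) (filtermap f U)" using ev by (simp add: eventually_filtermap)
  ultimately obtain l where l: "l \<in> C" "inf (nhds l) (filtermap f U) \<noteq> bot"
    using C unfolding compact_filter by blast
  have "(f \<longlongrightarrow> l) U"
  proof (rule topological_tendstoI, rule ccontr)
    fix S assume S: "open S" "l \<in> S" "\<not> eventually (\<lambda>x. f x \<in> S) U"
    then have "eventually (\<lambda>y. y \<notin> S) (filtermap f U)"
      using ultrafilter_not[OF U, of "\<lambda>x. f x \<in> S"] by (simp add: eventually_filtermap)
    moreover have "eventually (\<lambda>y. y \<in> S) (nhds l)" using S by (simp add: eventually_nhds_in_open)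
    ultimately have "eventually (\<lambda>y. False) (inf (nhds l) (filtermap f U))"
      unfolding eventually_inf by (intro exI[of _ "\<lambda>y. y \<in> S"] exI[of _ "\<lambda>y. y \<notin> S"]) auto
    then show False using l by (simp add: trivial_limit_def)
  qed
  with l that show ?thesis by blast
qed

text \<open>A compactness principle: along an ultrafilter finer than the finite subsets of X, each
  coordinate takes finitely many values and is therefore eventually constant. The limit k agrees on
  any finite set D of coordinates with the solution for arbitrarily large F.\<close>

lemma finite_solutions_limit:
  fixes h :: "'i set \<Rightarrow> 'e \<Rightarrow> 'v"
  assumes V: "finite V" and hV: "\<And>F e. h F e \<in> V"
  obtains k where "\<And>e. k e \<in> V"
    "\<And>D F0. finite D \<Longrightarrow> finite F0 \<Longrightarrow> F0 \<subseteq> X \<Longrightarrow> \<exists>F. finite F \<and> F0 \<subseteq> F \<and> F \<subseteq> X \<and> (\<forall>e\<in>D. k e = h F e)"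
proof -
  obtain U where U: "ultrafilter U" "U \<le> finite_subsets_at_top X"
    using ultrafilter_exists[OF finite_subsets_at_top_neq_bot] by blast
  have "\<exists>v\<in>V. eventually (\<lambda>F. h F e = v) U" for e
    by (rule ultrafilter_bex[OF U(1) V]) (simp add: hV)
  then obtain k where k: "\<And>e. k e \<in> V" "\<And>e. eventually (\<lambda>F. h F e = k e) U" by metis
  show ?thesis
  proof (rule that[OF k(1)])
    fix D :: "'e set" and F0 assume D: "finite D" and F0: "finite F0" "F0 \<subseteq> X"
    have "eventually (\<lambda>F. \<forall>e\<in>D. h F e = k e) U" using D k(2) by (simp add: eventually_ball_finite)
    moreover have "eventually (\<lambda>F. finite F \<and> F0 \<subseteq> F \<and> F \<subseteq> X) U"
      using F0 by (intro filter_leD[OF U(2)]) (auto simp: eventually_finite_subsets_at_top)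
    ultimately have "eventually (\<lambda>F. (\<forall>e\<in>D. h F e = k e) \<and> finite F \<and> F0 \<subseteq> F \<and> F \<subseteq> X) U"
      by (rule eventually_conj)
    then obtain F where "\<forall>e\<in>D. h F e = k e" "finite F \<and> F0 \<subseteq> F \<and> F \<subseteq> X"
      using ultrafilter_ex[OF U(1)] by blast
    then show "\<exists>F. finite F \<and> F0 \<subseteq> F \<and> F \<subseteq> X \<and> (\<forall>e\<in>D. k e = h F e)" by (metis)
  qed
qed

text \<open>The generating sets are closed under finite intersections, so they form a basis; this is
  the description of open sets used from here on.\<close>

lemma openin_stone_cech:
  "openin (stone_cech S) W \<longleftrightarrow> W \<subseteq> topspace (stone_cech S) \<and>
     (\<forall>F\<in>W. \<exists>A\<subseteq>S. eventually (\<lambda>x. x \<in> A) F \<and>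
        (\<forall>F'\<in>topspace (stone_cech S). eventually (\<lambda>x. x \<in> A) F' \<longrightarrow> F' \<in> W))"
  (is "_ \<longleftrightarrow> ?P W")
proof
  assume "openin (stone_cech S) W"
  then have "generate_topology_on ((\<lambda>A. {F. ultrafilter F \<and> F \<le> principal S \<and> eventually (\<lambda>x. x \<in> A) F}) ` Pow S) W"
    unfolding stone_cech_def by (simp add: openin_topology_generated_by)
  then show "?P W"
  proof (induction rule: generate_topology_on.induct)
    case Empty
    then show ?case by simp
  next
    case (Int a b)
    show ?case
    proof (intro conjI ballI)
      show "a \<inter> b \<subseteq> topspace (stone_cech S)" using Int by blast
      fix F assume F: "F \<in> a \<inter> b"
      obtain A where "A \<subseteq> S" "eventually (\<lambda>x. x \<in> A) F"
        "\<forall>F'\<in>topspace (stone_cech S). eventually (\<lambda>x. x \<in> A) F' \<longrightarrow> F' \<in> a"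
        using Int.IH(1) F by blast
      moreover obtain B where "B \<subseteq> S" "eventually (\<lambda>x. x \<in> B) F"
        "\<forall>F'\<in>topspace (stone_cech S). eventually (\<lambda>x. x \<in> B) F' \<longrightarrow> F' \<in> b"
        using Int.IH(2) F by blast
      ultimately show "\<exists>A\<subseteq>S. eventually (\<lambda>x. x \<in> A) F \<and>
          (\<forall>F'\<in>topspace (stone_cech S). eventually (\<lambda>x. x \<in> A) F' \<longrightarrow> F' \<in> a \<inter> b)"
        by (intro exI[of _ "A \<inter> B"]) (auto simp: eventually_conj_iff)
    qed
  next
    case (UN K)
    show ?case
    proof (intro conjI ballI)
      show "\<Union>K \<subseteq> topspace (stone_cech S)" using UN by blast
      fix F assume "F \<in> \<Union>K"
      then obtain k where k: "k \<in> K" "F \<in> k" by blast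
      then obtain A where "A \<subseteq> S" "eventually (\<lambda>x. x \<in> A) F"
        "\<forall>F'\<in>topspace (stone_cech S). eventually (\<lambda>x. x \<in> A) F' \<longrightarrow> F' \<in> k"
        using UN.IH[OF k(1)] by blast
      then show "\<exists>A\<subseteq>S. eventually (\<lambda>x. x \<in> A) F \<and>
          (\<forall>F'\<in>topspace (stone_cech S). eventually (\<lambda>x. x \<in> A) F' \<longrightarrow> F' \<in> \<Union>K)"
        using k(1) by (intro exI[of _ A]) blast
    qed
  next
    case (Basis s)
    then show ?case by (auto simp: topspace_stone_cech)
  qed
next
  assume P: "?P W"
  have B: "openin (stone_cech S) {F. ultrafilter F \<and> F \<le> principal S \<and> eventually (\<lambda>x. x \<in> A) F}" if "A \<subseteq> S" for A
    unfolding stone_cech_def by (rule topology_generated_by_Basis) (use that in auto)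
  show "openin (stone_cech S) W"
  proof (subst openin_subopen, intro ballI)
    fix F assume F: "F \<in> W"
    then obtain A where A: "A \<subseteq> S" "eventually (\<lambda>x. x \<in> A) F"
      "\<forall>F'\<in>topspace (stone_cech S). eventually (\<lambda>x. x \<in> A) F' \<longrightarrow> F' \<in> W" using P by blast
    show "\<exists>T. openin (stone_cech S) T \<and> F \<in> T \<and> T \<subseteq> W"
      by (rule exI[of _ "{F. ultrafilter F \<and> F \<le> principal S \<and> eventually (\<lambda>x. x \<in> A) F}"])
        (use A B F P in \<open>auto simp: topspace_stone_cech\<close>)
  qed
qed

lemma openin_stone_cech_basic:
  assumes "A \<subseteq> S"
  shows "openin (stone_cech S) {F \<in> topspace (stone_cech S). eventually (\<lambda>x. x \<in> A) F}"
  unfolding openin_stone_cech using assms by auto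

lemma closedin_stone_cech_basic:
  assumes "A \<subseteq> S"
  shows "closedin (stone_cech S) {F \<in> topspace (stone_cech S). eventually (\<lambda>x. x \<in> A) F}"
proof -
  have "topspace (stone_cech S) - {F \<in> topspace (stone_cech S). eventually (\<lambda>x. x \<in> A) F}
      = {F \<in> topspace (stone_cech S). eventually (\<lambda>x. x \<in> S - A) F}"
    by (auto simp: topspace_stone_cech le_principal eventually_conj_iff ultrafilter_not)
  moreover have "openin (stone_cech S) \<dots>" by (rule openin_stone_cech_basic) auto
  ultimately show ?thesis unfolding closedin_def by auto
qed

text \<open>If basic sets cover the space but no finitely many of their underlying sets cover S, the
  complements in S generate a proper filter. An ultrafilter below it is a point which the cover
  misses.\<close>

lemma compact_space_stone_cech: "compact_space (stone_cech S)"
proof -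
  let ?B = "\<lambda>A. {F \<in> topspace (stone_cech S). eventually (\<lambda>x. x \<in> A) F}"
  show ?thesis
    unfolding compact_space_alt
  proof (intro allI impI)
    fix C assume C: "(\<forall>U\<in>C. openin (stone_cech S) U) \<and> topspace (stone_cech S) \<subseteq> \<Union>C"
    define A where "A = {A. \<exists>U\<in>C. ?B A \<subseteq> U}"
    have cover: "\<exists>a\<in>A. eventually (\<lambda>x. x \<in> a) F" if F: "F \<in> topspace (stone_cech S)" for F
    proof -
      obtain U where U: "U \<in> C" "F \<in> U" using C F by blast
      then have "openin (stone_cech S) U" using C by blast
      then obtain a where a: "eventually (\<lambda>x. x \<in> a) F"
        "\<forall>F'\<in>topspace (stone_cech S). eventually (\<lambda>x. x \<in> a) F' \<longrightarrow> F' \<in> U"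
        using U(2) unfolding openin_stone_cech by blast
      then have "?B a \<subseteq> U" by blast
      then have "a \<in> A" unfolding A_def using U(1) by blast
      then show ?thesis using a(1) by blast
    qed
    have "\<exists>D. finite D \<and> D \<subseteq> A \<and> S \<subseteq> \<Union>D"
    proof (rule ccontr)
      assume no: "\<not> ?thesis"
      define F where "F = (INF D\<in>{D. finite D \<and> D \<subseteq> A}. principal (S - \<Union>D))"
      have ev: "eventually P F \<longleftrightarrow> (\<exists>D\<in>{D. finite D \<and> D \<subseteq> A}. eventually P (principal (S - \<Union>D)))" for P
        unfolding F_def
      proof (rule eventually_INF_base)
        show "{D. finite D \<and> D \<subseteq> A} \<noteq> {}" by blast
        fix D E assume "D \<in> {D. finite D \<and> D \<subseteq> A}" "E \<in> {D. finite D \<and> D \<subseteq> A}"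
        then have 1: "D \<union> E \<in> {D. finite D \<and> D \<subseteq> A}" by simp
        have 2: "principal (S - \<Union>(D \<union> E)) \<le> inf (principal (S - \<Union>D)) (principal (S - \<Union>E))" by auto
        show "\<exists>x\<in>{D. finite D \<and> D \<subseteq> A}. principal (S - \<Union>x) \<le> inf (principal (S - \<Union>D)) (principal (S - \<Union>E))"
          by (rule bexI[where x = "D \<union> E", OF _ 1]) (rule 2)
      qed
      have "F \<noteq> bot"
      proof
        assume "F = bot"
        then have "eventually (\<lambda>_. False) F" by simp
        then obtain D where D: "finite D \<and> D \<subseteq> A" "eventually (\<lambda>_. False) (principal (S - \<Union>D))"
          unfolding ev by blast
        then have "S \<subseteq> \<Union>D" by (auto simp: eventually_principal)
        then show False using no D(1) by blast
      qed
      then obtain U where U: "ultrafilter U" "U \<le> F" using ultrafilter_exists by blast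
      have "eventually (\<lambda>x. x \<in> S) F"
        unfolding ev by (rule bexI[where x = "{}"]) (simp_all add: eventually_principal)
      then have "eventually (\<lambda>x. x \<in> S) U" using U(2) unfolding le_filter_def by blast
      then have "U \<in> topspace (stone_cech S)" using U(1) by (simp add: topspace_stone_cech le_principal)
      then obtain a where a: "a \<in> A" "eventually (\<lambda>x. x \<in> a) U" using cover by blast
      have "eventually (\<lambda>x. x \<notin> a) F"
        unfolding ev by (rule bexI[where x = "{a}"]) (use a in \<open>simp_all add: eventually_principal\<close>)
      then have "eventually (\<lambda>x. x \<notin> a) U" using U(2) unfolding le_filter_def by blast
      then show False using a ultrafilter_not[OF U(1)] by blast
    qed
    then obtain D where D: "finite D" "D \<subseteq> A" "S \<subseteq> \<Union>D" by blast
    have "topspace (stone_cech S) \<subseteq> \<Union>(?B ` D)"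
    proof
      fix F assume F: "F \<in> topspace (stone_cech S)"
      then have "eventually (\<lambda>x. \<exists>a\<in>D. x \<in> a) F" using D(3)
        by (auto simp: topspace_stone_cech le_principal elim!: eventually_mono)
      then obtain a where "a \<in> D" "eventually (\<lambda>x. x \<in> a) F"
        using ultrafilter_bex[OF _ D(1), of F "\<lambda>a x. x \<in> a"] F by (auto simp: topspace_stone_cech)
      then show "F \<in> \<Union>(?B ` D)" using F by (auto simp: topspace_stone_cech)
    qed
    moreover obtain g where g: "\<And>a. a \<in> D \<Longrightarrow> g a \<in> C \<and> ?B a \<subseteq> g a"
    proof -
      have "\<exists>U. U \<in> C \<and> ?B a \<subseteq> U" if "a \<in> D" for a
        using that D(2) unfolding A_def by blast
      then show ?thesis using that by metis
    qed
    ultimately show "\<exists>C'. finite C' \<and> C' \<subseteq> C \<and> topspace (stone_cech S) \<subseteq> \<Union>C'"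
      using D(1) by (intro exI[of _ "g ` D"]) blast
  qed
qed

text \<open>The right side is clopen. An ultrafilter F in it is a limit of points of E: if A
  describes a basic neighbourhood of F, then A and E both belong to F and so have a common
  point.\<close>

lemma stone_cech_closure_of:
  assumes "E \<subseteq> S"
  shows "stone_cech S closure_of ((\<lambda>e. principal {e}) ` E) = {F \<in> topspace (stone_cech S). eventually (\<lambda>x. x \<in> E) F}"
proof (rule closure_of_unique)
  show "(\<lambda>e. principal {e}) ` E \<subseteq> {F \<in> topspace (stone_cech S). eventually (\<lambda>x. x \<in> E) F}"
    using assms by (auto simp: principal_in_stone_cech eventually_principal)
  show "closedin (stone_cech S) {F \<in> topspace (stone_cech S). eventually (\<lambda>x. x \<in> E) F}"
    by (rule closedin_stone_cech_basic[OF assms])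
  fix T assume T: "(\<lambda>e. principal {e}) ` E \<subseteq> T" "closedin (stone_cech S) T"
  show "{F \<in> topspace (stone_cech S). eventually (\<lambda>x. x \<in> E) F} \<subseteq> T"
  proof (rule subsetI, rule ccontr)
    fix F assume F: "F \<in> {F \<in> topspace (stone_cech S). eventually (\<lambda>x. x \<in> E) F}" "F \<notin> T"
    have "openin (stone_cech S) (topspace (stone_cech S) - T)" using T(2) by (simp add: closedin_def)
    then obtain A where A: "A \<subseteq> S" "eventually (\<lambda>x. x \<in> A) F"
      "\<forall>F'\<in>topspace (stone_cech S). eventually (\<lambda>x. x \<in> A) F' \<longrightarrow> F' \<in> topspace (stone_cech S) - T"
      using F unfolding openin_stone_cech by blast
    have "eventually (\<lambda>x. x \<in> A \<and> x \<in> E) F" using A F by (auto simp: eventually_conj_iff)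
    then obtain x where x: "x \<in> A" "x \<in> E"
      using F ultrafilter_ex[of F] by (auto simp: topspace_stone_cech)
    have "principal {x} \<in> topspace (stone_cech S) - T"
      using A x by (auto simp: eventually_principal principal_in_stone_cech)
    then show False using T(1) x by auto
  qed
qed

text \<open>This evaluates a continuous function at an ultrafilter through its values on S; hence,
  by \<open>cfun_stone_cech_eqI\<close>, equality need only be checked on S.\<close>

lemma cfun_stone_cech_tendsto:
  assumes f: "f \<in> cfun (stone_cech S)" and F: "F \<in> topspace (stone_cech S)"
  shows "((\<lambda>x. f (principal {x})) \<longlongrightarrow> f F) F"
proof (rule topological_tendstoI)
  fix V assume V: "open V" "f F \<in> V"
  have "openin (stone_cech S) {G \<in> topspace (stone_cech S). f G \<in> V}"
    using f V(1) unfolding cfun_def continuous_map_def by auto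
  then obtain A where A: "A \<subseteq> S" "eventually (\<lambda>x. x \<in> A) F"
    "\<forall>F'\<in>topspace (stone_cech S). eventually (\<lambda>x. x \<in> A) F' \<longrightarrow> f F' \<in> V"
    using F V(2) unfolding openin_stone_cech by blast
  show "eventually (\<lambda>x. f (principal {x}) \<in> V) F"
    using A(2) by (rule eventually_mono) (use A in \<open>auto simp: principal_in_stone_cech eventually_principal\<close>)
qed

lemma cfun_stone_cech_eqI:
  fixes f g :: "'a filter \<Rightarrow> 'b::{t2_space, zero}"
  assumes f: "f \<in> cfun (stone_cech S)" and g: "g \<in> cfun (stone_cech S)"
    and eq: "\<And>x. x \<in> S \<Longrightarrow> f (principal {x}) = g (principal {x})"
  shows "f = g"
proof
  fix F show "f F = g F"
  proof (cases "F \<in> topspace (stone_cech S)")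
    case True
    then have "eventually (\<lambda>x. x \<in> S) F" "F \<noteq> bot"
      by (auto simp: topspace_stone_cech le_principal ultrafilter_not_bot)
    then have "((\<lambda>x. f (principal {x})) \<longlongrightarrow> g F) F"
      using cfun_stone_cech_tendsto[OF g True] eq
      by (subst tendsto_cong[of _ "\<lambda>x. g (principal {x})"]) (auto elim: eventually_mono)
    then show ?thesis
      using cfun_stone_cech_tendsto[OF f True] \<open>F \<noteq> bot\<close> tendsto_unique by blast
  next
    case False
    then show ?thesis using f g by (auto simp: cfun_def)
  qed
qed

text \<open>The continuous extension of \<phi> from S to the ultrafilters on S. \<open>Lim\<close>
  is guaranteed to be a limit when \<phi> maps S into a compact set, which is the hypothesis of
  \<open>sc_ext_tendsto\<close>.\<close>

definition sc_ext :: "'a set \<Rightarrow> ('a \<Rightarrow> 'b::{t2_space, zero}) \<Rightarrow> 'a filter \<Rightarrow> 'b" where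
  "sc_ext S \<phi> F = (if F \<in> topspace (stone_cech S) then Lim F \<phi> else 0)"

lemma sc_ext_tendsto:
  assumes C: "compact C" "\<And>x. x \<in> S \<Longrightarrow> \<phi> x \<in> C" and F: "F \<in> topspace (stone_cech S)"
  shows "(\<phi> \<longlongrightarrow> sc_ext S \<phi> F) F"
proof -
  have U: "ultrafilter F" "eventually (\<lambda>x. x \<in> S) F" using F by (auto simp: topspace_stone_cech le_principal)
  have "eventually (\<lambda>x. \<phi> x \<in> C) F" using U(2) by (rule eventually_mono) (rule C(2))
  then obtain l where l: "(\<phi> \<longlongrightarrow> l) F" using ultrafilter_tendsto_compact[OF U(1) C(1)] by blast
  then have "Lim F \<phi> = l" by (rule tendsto_Lim[OF ultrafilter_not_bot[OF U(1)]])
  then show ?thesis using l F by (simp add: sc_ext_def)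
qed

lemma sc_ext_eqI:
  assumes "F \<in> topspace (stone_cech S)" "(\<phi> \<longlongrightarrow> l) F"
  shows "sc_ext S \<phi> F = l"
proof -
  have "ultrafilter F" using assms by (auto simp: topspace_stone_cech)
  then show ?thesis using assms tendsto_Lim[OF ultrafilter_not_bot] by (simp add: sc_ext_def)
qed

lemma sc_ext_principal:
  assumes "x \<in> S" shows "sc_ext S \<phi> (principal {x}) = \<phi> x"
  by (rule sc_ext_eqI) (use assms in \<open>auto simp: principal_in_stone_cech
      intro!: topological_tendstoI simp: eventually_principal\<close>)

lemma sc_ext_cfun:
  fixes \<phi> :: "'a \<Rightarrow> 'b::{t3_space, zero}"
  assumes C: "compact C" "\<And>x. x \<in> S \<Longrightarrow> \<phi> x \<in> C"
  shows "sc_ext S \<phi> \<in> cfun (stone_cech S)"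
proof -
  have "openin (stone_cech S) {F \<in> topspace (stone_cech S). sc_ext S \<phi> F \<in> V}" if V: "open V" for V
    unfolding openin_stone_cech
  proof (intro conjI ballI)
    fix F assume "F \<in> {F \<in> topspace (stone_cech S). sc_ext S \<phi> F \<in> V}"
    then have F: "F \<in> topspace (stone_cech S)" "sc_ext S \<phi> F \<in> V" by auto
    \<comment> \<open>Limits along neighbouring ultrafilters are only known to lie in the closure of
      W, so W is chosen with closure inside V. This is where regularity of the target
      enters.\<close>
    obtain W where W: "open W" "sc_ext S \<phi> F \<in> W" "closure W \<subseteq> V" using t3_shrink[OF V F(2)] by blast
    have "eventually (\<lambda>x. \<phi> x \<in> W) F"
      using sc_ext_tendsto[OF C F(1)] W by (auto simp: tendsto_def)
    then have ev: "eventually (\<lambda>x. x \<in> {x \<in> S. \<phi> x \<in> W}) F"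
      using F(1) by (auto simp: topspace_stone_cech le_principal eventually_conj_iff)
    have "sc_ext S \<phi> F' \<in> V" if F': "F' \<in> topspace (stone_cech S)" "eventually (\<lambda>x. x \<in> {x \<in> S. \<phi> x \<in> W}) F'" for F'
    proof -
      have "eventually (\<lambda>x. \<phi> x \<in> closure W) F'"
        using F'(2) by (rule eventually_mono) (use closure_subset in auto)
      moreover have "F' \<noteq> bot" using F'(1) by (auto simp: topspace_stone_cech ultrafilter_not_bot)
      ultimately have "sc_ext S \<phi> F' \<in> closure W"
        using sc_ext_tendsto[OF C F'(1)] by (intro Lim_in_closed_set[OF closed_closure]) auto
      then show ?thesis using W by blast
    qed
    then show "\<exists>A\<subseteq>S. eventually (\<lambda>x. x \<in> A) F \<and>
        (\<forall>F'\<in>topspace (stone_cech S). eventually (\<lambda>x. x \<in> A) F' \<longrightarrow> F' \<in> {F \<in> topspace (stone_cech S). sc_ext S \<phi> F \<in> V})"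
      using ev by (intro exI[of _ "{x \<in> S. \<phi> x \<in> W}"]) auto
  qed auto
  then show ?thesis unfolding cfun_def continuous_map_def by (auto simp: sc_ext_def)
qed

lemma cfun_stone_cech_compact_range:
  assumes "f \<in> cfun (stone_cech S)" shows "compact (f ` topspace (stone_cech S))"
proof -
  have "continuous_map (stone_cech S) euclidean f" using assms unfolding cfun_def by simp
  then have "compactin euclidean (f ` topspace (stone_cech S))"
    using compact_space_stone_cech[of S] image_compactin unfolding compact_space_def by blast
  then show ?thesis by simp
qed

lemma compact_discrete_finite:
  fixes C :: "'b::discrete_topology set"
  assumes "compact C" shows "finite C"
proof -
  have "\<forall>c\<in>C. open {c}" by (simp add: open_discrete)
  then obtain C' where "C' \<subseteq> C" "finite C'" "C \<subseteq> (\<Union>c\<in>C'. {c})"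
    using compactE_image[OF assms, of C "\<lambda>c. {c}"] by auto
  then show ?thesis by (auto elim: finite_subset)
qed

section \<open>Operators on square summable families\<close>

lemma norm_sq_ell2: "(norm \<xi>)\<^sup>2 = (\<Sum>\<^sub>\<infinity>i. (norm (ell2_apply \<xi> i))\<^sup>2)"
  by (simp add: power2_norm_eq_inner inner_ell2.rep_eq)

lemma ell2_summable: "(\<lambda>i. (norm (ell2_apply \<xi> i))\<^sup>2) summable_on UNIV"
  using ell2_apply[of \<xi>] by simp

lemma sum_le_norm_sq_ell2:
  "finite F \<Longrightarrow> (\<Sum>i\<in>F. (norm (ell2_apply \<xi> i))\<^sup>2) \<le> (norm \<xi>)\<^sup>2"
  unfolding norm_sq_ell2 by (rule finite_sum_le_infsum[OF ell2_summable]) auto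

lemma ell2_apply_zero [simp]: "ell2_apply 0 i = 0" by transfer simp
lemma ell2_apply_add: "ell2_apply (\<xi> + \<eta>) i = ell2_apply \<xi> i + ell2_apply \<eta> i" by transfer simp
lemma ell2_apply_scaleR: "ell2_apply (r *\<^sub>R \<xi>) i = r *\<^sub>R ell2_apply \<xi> i" by transfer simp
lemma ell2_apply_sum: "ell2_apply (\<Sum>a\<in>A. f a) i = (\<Sum>a\<in>A. ell2_apply (f a) i)"
  by (induction A rule: infinite_finite_induct) (auto simp: ell2_apply_add)
lemma ell2_eqI: "(\<And>i. ell2_apply \<xi> i = ell2_apply \<eta> i) \<Longrightarrow> \<xi> = \<eta>"
  by (metis ell2_apply_inject ext)

lemma square_summable_bound:
  fixes f :: "'i \<Rightarrow> complex"
  assumes "\<And>F. finite F \<Longrightarrow> (\<Sum>i\<in>F. (norm (f i))\<^sup>2) \<le> B"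
  shows "(\<lambda>i. (norm (f i))\<^sup>2) summable_on UNIV" "ell2_apply (Abs_ell2 f) = f" "(norm (Abs_ell2 f))\<^sup>2 \<le> B"
proof -
  show s: "(\<lambda>i. (norm (f i))\<^sup>2) summable_on UNIV"
    by (rule nonneg_bdd_above_summable_on) (auto intro!: bdd_aboveI[of _ B] assms)
  then show a: "ell2_apply (Abs_ell2 f) = f" by (simp add: Abs_ell2_inverse)
  show "(norm (Abs_ell2 f))\<^sup>2 \<le> B"
    unfolding norm_sq_ell2 a by (rule infsum_le_finite_sums[OF s]) (use assms in auto)
qed

lemma norm_ell2_apply_le: "norm (ell2_apply \<xi> i) \<le> norm \<xi>"
proof -
  have "(norm (ell2_apply \<xi> i))\<^sup>2 \<le> (norm \<xi>)\<^sup>2" using sum_le_norm_sq_ell2[of "{i}" \<xi>] by simp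
  then show ?thesis by (rule power2_le_imp_le) simp
qed

definition trunc :: "'i set \<Rightarrow> ('i \<Rightarrow> complex) \<Rightarrow> 'i ell2" where
  "trunc F f = Abs_ell2 (\<lambda>i. if i \<in> F then f i else 0)"

lemma trunc_apply: "finite F \<Longrightarrow> ell2_apply (trunc F f) i = (if i \<in> F then f i else 0)"
  and trunc_norm: "finite F \<Longrightarrow> (norm (trunc F f))\<^sup>2 = (\<Sum>i\<in>F. (norm (f i))\<^sup>2)"
proof -
  assume F: "finite F"
  have "(\<Sum>i\<in>E. (norm (if i \<in> F then f i else 0))\<^sup>2) \<le> (\<Sum>i\<in>F. (norm (f i))\<^sup>2)" if "finite E" for E
  proof -
    have "(\<Sum>i\<in>E. (norm (if i \<in> F then f i else 0))\<^sup>2) = (\<Sum>i\<in>E \<inter> F. (norm (f i))\<^sup>2)"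
      using that by (intro sum.mono_neutral_cong_right) auto
    also have "\<dots> \<le> (\<Sum>i\<in>F. (norm (f i))\<^sup>2)" using F by (intro sum_mono2) auto
    finally show ?thesis .
  qed
  from square_summable_bound(2)[OF this]
  have a: "ell2_apply (trunc F f) = (\<lambda>i. if i \<in> F then f i else 0)" unfolding trunc_def by blast
  then show "ell2_apply (trunc F f) i = (if i \<in> F then f i else 0)" by simp
  have "(\<Sum>\<^sub>\<infinity>i. (norm (ell2_apply (trunc F f) i))\<^sup>2) = (\<Sum>\<^sub>\<infinity>i\<in>F. (norm (f i))\<^sup>2)"
    unfolding a by (rule infsum_cong_neutral) auto
  then show "(norm (trunc F f))\<^sup>2 = (\<Sum>i\<in>F. (norm (f i))\<^sup>2)"
    unfolding norm_sq_ell2 using F by simp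
qed

abbreviation single :: "'i \<Rightarrow> complex \<Rightarrow> 'i ell2" where "single i c \<equiv> trunc {i} (\<lambda>_. c)"

text \<open>The type \<open>ell2\<close> is a real vector space and bounded operators are only real
  linear, so the values at both 1 and \<i> are needed to determine an operator on one
  coordinate.\<close>

lemma single_decompose: "single i c = Re c *\<^sub>R single i 1 + Im c *\<^sub>R single i \<i>"
  by (rule ell2_eqI) (auto simp: trunc_apply ell2_apply_add ell2_apply_scaleR complex_eq_iff)

lemma trunc_sum: "finite F \<Longrightarrow> trunc F f = (\<Sum>i\<in>F. single i (f i))"
  by (rule ell2_eqI) (auto simp: trunc_apply ell2_apply_sum)

lemma inner_trunc: "finite F \<Longrightarrow> trunc F f \<bullet> \<eta> = (\<Sum>i\<in>F. f i \<bullet> ell2_apply \<eta> i)"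
proof -
  assume F: "finite F"
  have "trunc F f \<bullet> \<eta> = (\<Sum>\<^sub>\<infinity>i\<in>F. f i \<bullet> ell2_apply \<eta> i)"
    unfolding inner_ell2.rep_eq using F by (intro infsum_cong_neutral) (auto simp: trunc_apply)
  then show ?thesis using F by simp
qed

lemma trunc_tendsto: "((\<lambda>F. trunc F (ell2_apply \<xi>)) \<longlongrightarrow> \<xi>) (finite_subsets_at_top UNIV)"
proof -
  have eq: "(norm (trunc F (ell2_apply \<xi>) - \<xi>))\<^sup>2 = (norm \<xi>)\<^sup>2 - (\<Sum>i\<in>F. (norm (ell2_apply \<xi> i))\<^sup>2)" if "finite F" for F
  proof -
    let ?t = "trunc F (ell2_apply \<xi>)"
    have "?t \<bullet> \<xi> = (\<Sum>i\<in>F. (norm (ell2_apply \<xi> i))\<^sup>2)"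
      using inner_trunc[OF that] by (simp add: power2_norm_eq_inner)
    moreover have "?t \<bullet> ?t = (\<Sum>i\<in>F. (norm (ell2_apply \<xi> i))\<^sup>2)"
      using trunc_norm[OF that, of "ell2_apply \<xi>"] by (simp add: power2_norm_eq_inner)
    ultimately show ?thesis
      by (simp add: power2_norm_eq_inner inner_diff_left inner_diff_right inner_commute)
  qed
  have "((\<lambda>i. (norm (ell2_apply \<xi> i))\<^sup>2) has_sum (norm \<xi>)\<^sup>2) UNIV"
    unfolding norm_sq_ell2 using ell2_summable by (rule has_sum_infsum)
  then have "((\<lambda>F. (norm \<xi>)\<^sup>2 - (\<Sum>i\<in>F. (norm (ell2_apply \<xi> i))\<^sup>2)) \<longlongrightarrow> (norm \<xi>)\<^sup>2 - (norm \<xi>)\<^sup>2) (finite_subsets_at_top UNIV)"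
    unfolding has_sum_def by (intro tendsto_diff tendsto_const)
  moreover have "eventually (\<lambda>F. (norm \<xi>)\<^sup>2 - (\<Sum>i\<in>F. (norm (ell2_apply \<xi> i))\<^sup>2) = (norm (trunc F (ell2_apply \<xi>) - \<xi>))\<^sup>2)
      (finite_subsets_at_top UNIV)"
    by (rule eventually_finite_subsets_at_top_weakI) (simp add: eq)
  ultimately have "((\<lambda>F. (norm (trunc F (ell2_apply \<xi>) - \<xi>))\<^sup>2) \<longlongrightarrow> 0) (finite_subsets_at_top UNIV)"
    by (simp add: tendsto_cong)
  from tendsto_real_sqrt[OF this]
  have "((\<lambda>F. norm (trunc F (ell2_apply \<xi>) - \<xi>)) \<longlongrightarrow> 0) (finite_subsets_at_top UNIV)" by simp
  then show ?thesis by (simp add: tendsto_norm_zero_iff LIM_zero_iff)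
qed

text \<open>The adjoint is written down by coordinates: the real and imaginary parts of coordinate i
  of S \<eta> are forced by testing T on 1 and on \<i> at i. The identity then holds for finitely
  supported \<xi> by linearity and for all \<xi> by density.\<close>

lemma real_adjoint_exists:
  fixes T :: "'i ell2 \<Rightarrow>\<^sub>L 'i ell2"
  shows "\<exists>S :: 'i ell2 \<Rightarrow>\<^sub>L 'i ell2. \<forall>\<xi> \<eta>. T \<xi> \<bullet> \<eta> = \<xi> \<bullet> S \<eta>"
proof -
  define s where "s \<eta> i = Complex (T (single i 1) \<bullet> \<eta>) (T (single i \<i>) \<bullet> \<eta>)" for \<eta> i
  have sc: "T (single i c) \<bullet> \<eta> = c \<bullet> s \<eta> i" for i c \<eta>
    unfolding s_def by (subst single_decompose)
      (simp add: blinfun.add_right blinfun.scaleR_right inner_add_left inner_complex_def)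
  have fin: "T (trunc F f) \<bullet> \<eta> = (\<Sum>i\<in>F. f i \<bullet> s \<eta> i)" if "finite F" for F f \<eta>
    by (simp add: trunc_sum[OF that] blinfun.sum_right inner_sum_left sc)
  have bd: "(\<Sum>i\<in>F. (norm (s \<eta> i))\<^sup>2) \<le> (norm T * norm \<eta>)\<^sup>2" if F: "finite F" for F \<eta>
  proof -
    \<comment> \<open>Testing T on the truncation of s \<eta> itself yields Q \<le> norm T * norm
      \<eta> * sqrt Q, hence a bound independent of F.\<close>
    define Q where "Q = (\<Sum>i\<in>F. (norm (s \<eta> i))\<^sup>2)"
    have Q0: "Q \<ge> 0" unfolding Q_def by (simp add: sum_nonneg)
    have "Q = T (trunc F (s \<eta>)) \<bullet> \<eta>" unfolding fin[OF F] Q_def by (simp add: power2_norm_eq_inner)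
    also have "\<dots> \<le> norm (T (trunc F (s \<eta>))) * norm \<eta>" by (rule norm_cauchy_schwarz)
    also have "\<dots> \<le> norm T * norm (trunc F (s \<eta>)) * norm \<eta>"
      by (intro mult_right_mono norm_blinfun) auto
    also have "norm (trunc F (s \<eta>)) = sqrt Q"
      using trunc_norm[OF F, of "s \<eta>"] unfolding Q_def by (metis norm_ge_zero real_sqrt_abs abs_of_nonneg)
    finally have le: "Q \<le> (norm T * norm \<eta>) * sqrt Q" by (simp add: mult_ac)
    have "sqrt Q \<le> norm T * norm \<eta>"
    proof (cases "Q = 0")
      case False
      then have "sqrt Q > 0" using Q0 by simp
      moreover have "sqrt Q * sqrt Q \<le> (norm T * norm \<eta>) * sqrt Q" using le Q0 by simp
      ultimately show ?thesis by (metis mult_right_le_imp_le)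
    qed simp
    then show ?thesis unfolding Q_def[symmetric] by (rule sqrt_le_D)
  qed
  define S where "S \<eta> = Abs_ell2 (s \<eta>)" for \<eta>
  have Sa: "ell2_apply (S \<eta>) = s \<eta>" for \<eta>
    unfolding S_def by (rule square_summable_bound(2)[OF bd])
  have Sn: "norm (S \<eta>) \<le> norm \<eta> * norm T" for \<eta>
    using power2_le_imp_le[OF square_summable_bound(3)[OF bd, of \<eta>]] unfolding S_def
    by (simp add: mult.commute)
  have "bounded_linear S"
  proof (rule bounded_linear_intro[OF _ _ Sn])
    show "S (x + y) = S x + S y" for x y
      by (rule ell2_eqI) (simp add: Sa ell2_apply_add s_def inner_add_right complex_eq_iff)
    show "S (r *\<^sub>R x) = r *\<^sub>R S x" for r x
      by (rule ell2_eqI) (simp add: Sa ell2_apply_scaleR s_def complex_eq_iff)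
  qed
  then have SB: "blinfun_apply (Blinfun S) = S" by (rule bounded_linear_Blinfun_apply)
  have "T \<xi> \<bullet> \<eta> = \<xi> \<bullet> S \<eta>" for \<xi> \<eta>
  proof -
    let ?A = "finite_subsets_at_top (UNIV :: 'i set)"
    have 1: "((\<lambda>F. T (trunc F (ell2_apply \<xi>)) \<bullet> \<eta>) \<longlongrightarrow> T \<xi> \<bullet> \<eta>) ?A"
      by (intro tendsto_intros trunc_tendsto)
    have 2: "((\<lambda>F. trunc F (ell2_apply \<xi>) \<bullet> S \<eta>) \<longlongrightarrow> \<xi> \<bullet> S \<eta>) ?A"
      by (intro tendsto_intros trunc_tendsto)
    have "eventually (\<lambda>F. T (trunc F (ell2_apply \<xi>)) \<bullet> \<eta> = trunc F (ell2_apply \<xi>) \<bullet> S \<eta>) ?A"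
      by (rule eventually_finite_subsets_at_top_weakI) (simp add: fin inner_trunc Sa)
    then have "((\<lambda>F. T (trunc F (ell2_apply \<xi>)) \<bullet> \<eta>) \<longlongrightarrow> \<xi> \<bullet> S \<eta>) ?A"
      using 2 by (simp add: tendsto_cong)
    then show ?thesis using 1 tendsto_unique[OF finite_subsets_at_top_neq_bot] by blast
  qed
  then show ?thesis using SB by (intro exI[of _ "Blinfun S"]) simp
qed

text \<open>Multiplication by the imaginary unit as a real linear operator; commuting with it
  expresses complex linearity.\<close>

definition mult_i :: "'i ell2 \<Rightarrow>\<^sub>L 'i ell2" where
  "mult_i = Blinfun (\<lambda>\<xi>. Abs_ell2 (\<lambda>i. \<i> * ell2_apply \<xi> i))"

lemma mult_i_apply:
  fixes \<xi> :: "'i ell2"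
  shows "ell2_apply (mult_i \<xi>) i = \<i> * ell2_apply \<xi> i"
proof -
  define M where "M \<xi> = Abs_ell2 (\<lambda>i. \<i> * ell2_apply \<xi> i)" for \<xi> :: "'i ell2"
  have bd: "(\<Sum>i\<in>F. (norm (\<i> * ell2_apply \<xi> i))\<^sup>2) \<le> (norm \<xi>)\<^sup>2" if "finite F" for F and \<xi> :: "'i ell2"
    using sum_le_norm_sq_ell2[OF that, of \<xi>] by (simp add: norm_mult)
  have Ma: "ell2_apply (M \<xi>) = (\<lambda>i. \<i> * ell2_apply \<xi> i)" for \<xi>
    unfolding M_def by (rule square_summable_bound(2)[OF bd])
  have Mn: "norm (M \<xi>) \<le> norm \<xi> * 1" for \<xi>
    using power2_le_imp_le[OF square_summable_bound(3)[OF bd, of \<xi>]] unfolding M_def by simp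
  have "bounded_linear M"
    by (rule bounded_linear_intro[OF _ _ Mn]; rule ell2_eqI)
      (simp_all add: Ma ell2_apply_add ell2_apply_scaleR algebra_simps)
  then have "blinfun_apply mult_i = M"
    unfolding mult_i_def M_def by (rule bounded_linear_Blinfun_apply)
  then show ?thesis by (simp add: Ma)
qed

text \<open>Im (a * cnj b) is the real inner product of a with \<i> * b, so the complex inner
  product is recovered from the real one and \<open>mult_i\<close>.\<close>

lemma cinner_ell2_Complex: "cinner_ell2 \<xi> \<eta> = Complex (\<xi> \<bullet> \<eta>) (\<xi> \<bullet> mult_i \<eta>)"
proof -
  have s: "(\<lambda>i. ell2_apply \<xi> i * cnj (ell2_apply \<eta> i)) summable_on UNIV"
  proof (rule abs_summable_summable, rule summable_on_comparison_test)
    show "(\<lambda>i. (norm (ell2_apply \<xi> i))\<^sup>2 + (norm (ell2_apply \<eta> i))\<^sup>2) summable_on UNIV"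
      by (intro summable_on_add ell2_summable)
    fix i
    show "norm (ell2_apply \<xi> i * cnj (ell2_apply \<eta> i)) \<le> (norm (ell2_apply \<xi> i))\<^sup>2 + (norm (ell2_apply \<eta> i))\<^sup>2"
      using sum_squares_bound[of "norm (ell2_apply \<xi> i)" "norm (ell2_apply \<eta> i)"]
        mult_nonneg_nonneg[OF norm_ge_zero norm_ge_zero, of "ell2_apply \<xi> i" "ell2_apply \<eta> i"]
      unfolding norm_mult complex_mod_cnj by linarith
  qed simp
  have "Re (cinner_ell2 \<xi> \<eta>) = \<xi> \<bullet> \<eta>"
    unfolding cinner_ell2_def inner_ell2.rep_eq
    by (subst infsum_Re[OF s, symmetric]) (simp add: inner_complex_def)
  moreover have "Im (cinner_ell2 \<xi> \<eta>) = \<xi> \<bullet> mult_i \<eta>"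
    unfolding cinner_ell2_def inner_ell2.rep_eq
    by (subst infsum_Im[OF s, symmetric]) (simp add: inner_complex_def mult_i_apply algebra_simps)
  ultimately show ?thesis by (simp add: complex_eq_iff)
qed

lemma mult_i_inner: "mult_i \<xi> \<bullet> \<eta> = - (\<xi> \<bullet> mult_i \<eta>)"
  unfolding inner_ell2.rep_eq infsum_uminus[symmetric]
  by (rule infsum_cong) (simp add: mult_i_apply inner_complex_def)

lemma adjoint_op_eqI:
  fixes T S :: "'i ell2 \<Rightarrow>\<^sub>L 'i ell2"
  assumes "\<And>\<xi> \<eta>. cinner_ell2 (T \<xi>) \<eta> = cinner_ell2 \<xi> (S \<eta>)"
  shows "adjoint_op T = S"
  unfolding adjoint_op_def
proof (rule the_equality)
  show "\<forall>\<xi> \<eta>. cinner_ell2 (T \<xi>) \<eta> = cinner_ell2 \<xi> (S \<eta>)" using assms by blast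
  fix S' :: "'i ell2 \<Rightarrow>\<^sub>L 'i ell2" assume S': "\<forall>\<xi> \<eta>. cinner_ell2 (T \<xi>) \<eta> = cinner_ell2 \<xi> (S' \<eta>)"
  show "S' = S"
  proof (rule blinfun_eqI)
    fix \<eta>
    have "\<xi> \<bullet> S' \<eta> = \<xi> \<bullet> S \<eta>" for \<xi>
      using assms[of \<xi> \<eta>] S' unfolding cinner_ell2_Complex by (metis complex.inject)
    then have "(S' \<eta> - S \<eta>) \<bullet> (S' \<eta> - S \<eta>) = 0" by (simp add: inner_diff_right)
    then show "S' \<eta> = S \<eta>" by simp
  qed
qed

text \<open>The real adjoint satisfies the complex identity because T commutes with
  \<open>mult_i\<close>. So the description defining \<open>adjoint_op\<close> is met, and later
  computations with adjoints can use real inner products.\<close>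

lemma adjoint_op_real:
  fixes T :: "'i ell2 \<Rightarrow>\<^sub>L 'i ell2"
  assumes "T o\<^sub>L mult_i = mult_i o\<^sub>L T"
  shows "T \<xi> \<bullet> \<eta> = \<xi> \<bullet> adjoint_op T \<eta>" "cinner_ell2 (T \<xi>) \<eta> = cinner_ell2 \<xi> (adjoint_op T \<eta>)"
proof -
  have TJ: "T (mult_i \<xi>) = mult_i (T \<xi>)" for \<xi> using assms by (metis blinfun_apply_blinfun_compose)
  obtain S where S: "\<And>\<xi> \<eta>. T \<xi> \<bullet> \<eta> = \<xi> \<bullet> blinfun_apply S \<eta>" using real_adjoint_exists by blast
  have C: "cinner_ell2 (T \<xi>) \<eta> = cinner_ell2 \<xi> (S \<eta>)" for \<xi> \<eta>
  proof -
    have "T \<xi> \<bullet> mult_i \<eta> = - (T (mult_i \<xi>) \<bullet> \<eta>)" using mult_i_inner[of "T \<xi>" \<eta>] by (simp add: TJ)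
    also have "\<dots> = \<xi> \<bullet> mult_i (S \<eta>)" using mult_i_inner[of \<xi> "S \<eta>"] by (simp add: S)
    finally show ?thesis by (simp add: cinner_ell2_Complex S)
  qed
  have "adjoint_op T = S" by (rule adjoint_op_eqI) (rule C)
  then show "T \<xi> \<bullet> \<eta> = \<xi> \<bullet> adjoint_op T \<eta>" "cinner_ell2 (T \<xi>) \<eta> = cinner_ell2 \<xi> (adjoint_op T \<eta>)"
    using S C by simp_all
qed

lemma adjoint_op_eq_real:
  fixes T :: "'i ell2 \<Rightarrow>\<^sub>L 'i ell2"
  assumes "T o\<^sub>L mult_i = mult_i o\<^sub>L T" "\<And>\<xi> \<eta>. T \<xi> \<bullet> \<eta> = \<xi> \<bullet> blinfun_apply S \<eta>"
  shows "adjoint_op T = S"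
proof (rule blinfun_eqI)
  fix \<eta>
  have "(adjoint_op T \<eta> - S \<eta>) \<bullet> (adjoint_op T \<eta> - S \<eta>) = 0"
    using adjoint_op_real(1)[OF assms(1), of "adjoint_op T \<eta> - S \<eta>" \<eta>] assms(2)[of "adjoint_op T \<eta> - S \<eta>" \<eta>]
    by (simp add: inner_diff_right)
  then show "adjoint_op T \<eta> = S \<eta>" by simp
qed

lemma norm_adjoint_le:
  fixes T :: "'i ell2 \<Rightarrow>\<^sub>L 'i ell2"
  assumes "T o\<^sub>L mult_i = mult_i o\<^sub>L T" shows "norm (adjoint_op T) \<le> norm T"
proof (rule norm_blinfun_bound)
  fix \<eta>
  have "(norm (adjoint_op T \<eta>))\<^sup>2 = T (adjoint_op T \<eta>) \<bullet> \<eta>"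
    unfolding power2_norm_eq_inner using adjoint_op_real(1)[OF assms] by simp
  also have "\<dots> \<le> norm (T (adjoint_op T \<eta>)) * norm \<eta>" by (rule norm_cauchy_schwarz)
  also have "\<dots> \<le> norm T * norm (adjoint_op T \<eta>) * norm \<eta>" by (intro mult_right_mono norm_blinfun) auto
  finally have "norm (adjoint_op T \<eta>) * norm (adjoint_op T \<eta>) \<le> (norm T * norm \<eta>) * norm (adjoint_op T \<eta>)"
    by (simp add: power2_eq_square mult_ac)
  then show "norm (adjoint_op T \<eta>) \<le> norm T * norm \<eta>"
    by (cases "norm (adjoint_op T \<eta>) = 0") (auto simp: mult_le_cancel_right)
qed simp

text \<open>A Schur-type criterion: bounded entries, and uniformly few nonzero entries in each row
  and column. The index type is arbitrary because the indices will be the arrows of the groupoid,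
  not the points of X.\<close>

definition band_kernel :: "('i \<Rightarrow> 'i \<Rightarrow> complex) \<Rightarrow> bool" where
  "band_kernel K \<longleftrightarrow> (\<exists>C N. (\<forall>i j. norm (K i j) \<le> C) \<and>
     (\<forall>i. finite {j. K i j \<noteq> 0} \<and> card {j. K i j \<noteq> 0} \<le> N) \<and>
     (\<forall>j. finite {i. K i j \<noteq> 0} \<and> card {i. K i j \<noteq> 0} \<le> (N::nat)))"

definition kernel_op :: "('i \<Rightarrow> 'i \<Rightarrow> complex) \<Rightarrow> 'i ell2 \<Rightarrow>\<^sub>L 'i ell2" where
  "kernel_op K = Blinfun (\<lambda>\<xi>. Abs_ell2 (\<lambda>i. \<Sum>j | K i j \<noteq> 0. K i j * ell2_apply \<xi> j))"

text \<open>The operator is bounded by C * N: Cauchy-Schwarz on each row costs a factor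
  \<open>C\<^sup>2 * N\<close> for the square, and in the sum over rows each coordinate of \<xi> is
  counted at most N times by the column bound.\<close>

lemma kernel_op_apply:
  assumes "band_kernel K"
  shows "ell2_apply (kernel_op K \<xi>) i = (\<Sum>j | K i j \<noteq> 0. K i j * ell2_apply \<xi> j)"
proof -
  obtain C N where B: "\<forall>i j. norm (K i j) \<le> C"
    "\<forall>i. finite {j. K i j \<noteq> 0} \<and> card {j. K i j \<noteq> 0} \<le> N"
    "\<forall>j. finite {i. K i j \<noteq> 0} \<and> card {i. K i j \<noteq> 0} \<le> (N::nat)"
    using assms unfolding band_kernel_def by blast
  then have C: "\<And>i j. norm (K i j) \<le> C"
    and row: "\<And>i. finite {j. K i j \<noteq> 0}" "\<And>i. card {j. K i j \<noteq> 0} \<le> N"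
    and col: "\<And>j. finite {i. K i j \<noteq> 0}" "\<And>j. card {i. K i j \<noteq> 0} \<le> N"
    by auto
  have C0: "C \<ge> 0" using C norm_ge_zero order_trans by blast
  define k where "k \<xi> i = (\<Sum>j | K i j \<noteq> 0. K i j * ell2_apply \<xi> j)" for \<xi> i
  have bd: "(\<Sum>i\<in>F. (norm (k \<xi> i))\<^sup>2) \<le> (norm \<xi> * (C * N))\<^sup>2" if F: "finite F" for F \<xi>
  proof -
    let ?x = "\<lambda>j. (norm (ell2_apply \<xi> j))\<^sup>2"
    have pt: "(norm (k \<xi> i))\<^sup>2 \<le> C\<^sup>2 * N * (\<Sum>j | K i j \<noteq> 0. ?x j)" for i
    proof -
      have "norm (k \<xi> i) \<le> (\<Sum>j | K i j \<noteq> 0. norm (K i j) * norm (ell2_apply \<xi> j))"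
        unfolding k_def by (rule order_trans[OF norm_sum]) (simp add: norm_mult)
      then have "(norm (k \<xi> i))\<^sup>2 \<le> (\<Sum>j | K i j \<noteq> 0. norm (K i j) * norm (ell2_apply \<xi> j))\<^sup>2"
        by (intro power_mono) auto
      also have "\<dots> \<le> (\<Sum>j | K i j \<noteq> 0. (norm (K i j))\<^sup>2) * (\<Sum>j | K i j \<noteq> 0. ?x j)"
        by (rule Cauchy_Schwarz_ineq_sum)
      also have "(\<Sum>j | K i j \<noteq> 0. (norm (K i j))\<^sup>2) \<le> (\<Sum>j | K i j \<noteq> 0. C\<^sup>2)"
        by (intro sum_mono power_mono C) auto
      also have "\<dots> \<le> C\<^sup>2 * N"
        using mult_left_mono[of "real (card {j. K i j \<noteq> 0})" N "C\<^sup>2"] row(2)[of i] by (simp add: mult.commute)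
      finally show ?thesis by (simp add: sum_nonneg mult_right_mono)
    qed
    define U where "U = (\<Union>i\<in>F. {j. K i j \<noteq> 0})"
    have Uf: "finite U" using F row(1) unfolding U_def by auto
    have "(\<Sum>i\<in>F. \<Sum>j | K i j \<noteq> 0. ?x j) = (\<Sum>i\<in>F. \<Sum>j\<in>U. if K i j \<noteq> 0 then ?x j else 0)"
    proof (rule sum.cong[OF refl])
      fix i assume "i \<in> F"
      then have "{j. K i j \<noteq> 0} \<subseteq> U" unfolding U_def by blast
      then show "(\<Sum>j | K i j \<noteq> 0. ?x j) = (\<Sum>j\<in>U. if K i j \<noteq> 0 then ?x j else 0)"
        using Uf by (intro sum.mono_neutral_cong_left) auto
    qed
    also have "\<dots> = (\<Sum>j\<in>U. \<Sum>i\<in>F. if K i j \<noteq> 0 then ?x j else 0)" by (rule sum.swap)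
    also have "\<dots> \<le> (\<Sum>j\<in>U. N * ?x j)"
    proof (rule sum_mono)
      fix j assume "j \<in> U"
      have "(\<Sum>i\<in>F. if K i j \<noteq> 0 then ?x j else 0) = (\<Sum>i\<in>F \<inter> {i. K i j \<noteq> 0}. ?x j)"
        using F by (subst sum.inter_restrict) auto
      also have "\<dots> = card (F \<inter> {i. K i j \<noteq> 0}) * ?x j" by simp
      also have "card (F \<inter> {i. K i j \<noteq> 0}) \<le> N"
        using col(2)[of j] card_mono[OF col(1)[of j], of "F \<inter> {i. K i j \<noteq> 0}"] by auto
      finally show "(\<Sum>i\<in>F. if K i j \<noteq> 0 then ?x j else 0) \<le> N * ?x j"
        by (simp add: mult_right_mono)
    qed
    also have "\<dots> = N * (\<Sum>j\<in>U. ?x j)" by (simp add: sum_distrib_left)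
    also have "\<dots> \<le> N * (norm \<xi>)\<^sup>2" by (intro mult_left_mono sum_le_norm_sq_ell2 Uf) auto
    finally have sw: "(\<Sum>i\<in>F. \<Sum>j | K i j \<noteq> 0. ?x j) \<le> N * (norm \<xi>)\<^sup>2" .
    have "(\<Sum>i\<in>F. (norm (k \<xi> i))\<^sup>2) \<le> (\<Sum>i\<in>F. C\<^sup>2 * N * (\<Sum>j | K i j \<noteq> 0. ?x j))"
      by (intro sum_mono pt)
    also have "\<dots> = C\<^sup>2 * N * (\<Sum>i\<in>F. \<Sum>j | K i j \<noteq> 0. ?x j)" by (simp add: sum_distrib_left)
    also have "\<dots> \<le> C\<^sup>2 * N * (N * (norm \<xi>)\<^sup>2)" by (intro mult_left_mono sw) auto
    also have "\<dots> = (norm \<xi> * (C * N))\<^sup>2" by (simp add: power2_eq_square mult_ac)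
    finally show ?thesis .
  qed
  define M where "M \<xi> = Abs_ell2 (k \<xi>)" for \<xi>
  have Ma: "ell2_apply (M \<xi>) = k \<xi>" for \<xi>
    unfolding M_def by (rule square_summable_bound(2)[OF bd])
  have Mn: "norm (M \<xi>) \<le> norm \<xi> * (C * N)" for \<xi>
  proof (rule power2_le_imp_le)
    show "(norm (M \<xi>))\<^sup>2 \<le> (norm \<xi> * (C * N))\<^sup>2"
      unfolding M_def by (rule square_summable_bound(3)[OF bd])
  qed (use C0 in simp)
  have "bounded_linear M"
    by (rule bounded_linear_intro[OF _ _ Mn]; rule ell2_eqI)
      (simp_all add: Ma k_def ell2_apply_add ell2_apply_scaleR algebra_simps sum.distrib scaleR_sum_right)
  then have "blinfun_apply (kernel_op K) = M"
    unfolding kernel_op_def M_def k_def by (rule bounded_linear_Blinfun_apply)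
  then show ?thesis by (simp add: Ma k_def)
qed

lemma kernel_op_apply_superset:
  assumes "band_kernel K" "finite J" "\<And>j. K i j \<noteq> 0 \<Longrightarrow> j \<in> J"
  shows "ell2_apply (kernel_op K \<xi>) i = (\<Sum>j\<in>J. K i j * ell2_apply \<xi> j)"
  unfolding kernel_op_apply[OF assms(1)] using assms by (intro sum.mono_neutral_left) auto

lemma kernel_op_mult_i:
  assumes "band_kernel K" shows "kernel_op K o\<^sub>L mult_i = mult_i o\<^sub>L kernel_op K"
  by (rule blinfun_eqI, rule ell2_eqI)
    (simp add: kernel_op_apply[OF assms] mult_i_apply sum_distrib_left mult_ac)

lemma band_kernelD:
  assumes "band_kernel K" shows "finite {j. K i j \<noteq> 0}" "finite {i. K i j \<noteq> 0}"
  using assms unfolding band_kernel_def by auto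

lemma band_kernel_adjoint: "band_kernel K \<Longrightarrow> band_kernel (\<lambda>i j. cnj (K j i))"
  unfolding band_kernel_def by auto

lemma kernel_op_single:
  assumes "band_kernel K" shows "ell2_apply (kernel_op K (single j c)) i = K i j * c"
proof -
  have "ell2_apply (kernel_op K (single j c)) i = (\<Sum>j'\<in>insert j {j. K i j \<noteq> 0}. K i j' * ell2_apply (single j c) j')"
    by (rule kernel_op_apply_superset[OF assms]) (use band_kernelD[OF assms] in auto)
  also have "\<dots> = (\<Sum>j'\<in>insert j {j. K i j \<noteq> 0}. if j' = j then K i j * c else 0)"
    by (rule sum.cong) (auto simp: trunc_apply)
  also have "\<dots> = K i j * c" using band_kernelD[OF assms] by (subst sum.delta) auto
  finally show ?thesis .
qed

lemma inner_single: "single i c \<bullet> \<eta> = c \<bullet> ell2_apply \<eta> i"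
  by (simp add: inner_trunc)

lemma kernel_op_adjoint:
  assumes "band_kernel K"
  shows "adjoint_op (kernel_op K) = kernel_op (\<lambda>i j. cnj (K j i))"
proof (rule blinfun_eqI, rule ell2_eqI)
  fix \<eta> i
  let ?T = "kernel_op K"
  have fi: "finite {j. K j i \<noteq> 0}" by (rule band_kernelD[OF assms])
  have T: "?T (single i c) = trunc {j. K j i \<noteq> 0} (\<lambda>j. K j i * c)" for c
    by (rule ell2_eqI) (auto simp: kernel_op_single[OF assms] trunc_apply[OF fi])
  have "c \<bullet> ell2_apply (adjoint_op ?T \<eta>) i = c \<bullet> (\<Sum>j | K j i \<noteq> 0. cnj (K j i) * ell2_apply \<eta> j)" for c
  proof -
    have "c \<bullet> ell2_apply (adjoint_op ?T \<eta>) i = single i c \<bullet> adjoint_op ?T \<eta>" by (simp add: inner_single)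
    also have "\<dots> = ?T (single i c) \<bullet> \<eta>" by (simp add: adjoint_op_real(1)[OF kernel_op_mult_i[OF assms]])
    also have "\<dots> = (\<Sum>j | K j i \<noteq> 0. (K j i * c) \<bullet> ell2_apply \<eta> j)" unfolding T by (rule inner_trunc[OF fi])
    also have "\<dots> = (\<Sum>j | K j i \<noteq> 0. c \<bullet> (cnj (K j i) * ell2_apply \<eta> j))"
      by (rule sum.cong) (auto simp: inner_complex_def algebra_simps)
    finally show ?thesis by (simp add: inner_sum_right)
  qed
  \<comment> \<open>Real inner products with 1 and with \<i> read off the real and the imaginary
    part.\<close>
  from this[of 1] this[of \<i>]
  have "ell2_apply (adjoint_op ?T \<eta>) i = (\<Sum>j | K j i \<noteq> 0. cnj (K j i) * ell2_apply \<eta> j)"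
    by (simp add: complex_eq_iff inner_complex_def)
  also have "\<dots> = ell2_apply (kernel_op (\<lambda>i j. cnj (K j i)) \<eta>) i"
    by (simp add: kernel_op_apply[OF band_kernel_adjoint[OF assms]])
  finally show "ell2_apply (adjoint_op ?T \<eta>) i = ell2_apply (kernel_op (\<lambda>i j. cnj (K j i)) \<eta>) i" .
qed

lemma kernel_op_compose:
  assumes K: "band_kernel K" and L: "band_kernel L" and M: "band_kernel M"
    and prod: "\<And>i j. M i j = (\<Sum>k | K i k \<noteq> 0. K i k * L k j)"
  shows "kernel_op K o\<^sub>L kernel_op L = kernel_op M"
proof (rule blinfun_eqI, rule ell2_eqI)
  fix \<xi> i
  let ?A = "{k. K i k \<noteq> 0}"
  define J where "J = (\<Union>k\<in>?A. {j. L k j \<noteq> 0})"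
  have fA: "finite ?A" by (rule band_kernelD[OF K])
  have fJ: "finite J" unfolding J_def using fA band_kernelD[OF L] by auto
  have MJ: "j \<in> J" if "M i j \<noteq> 0" for j
  proof (rule ccontr)
    assume "j \<notin> J"
    then have "M i j = 0" unfolding prod J_def by (intro sum.neutral) auto
    with that show False by simp
  qed
  have "ell2_apply (kernel_op M \<xi>) i = (\<Sum>j\<in>J. M i j * ell2_apply \<xi> j)"
    by (rule kernel_op_apply_superset[OF M fJ MJ])
  also have "\<dots> = (\<Sum>j\<in>J. \<Sum>k\<in>?A. K i k * (L k j * ell2_apply \<xi> j))"
    unfolding prod by (simp add: sum_distrib_right sum_distrib_left mult_ac)
  also have "\<dots> = (\<Sum>k\<in>?A. \<Sum>j\<in>J. K i k * (L k j * ell2_apply \<xi> j))" by (rule sum.swap)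
  also have "\<dots> = (\<Sum>k\<in>?A. K i k * ell2_apply (kernel_op L \<xi>) k)"
  proof (rule sum.cong[OF refl])
    fix k assume "k \<in> ?A"
    then have "ell2_apply (kernel_op L \<xi>) k = (\<Sum>j\<in>J. L k j * ell2_apply \<xi> j)"
      by (intro kernel_op_apply_superset[OF L fJ]) (auto simp: J_def)
    then show "(\<Sum>j\<in>J. K i k * (L k j * ell2_apply \<xi> j)) = K i k * ell2_apply (kernel_op L \<xi>) k"
      by (simp add: sum_distrib_left)
  qed
  also have "\<dots> = ell2_apply (kernel_op K (kernel_op L \<xi>)) i" by (simp add: kernel_op_apply[OF K])
  finally show "ell2_apply ((kernel_op K o\<^sub>L kernel_op L) \<xi>) i = ell2_apply (kernel_op M \<xi>) i" by simp
qed

lemma kernel_op_add: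
  assumes K: "band_kernel K" and L: "band_kernel L" and M: "band_kernel (\<lambda>i j. K i j + L i j)"
  shows "kernel_op K + kernel_op L = kernel_op (\<lambda>i j. K i j + L i j)"
proof (rule blinfun_eqI, rule ell2_eqI)
  fix \<xi> i
  let ?J = "{j. K i j \<noteq> 0} \<union> {j. L i j \<noteq> 0}"
  have J: "finite ?J" using band_kernelD[OF K] band_kernelD[OF L] by auto
  have "ell2_apply (kernel_op K \<xi>) i = (\<Sum>j\<in>?J. K i j * ell2_apply \<xi> j)"
    by (rule kernel_op_apply_superset[OF K J]) auto
  moreover have "ell2_apply (kernel_op L \<xi>) i = (\<Sum>j\<in>?J. L i j * ell2_apply \<xi> j)"
    by (rule kernel_op_apply_superset[OF L J]) auto
  moreover have "ell2_apply (kernel_op (\<lambda>i j. K i j + L i j) \<xi>) i = (\<Sum>j\<in>?J. (K i j + L i j) * ell2_apply \<xi> j)"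
    by (rule kernel_op_apply_superset[OF M J]) auto
  ultimately show "ell2_apply ((kernel_op K + kernel_op L) \<xi>) i = ell2_apply (kernel_op (\<lambda>i j. K i j + L i j) \<xi>) i"
    by (simp add: plus_blinfun.rep_eq ell2_apply_add distrib_right sum.distrib)
qed

section \<open>The coarse groupoid and band matrices\<close>

lemma sum_eq_over_image:
  assumes "finite I" "inj_on r I" "A \<subseteq> r ` I" "\<And>x. x \<in> r ` I - A \<Longrightarrow> f x = 0"
  shows "sum f A = (\<Sum>k\<in>I. f (r k))"
proof -
  have "sum f A = sum f (r ` I)"
    using assms by (intro sum.mono_neutral_left) auto
  then show ?thesis using assms(2) by (simp add: sum.reindex)
qed

locale coarse_space = Metric_space X d for X :: "'a set" and d :: "'a \<Rightarrow> 'a \<Rightarrow> real" +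
  assumes ulf: "uniformly_locally_finite X d"
begin

abbreviation G where "G \<equiv> coarse_groupoid X d"
abbreviation arr where "arr \<equiv> topspace (coarse_arrows X d)"
abbreviation bX where "bX \<equiv> topspace (stone_cech X)"
abbreviation bXX where "bXX \<equiv> topspace (stone_cech (X \<times> X))"

section \<open>The space of arrows and its compactly supported functions\<close>

lemma G_simps:
  "arrows G = coarse_arrows X d" "unit_space G = stone_cech X" "rng G = filtermap fst" "src G = filtermap snd"
  "gident G = filtermap (\<lambda>x. (x, x))" "ginv G = filtermap prod.swap"
  by (simp_all add: coarse_groupoid_def)

text \<open>Every entourage lies in a strip, so strips are cofinal among entourages. For negative R
  the strip is empty.\<close>

definition strip :: "real \<Rightarrow> ('a \<times> 'a) set" where
  "strip R = {(x, y). x \<in> X \<and> y \<in> X \<and> d x y \<le> R}"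

lemma entourage_strip: "entourage X d (strip R)"
  unfolding entourage_def strip_def by auto

lemma entourage_subset_strip:
  assumes "entourage X d E" obtains R where "R \<ge> 0" "E \<subseteq> strip R"
proof -
  obtain R where R: "E \<subseteq> X \<times> X" "\<forall>(x, y)\<in>E. d x y \<le> R" using assms unfolding entourage_def by auto
  have "E \<subseteq> strip (max R 0)" using R unfolding strip_def by fastforce
  then show ?thesis by (intro that[of "max R 0"]) auto
qed

lemma ball_bound: "\<exists>N. \<forall>x\<in>X. finite (mcball x R) \<and> card (mcball x R) \<le> N"
proof (cases "R \<ge> 0")
  case True
  then show ?thesis using ulf unfolding uniformly_locally_finite_def by blast
next
  case False
  then have "mcball x R = {}" for x by (simp add: mcball_eq_empty)
  then show ?thesis by simp
qed

lemma entourage_closure_eq: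
  assumes "entourage X d E"
  shows "entourage_closure X E = {\<omega> \<in> bXX. eventually (\<lambda>e. e \<in> E) \<omega>}"
  unfolding entourage_closure_def
  by (rule stone_cech_closure_of) (use assms in \<open>auto simp: entourage_def\<close>)

lemma openin_arrows_Int:
  assumes "openin (stone_cech (X \<times> X)) T"
  shows "openin (coarse_arrows X d) (T \<inter> (\<Union>E\<in>Collect (entourage X d). entourage_closure X E))"
  unfolding openin_coarse_arrows
proof (intro conjI allI impI)
  fix E assume E: "entourage X d E"
  have "T \<inter> (\<Union>E\<in>Collect (entourage X d). entourage_closure X E) \<inter> entourage_closure X E = T \<inter> entourage_closure X E"
    using E by blast
  then show "openin (subtopology (stone_cech (X \<times> X)) (entourage_closure X E))
      (T \<inter> (\<Union>E\<in>Collect (entourage X d). entourage_closure X E) \<inter> entourage_closure X E)"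
    using assms unfolding openin_subtopology by blast
qed blast

lemma arr_Union: "arr = (\<Union>E\<in>Collect (entourage X d). entourage_closure X E)"
proof
  show "arr \<subseteq> (\<Union>E\<in>Collect (entourage X d). entourage_closure X E)"
    using openin_topspace[of "coarse_arrows X d"] unfolding openin_coarse_arrows by blast
  have "(\<Union>E\<in>Collect (entourage X d). entourage_closure X E) \<subseteq> bXX"
    by (auto simp: entourage_closure_eq)
  then show "(\<Union>E\<in>Collect (entourage X d). entourage_closure X E) \<subseteq> arr"
    using openin_subset[OF openin_arrows_Int[OF openin_topspace[of "stone_cech (X \<times> X)"]]] by auto
qed

lemma openin_arrows: "openin (stone_cech (X \<times> X)) T \<Longrightarrow> openin (coarse_arrows X d) (T \<inter> arr)"
  using openin_arrows_Int arr_Union by simp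

lemma arr_iff: "\<omega> \<in> arr \<longleftrightarrow> ultrafilter \<omega> \<and> (\<exists>R. eventually (\<lambda>e. e \<in> strip R) \<omega>)"
proof
  assume "\<omega> \<in> arr"
  then obtain E where E: "entourage X d E" "\<omega> \<in> bXX" "eventually (\<lambda>e. e \<in> E) \<omega>"
    unfolding arr_Union by (auto simp: entourage_closure_eq)
  obtain R where "E \<subseteq> strip R" using entourage_subset_strip[OF E(1)] by blast
  then have "eventually (\<lambda>e. e \<in> strip R) \<omega>" using E(3) by (auto elim: eventually_mono)
  then show "ultrafilter \<omega> \<and> (\<exists>R. eventually (\<lambda>e. e \<in> strip R) \<omega>)" using E(2) by (auto simp: topspace_stone_cech)
next
  assume "ultrafilter \<omega> \<and> (\<exists>R. eventually (\<lambda>e. e \<in> strip R) \<omega>)"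
  then obtain R where R: "ultrafilter \<omega>" "eventually (\<lambda>e. e \<in> strip R) \<omega>" by blast
  have "eventually (\<lambda>e. e \<in> X \<times> X) \<omega>" using R(2) by (rule eventually_mono) (auto simp: strip_def)
  then have "\<omega> \<in> entourage_closure X (strip R)"
    using R by (simp add: entourage_closure_eq[OF entourage_strip] topspace_stone_cech le_principal)
  then show "\<omega> \<in> arr" unfolding arr_Union using entourage_strip by blast
qed

lemma arr_bXX: "\<omega> \<in> arr \<Longrightarrow> \<omega> \<in> bXX"
  unfolding arr_Union by (auto simp: entourage_closure_eq)

lemma strip_arr: "entourage_closure X (strip R) \<subseteq> arr"
  unfolding arr_Union using entourage_strip by blast

lemma openin_arrows_strip:
  assumes "openin (coarse_arrows X d) U"
  obtains T where "openin (stone_cech (X \<times> X)) T"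
    "U \<inter> entourage_closure X (strip R) = T \<inter> entourage_closure X (strip R)"
proof -
  have "openin (subtopology (stone_cech (X \<times> X)) (entourage_closure X (strip R))) (U \<inter> entourage_closure X (strip R))"
    using assms entourage_strip[of R] unfolding openin_coarse_arrows by blast
  then show ?thesis using that unfolding openin_subtopology by blast
qed

text \<open>Strip closures turn out to be open, closed and compact. They exhaust the arrows by
  compact open sets, which is why compact support means finite width.\<close>

lemma openin_strip: "openin (coarse_arrows X d) (entourage_closure X (strip R))"
proof -
  have "openin (stone_cech (X \<times> X)) (entourage_closure X (strip R))"
    unfolding entourage_closure_eq[OF entourage_strip]
    by (rule openin_stone_cech_basic) (auto simp: strip_def)
  from openin_arrows[OF this] show ?thesis using strip_arr by (simp add: Int_absorb2)
qed

lemma closedin_strip: "closedin (coarse_arrows X d) (entourage_closure X (strip R))"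
proof -
  have "closedin (stone_cech (X \<times> X)) (entourage_closure X (strip R))"
    unfolding entourage_closure_eq[OF entourage_strip]
    by (rule closedin_stone_cech_basic) (auto simp: strip_def)
  then have "openin (coarse_arrows X d) ((bXX - entourage_closure X (strip R)) \<inter> arr)"
    by (intro openin_arrows) (simp add: closedin_def)
  moreover have "(bXX - entourage_closure X (strip R)) \<inter> arr = arr - entourage_closure X (strip R)"
    using arr_bXX by blast
  ultimately show ?thesis unfolding closedin_def using strip_arr by simp
qed

text \<open>On a single strip closure the weak topology coincides with that of \<beta>(X \<times>
  X), so compactness is inherited from a closed subset of a compact space.\<close>

lemma compactin_strip: "compactin (coarse_arrows X d) (entourage_closure X (strip R))"
  unfolding compactin_def
proof (intro conjI allI impI strip_arr)
  let ?K = "entourage_closure X (strip R)"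
  fix \<U> assume U: "(\<forall>U\<in>\<U>. openin (coarse_arrows X d) U) \<and> ?K \<subseteq> \<Union>\<U>"
  have "\<exists>T. openin (stone_cech (X \<times> X)) T \<and> U \<inter> ?K = T \<inter> ?K" if "U \<in> \<U>" for U
  proof -
    have "openin (coarse_arrows X d) U" using U that by blast
    then obtain T where "openin (stone_cech (X \<times> X)) T" "U \<inter> ?K = T \<inter> ?K"
      by (rule openin_arrows_strip)
    then show ?thesis by (intro exI conjI)
  qed
  then obtain T where T: "\<And>U. U \<in> \<U> \<Longrightarrow> openin (stone_cech (X \<times> X)) (T U)" "\<And>U. U \<in> \<U> \<Longrightarrow> U \<inter> ?K = T U \<inter> ?K"
    by metis
  have "closedin (stone_cech (X \<times> X)) ?K"
    unfolding entourage_closure_eq[OF entourage_strip]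
    by (rule closedin_stone_cech_basic) (auto simp: strip_def)
  then have "compactin (stone_cech (X \<times> X)) ?K"
    by (rule closedin_compact_space[OF compact_space_stone_cech])
  moreover have "?K \<subseteq> \<Union>(T ` \<U>)" using U T(2) by blast
  moreover have "\<forall>U\<in>T ` \<U>. openin (stone_cech (X \<times> X)) U" using T(1) by blast
  ultimately obtain \<F> where "finite \<F>" "\<F> \<subseteq> T ` \<U>" "?K \<subseteq> \<Union>\<F>"
    unfolding compactin_def by meson
  then obtain \<V> where "\<V> \<subseteq> \<U>" "finite \<V>" "?K \<subseteq> \<Union>(T ` \<V>)" by (metis finite_subset_image)
  moreover from this have "?K \<subseteq> \<Union>\<V>" using T(2) by blast
  ultimately show "\<exists>\<F>. finite \<F> \<and> \<F> \<subseteq> \<U> \<and> ?K \<subseteq> \<Union>\<F>" by blast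
qed

text \<open>Band matrices over \<open>X\<close> are the restrictions to \<open>X \<times> X\<close> of the elements of \<open>cfun_c\<close>.\<close>

definition band :: "('a \<Rightarrow> 'a \<Rightarrow> 'b::{t3_space, zero}) \<Rightarrow> bool" where
  "band a \<longleftrightarrow> (\<exists>C R. compact C \<and> R \<ge> 0 \<and> (\<forall>x y. a x y \<in> C \<and> (a x y \<noteq> 0 \<longrightarrow> (x, y) \<in> strip R)))"

definition ext :: "('a \<Rightarrow> 'a \<Rightarrow> 'b::{t3_space, zero}) \<Rightarrow> ('a \<times> 'a) filter \<Rightarrow> 'b" where
  "ext a = sc_ext (X \<times> X) (\<lambda>(x, y). a x y)"

lemma ext_tendsto:
  assumes "band a" "\<omega> \<in> bXX" shows "((\<lambda>(x, y). a x y) \<longlongrightarrow> ext a \<omega>) \<omega>"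
  using assms unfolding band_def ext_def by (auto intro: sc_ext_tendsto)

lemma ext_support:
  assumes "\<And>x y. a x y \<noteq> 0 \<Longrightarrow> (x, y) \<in> strip R" "ext a \<omega> \<noteq> 0"
  shows "\<omega> \<in> entourage_closure X (strip R)"
proof -
  have \<omega>: "\<omega> \<in> bXX" using assms(2) unfolding ext_def sc_ext_def by (auto split: if_splits)
  have "eventually (\<lambda>e. e \<in> strip R) \<omega>"
  proof (rule ccontr)
    assume "\<not> ?thesis"
    then have "eventually (\<lambda>e. e \<notin> strip R) \<omega>" using \<omega> ultrafilter_not by (auto simp: topspace_stone_cech)
    then have "eventually (\<lambda>e. (\<lambda>(x, y). a x y) e = 0) \<omega>"
      by (rule eventually_mono) (use assms(1) in auto)
    then have "ext a \<omega> = 0" unfolding ext_def by (intro sc_ext_eqI[OF \<omega>] tendsto_eventually)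
    with assms(2) show False by contradiction
  qed
  then show ?thesis using \<omega> by (simp add: entourage_closure_eq[OF entourage_strip])
qed

lemma ext_cfun_c:
  assumes "band a" shows "ext a \<in> cfun_c (coarse_arrows X d)"
proof -
  obtain C R where C: "compact C" "\<And>x y. a x y \<in> C" and R: "\<And>x y. a x y \<noteq> 0 \<Longrightarrow> (x, y) \<in> strip R"
    using assms unfolding band_def by blast
  have cf: "ext a \<in> cfun (stone_cech (X \<times> X))"
    unfolding ext_def by (rule sc_ext_cfun[OF C(1)]) (use C(2) in auto)
  have supp: "{\<omega>. ext a \<omega> \<noteq> 0} \<subseteq> entourage_closure X (strip R)" using ext_support[OF R] by blast
  have "openin (coarse_arrows X d) {\<omega> \<in> arr. ext a \<omega> \<in> V}" if V: "open V" for V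
  proof -
    have "openin (stone_cech (X \<times> X)) {\<omega> \<in> bXX. ext a \<omega> \<in> V}"
      using cf V unfolding cfun_def continuous_map_def by auto
    from openin_arrows[OF this] show ?thesis
      using arr_bXX by (simp add: Int_def conj_commute cong: conj_cong)
  qed
  then have "continuous_map (coarse_arrows X d) euclidean (ext a)" by (auto simp: continuous_map_def)
  moreover have "ext a \<omega> = 0" if "\<omega> \<notin> arr" for \<omega> using supp strip_arr that by blast
  moreover have "compactin (coarse_arrows X d) (coarse_arrows X d closure_of {\<omega>. ext a \<omega> \<noteq> 0})"
    by (rule closed_compactin[OF compactin_strip closure_of_minimal[OF supp closedin_strip]]) simp
  ultimately show ?thesis unfolding cfun_c_def cfun_def by auto
qed

lemma cfun_arrows_tendsto:
  assumes f: "f \<in> cfun (coarse_arrows X d)" and \<omega>: "\<omega> \<in> arr"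
  shows "((\<lambda>e. f (principal {e})) \<longlongrightarrow> f \<omega>) \<omega>"
proof (rule topological_tendstoI)
  fix V assume V: "open V" "f \<omega> \<in> V"
  obtain R where R: "\<omega> \<in> bXX" "eventually (\<lambda>e. e \<in> strip R) \<omega>" using \<omega> arr_iff arr_bXX by blast
  then have \<omega>R: "\<omega> \<in> entourage_closure X (strip R)" by (simp add: entourage_closure_eq[OF entourage_strip])
  have "openin (coarse_arrows X d) {\<eta> \<in> arr. f \<eta> \<in> V}"
    using f V(1) unfolding cfun_def continuous_map_def by auto
  then obtain T where T: "openin (stone_cech (X \<times> X)) T"
    "{\<eta> \<in> arr. f \<eta> \<in> V} \<inter> entourage_closure X (strip R) = T \<inter> entourage_closure X (strip R)"
    by (rule openin_arrows_strip)
  have "\<omega> \<in> T" using \<omega>R \<omega> V(2) T(2) by blast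
  then obtain A where A: "A \<subseteq> X \<times> X" "eventually (\<lambda>e. e \<in> A) \<omega>"
    "\<forall>F\<in>bXX. eventually (\<lambda>e. e \<in> A) F \<longrightarrow> F \<in> T"
    using T(1) unfolding openin_stone_cech by blast
  have "eventually (\<lambda>e. e \<in> A \<and> e \<in> strip R) \<omega>" using A(2) R(2) by (rule eventually_conj)
  then show "eventually (\<lambda>e. f (principal {e}) \<in> V) \<omega>"
  proof (rule eventually_mono)
    fix e assume e: "e \<in> A \<and> e \<in> strip R"
    have "principal {e} \<in> bXX" using e A(1) by (intro principal_in_stone_cech) blast
    moreover have "eventually (\<lambda>x. x \<in> A) (principal {e})" "eventually (\<lambda>x. x \<in> strip R) (principal {e})"
      using e by (auto simp: eventually_principal)
    ultimately have "principal {e} \<in> T \<inter> entourage_closure X (strip R)"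
      using A(3) by (simp add: entourage_closure_eq[OF entourage_strip])
    then show "f (principal {e}) \<in> V" using T(2) by blast
  qed
qed

text \<open>The compact support is covered by the increasing open strip closures of integer width,
  so one of them contains it. The values of f at the points of X \<times> X therefore form a band
  matrix, and f is its limit along each arrow.\<close>

lemma cfun_c_ext:
  assumes "f \<in> cfun_c (coarse_arrows X d)"
  obtains a where "band a" "f = ext a"
proof -
  let ?K = "coarse_arrows X d closure_of {y. f y \<noteq> 0}"
  have f: "f \<in> cfun (coarse_arrows X d)" and K: "compactin (coarse_arrows X d) ?K"
    using assms unfolding cfun_c_def by auto
  have "{y. f y \<noteq> 0} \<subseteq> arr" using f unfolding cfun_def by blast
  then have sK: "{y. f y \<noteq> 0} \<subseteq> ?K" by (rule closure_of_subset)
  have Karr: "?K \<subseteq> arr" by (rule closure_of_subset_topspace)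
  let ?S = "\<lambda>n::nat. entourage_closure X (strip n)"
  have mono: "?S n \<subseteq> ?S m" if "n \<le> m" for n m
    unfolding entourage_closure_eq[OF entourage_strip] using that
    by (auto simp: strip_def elim!: eventually_mono)
  have "arr \<subseteq> \<Union>(range ?S)"
  proof
    fix \<omega> assume \<omega>: "\<omega> \<in> arr"
    then obtain R where R: "eventually (\<lambda>e. e \<in> strip R) \<omega>" using arr_iff by blast
    obtain n :: nat where "R \<le> n" using real_arch_simple by blast
    then have "eventually (\<lambda>e. e \<in> strip n) \<omega>" using R by (auto simp: strip_def elim!: eventually_mono)
    then have "\<omega> \<in> ?S n" using arr_bXX[OF \<omega>] by (simp add: entourage_closure_eq[OF entourage_strip])
    then show "\<omega> \<in> \<Union>(range ?S)" by blast
  qed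
  then have "?K \<subseteq> \<Union>(range ?S)" using Karr by blast
  moreover have "\<forall>U\<in>range ?S. openin (coarse_arrows X d) U" using openin_strip by blast
  ultimately obtain \<F> where F: "finite \<F>" "\<F> \<subseteq> range ?S" "?K \<subseteq> \<Union>\<F>"
    using K unfolding compactin_def by meson
  then obtain I where I: "finite I" "\<F> = ?S ` I" by (metis finite_subset_image)
  have "?K \<subseteq> ?S (Max (insert 0 I))"
  proof
    fix \<omega> assume "\<omega> \<in> ?K"
    then obtain n where "n \<in> I" "\<omega> \<in> ?S n" using F(3) I by blast
    then show "\<omega> \<in> ?S (Max (insert 0 I))" using mono[of n "Max (insert 0 I)"] I(1) by auto
  qed
  then obtain N :: nat where N: "{y. f y \<noteq> 0} \<subseteq> ?S N" using sK by blast
  define a where "a x y = f (principal {(x, y)})" for x y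
  have "compactin euclidean (f ` ?K)"
    using f unfolding cfun_def by (intro image_compactin[OF K]) auto
  then have "compact (insert 0 (f ` ?K))" by simp
  moreover have "a x y \<in> insert 0 (f ` ?K)" for x y using sK unfolding a_def by blast
  moreover have "(x, y) \<in> strip N" if "a x y \<noteq> 0" for x y
  proof -
    have "principal {(x, y)} \<in> ?S N" using N that unfolding a_def by blast
    then show ?thesis by (simp add: entourage_closure_eq[OF entourage_strip] eventually_principal)
  qed
  ultimately have b: "band a" unfolding band_def by (metis of_nat_0_le_iff)
  have "f = ext a"
  proof
    fix \<omega> show "f \<omega> = ext a \<omega>"
    proof (cases "\<omega> \<in> arr")
      case True
      have "((\<lambda>(x, y). a x y) \<longlongrightarrow> f \<omega>) \<omega>"
      proof -
        have "(\<lambda>(x, y). a x y) = (\<lambda>e. f (principal {e}))" by (auto simp: a_def fun_eq_iff)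
        then show ?thesis using cfun_arrows_tendsto[OF f True] by simp
      qed
      from sc_ext_eqI[OF arr_bXX[OF True] this] show ?thesis unfolding ext_def ..
    next
      case False
      then have "f \<omega> = 0" using f unfolding cfun_def by blast
      moreover have "ext a \<omega> = 0" using ext_cfun_c[OF b] False unfolding cfun_c_def cfun_def by blast
      ultimately show ?thesis by simp
    qed
  qed
  with b that show ?thesis by blast
qed

text \<open>The arrow with source u and range the image of u under t. By \<open>gam_eq_iff\<close>
  it depends only on the germ of t at u, that is, on t up to sets that u does not see.\<close>

definition gam :: "('a \<Rightarrow> 'a) \<Rightarrow> 'a filter \<Rightarrow> ('a \<times> 'a) filter" where
  "gam t u = filtermap (\<lambda>x. (t x, x)) u"

lemma bX_iff: "u \<in> bX \<longleftrightarrow> ultrafilter u \<and> eventually (\<lambda>x. x \<in> X) u"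
  by (simp add: topspace_stone_cech le_principal)

lemma bXX_iff: "u \<in> bXX \<longleftrightarrow> ultrafilter u \<and> eventually (\<lambda>x. x \<in> X \<times> X) u"
  by (simp add: topspace_stone_cech le_principal)

lemma src_gam: "filtermap snd (gam t u) = u"
  unfolding gam_def by (simp add: filtermap_filtermap filtermap_ident)

lemma gam_eq_iff: "gam t u = gam s u \<longleftrightarrow> eventually (\<lambda>x. t x = s x) u"
proof
  assume "gam t u = gam s u"
  moreover have "eventually (\<lambda>(y, x). y = t x) (gam t u)" by (simp add: gam_def eventually_filtermap)
  ultimately have "eventually (\<lambda>(y, x). y = t x) (gam s u)" by simp
  then show "eventually (\<lambda>x. t x = s x) u" by (simp add: gam_def eventually_filtermap eq_commute)
next
  assume "eventually (\<lambda>x. t x = s x) u"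
  then have *: "eventually (\<lambda>x. P (t x, x) \<longleftrightarrow> P (s x, x)) u" for P by (rule eventually_mono) simp
  show "gam t u = gam s u"
    by (rule filter_eqI) (simp add: gam_def eventually_filtermap eventually_subst[OF *])
qed

lemma gam_arr:
  assumes "u \<in> bX" "eventually (\<lambda>x. t x \<in> X \<and> d (t x) x \<le> R) u"
  shows "gam t u \<in> arr"
proof -
  have "eventually (\<lambda>x. (t x, x) \<in> strip R) u"
    using assms by (auto simp: bX_iff strip_def elim: eventually_elim2)
  then show ?thesis using assms(1)
    unfolding arr_iff gam_def by (auto simp: bX_iff eventually_filtermap intro: ultrafilter_filtermap)
qed

lemma enumeration:
  "\<exists>(en :: 'a \<Rightarrow> nat \<Rightarrow> 'a) N. \<forall>y\<in>X. card (mcball y R) \<le> N \<and>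
     bij_betw (en y) {..<card (mcball y R)} (mcball y R)"
proof -
  obtain N where N: "\<forall>x\<in>X. finite (mcball x R) \<and> card (mcball x R) \<le> N"
    using ball_bound by blast
  have "\<exists>h. y \<in> X \<longrightarrow> bij_betw h {..<card (mcball y R)} (mcball y R)" for y
  proof (cases "y \<in> X")
    case True
    then show ?thesis using N ex_bij_betw_nat_finite[of "mcball y R"] by (auto simp: lessThan_atLeast0)
  qed simp
  then obtain en where "\<And>y. y \<in> X \<longrightarrow> bij_betw (en y) {..<card (mcball y R)} (mcball y R)" by metis
  then show ?thesis using N by (intro exI[of _ en] exI[of _ N]) simp
qed

text \<open>The size of the R-ball around t x takes at most N + 1 values, so it is constant, equal
  to m, on a set in u. The maps \<open>r k\<close> then list the ball around t x by exactly m germs,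
  which turns sums over balls into sums of a fixed length along u.\<close>

lemma local_enumeration:
  "\<exists>N::nat. \<forall>u\<in>bX. \<forall>t. eventually (\<lambda>x. t x \<in> X) u \<longrightarrow>
    (\<exists>m (r :: nat \<Rightarrow> 'a \<Rightarrow> 'a). m \<le> N \<and> eventually (\<lambda>x. bij_betw (\<lambda>k. r k x) {..<m} (mcball (t x) R)) u)"
proof -
  obtain en :: "'a \<Rightarrow> nat \<Rightarrow> 'a" and N where en: "\<And>y. y \<in> X \<Longrightarrow> card (mcball y R) \<le> N"
    "\<And>y. y \<in> X \<Longrightarrow> bij_betw (en y) {..<card (mcball y R)} (mcball y R)" using enumeration[of R] by (metis (no_types, lifting))
  have *: "\<exists>m (r :: nat \<Rightarrow> 'a \<Rightarrow> 'a). m \<le> N \<and> eventually (\<lambda>x. bij_betw (\<lambda>k. r k x) {..<m} (mcball (t x) R)) u"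
    if u: "u \<in> bX" and t: "eventually (\<lambda>x. t x \<in> X) u" for u and t :: "'a \<Rightarrow> 'a"
  proof -
    have U: "ultrafilter u" using u by (simp add: bX_iff)
    have "eventually (\<lambda>x. \<exists>m\<in>{..N}. t x \<in> X \<and> card (mcball (t x) R) = m) u"
      using t by (rule eventually_mono) (use en(1) in auto)
    from ultrafilter_bex[OF U finite_atMost this]
    obtain m where m: "m \<le> N" "eventually (\<lambda>x. t x \<in> X \<and> card (mcball (t x) R) = m) u"
      by blast
    have "eventually (\<lambda>x. bij_betw (\<lambda>k. en (t x) k) {..<m} (mcball (t x) R)) u"
      using m(2) by (rule eventually_mono) (use en(2) in auto)
    with m(1) show ?thesis by (intro exI conjI)
  qed
  show ?thesis by (intro exI[of _ N] ballI allI impI *)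
qed

text \<open>Each s x equals some r k x, with finitely many k to choose from; the ultrafilter decides
  for one k.\<close>

lemma translate_in_enumeration:
  fixes m :: nat
  assumes u: "u \<in> bX" and r: "eventually (\<lambda>x. bij_betw (\<lambda>k. r k x) {..<m} (mcball (t x) R)) u"
    and s: "eventually (\<lambda>x. (t x, s x) \<in> strip R) u"
  shows "\<exists>k<m. gam s u = gam (r k) u"
proof -
  have "eventually (\<lambda>x. \<exists>k\<in>{..<m}. s x = r k x) u"
    using r s
  proof (rule eventually_elim2)
    fix x assume "bij_betw (\<lambda>k. r k x) {..<m} (mcball (t x) R)" "(t x, s x) \<in> strip R"
    then have "s x \<in> (\<lambda>k. r k x) ` {..<m}" by (auto simp: bij_betw_def strip_def)
    then show "\<exists>k\<in>{..<m}. s x = r k x" by blast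
  qed
  from ultrafilter_bex[OF _ finite_lessThan this]
  obtain k where "k < m" "eventually (\<lambda>x. s x = r k x) u" using u by (auto simp: bX_iff)
  then show ?thesis by (auto simp: gam_eq_iff)
qed

lemma enumeration_inj:
  fixes m :: nat
  assumes u: "u \<in> bX" and r: "eventually (\<lambda>x. bij_betw (\<lambda>k. r k x) {..<m} (mcball (t x) R)) u"
  shows "inj_on (\<lambda>k. gam (r k) u) {..<m}"
proof (rule inj_onI)
  fix k l assume kl: "k \<in> {..<m}" "l \<in> {..<m}" "gam (r k) u = gam (r l) u"
  then have "eventually (\<lambda>x. r k x = r l x) u" by (simp add: gam_eq_iff)
  then have "eventually (\<lambda>x. bij_betw (\<lambda>k. r k x) {..<m} (mcball (t x) R) \<and> r k x = r l x) u"
    using r by (rule eventually_conj[rotated])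
  then obtain x where "bij_betw (\<lambda>k. r k x) {..<m} (mcball (t x) R)" "r k x = r l x"
    using ultrafilter_ex u by (auto simp: bX_iff)
  then show "k = l" using kl by (auto simp: bij_betw_def inj_on_def)
qed

lemma enumeration_mem:
  fixes m :: nat
  assumes r: "eventually (\<lambda>x. bij_betw (\<lambda>k. r k x) {..<m} (mcball (t x) R)) u" and k: "k < m"
  shows "eventually (\<lambda>x. (t x, r k x) \<in> strip R) u"
  using r
proof (rule eventually_mono)
  fix x assume "bij_betw (\<lambda>k. r k x) {..<m} (mcball (t x) R)"
  then have "r k x \<in> mcball (t x) R" using k by (auto simp: bij_betw_def)
  then show "(t x, r k x) \<in> strip R" by (simp add: strip_def)
qed

text \<open>By uniform local finiteness the strip of width R is covered by the graphs of finitely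
  many maps, the k-th sending x to the k-th point of its R-ball. An ultrafilter on the strip
  concentrates on one of these graphs and so is the germ of that map at its source.\<close>

lemma arr_gam:
  assumes g: "g \<in> arr"
  shows "filtermap snd g \<in> bX"
    "\<exists>t. g = gam t (filtermap snd g) \<and> eventually (\<lambda>x. t x \<in> X) (filtermap snd g) \<and>
      (\<exists>R. eventually (\<lambda>x. (t x, x) \<in> strip R) (filtermap snd g))"
proof -
  let ?u = "filtermap snd g"
  obtain R where R: "ultrafilter g" "eventually (\<lambda>e. e \<in> strip R) g" using g arr_iff by blast
  have "eventually (\<lambda>x. x \<in> X) ?u"
    unfolding eventually_filtermap using R(2) by (rule eventually_mono) (auto simp: strip_def)
  then show u: "?u \<in> bX" using R(1) by (simp add: bX_iff ultrafilter_filtermap)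
  obtain en :: "'a \<Rightarrow> nat \<Rightarrow> 'a" and N where en: "\<And>y. y \<in> X \<Longrightarrow> card (mcball y R) \<le> N"
    "\<And>y. y \<in> X \<Longrightarrow> bij_betw (en y) {..<card (mcball y R)} (mcball y R)" using enumeration[of R] by (metis (no_types, lifting))
  have "eventually (\<lambda>e. \<exists>k\<in>{..<N}. fst e = en (snd e) k) g"
    using R(2)
  proof (rule eventually_mono)
    fix e assume e: "e \<in> strip R"
    then have x: "snd e \<in> X" "fst e \<in> mcball (snd e) R" by (auto simp: strip_def commute)
    then obtain k where "k < card (mcball (snd e) R)" "fst e = en (snd e) k"
      using en(2)[OF x(1)] unfolding bij_betw_def by (metis imageE lessThan_iff)
    then show "\<exists>k\<in>{..<N}. fst e = en (snd e) k" using en(1)[OF x(1)] by auto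
  qed
  from ultrafilter_bex[OF R(1) finite_lessThan this]
  obtain k where k: "eventually (\<lambda>e. fst e = en (snd e) k) g" by blast
  define t where "t x = en x k" for x
  have ev: "eventually (\<lambda>e. e = (t (snd e), snd e)) g"
    using k by (rule eventually_mono) (auto simp: t_def prod_eq_iff)
  have "g = gam t ?u"
  proof (rule filter_eqI)
    fix P
    have "eventually (\<lambda>e. P e \<longleftrightarrow> P (t (snd e), snd e)) g" using ev by (rule eventually_mono) simp
    from eventually_subst[OF this] show "eventually P g \<longleftrightarrow> eventually P (gam t ?u)"
      by (simp add: gam_def eventually_filtermap)
  qed
  moreover have st: "eventually (\<lambda>x. (t x, x) \<in> strip R) ?u"
    unfolding eventually_filtermap using ev R(2) by (rule eventually_elim2) simp
  moreover have "eventually (\<lambda>x. t x \<in> X) ?u" using st by (rule eventually_mono) (simp add: strip_def)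
  ultimately show "\<exists>t. g = gam t ?u \<and> eventually (\<lambda>x. t x \<in> X) ?u \<and>
      (\<exists>R. eventually (\<lambda>x. (t x, x) \<in> strip R) ?u)" by blast
qed

lemma arr_translate:
  assumes "g \<in> arr" "filtermap snd g = u"
  shows "\<exists>t. g = gam t u \<and> eventually (\<lambda>x. t x \<in> X) u"
  using arr_gam(2)[OF assms(1)] unfolding assms(2) by blast

text \<open>The product filter restricted to composable pairs lives on the pairs ((t x, x), (x, s
  x)), so g times the inverse of h is the image of u under x -> (t x, s x).\<close>

lemma gmult_gam:
  "gmult G (gam t u) (ginv G (gam s u)) = filtermap (\<lambda>x. (t x, s x)) u"
proof -
  let ?j = "\<lambda>x. ((t x, x), (x, s x))"
  let ?C = "principal {((x, y), (y', z)) | x y y' z. y = y'} :: (('a \<times> 'a) \<times> ('a \<times> 'a)) filter"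
  have inv: "ginv G (gam s u) = filtermap (\<lambda>x. (x, s x)) u"
    by (simp add: G_simps gam_def filtermap_filtermap)
  have "inf (gam t u \<times>\<^sub>F filtermap (\<lambda>x. (x, s x)) u) ?C = filtermap ?j u"
  proof (rule antisym)
    show "filtermap ?j u \<le> inf (gam t u \<times>\<^sub>F filtermap (\<lambda>x. (x, s x)) u) ?C"
    proof (rule inf_greatest)
      have "filterlim ?j (gam t u \<times>\<^sub>F filtermap (\<lambda>x. (x, s x)) u) u"
        by (rule filterlim_Pair) (simp_all add: filterlim_def gam_def)
      then show "filtermap ?j u \<le> gam t u \<times>\<^sub>F filtermap (\<lambda>x. (x, s x)) u" by (simp add: filterlim_def)
      show "filtermap ?j u \<le> ?C" by (simp add: le_principal eventually_filtermap)
    qed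
    show "inf (gam t u \<times>\<^sub>F filtermap (\<lambda>x. (x, s x)) u) ?C \<le> filtermap ?j u"
    proof (rule filter_leI)
      fix P assume "eventually P (filtermap ?j u)"
      then have P: "eventually (\<lambda>x. P (?j x)) u" by (simp add: eventually_filtermap)
      have 1: "eventually (\<lambda>(y, x). y = t x \<and> P (?j x)) (gam t u)"
        using P by (simp add: gam_def eventually_filtermap)
      have 2: "eventually (\<lambda>(x, z). z = s x) (filtermap (\<lambda>x. (x, s x)) u)"
        by (simp add: eventually_filtermap)
      have "eventually (\<lambda>p. (case fst p of (y, x) \<Rightarrow> y = t x \<and> P (?j x)) \<and> (case snd p of (x, z) \<Rightarrow> z = s x))
          (gam t u \<times>\<^sub>F filtermap (\<lambda>x. (x, s x)) u)"
        unfolding eventually_prod_filter using 1 2 by (intro exI conjI) auto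
      then show "eventually P (inf (gam t u \<times>\<^sub>F filtermap (\<lambda>x. (x, s x)) u) ?C)"
        unfolding eventually_inf_principal by (rule eventually_mono) auto
    qed
  qed
  then have "gmult G (gam t u) (ginv G (gam s u)) = filtermap (\<lambda>((x, y), (y', z)). (x, z)) (filtermap ?j u)"
    unfolding inv by (simp add: coarse_groupoid_def)
  then show ?thesis by (simp add: filtermap_filtermap)
qed

text \<open>The bridge from the groupoid to matrices: the value of an extension at such a product
  arrow is the limit along u of ordinary matrix entries.\<close>

lemma ext_pair_tendsto:
  assumes a: "band a" and u: "u \<in> bX" and t: "eventually (\<lambda>x. t x \<in> X) u" and s: "eventually (\<lambda>x. s x \<in> X) u"
  shows "((\<lambda>x. a (t x) (s x)) \<longlongrightarrow> ext a (filtermap (\<lambda>x. (t x, s x)) u)) u"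
proof -
  have "eventually (\<lambda>x. (t x, s x) \<in> X \<times> X) u" using t s by (auto elim: eventually_elim2)
  then have "filtermap (\<lambda>x. (t x, s x)) u \<in> bXX"
    using u by (simp add: bXX_iff bX_iff ultrafilter_filtermap eventually_filtermap)
  from ext_tendsto[OF a this] show ?thesis
    by (simp add: tendsto_compose_filtermap[symmetric] o_def)
qed

lemma ext_pair_eqI:
  assumes a: "band a" and u: "u \<in> bX" and t: "eventually (\<lambda>x. t x \<in> X) u" and s: "eventually (\<lambda>x. s x \<in> X) u"
    and l: "((\<lambda>x. a (t x) (s x)) \<longlongrightarrow> l) u"
  shows "ext a (filtermap (\<lambda>x. (t x, s x)) u) = l"
  using tendsto_unique[OF _ ext_pair_tendsto[OF a u t s] l] ultrafilter_not_bot u by (auto simp: bX_iff)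

lemma ext_pair_nonzero:
  assumes a: "band a" and R: "\<And>x y. a x y \<noteq> 0 \<Longrightarrow> (x, y) \<in> strip R"
    and u: "u \<in> bX" and t: "eventually (\<lambda>x. t x \<in> X) u" and s: "eventually (\<lambda>x. s x \<in> X) u"
    and nz: "ext a (filtermap (\<lambda>x. (t x, s x)) u) \<noteq> 0"
  shows "eventually (\<lambda>x. (t x, s x) \<in> strip R) u"
proof -
  have "filtermap (\<lambda>x. (t x, s x)) u \<in> entourage_closure X (strip R)"
    by (rule ext_support[OF R nz])
  then show ?thesis by (simp add: entourage_closure_eq[OF entourage_strip] eventually_filtermap)
qed

end

section \<open>Complex functions on the unit space as a ring with involution\<close>

lemma cfun_stone_cechI:
  fixes \<phi> :: "'a \<Rightarrow> 'b::{t3_space, zero}"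
  assumes C: "compact C" "\<And>x. x \<in> S \<Longrightarrow> \<phi> x \<in> C"
    and lim: "\<And>F. F \<in> topspace (stone_cech S) \<Longrightarrow> (\<phi> \<longlongrightarrow> h F) F"
    and out: "\<And>F. F \<notin> topspace (stone_cech S) \<Longrightarrow> h F = 0"
  shows "h \<in> cfun (stone_cech S)" "h = sc_ext S \<phi>"
proof -
  show "h = sc_ext S \<phi>"
  proof
    fix F show "h F = sc_ext S \<phi> F"
      using sc_ext_eqI[OF _ lim] out by (cases "F \<in> topspace (stone_cech S)") (auto simp: sc_ext_def)
  qed
  then show "h \<in> cfun (stone_cech S)" using sc_ext_cfun[OF C] by simp
qed

lemma cfun_complex_bounded:
  fixes f :: "'a filter \<Rightarrow> complex"
  assumes "f \<in> cfun (stone_cech S)"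
  shows "\<exists>B. \<forall>x\<in>S. norm (f (principal {x})) \<le> B"
proof -
  have "bounded (f ` topspace (stone_cech S))"
    using cfun_stone_cech_compact_range[OF assms] by (rule compact_imp_bounded)
  then obtain B where "\<forall>F\<in>topspace (stone_cech S). norm (f F) \<le> B" by (auto simp: bounded_iff)
  then show ?thesis by (intro exI[of _ B]) (simp add: principal_in_stone_cech)
qed

lemma cfun_stone_cech_complex_op:
  fixes f g :: "'a filter \<Rightarrow> complex"
  assumes f: "f \<in> cfun (stone_cech S)" and g: "g \<in> cfun (stone_cech S)"
  shows "(\<lambda>F. f F + g F) \<in> cfun (stone_cech S)" "(\<lambda>F. f F * g F) \<in> cfun (stone_cech S)"
    "(\<lambda>F. cnj (f F)) \<in> cfun (stone_cech S)" "(\<lambda>F. - f F) \<in> cfun (stone_cech S)"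
proof -
  obtain B where B: "\<And>x. x \<in> S \<Longrightarrow> norm (f (principal {x})) \<le> B" using cfun_complex_bounded[OF f] by auto
  obtain B' where B': "\<And>x. x \<in> S \<Longrightarrow> norm (g (principal {x})) \<le> B'" using cfun_complex_bounded[OF g] by auto
  note lf = cfun_stone_cech_tendsto[OF f] and lg = cfun_stone_cech_tendsto[OF g]
  have out: "f F = 0" "g F = 0" if "F \<notin> topspace (stone_cech S)" for F
    using f g that unfolding cfun_def by auto
  show "(\<lambda>F. f F + g F) \<in> cfun (stone_cech S)"
    by (rule cfun_stone_cechI(1)[of "cball 0 (B + B')", OF _ _ tendsto_add[OF lf lg]])
      (auto simp: out intro: norm_triangle_le add_mono B B')
  show "(\<lambda>F. f F * g F) \<in> cfun (stone_cech S)"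
    by (rule cfun_stone_cechI(1)[of "cball 0 (B * B')", OF _ _ tendsto_mult[OF lf lg]])
      (auto simp: out norm_mult intro!: mult_mono B B' order_trans[OF norm_ge_zero B])
  show "(\<lambda>F. cnj (f F)) \<in> cfun (stone_cech S)"
    by (rule cfun_stone_cechI(1)[of "cball 0 B", OF _ _ tendsto_cnj[OF lf]]) (auto simp: out B)
  show "(\<lambda>F. - f F) \<in> cfun (stone_cech S)"
    by (rule cfun_stone_cechI(1)[of "cball 0 B", OF _ _ tendsto_minus[OF lf]]) (auto simp: out B)
qed

lemma cfun_stone_cech_indicator:
  "(\<lambda>F. if F \<in> topspace (stone_cech S) then 1 else 0 :: complex) \<in> cfun (stone_cech S)"
  by (rule cfun_stone_cechI(1)[of "{1}" _ "\<lambda>_. 1"]) auto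

lemma star_algebra_cfun_algebra: "star_algebra (cfun_algebra (stone_cech S))"
proof -
  let ?R = "cfun_algebra (stone_cech S)"
  have car: "carrier ?R = cfun (stone_cech S)" by (simp add: cfun_algebra_def)
  have ops: "f \<oplus>\<^bsub>?R\<^esub> g = (\<lambda>F. f F + g F)" "f \<otimes>\<^bsub>?R\<^esub> g = (\<lambda>F. f F * g F)"
    "\<zero>\<^bsub>?R\<^esub> = (\<lambda>_. 0)" "\<one>\<^bsub>?R\<^esub> = (\<lambda>F. if F \<in> topspace (stone_cech S) then 1 else 0)"
    "star ?R f = (\<lambda>F. cnj (f F))" for f g by (simp_all add: cfun_algebra_def)
  have zero: "(\<lambda>_. 0) \<in> cfun (stone_cech S)" by (simp add: cfun_def)
  have out: "f F = 0" if "f \<in> cfun (stone_cech S)" "F \<notin> topspace (stone_cech S)" for f :: "'a filter \<Rightarrow> complex" and F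
    using that unfolding cfun_def by simp
  have unit: "(\<lambda>F. (if F \<in> topspace (stone_cech S) then 1 else 0) * f F) = f"
    "(\<lambda>F. f F * (if F \<in> topspace (stone_cech S) then 1 else 0)) = f"
    if "f \<in> cfun (stone_cech S)" for f :: "'a filter \<Rightarrow> complex"
    using out[OF that] by (auto simp: fun_eq_iff)
  have "abelian_group ?R"
  proof (rule abelian_groupI, unfold car ops)
    fix f :: "'a filter \<Rightarrow> complex" assume "f \<in> cfun (stone_cech S)"
    then show "\<exists>g\<in>cfun (stone_cech S). (\<lambda>F. g F + f F) = (\<lambda>_. 0)"
      by (intro bexI[of _ "\<lambda>F. - f F"] cfun_stone_cech_complex_op(4)) simp_all
  qed (simp_all add: cfun_stone_cech_complex_op zero add_ac)
  moreover have "Group.monoid ?R"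
    by (rule monoidI, unfold car ops)
      (simp_all add: cfun_stone_cech_complex_op cfun_stone_cech_indicator unit mult_ac)
  ultimately have "ring ?R"
    by (rule ringI) (simp_all add: car ops algebra_simps)
  moreover have "star_algebra_axioms ?R"
    by (unfold_locales, unfold car ops) (simp_all add: cfun_stone_cech_complex_op mult_ac)
  ultimately show ?thesis by (simp add: star_algebra_def)
qed

section \<open>Band matrices and the regular representation\<close>

context coarse_space
begin

lemma bandD:
  fixes a :: "'a \<Rightarrow> 'a \<Rightarrow> complex"
  assumes "band a"
  shows "\<exists>C R. C \<ge> 0 \<and> R \<ge> 0 \<and> (\<forall>x y. norm (a x y) \<le> C \<and> (a x y \<noteq> 0 \<longrightarrow> (x, y) \<in> strip R))"
proof -
  obtain K R where K: "compact K" "R \<ge> 0" "\<forall>x y. a x y \<in> K \<and> (a x y \<noteq> 0 \<longrightarrow> (x, y) \<in> strip R)"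
    using assms unfolding band_def by blast
  obtain C where C: "\<forall>z\<in>K. norm z \<le> C" using compact_imp_bounded[OF K(1)] by (auto simp: bounded_iff)
  have "norm (a x y) \<le> max C 0" for x y using C K(3) by (simp add: max.coboundedI1)
  then show ?thesis using K by (intro exI[of _ "max C 0"] exI[of _ R]) auto
qed

lemma bandI:
  fixes a :: "'a \<Rightarrow> 'a \<Rightarrow> complex"
  assumes "\<And>x y. norm (a x y) \<le> C" "\<And>x y. a x y \<noteq> 0 \<Longrightarrow> (x, y) \<in> strip R"
  shows "band a"
proof -
  have "strip R \<subseteq> strip (max R 0)" by (auto simp: strip_def)
  then show ?thesis unfolding band_def using assms
    by (intro exI[of _ "cball 0 C"] exI[of _ "max R 0"]) auto
qed

lemma strip_sym: "(x, y) \<in> strip R \<longleftrightarrow> (y, x) \<in> strip R"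
  by (auto simp: strip_def commute)

lemma strip_trans: "(x, y) \<in> strip R \<Longrightarrow> (y, z) \<in> strip R' \<Longrightarrow> (x, z) \<in> strip (R + R')"
  using triangle[of x y z] by (auto simp: strip_def)

lemma strip_mono: "(x, y) \<in> strip R \<Longrightarrow> R \<le> R' \<Longrightarrow> (x, y) \<in> strip R'"
  by (auto simp: strip_def)

lemma strip_ball: "(x, y) \<in> strip R \<longleftrightarrow> y \<in> mcball x R"
  by (auto simp: strip_def)

lemma finite_ball: "finite (mcball x R)"
proof (cases "x \<in> X")
  case True then show ?thesis using ball_bound[of R] by blast
next
  case False then have "mcball x R = {}" by (simp add: mcball_eq_empty)
  then show ?thesis by simp
qed

lemma band_row_finite:
  assumes "band a" shows "finite {y. a x y \<noteq> 0}" "finite {y. a y x \<noteq> 0}"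
proof -
  obtain R where R: "\<And>x y. a x y \<noteq> 0 \<Longrightarrow> (x, y) \<in> strip R" using assms unfolding band_def by blast
  have "{y. a x y \<noteq> 0} \<subseteq> mcball x R" using R strip_ball by blast
  then show "finite {y. a x y \<noteq> 0}" using finite_ball finite_subset by blast
  have "{y. a y x \<noteq> 0} \<subseteq> mcball x R" using R strip_ball strip_sym by blast
  then show "finite {y. a y x \<noteq> 0}" using finite_ball finite_subset by blast
qed

lemma band_add:
  fixes a b :: "'a \<Rightarrow> 'a \<Rightarrow> complex"
  assumes "band a" "band b" shows "band (\<lambda>x y. a x y + b x y)"
proof -
  obtain C R where a: "C \<ge> 0" "R \<ge> 0" "\<And>x y. norm (a x y) \<le> C" "\<And>x y. a x y \<noteq> 0 \<Longrightarrow> (x, y) \<in> strip R"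
    using bandD[OF assms(1)] by auto
  obtain C' R' where b: "C' \<ge> 0" "R' \<ge> 0" "\<And>x y. norm (b x y) \<le> C'" "\<And>x y. b x y \<noteq> 0 \<Longrightarrow> (x, y) \<in> strip R'"
    using bandD[OF assms(2)] by auto
  show ?thesis
  proof (rule bandI)
    show "norm (a x y + b x y) \<le> C + C'" for x y using a(3) b(3) by (intro norm_triangle_le add_mono)
    show "(x, y) \<in> strip (max R R')" if "a x y + b x y \<noteq> 0" for x y
    proof -
      have "a x y \<noteq> 0 \<or> b x y \<noteq> 0" using that by auto
      then show ?thesis using a(4) b(4) strip_mono by (meson max.cobounded1 max.cobounded2)
    qed
  qed
qed

lemma band_adjoint:
  fixes a :: "'a \<Rightarrow> 'a \<Rightarrow> complex"
  assumes "band a" shows "band (\<lambda>x y. cnj (a y x))"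
proof -
  obtain C R where a: "C \<ge> 0" "R \<ge> 0" "\<And>x y. norm (a x y) \<le> C" "\<And>x y. a x y \<noteq> 0 \<Longrightarrow> (x, y) \<in> strip R"
    using bandD[OF assms(1)] by auto
  show ?thesis
  proof (rule bandI[of _ C R])
    show "(x, y) \<in> strip R" if "cnj (a y x) \<noteq> 0" for x y
      using a(4)[of y x] strip_sym[of x y] that by simp
  qed (use a in simp)
qed

lemma band_uminus:
  fixes a :: "'a \<Rightarrow> 'a \<Rightarrow> complex"
  assumes "band a" shows "band (\<lambda>x y. - a x y)"
proof -
  obtain C R where a: "C \<ge> 0" "R \<ge> 0" "\<And>x y. norm (a x y) \<le> C" "\<And>x y. a x y \<noteq> 0 \<Longrightarrow> (x, y) \<in> strip R"
    using bandD[OF assms(1)] by auto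
  show ?thesis by (rule bandI[of _ C R]) (use a in auto)
qed

lemma local_enumeration_at:
  assumes "u \<in> bX" "eventually (\<lambda>x. t x \<in> X) u"
  shows "\<exists>(m :: nat) (r :: nat \<Rightarrow> 'a \<Rightarrow> 'a). eventually (\<lambda>x. bij_betw (\<lambda>k. r k x) {..<m} (mcball (t x) R)) u"
  using local_enumeration[of R] assms by blast

text \<open>Matrix multiplication; summing over the row support of a keeps the sum finite for band
  matrices over an infinite X.\<close>

definition bmul :: "('a \<Rightarrow> 'a \<Rightarrow> complex) \<Rightarrow> ('a \<Rightarrow> 'a \<Rightarrow> complex) \<Rightarrow> 'a \<Rightarrow> 'a \<Rightarrow> complex" where
  "bmul a b x z = (\<Sum>y | a x y \<noteq> 0. a x y * b y z)"

lemma bmul_superset: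
  assumes "finite Y" "\<And>y. a x y \<noteq> 0 \<Longrightarrow> b y z \<noteq> 0 \<Longrightarrow> y \<in> Y" "finite {y. a x y \<noteq> 0}"
  shows "bmul a b x z = (\<Sum>y\<in>Y. a x y * b y z)"
proof -
  have "bmul a b x z = (\<Sum>y\<in>{y. a x y \<noteq> 0} \<union> Y. a x y * b y z)"
    unfolding bmul_def using assms by (intro sum.mono_neutral_left) auto
  also have "\<dots> = (\<Sum>y\<in>Y. a x y * b y z)"
    using assms by (intro sum.mono_neutral_right) auto
  finally show ?thesis .
qed

lemma band_bmul:
  assumes "band a" "band b" shows "band (bmul a b)"
proof -
  obtain C R where a: "C \<ge> 0" "R \<ge> 0" "\<And>x y. norm (a x y) \<le> C" "\<And>x y. a x y \<noteq> 0 \<Longrightarrow> (x, y) \<in> strip R"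
    using bandD[OF assms(1)] by auto
  obtain C' R' where b: "C' \<ge> 0" "R' \<ge> 0" "\<And>x y. norm (b x y) \<le> C'" "\<And>x y. b x y \<noteq> 0 \<Longrightarrow> (x, y) \<in> strip R'"
    using bandD[OF assms(2)] by auto
  obtain N where N: "\<forall>x\<in>X. finite (mcball x R) \<and> card (mcball x R) \<le> N" using ball_bound by blast
  show ?thesis
  proof (rule bandI)
    fix x z
    show "norm (bmul a b x z) \<le> N * (C * C')"
    proof (cases "x \<in> X")
      case True
      have "{y. a x y \<noteq> 0} \<subseteq> mcball x R" using a(4) strip_ball by blast
      then have "card {y. a x y \<noteq> 0} \<le> N" using N True card_mono le_trans by meson
      have "norm (bmul a b x z) \<le> (\<Sum>y | a x y \<noteq> 0. norm (a x y * b y z))" unfolding bmul_def by (rule norm_sum)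
      also have "\<dots> \<le> (\<Sum>y | a x y \<noteq> 0. C * C')"
        using a b by (intro sum_mono) (auto simp: norm_mult intro!: mult_mono)
      also have "\<dots> = card {y. a x y \<noteq> 0} * (C * C')" by simp
      also have "\<dots> \<le> N * (C * C')" using \<open>card {y. a x y \<noteq> 0} \<le> N\<close> a b by (intro mult_right_mono) auto
      finally show ?thesis .
    next
      case False
      then have "{y. a x y \<noteq> 0} = {}" using a(4) by (auto simp: strip_def)
      then show ?thesis using a b by (simp add: bmul_def)
    qed
    assume "bmul a b x z \<noteq> 0"
    then obtain y where "a x y * b y z \<noteq> 0" unfolding bmul_def by (metis (mono_tags, lifting) sum.neutral)
    then have "(x, y) \<in> strip R" "(y, z) \<in> strip R'" using a(4) b(4) by auto
    then show "(x, z) \<in> strip (R + R')" by (rule strip_trans)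
  qed
qed

text \<open>The matrix of the regular representation of \<open>ext a\<close> in the basis of arrows:
  the entry at (g, h) is the value at g times the inverse of h, and different source fibres do not
  interact.\<close>

definition rker :: "('a \<Rightarrow> 'a \<Rightarrow> complex) \<Rightarrow> ('a \<times> 'a) filter \<Rightarrow> ('a \<times> 'a) filter \<Rightarrow> complex" where
  "rker a g h = (if g \<in> arr \<and> h \<in> arr \<and> filtermap snd g = filtermap snd h
     then ext a (gmult G g (ginv G h)) else 0)"

lemma rker_gam:
  assumes "gam t u \<in> arr" "gam s u \<in> arr"
  shows "rker a (gam t u) (gam s u) = ext a (filtermap (\<lambda>x. (t x, s x)) u)"
  using assms unfolding rker_def by (simp add: src_gam gmult_gam)

lemma rker_nonzero_arr:
  "rker a g h \<noteq> 0 \<Longrightarrow> g \<in> arr \<and> h \<in> arr \<and> filtermap snd g = filtermap snd h"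
  unfolding rker_def by (auto split: if_splits)

text \<open>For g the germ of t at u, a nonzero entry at the germ of s forces s x into the R-ball
  around t x along u. So h is one of the at most N germs listing these balls.\<close>

lemma rker_row:
  assumes a: "band a"
  shows "\<exists>N. \<forall>g. finite {h. rker a g h \<noteq> 0} \<and> card {h. rker a g h \<noteq> 0} \<le> N"
proof -
  obtain R where R: "\<And>x y. a x y \<noteq> 0 \<Longrightarrow> (x, y) \<in> strip R" using a unfolding band_def by blast
  obtain N :: nat where N: "\<forall>u\<in>bX. \<forall>t. eventually (\<lambda>x. t x \<in> X) u \<longrightarrow>
    (\<exists>m (r :: nat \<Rightarrow> 'a \<Rightarrow> 'a). m \<le> N \<and> eventually (\<lambda>x. bij_betw (\<lambda>k. r k x) {..<m} (mcball (t x) R)) u)"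
    using local_enumeration by blast
  have "finite {h. rker a g h \<noteq> 0} \<and> card {h. rker a g h \<noteq> 0} \<le> N" for g
  proof (cases "g \<in> arr")
    case False
    then have "{h. rker a g h \<noteq> 0} = {}" using rker_nonzero_arr by blast
    then show ?thesis by simp
  next
    case True
    obtain t where t: "g = gam t (filtermap snd g)" "eventually (\<lambda>x. t x \<in> X) (filtermap snd g)" "filtermap snd g \<in> bX"
      using arr_gam[OF True] by blast
    define u where "u = filtermap snd g"
    note t = t[folded u_def]
    obtain m r where m: "m \<le> N" and r: "eventually (\<lambda>x. bij_betw (\<lambda>k. r k x) {..<m} (mcball (t x) R)) u"
      using N t by blast
    have sub: "{h. rker a g h \<noteq> 0} \<subseteq> (\<lambda>k. gam (r k) u) ` {..<m}"
    proof
      fix h assume "h \<in> {h. rker a g h \<noteq> 0}"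
      then have nz: "rker a g h \<noteq> 0" by simp
      then have h: "h \<in> arr" "filtermap snd h = u" using rker_nonzero_arr unfolding u_def by metis+
      obtain s where s: "h = gam s u" "eventually (\<lambda>x. s x \<in> X) u"
        using arr_translate[OF h] by blast
      have "ext a (filtermap (\<lambda>x. (t x, s x)) u) \<noteq> 0"
        using nz rker_gam[of t u s a] True h(1) t(1) s(1) by simp
      from ext_pair_nonzero[OF a R t(3,2) s(2) this]
      obtain k where "k < m" "gam s u = gam (r k) u" using translate_in_enumeration[OF t(3) r] by blast
      then show "h \<in> (\<lambda>k. gam (r k) u) ` {..<m}" using s(1) by blast
    qed
    have "card {h. rker a g h \<noteq> 0} \<le> card ((\<lambda>k. gam (r k) u) ` {..<m})"
      by (rule card_mono[OF _ sub]) simp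
    also have "\<dots> \<le> m" by (metis card_image_le card_lessThan finite_lessThan)
    finally show ?thesis using m finite_subset[OF sub] by simp
  qed
  then show ?thesis by blast
qed

text \<open>Besides giving adjoints, this turns the row bound for the conjugate transpose into the
  column bound demanded by \<open>band_kernel\<close>.\<close>

lemma rker_adjoint:
  assumes a: "band a" shows "rker (\<lambda>x y. cnj (a y x)) g h = cnj (rker a h g)"
proof (cases "g \<in> arr \<and> h \<in> arr \<and> filtermap snd g = filtermap snd h")
  case False
  then show ?thesis unfolding rker_def by auto
next
  case True
  obtain t where t: "g = gam t (filtermap snd g)" "eventually (\<lambda>x. t x \<in> X) (filtermap snd g)" "filtermap snd g \<in> bX"
    using arr_gam[of g] True by blast
  define u where "u = filtermap snd g"
  note t = t[folded u_def]
  obtain s where s: "h = gam s u" "eventually (\<lambda>x. s x \<in> X) u"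
    using arr_translate[of h u] True unfolding u_def by auto
  have "rker a h g = ext a (filtermap (\<lambda>x. (s x, t x)) u)" using rker_gam[of s u t a] True t(1) s(1) by simp
  moreover have "rker (\<lambda>x y. cnj (a y x)) g h = ext (\<lambda>x y. cnj (a y x)) (filtermap (\<lambda>x. (t x, s x)) u)"
    using rker_gam[of t u s] True t(1) s(1) by simp
  moreover have "\<dots> = cnj (ext a (filtermap (\<lambda>x. (s x, t x)) u))"
    by (rule ext_pair_eqI[OF band_adjoint[OF a] t(3) t(2) s(2) tendsto_cnj[OF ext_pair_tendsto[OF a t(3) s(2) t(2)]]])
  ultimately show ?thesis by simp
qed

lemma ext_bounded:
  fixes a :: "'a \<Rightarrow> 'a \<Rightarrow> complex"
  assumes a: "band a" shows "\<exists>C. \<forall>\<omega>. norm (ext a \<omega>) \<le> C"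
proof -
  obtain C R where C: "C \<ge> 0" "\<And>x y. norm (a x y) \<le> C" using bandD[OF a] by auto
  have "norm (ext a \<omega>) \<le> C" for \<omega>
  proof (cases "\<omega> \<in> bXX")
    case True
    then have "((\<lambda>e. norm ((\<lambda>(x, y). a x y) e)) \<longlongrightarrow> norm (ext a \<omega>)) \<omega>"
      using ext_tendsto[OF a True] by (intro tendsto_norm)
    then show ?thesis
      by (rule tendsto_upperbound) (use True C in \<open>auto simp: bXX_iff ultrafilter_not_bot intro!: always_eventually\<close>)
  next
    case False
    then show ?thesis using C by (simp add: ext_def sc_ext_def)
  qed
  then show ?thesis by blast
qed

lemma band_kernel_rker:
  assumes a: "band a" shows "band_kernel (rker a)"
proof -
  obtain N where N: "\<forall>g. finite {h. rker a g h \<noteq> 0} \<and> card {h. rker a g h \<noteq> 0} \<le> N" using rker_row[OF a] by blast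
  obtain N' where N': "\<forall>g. finite {h. rker (\<lambda>x y. cnj (a y x)) g h \<noteq> 0} \<and> card {h. rker (\<lambda>x y. cnj (a y x)) g h \<noteq> 0} \<le> N'"
    using rker_row[OF band_adjoint[OF a]] by blast
  obtain C where C: "\<And>\<omega>. norm (ext a \<omega>) \<le> C" using ext_bounded[OF a] by auto
  have "norm (rker a g h) \<le> C" for g h
    using C[of "gmult G g (ginv G h)"] order_trans[OF norm_ge_zero C] by (simp add: rker_def)
  moreover have "finite {g. rker a g h \<noteq> 0} \<and> card {g. rker a g h \<noteq> 0} \<le> N'" for h
    using N'[rule_format, of h] by (simp add: rker_adjoint[OF a])
  ultimately show ?thesis unfolding band_kernel_def
    using N by (intro exI[of _ C] exI[of _ "max N N'"]) (auto simp: le_max_iff_disj)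
qed

definition Pi :: "('a \<Rightarrow> 'a \<Rightarrow> complex) \<Rightarrow> ('a \<times> 'a) filter ell2 \<Rightarrow>\<^sub>L ('a \<times> 'a) filter ell2" where
  "Pi a = kernel_op (rker a)"

lemma regular_rep_ext:
  assumes a: "band a" shows "regular_rep G (ext a) = Pi a"
proof -
  have "(if g \<in> arr then \<Sum>\<^sub>\<infinity>h\<in>{h \<in> arr. filtermap snd h = filtermap snd g}. ext a (gmult G g (ginv G h)) * ell2_apply \<xi> h else 0)
     = (\<Sum>h | rker a g h \<noteq> 0. rker a g h * ell2_apply \<xi> h)" for g \<xi>
  proof (cases "g \<in> arr")
    case True
    have "(\<Sum>\<^sub>\<infinity>h\<in>{h \<in> arr. filtermap snd h = filtermap snd g}. ext a (gmult G g (ginv G h)) * ell2_apply \<xi> h)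
       = (\<Sum>\<^sub>\<infinity>h\<in>{h. rker a g h \<noteq> 0}. rker a g h * ell2_apply \<xi> h)"
      by (rule infsum_cong_neutral) (use True in \<open>auto simp: rker_def split: if_splits\<close>)
    then show ?thesis using True band_kernelD[OF band_kernel_rker[OF a]] by simp
  next
    case False
    then have "{h. rker a g h \<noteq> 0} = {}" using rker_nonzero_arr by blast
    then show ?thesis using False by simp
  qed
  then show ?thesis unfolding regular_rep_def Pi_def kernel_op_def G_simps by simp
qed

lemma Pi_add:
  assumes a: "band a" and b: "band b" shows "Pi a + Pi b = Pi (\<lambda>x y. a x y + b x y)"
proof -
  have "rker (\<lambda>x y. a x y + b x y) = (\<lambda>g h. rker a g h + rker b g h)"
  proof (intro ext)
    fix g h
    show "rker (\<lambda>x y. a x y + b x y) g h = rker a g h + rker b g h"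
    proof (cases "g \<in> arr \<and> h \<in> arr \<and> filtermap snd g = filtermap snd h")
      case False
      then show ?thesis unfolding rker_def by auto
    next
      case True
      obtain t where t: "g = gam t (filtermap snd g)" "eventually (\<lambda>x. t x \<in> X) (filtermap snd g)" "filtermap snd g \<in> bX"
        using arr_gam[of g] True by blast
      define u where "u = filtermap snd g"
      note t = t[folded u_def]
      obtain s where s: "h = gam s u" "eventually (\<lambda>x. s x \<in> X) u"
        using arr_translate[of h u] True unfolding u_def by auto
      have *: "rker c g h = ext c (filtermap (\<lambda>x. (t x, s x)) u)" for c
        using rker_gam[of t u s c] True t(1) s(1) by simp
      show ?thesis unfolding *
        by (rule ext_pair_eqI[OF band_add[OF a b] t(3,2) s(2)
              tendsto_add[OF ext_pair_tendsto[OF a t(3,2) s(2)] ext_pair_tendsto[OF b t(3,2) s(2)]]])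
    qed
  qed
  then show ?thesis unfolding Pi_def
    using kernel_op_add[OF band_kernel_rker[OF a] band_kernel_rker[OF b]] band_kernel_rker[OF band_add[OF a b]] by simp
qed

lemma Pi_adjoint: "band a \<Longrightarrow> adjoint_op (Pi a) = Pi (\<lambda>x y. cnj (a y x))"
  unfolding Pi_def by (simp add: kernel_op_adjoint band_kernel_rker rker_adjoint fun_eq_iff[symmetric] flip: rker_adjoint)

lemma Pi_zero: "Pi (\<lambda>_ _. 0) = 0"
proof -
  have b: "band (\<lambda>_ _. 0 :: complex)" by (rule bandI[of _ 0 0]) auto
  have "Pi (\<lambda>_ _. 0) + Pi (\<lambda>_ _. 0) = Pi (\<lambda>_ _. 0)" using Pi_add[OF b b] by simp
  then show ?thesis by simp
qed

lemma Pi_uminus: "band a \<Longrightarrow> - Pi a = Pi (\<lambda>x y. - a x y)"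
  using Pi_add[of a "\<lambda>x y. - a x y"] band_uminus[of a] Pi_zero by (simp add: minus_unique)

text \<open>Only arrows k that are germs of the m maps listing the balls around t x contribute to
  the convolution sum. Its length is thus fixed along u, the limit commutes with it, and what
  remains is the matrix product at the pair (t x, s x).\<close>

lemma Pi_mult:
  assumes a: "band a" and b: "band b" shows "Pi a o\<^sub>L Pi b = Pi (bmul a b)"
  unfolding Pi_def
proof (rule kernel_op_compose[OF band_kernel_rker[OF a] band_kernel_rker[OF b] band_kernel_rker[OF band_bmul[OF a b]]])
  fix g h
  obtain R where R: "\<And>x y. a x y \<noteq> 0 \<Longrightarrow> (x, y) \<in> strip R" using a unfolding band_def by blast
  show "rker (bmul a b) g h = (\<Sum>k | rker a g k \<noteq> 0. rker a g k * rker b k h)"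
  proof (cases "g \<in> arr \<and> h \<in> arr \<and> filtermap snd g = filtermap snd h")
    case False
    have "rker a g k * rker b k h = 0" for k
    proof (rule ccontr)
      assume "rker a g k * rker b k h \<noteq> 0"
      then have "rker a g k \<noteq> 0" "rker b k h \<noteq> 0" by auto
      then show False using rker_nonzero_arr[of a g k] rker_nonzero_arr[of b k h] False by metis
    qed
    then have "(\<Sum>k | rker a g k \<noteq> 0. rker a g k * rker b k h) = 0" by (intro sum.neutral) blast
    then show ?thesis using False by (auto simp: rker_def[of "bmul a b"])
  next
    case True
    obtain t where t: "g = gam t (filtermap snd g)" "eventually (\<lambda>x. t x \<in> X) (filtermap snd g)"
        "\<exists>R. eventually (\<lambda>x. (t x, x) \<in> strip R) (filtermap snd g)" "filtermap snd g \<in> bX"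
      using arr_gam[of g] True by blast
    define u where "u = filtermap snd g"
    note t = t[folded u_def]
    obtain s where s: "h = gam s u" "eventually (\<lambda>x. s x \<in> X) u"
      using arr_translate[of h u] True unfolding u_def by auto
    obtain R' where R': "eventually (\<lambda>x. (t x, x) \<in> strip R') u" using t(3) by blast
    obtain m :: nat and r :: "nat \<Rightarrow> 'a \<Rightarrow> 'a"
      where r: "eventually (\<lambda>x. bij_betw (\<lambda>k. r k x) {..<m} (mcball (t x) R)) u"
      using local_enumeration_at[OF t(4,2)] by blast
    have rX: "eventually (\<lambda>x. r k x \<in> X) u" if "k < m" for k
      using enumeration_mem[OF r that] by (rule eventually_mono) (simp add: strip_def)
    have rarr: "gam (r k) u \<in> arr" if "k < m" for k
    proof (rule gam_arr[OF t(4)])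
      show "eventually (\<lambda>x. r k x \<in> X \<and> d (r k x) x \<le> R + R') u"
        using enumeration_mem[OF r that] R'
      proof (rule eventually_elim2)
        fix x assume "(t x, r k x) \<in> strip R" "(t x, x) \<in> strip R'"
        then have "(r k x, x) \<in> strip (R + R')" using strip_trans strip_sym by blast
        then show "r k x \<in> X \<and> d (r k x) x \<le> R + R'" by (simp add: strip_def)
      qed
    qed
    let ?ga = "\<lambda>k. gam (r k) u"
    have ra: "rker a g (?ga k) = ext a (filtermap (\<lambda>x. (t x, r k x)) u)" if "k < m" for k
      using rker_gam[of t u "r k" a] True t(1) rarr[OF that] by simp
    have rb: "rker b (?ga k) h = ext b (filtermap (\<lambda>x. (r k x, s x)) u)" if "k < m" for k
      using rker_gam[of "r k" u s b] True s(1) rarr[OF that] by simp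
    have rab: "rker (bmul a b) g h = ext (bmul a b) (filtermap (\<lambda>x. (t x, s x)) u)"
      using rker_gam[of t u s] True t(1) s(1) by simp
    have "(\<Sum>k | rker a g k \<noteq> 0. rker a g k * rker b k h) = (\<Sum>k\<in>{..<m}. rker a g (?ga k) * rker b (?ga k) h)"
    proof (rule sum_eq_over_image[OF finite_lessThan enumeration_inj[OF t(4) r]])
      show "{k. rker a g k \<noteq> 0} \<subseteq> ?ga ` {..<m}"
      proof
        fix k assume "k \<in> {k. rker a g k \<noteq> 0}"
        then have nz: "rker a g k \<noteq> 0" by simp
        then have k: "k \<in> arr" "filtermap snd k = u" using rker_nonzero_arr unfolding u_def by metis+
        obtain q where q: "k = gam q u" "eventually (\<lambda>x. q x \<in> X) u"
          using arr_translate[OF k] by blast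
        have "ext a (filtermap (\<lambda>x. (t x, q x)) u) \<noteq> 0"
          using nz rker_gam[of t u q a] True k(1) t(1) q(1) by simp
        from ext_pair_nonzero[OF a R t(4,2) q(2) this]
        obtain l where "l < m" "gam q u = ?ga l" using translate_in_enumeration[OF t(4) r] by blast
        then show "k \<in> ?ga ` {..<m}" using q(1) by blast
      qed
    qed simp
    also have "\<dots> = (\<Sum>k\<in>{..<m}. ext a (filtermap (\<lambda>x. (t x, r k x)) u) * ext b (filtermap (\<lambda>x. (r k x, s x)) u))"
      by (rule sum.cong) (simp_all add: ra rb)
    also have "\<dots> = rker (bmul a b) g h"
      unfolding rab
    proof (rule ext_pair_eqI[OF band_bmul[OF a b] t(4,2) s(2), symmetric])
      have "((\<lambda>x. \<Sum>k\<in>{..<m}. a (t x) (r k x) * b (r k x) (s x)) \<longlongrightarrow>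
          (\<Sum>k\<in>{..<m}. ext a (filtermap (\<lambda>x. (t x, r k x)) u) * ext b (filtermap (\<lambda>x. (r k x, s x)) u))) u"
        by (intro tendsto_sum tendsto_mult ext_pair_tendsto a b t s rX) simp_all
      moreover have "eventually (\<lambda>x. (\<Sum>k\<in>{..<m}. a (t x) (r k x) * b (r k x) (s x)) = bmul a b (t x) (s x)) u"
        using r
      proof (rule eventually_mono)
        fix x assume bij: "bij_betw (\<lambda>k. r k x) {..<m} (mcball (t x) R)"
        have "bmul a b (t x) (s x) = (\<Sum>y\<in>mcball (t x) R. a (t x) y * b y (s x))"
          by (rule bmul_superset[OF finite_ball _ band_row_finite(1)[OF a]]) (use R strip_ball in blast)
        also have "\<dots> = (\<Sum>k\<in>{..<m}. a (t x) (r k x) * b (r k x) (s x))"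
          by (rule sum.reindex_bij_betw[OF bij, symmetric])
        finally show "(\<Sum>k\<in>{..<m}. a (t x) (r k x) * b (r k x) (s x)) = bmul a b (t x) (s x)" by simp
      qed
      ultimately show "((\<lambda>x. bmul a b (t x) (s x)) \<longlongrightarrow>
          (\<Sum>k\<in>{..<m}. ext a (filtermap (\<lambda>x. (t x, r k x)) u) * ext b (filtermap (\<lambda>x. (r k x, s x)) u))) u"
        by (simp add: tendsto_cong)
    qed
    finally show ?thesis by simp
  qed
qed

definition diag :: "('a \<Rightarrow> complex) \<Rightarrow> 'a \<Rightarrow> 'a \<Rightarrow> complex" where
  "diag v x y = (if x = y \<and> x \<in> X then v x else 0)"

lemma band_diag:
  assumes "\<And>x. x \<in> X \<Longrightarrow> norm (v x) \<le> C" shows "band (diag v)"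
proof (rule bandI)
  show "norm (diag v x y) \<le> max C 0" for x y using assms by (auto simp: diag_def max.coboundedI1)
  show "(x, y) \<in> strip 0" if "diag v x y \<noteq> 0" for x y
    using that by (auto simp: diag_def strip_def split: if_splits)
qed

text \<open>The units are the ultrafilters that contain the diagonal. Any other ultrafilter contains
  the complement of the diagonal, where the matrix vanishes, so both sides are zero there.\<close>

lemma unit_extension_diag:
  fixes f :: "'a filter \<Rightarrow> complex"
  assumes f: "f \<in> cfun (stone_cech X)"
  shows "unit_extension G f = ext (diag (\<lambda>x. f (principal {x})))" "band (diag (\<lambda>x. f (principal {x})))"
proof -
  let ?v = "\<lambda>x. f (principal {x})"
  obtain B where "\<And>x. x \<in> X \<Longrightarrow> norm (?v x) \<le> B" using cfun_complex_bounded[OF f] by auto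
  then show b: "band (diag ?v)" by (rule band_diag)
  show "unit_extension G f = ext (diag ?v)"
  proof (rule HOL.ext)
    fix g
    show "unit_extension G f g = ext (diag ?v) g"
    proof (cases "g \<in> gident G ` bX")
      case True
      then obtain u where u: "u \<in> bX" "g = filtermap (\<lambda>x. (x, x)) u" unfolding G_simps by blast
      have uX: "eventually (\<lambda>x. x \<in> X) u" using u by (simp add: bX_iff)
      have "ext (diag ?v) g = f u"
        unfolding u(2)
      proof (rule ext_pair_eqI[OF b u(1) uX uX])
        have "eventually (\<lambda>x. diag ?v x x = ?v x) u" using uX by (rule eventually_mono) (simp add: diag_def)
        then show "((\<lambda>x. diag ?v x x) \<longlongrightarrow> f u) u"
          using cfun_stone_cech_tendsto[OF f u(1)] by (simp add: tendsto_cong)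
      qed
      moreover have "unit_extension G f g = f u"
        using True u(2) by (simp add: unit_extension_def G_simps filtermap_filtermap filtermap_ident)
      ultimately show ?thesis by simp
    next
      case False
      have "ext (diag ?v) g = 0"
      proof (cases "g \<in> bXX")
        case True
        have "\<not> eventually (\<lambda>e. fst e = snd e) g"
        proof
          assume ev: "eventually (\<lambda>e. fst e = snd e) g"
          have "filtermap snd g \<in> bX" using True
            by (auto simp: bXX_iff bX_iff eventually_filtermap ultrafilter_filtermap elim: eventually_mono)
          moreover have "g = filtermap (\<lambda>x. (x, x)) (filtermap snd g)"
          proof (rule filter_eqI)
            fix P
            have "eventually (\<lambda>e. P e \<longleftrightarrow> P (snd e, snd e)) g"
              using ev by (rule eventually_mono) (metis prod.collapse)
            from eventually_subst[OF this]
            show "eventually P g \<longleftrightarrow> eventually P (filtermap (\<lambda>x. (x, x)) (filtermap snd g))"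
              by (simp add: eventually_filtermap)
          qed
          ultimately show False using False unfolding G_simps by blast
        qed
        then have "eventually (\<lambda>e. \<not> fst e = snd e) g"
          using True ultrafilter_not by (auto simp: bXX_iff)
        then have "eventually (\<lambda>e. (\<lambda>(x, y). diag ?v x y) e = 0) g"
          by (rule eventually_mono) (auto simp: diag_def)
        then show ?thesis unfolding ext_def by (intro sc_ext_eqI[OF True] tendsto_eventually)
      next
        case False
        then show ?thesis by (simp add: ext_def sc_ext_def)
      qed
      then show ?thesis using False by (simp add: unit_extension_def G_simps)
    qed
  qed
qed

lemma unit_inclusion_diag:
  assumes "f \<in> cfun (stone_cech X)"
  shows "unit_inclusion G f = Pi (diag (\<lambda>x. f (principal {x})))"
  unfolding unit_inclusion_def unit_extension_diag(1)[OF assms] by (rule regular_rep_ext[OF unit_extension_diag(2)[OF assms]])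

text \<open>The pair (y, x) has source x, so this is summation over the source fibre of x; for the
  transposed matrix it is summation over the range fibre.\<close>

definition colsum :: "('a \<Rightarrow> 'a \<Rightarrow> int) \<Rightarrow> 'a \<Rightarrow> int" where
  "colsum h x = (\<Sum>y | h y x \<noteq> 0. h y x)"

lemma colsum_ball:
  assumes "\<And>x y. h x y \<noteq> 0 \<Longrightarrow> (x, y) \<in> strip R"
  shows "colsum h x = (\<Sum>y\<in>mcball x R. h y x)"
  unfolding colsum_def using assms strip_ball strip_sym by (intro sum.mono_neutral_left finite_ball) blast+

text \<open>The arrows with source u at which \<open>ext h\<close> does not vanish are among the m
  germs listing the R-balls around x, so the fibre sum is the limit of the sums over these
  balls.\<close>

lemma fibre_sum_src:
  assumes h: "band h"
  shows "fibre_sum G (src G) (ext h) = sc_ext X (colsum h)"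
proof
  fix u
  obtain R where R: "\<And>x y. h x y \<noteq> 0 \<Longrightarrow> (x, y) \<in> strip R" using h unfolding band_def by blast
  show "fibre_sum G (src G) (ext h) u = sc_ext X (colsum h) u"
  proof (cases "u \<in> bX")
    case False
    have "{g \<in> arr. filtermap snd g = u \<and> ext h g \<noteq> 0} = {}" using arr_gam(1) False by auto
    then show ?thesis using False unfolding fibre_sum_def G_simps by (simp add: sc_ext_def)
  next
    case u: True
    have uX: "eventually (\<lambda>x. x \<in> X) u" using u by (simp add: bX_iff)
    obtain m :: nat and r :: "nat \<Rightarrow> 'a \<Rightarrow> 'a"
      where r: "eventually (\<lambda>x. bij_betw (\<lambda>k. r k x) {..<m} (mcball x R)) u"
      using local_enumeration_at[OF u uX] by blast
    have rs: "eventually (\<lambda>x. (r k x, x) \<in> strip R) u" if "k < m" for k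
      using enumeration_mem[OF r that] by (rule eventually_mono) (use strip_sym in blast)
    have rX: "eventually (\<lambda>x. r k x \<in> X) u" if "k < m" for k
      using rs[OF that] by (rule eventually_mono) (simp add: strip_def)
    let ?ga = "\<lambda>k. gam (r k) u"
    have garr: "?ga k \<in> arr" if "k < m" for k
      by (rule gam_arr[OF u, of _ R]) (use rs[OF that] in \<open>simp add: strip_def eventually_conj_iff\<close>)
    have "(\<Sum>g | g \<in> arr \<and> filtermap snd g = u \<and> ext h g \<noteq> 0. ext h g) = (\<Sum>k\<in>{..<m}. ext h (?ga k))"
    proof (rule sum_eq_over_image[OF finite_lessThan enumeration_inj[OF u r]])
      show "{g. g \<in> arr \<and> filtermap snd g = u \<and> ext h g \<noteq> 0} \<subseteq> ?ga ` {..<m}"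
      proof
        fix g assume "g \<in> {g. g \<in> arr \<and> filtermap snd g = u \<and> ext h g \<noteq> 0}"
        then have g: "g \<in> arr" "filtermap snd g = u" "ext h g \<noteq> 0" by auto
        obtain s where s: "g = gam s u" "eventually (\<lambda>x. s x \<in> X) u"
          using arr_translate[OF g(1,2)] by blast
        have "eventually (\<lambda>x. (s x, x) \<in> strip R) u"
          using ext_pair_nonzero[OF h R u s(2) uX] g(3) unfolding s(1) gam_def by blast
        then have "eventually (\<lambda>x. (x, s x) \<in> strip R) u"
          by (rule eventually_mono) (use strip_sym in blast)
        then obtain l where "l < m" "gam s u = ?ga l" using translate_in_enumeration[OF u r] by blast
        then show "g \<in> ?ga ` {..<m}" using s(1) by blast
      qed
      show "ext h g = 0" if "g \<in> ?ga ` {..<m} - {g. g \<in> arr \<and> filtermap snd g = u \<and> ext h g \<noteq> 0}" for g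
        using that garr by (auto simp: src_gam)
    qed
    moreover have "sc_ext X (colsum h) u = (\<Sum>k\<in>{..<m}. ext h (?ga k))"
    proof (rule sc_ext_eqI[OF u])
      have "((\<lambda>x. \<Sum>k\<in>{..<m}. h (r k x) x) \<longlongrightarrow> (\<Sum>k\<in>{..<m}. ext h (?ga k))) u"
        unfolding gam_def by (intro tendsto_sum ext_pair_tendsto h u rX uX) simp
      moreover have "eventually (\<lambda>x. (\<Sum>k\<in>{..<m}. h (r k x) x) = colsum h x) u"
        using r
      proof (rule eventually_mono)
        fix x assume bij: "bij_betw (\<lambda>k. r k x) {..<m} (mcball x R)"
        show "(\<Sum>k\<in>{..<m}. h (r k x) x) = colsum h x"
          using sum.reindex_bij_betw[OF bij, of "\<lambda>y. h y x"] colsum_ball[OF R, where x = x] by simp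
      qed
      ultimately show "(colsum h \<longlongrightarrow> (\<Sum>k\<in>{..<m}. ext h (?ga k))) u"
        by (simp add: tendsto_cong)
    qed
    ultimately show ?thesis unfolding fibre_sum_def G_simps by simp
  qed
qed

lemma band_swap:
  assumes "band h" shows "band (\<lambda>x y. h y x)"
proof -
  obtain C R where "compact C" "R \<ge> 0" "\<forall>x y. h x y \<in> C \<and> (h x y \<noteq> 0 \<longrightarrow> (x, y) \<in> strip R)"
    using assms unfolding band_def by blast
  then show ?thesis unfolding band_def using strip_sym by (intro exI[of _ C] exI[of _ R]) blast
qed

text \<open>Inversion exchanges range and source and transposes h, which reduces this to the source
  case.\<close>

lemma fibre_sum_rng:
  fixes h :: "'a \<Rightarrow> 'a \<Rightarrow> int"
  assumes h: "band h"
  shows "fibre_sum G (rng G) (ext h) = sc_ext X (colsum (\<lambda>x y. h y x))"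
proof
  fix u
  let ?h = "\<lambda>x y. h y x"
  let ?sw = "filtermap prod.swap :: ('a \<times> 'a) filter \<Rightarrow> ('a \<times> 'a) filter"
  have sw2: "?sw (?sw g) = g" for g by (simp add: filtermap_filtermap filtermap_ident)
  have sarr: "?sw g \<in> arr" if g: "g \<in> arr" for g
  proof -
    obtain R where "ultrafilter g" "eventually (\<lambda>e. e \<in> strip R) g" using g unfolding arr_iff by blast
    have "eventually (\<lambda>e. prod.swap e \<in> strip R) g"
      using \<open>eventually (\<lambda>e. e \<in> strip R) g\<close>
    proof (rule eventually_mono)
      fix e assume "e \<in> strip R"
      then show "prod.swap e \<in> strip R"
        using strip_sym[of "fst e" "snd e" R] by (simp add: prod.swap_def)
    qed
    then show ?thesis using \<open>ultrafilter g\<close>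
      unfolding arr_iff by (auto simp: ultrafilter_filtermap eventually_filtermap)
  qed
  have ss: "filtermap snd (?sw g) = filtermap fst g" for g
    by (simp add: filtermap_filtermap o_def)
  have se: "ext h g = ext ?h (?sw g)" if "g \<in> arr" for g
  proof -
    have "((\<lambda>(x, y). ?h x y) \<longlongrightarrow> ext ?h (?sw g)) (?sw g)"
      by (rule ext_tendsto[OF band_swap[OF h] arr_bXX[OF sarr[OF that]]])
    then have "((\<lambda>e. (\<lambda>(x, y). ?h x y) (prod.swap e)) \<longlongrightarrow> ext ?h (?sw g)) g"
      by (simp add: filterlim_filtermap)
    moreover have "(\<lambda>e. (\<lambda>(x, y). ?h x y) (prod.swap e)) = (\<lambda>(x, y). h x y)" by auto
    ultimately show ?thesis unfolding ext_def[of h] using sc_ext_eqI[OF arr_bXX[OF that]] by metis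
  qed
  have "(\<Sum>g | g \<in> arr \<and> filtermap fst g = u \<and> ext h g \<noteq> 0. ext h g)
      = (\<Sum>g | g \<in> arr \<and> filtermap snd g = u \<and> ext ?h g \<noteq> 0. ext ?h g)"
  proof (rule sum.reindex_bij_witness[of _ ?sw ?sw])
    fix g assume g: "g \<in> {g. g \<in> arr \<and> filtermap fst g = u \<and> ext h g \<noteq> 0}"
    then show "?sw g \<in> {g. g \<in> arr \<and> filtermap snd g = u \<and> ext ?h g \<noteq> 0}" "ext ?h (?sw g) = ext h g"
      using sarr se by (auto simp: ss)
  next
    fix g assume g: "g \<in> {g. g \<in> arr \<and> filtermap snd g = u \<and> ext ?h g \<noteq> 0}"
    then show "?sw g \<in> {g. g \<in> arr \<and> filtermap fst g = u \<and> ext h g \<noteq> 0}"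
      using sarr[of g] se[of "?sw g"] ss[of "?sw g"] by (simp add: sw2)
  qed (simp_all add: sw2)
  then show "fibre_sum G (rng G) (ext h) u = sc_ext X (colsum ?h) u"
    using fibre_sum_src[OF band_swap[OF h]] unfolding fibre_sum_def G_simps by (simp add: fun_eq_iff)
qed

text \<open>Under the identification of \<open>cfun_c\<close> with band matrices, the groupoid
  boundaries become extensions of boundaries of uniformly finite chains.\<close>

lemma H0_boundaries_coarse:
  "H0_boundaries G = (\<lambda>h u. sc_ext X (colsum h) u - sc_ext X (colsum (\<lambda>x y. h y x)) u) ` Collect band"
proof -
  have "cfun_c (arrows G) = ext ` Collect (band :: ('a \<Rightarrow> 'a \<Rightarrow> int) \<Rightarrow> bool)"
    unfolding G_simps using ext_cfun_c cfun_c_ext by blast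
  then show ?thesis unfolding H0_boundaries_def
    by (auto simp: image_image fibre_sum_src fibre_sum_rng intro!: image_cong)
qed

end

section \<open>The reduced algebra of the coarse groupoid\<close>

lemma closure_unary:
  fixes f :: "'x::metric_space \<Rightarrow> 'y::metric_space"
  assumes "x \<in> closure S" "\<And>a. a \<in> S \<Longrightarrow> f a \<in> T"
    "\<And>xs. (\<And>n. xs n \<in> S) \<Longrightarrow> xs \<longlonglongrightarrow> x \<Longrightarrow> (\<lambda>n. f (xs n)) \<longlonglongrightarrow> f x"
  shows "f x \<in> closure T"
proof -
  obtain xs where "\<And>n. xs n \<in> S" "xs \<longlonglongrightarrow> x" using assms(1) unfolding closure_sequential by blast
  then show ?thesis unfolding closure_sequential using assms by (intro exI[of _ "\<lambda>n. f (xs n)"]) auto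
qed

lemma closure_binary:
  fixes f :: "'x::metric_space \<Rightarrow> 'x \<Rightarrow> 'x"
  assumes "x \<in> closure S" "y \<in> closure S" "\<And>a b. a \<in> S \<Longrightarrow> b \<in> S \<Longrightarrow> f a b \<in> S"
    "\<And>xs ys. xs \<longlonglongrightarrow> x \<Longrightarrow> ys \<longlonglongrightarrow> y \<Longrightarrow> (\<lambda>n. f (xs n) (ys n)) \<longlonglongrightarrow> f x y"
  shows "f x y \<in> closure S"
proof -
  obtain xs ys where "\<And>n. xs n \<in> S" "xs \<longlonglongrightarrow> x" "\<And>n. ys n \<in> S" "ys \<longlonglongrightarrow> y"
    using assms(1,2) unfolding closure_sequential by metis
  then show ?thesis unfolding closure_sequential using assms
    by (intro exI[of _ "\<lambda>n. f (xs n) (ys n)"]) auto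
qed

context coarse_space
begin

abbreviation A where "A \<equiv> reduced_algebra G"

abbreviation BPi where "BPi \<equiv> Pi ` Collect band"

lemma A_carrier: "carrier A = closure BPi"
proof -
  have "regular_rep G ` cfun_c (arrows G) = BPi"
  proof (intro equalityI subsetI)
    fix T assume "T \<in> regular_rep G ` cfun_c (arrows G)"
    then obtain f where f: "f \<in> cfun_c (coarse_arrows X d)" "T = regular_rep G f" by (auto simp: G_simps)
    obtain a where "band a" "f = ext a" using cfun_c_ext[OF f(1)] by metis
    then show "T \<in> BPi" using f(2) regular_rep_ext by blast
  next
    fix T assume "T \<in> BPi"
    then obtain a where "band a" "T = Pi a" by blast
    then show "T \<in> regular_rep G ` cfun_c (arrows G)"
      using ext_cfun_c[of a] regular_rep_ext[of a] by (auto simp: G_simps intro!: image_eqI[of _ _ "ext a"])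
  qed
  then show ?thesis by (simp add: reduced_algebra_def)
qed

lemma Pi_carrier: "band a \<Longrightarrow> Pi a \<in> carrier A"
  unfolding A_carrier by (rule subsetD[OF closure_subset]) simp

lemma A_ops:
  "S \<otimes>\<^bsub>A\<^esub> T = S o\<^sub>L T" "S \<oplus>\<^bsub>A\<^esub> T = S + T" "\<zero>\<^bsub>A\<^esub> = 0" "star A T = adjoint_op T"
  by (simp_all add: reduced_algebra_def)

lemma band_one: "band (diag (\<lambda>_. 1))"
  by (rule band_diag[of _ 1]) simp

lemma diag_cong: "(\<And>x. x \<in> X \<Longrightarrow> v x = w x) \<Longrightarrow> diag v = diag w"
  by (auto simp: diag_def fun_eq_iff)

lemma A_one: "\<one>\<^bsub>A\<^esub> = Pi (diag (\<lambda>_. 1))"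
proof -
  have "\<one>\<^bsub>A\<^esub> = unit_inclusion G (\<lambda>F. if F \<in> bX then 1 else 0)" by (simp add: reduced_algebra_def G_simps)
  also have "\<dots> = Pi (diag (\<lambda>x. if principal {x} \<in> bX then 1 else 0))"
    by (rule unit_inclusion_diag[OF cfun_stone_cech_indicator])
  also have "diag (\<lambda>x. if principal {x} \<in> bX then 1 else 0) = diag (\<lambda>_. 1)"
    by (rule diag_cong) (simp add: principal_in_stone_cech)
  finally show ?thesis .
qed

lemma diag_bmul: "bmul (diag v) a x z = (if x \<in> X then v x * a x z else 0)"
proof -
  have "bmul (diag v) a x z = (\<Sum>y\<in>{x}. diag v x y * a y z)"
    by (rule bmul_superset) (auto simp: diag_def split: if_splits intro: finite_subset[of _ "{x}"])
  then show ?thesis by (simp add: diag_def)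
qed

lemma bmul_diag:
  assumes "band a" shows "bmul a (diag v) x z = (if z \<in> X then a x z * v z else 0)"
proof -
  have "bmul a (diag v) x z = (\<Sum>y\<in>{z}. a x y * diag v y z)"
    by (rule bmul_superset) (auto simp: diag_def band_row_finite[OF assms] split: if_splits)
  then show ?thesis by (simp add: diag_def)
qed

lemma band_outside:
  assumes "band a" "x \<notin> X \<or> y \<notin> X" shows "a x y = 0"
  using assms unfolding band_def strip_def by blast

text \<open>Identities between continuous expressions pass from finite-width operators to their norm
  closure.\<close>

lemma A_closed_induct:
  assumes T: "T \<in> carrier A" and "\<And>a. band a \<Longrightarrow> f (Pi a) = g (Pi a)"
    and "continuous_on UNIV f" "continuous_on UNIV g"
  shows "f T = (g T :: 'c::t2_space)"
proof -
  have "closed {T. f T = g T}" by (rule closed_Collect_eq[OF assms(3,4)])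
  moreover have "BPi \<subseteq> {T. f T = g T}" using assms(2) by blast
  ultimately have "closure BPi \<subseteq> {T. f T = g T}" by (rule closure_minimal[rotated])
  then show ?thesis using T unfolding A_carrier by blast
qed

lemma A_mult_i:
  assumes "T \<in> carrier A" shows "T o\<^sub>L mult_i = mult_i o\<^sub>L T"
  by (rule A_closed_induct[OF assms])
    (auto simp: Pi_def intro!: kernel_op_mult_i band_kernel_rker continuous_intros)

lemma A_add: "S \<in> carrier A \<Longrightarrow> T \<in> carrier A \<Longrightarrow> S + T \<in> carrier A"
  unfolding A_carrier
  by (rule closure_binary[where f = "(+)"]) (auto simp: Pi_add intro: band_add tendsto_add)

lemma A_mult: "S \<in> carrier A \<Longrightarrow> T \<in> carrier A \<Longrightarrow> S o\<^sub>L T \<in> carrier A"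
  unfolding A_carrier
  by (rule closure_binary[where f = "(o\<^sub>L)"])
    (auto simp: Pi_mult intro: band_bmul bounded_bilinear.tendsto[OF bounded_bilinear_blinfun_compose])

lemma A_uminus: "T \<in> carrier A \<Longrightarrow> - T \<in> carrier A"
  unfolding A_carrier
  by (rule closure_unary[where f = uminus]) (auto simp: Pi_uminus intro: band_uminus tendsto_minus)

lemma adjoint_diff:
  assumes "S \<in> carrier A" "T \<in> carrier A"
  shows "adjoint_op (S - T) = adjoint_op S - adjoint_op T"
proof (rule adjoint_op_eq_real)
  have "S - T \<in> carrier A" using A_add[OF assms(1) A_uminus[OF assms(2)]] by simp
  then show "(S - T) o\<^sub>L mult_i = mult_i o\<^sub>L (S - T)" by (rule A_mult_i)
  show "(S - T) \<xi> \<bullet> \<eta> = \<xi> \<bullet> (adjoint_op S - adjoint_op T) \<eta>" for \<xi> \<eta>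
    using adjoint_op_real(1)[OF A_mult_i[OF assms(1)]] adjoint_op_real(1)[OF A_mult_i[OF assms(2)]]
    by (simp add: blinfun.diff_left inner_diff_left inner_diff_right)
qed

text \<open>\<open>adjoint_op\<close> is given by a description and not by a continuous
  construction. On the algebra its elements are complex linear, so it is additive and norm
  decreasing there, which yields continuity.\<close>

lemma A_star_tendsto:
  assumes "\<And>n. Ts n \<in> carrier A" "T \<in> carrier A" "Ts \<longlonglongrightarrow> T"
  shows "(\<lambda>n. adjoint_op (Ts n)) \<longlonglongrightarrow> adjoint_op T"
proof -
  have "(\<lambda>n. norm (Ts n - T)) \<longlonglongrightarrow> 0" using assms(3) by (simp add: tendsto_norm_zero_iff LIM_zero_iff)
  then have "(\<lambda>n. adjoint_op (Ts n) - adjoint_op T) \<longlonglongrightarrow> 0"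
  proof (rule Lim_null_comparison[rotated], intro always_eventually allI)
    fix n
    have "Ts n - T \<in> carrier A" using A_add[OF assms(1) A_uminus[OF assms(2)], of n] by simp
    from norm_adjoint_le[OF A_mult_i[OF this]] show "norm (adjoint_op (Ts n) - adjoint_op T) \<le> norm (Ts n - T)"
      by (simp add: adjoint_diff[OF assms(1,2)])
  qed
  then show ?thesis by (simp add: LIM_zero_iff)
qed

lemma A_star:
  assumes T: "T \<in> carrier A" shows "adjoint_op T \<in> carrier A"
  unfolding A_carrier
proof (rule closure_unary[where S = BPi and f = adjoint_op])
  show "T \<in> closure BPi" using T A_carrier by simp
  show "adjoint_op a \<in> BPi" if "a \<in> BPi" for a using that band_adjoint by (auto simp: Pi_adjoint)
  fix xs assume xs: "\<And>n. xs n \<in> BPi" "xs \<longlonglongrightarrow> T"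
  have "xs n \<in> carrier A" for n
    unfolding A_carrier using xs(1)[of n] by (rule subsetD[OF closure_subset])
  from A_star_tendsto[OF this T xs(2)] show "(\<lambda>n. adjoint_op (xs n)) \<longlonglongrightarrow> adjoint_op T" .
qed

lemma A_one_left:
  assumes "T \<in> carrier A" shows "Pi (diag (\<lambda>_. 1)) o\<^sub>L T = T" "T o\<^sub>L Pi (diag (\<lambda>_. 1)) = T"
proof -
  have 1: "Pi (diag (\<lambda>_. 1)) o\<^sub>L Pi a = Pi a" if "band a" for a
  proof -
    have "bmul (diag (\<lambda>_. 1)) a = a"
      using band_outside[OF that] by (auto simp: fun_eq_iff diag_bmul)
    then show ?thesis by (simp add: Pi_mult[OF band_one that])
  qed
  have 2: "Pi a o\<^sub>L Pi (diag (\<lambda>_. 1)) = Pi a" if "band a" for a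
  proof -
    have "bmul a (diag (\<lambda>_. 1)) = a"
      using band_outside[OF that] by (auto simp: fun_eq_iff bmul_diag[OF that])
    then show ?thesis by (simp add: Pi_mult[OF that band_one])
  qed
  show "Pi (diag (\<lambda>_. 1)) o\<^sub>L T = T"
    by (rule A_closed_induct[where f = "\<lambda>T. Pi (diag (\<lambda>_. 1)) o\<^sub>L T" and g = "\<lambda>T. T", OF assms 1])
      (auto intro!: continuous_intros)
  show "T o\<^sub>L Pi (diag (\<lambda>_. 1)) = T"
    by (rule A_closed_induct[where f = "\<lambda>T. T o\<^sub>L Pi (diag (\<lambda>_. 1))" and g = "\<lambda>T. T", OF assms 2])
      (auto intro!: continuous_intros)
qed

lemma star_algebra_A: "star_algebra A"
proof -
  have ag: "abelian_group A"
  proof (rule abelian_groupI, unfold A_ops)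
    show "0 \<in> carrier A" using A_add[OF _ A_uminus] Pi_carrier[OF band_one] by fastforce
    fix T assume "T \<in> carrier A"
    then show "\<exists>S\<in>carrier A. S + T = 0" by (intro bexI[of _ "- T"] A_uminus) simp_all
  qed (simp_all add: A_add add_ac)
  have "Group.monoid A"
  proof (rule monoidI, unfold A_ops A_one)
    show "S o\<^sub>L T o\<^sub>L U = S o\<^sub>L (T o\<^sub>L U)" for S T U :: "('a \<times> 'a) filter ell2 \<Rightarrow>\<^sub>L ('a \<times> 'a) filter ell2"
      by (rule blinfun_eqI) simp
  qed (simp_all add: A_mult Pi_carrier band_one A_one_left)
  with ag have "ring A"
    by (rule ringI) (simp_all add: A_ops bounded_bilinear.add_left[OF bounded_bilinear_blinfun_compose]
        bounded_bilinear.add_right[OF bounded_bilinear_blinfun_compose])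
  moreover have "star_algebra_axioms A"
  proof (unfold_locales, unfold A_ops)
    fix S assume S: "S \<in> carrier A"
    show "adjoint_op S \<in> carrier A" by (rule A_star[OF S])
    show "adjoint_op (adjoint_op S) = S"
      by (rule adjoint_op_eq_real[OF A_mult_i[OF A_star[OF S]]])
        (metis adjoint_op_real(1)[OF A_mult_i[OF S]] inner_commute)
    fix T assume T: "T \<in> carrier A"
    show "adjoint_op (S + T) = adjoint_op S + adjoint_op T"
      by (rule adjoint_op_eq_real[OF A_mult_i[OF A_add[OF S T]]])
        (simp add: blinfun.add_left inner_add_left inner_add_right adjoint_op_real(1)[OF A_mult_i] S T)
    show "adjoint_op (S o\<^sub>L T) = adjoint_op T o\<^sub>L adjoint_op S"
      by (rule adjoint_op_eq_real[OF A_mult_i[OF A_mult[OF S T]]])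
        (simp add: adjoint_op_real(1)[OF A_mult_i] S T)
  qed
  ultimately show ?thesis by (simp add: star_algebra_def)
qed

sublocale A: star_algebra "reduced_algebra (coarse_groupoid X d)"
  by (rule star_algebra_A)

lemma Pi_cong_diag: "(\<And>x. x \<in> X \<Longrightarrow> v x = w x) \<Longrightarrow> Pi (diag v) = Pi (diag w)"
  using diag_cong[of v w] by simp

lemma star_hom_unit_inclusion:
  "star_hom (cfun_algebra (stone_cech X)) (reduced_algebra (coarse_groupoid X d)) (unit_inclusion (coarse_groupoid X d))"
proof -
  note b = unit_extension_diag(2) and u = unit_inclusion_diag and c = cfun_stone_cech_complex_op
  have "star_hom_axioms (cfun_algebra (stone_cech X)) A (unit_inclusion G)"
  proof (unfold_locales, unfold A_ops)
    fix f assume "f \<in> carrier (cfun_algebra (stone_cech X))"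
    then have f: "f \<in> cfun (stone_cech X)" by (simp add: cfun_algebra_def)
    show "unit_inclusion G f \<in> carrier A" by (simp add: u[OF f] Pi_carrier b[OF f])
    have "unit_inclusion G (\<lambda>F. cnj (f F)) = Pi (\<lambda>x y. cnj (diag (\<lambda>x. f (principal {x})) y x))"
      unfolding u[OF c(3)[OF f f]] by (rule arg_cong[of _ _ Pi]) (auto simp: diag_def fun_eq_iff)
    then show "unit_inclusion G (star (cfun_algebra (stone_cech X)) f) = adjoint_op (unit_inclusion G f)"
      by (simp add: u[OF f] Pi_adjoint[OF b[OF f]] cfun_algebra_def)
    fix g assume "g \<in> carrier (cfun_algebra (stone_cech X))"
    then have g: "g \<in> cfun (stone_cech X)" by (simp add: cfun_algebra_def)
    have "unit_inclusion G (\<lambda>F. f F + g F) = Pi (\<lambda>x y. diag (\<lambda>x. f (principal {x})) x y + diag (\<lambda>x. g (principal {x})) x y)"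
      unfolding u[OF c(1)[OF f g]] by (rule arg_cong[of _ _ Pi]) (auto simp: diag_def fun_eq_iff)
    then show "unit_inclusion G (f \<oplus>\<^bsub>cfun_algebra (stone_cech X)\<^esub> g) = unit_inclusion G f + unit_inclusion G g"
      by (simp add: u[OF f] u[OF g] Pi_add[OF b[OF f] b[OF g]] cfun_algebra_def)
    have "unit_inclusion G (\<lambda>F. f F * g F) = Pi (bmul (diag (\<lambda>x. f (principal {x}))) (diag (\<lambda>x. g (principal {x}))))"
      unfolding u[OF c(2)[OF f g]] by (rule arg_cong[of _ _ Pi]) (auto simp: diag_bmul fun_eq_iff, auto simp: diag_def)
    then show "unit_inclusion G (f \<otimes>\<^bsub>cfun_algebra (stone_cech X)\<^esub> g) = unit_inclusion G f o\<^sub>L unit_inclusion G g"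
      by (simp add: u[OF f] u[OF g] Pi_mult[OF b[OF f] b[OF g]] cfun_algebra_def)
  qed
  then show ?thesis unfolding star_hom_def using star_algebra_cfun_algebra star_algebra_A by blast
qed

section \<open>Matrices over the reduced algebra and diagonal projections\<close>

definition PM :: "nat \<Rightarrow> nat \<Rightarrow> (nat \<Rightarrow> nat \<Rightarrow> 'a \<Rightarrow> 'a \<Rightarrow> complex) \<Rightarrow> nat \<Rightarrow> nat \<Rightarrow> ('a \<times> 'a) filter ell2 \<Rightarrow>\<^sub>L ('a \<times> 'a) filter ell2" where
  "PM m n \<alpha> = (\<lambda>i j. if i < m \<and> j < n then Pi (\<alpha> i j) else 0)"

lemma PM_mats: "(\<And>i j. band (\<alpha> i j)) \<Longrightarrow> PM m n \<alpha> \<in> mats A m n"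
  unfolding mats_def PM_def by (auto simp: Pi_carrier A_ops)

lemma band_zero: "band (\<lambda>_ _. 0 :: complex)"
  by (rule bandI[of _ 0 0]) auto

lemma band_sum:
  assumes "finite L" "\<And>l. l \<in> L \<Longrightarrow> band (\<gamma> l)" shows "band (\<lambda>x y. \<Sum>l\<in>L. \<gamma> l x y :: complex)"
  using assms by (induction L rule: finite_induct) (auto simp: band_zero intro: band_add)

lemma finsum_Pi:
  assumes "finite L" "\<And>l. l \<in> L \<Longrightarrow> band (\<gamma> l)"
  shows "finsum A (\<lambda>l. Pi (\<gamma> l)) L = Pi (\<lambda>x y. \<Sum>l\<in>L. \<gamma> l x y)"
  using assms
proof (induction L rule: finite_induct)
  case empty
  then show ?case by (simp add: A_ops Pi_zero)
next
  case (insert l L)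
  then have "finsum A (\<lambda>l. Pi (\<gamma> l)) (insert l L) = Pi (\<gamma> l) + finsum A (\<lambda>l. Pi (\<gamma> l)) L"
    by (subst A.finsum_insert) (auto simp: A_ops Pi_carrier)
  also have "\<dots> = Pi (\<lambda>x y. \<gamma> l x y + (\<Sum>l\<in>L. \<gamma> l x y))"
    using insert by (simp add: Pi_add band_sum)
  finally show ?case using insert by simp
qed

lemma PM_mul:
  assumes \<alpha>: "\<And>i j. band (\<alpha> i j)" and \<beta>: "\<And>i j. band (\<beta> i j)"
  shows "mat_mul A n (PM m n \<alpha>) (PM n k \<beta>) = PM m k (\<lambda>i j x z. \<Sum>l<n. bmul (\<alpha> i l) (\<beta> l j) x z)"
proof (intro HOL.ext)
  fix i j
  show "mat_mul A n (PM m n \<alpha>) (PM n k \<beta>) i j = PM m k (\<lambda>i j x z. \<Sum>l<n. bmul (\<alpha> i l) (\<beta> l j) x z) i j"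
  proof (cases "i < m \<and> j < k")
    case True
    have "mat_mul A n (PM m n \<alpha>) (PM n k \<beta>) i j = finsum A (\<lambda>l. Pi (bmul (\<alpha> i l) (\<beta> l j))) {..<n}"
      unfolding mat_mul_def
      by (rule A.finsum_cong') (use True \<alpha> \<beta> in \<open>auto simp: PM_def A_ops Pi_mult Pi_carrier band_bmul\<close>)
    then show ?thesis using True \<alpha> \<beta> by (simp add: finsum_Pi band_bmul PM_def)
  next
    case False
    then show ?thesis
      using A.mats_zero[OF A.mat_mul_mats[OF PM_mats[OF \<alpha>] PM_mats[OF \<beta>]] False]
      by (auto simp: PM_def A_ops)
  qed
qed

lemma PM_star:
  assumes \<alpha>: "\<And>i j. band (\<alpha> i j)"
  shows "mat_star A (PM m n \<alpha>) = PM n m (\<lambda>i j x y. cnj (\<alpha> j i y x))"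
proof -
  have "adjoint_op 0 = (0 :: ('a \<times> 'a) filter ell2 \<Rightarrow>\<^sub>L ('a \<times> 'a) filter ell2)"
    using A.star_zero by (simp add: A_ops)
  then show ?thesis
    unfolding mat_star_def PM_def using \<alpha> by (auto simp: fun_eq_iff A_ops Pi_adjoint)
qed

definition chi :: "('a \<times> nat) set \<Rightarrow> nat \<Rightarrow> 'a \<Rightarrow> complex" where
  "chi P i x = (if (x, i) \<in> P then 1 else 0)"

text \<open>The projection onto the basis vectors indexed by P, inside n copies of l2(X), seen as a
  matrix over the reduced algebra.\<close>

definition dproj :: "nat \<Rightarrow> ('a \<times> nat) set \<Rightarrow> nat \<Rightarrow> nat \<Rightarrow> ('a \<times> 'a) filter ell2 \<Rightarrow>\<^sub>L ('a \<times> 'a) filter ell2" where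
  "dproj n P = PM n n (\<lambda>i j. if i = j then diag (chi P i) else (\<lambda>_ _. 0))"

lemma band_chi: "band (diag (chi P i))"
  by (rule band_diag[of _ 1]) (simp add: chi_def)

text \<open>The partial isometry that moves the basis vector at \<open>p \<in> P\<close> to the one at \<open>\<theta> p\<close>.\<close>

definition trans :: "('a \<times> nat) set \<Rightarrow> ('a \<times> nat \<Rightarrow> 'a \<times> nat) \<Rightarrow> nat \<Rightarrow> nat \<Rightarrow> 'a \<Rightarrow> 'a \<Rightarrow> complex" where
  "trans P \<theta> j i y x = (if (x, i) \<in> P \<and> \<theta> (x, i) = (y, j) then 1 else 0)"

lemma band_trans:
  assumes "\<And>p. p \<in> P \<Longrightarrow> (fst p, fst (\<theta> p)) \<in> strip R" shows "band (trans P \<theta> j i)"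
proof (rule bandI)
  show "norm (trans P \<theta> j i y x) \<le> 1" for y x by (simp add: trans_def)
  show "(y, x) \<in> strip R" if "trans P \<theta> j i y x \<noteq> 0" for y x
    using that assms[of "(x, i)"] strip_sym[of x y] by (auto simp: trans_def split: if_splits)
qed

text \<open>Row (x, i) of the adjoint has a single nonzero entry, at \<theta> (x, i), so the product
  reduces to one term; injectivity of \<theta> makes that term vanish in every column other than (x,
  i).\<close>

lemma trans_star_mul:
  assumes P: "P \<subseteq> X \<times> {..<n}" and Q: "\<theta> ` P \<subseteq> X \<times> {..<m}" and inj: "inj_on \<theta> P"
    and R: "\<And>p. p \<in> P \<Longrightarrow> (fst p, fst (\<theta> p)) \<in> strip R"
  shows "mat_mul A m (mat_star A (PM m n (trans P \<theta>))) (PM m n (trans P \<theta>)) = dproj n P"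
proof -
  let ?t = "trans P \<theta>"
  let ?ts = "\<lambda>i j x y. cnj (?t j i y x)"
  have bt: "band (?t j i)" for i j by (rule band_trans[OF R])
  have bts: "band (?ts i j)" for i j by (rule band_adjoint[OF bt])
  have "(\<Sum>j<m. bmul (?ts i j) (?t j i') x x') = (if i = i' then diag (chi P i) else (\<lambda>_ _. 0)) x x'" for i i' x x'
  proof (cases "(x, i) \<in> P")
    case False
    then have "bmul (?ts i j) (?t j i') x x' = 0" for j by (simp add: bmul_def trans_def)
    then show ?thesis using False by (auto simp: diag_def chi_def)
  next
    case True
    obtain y j where yj: "\<theta> (x, i) = (y, j)" by force
    have j: "j < m" "y \<in> X" using Q True yj by force+
    have x: "x \<in> X" using P True by blast
    have "bmul (?ts i l) (?t l i') x x' = (if l = j then ?t j i' y x' else 0)" for l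
    proof -
      have "bmul (?ts i l) (?t l i') x x' = (\<Sum>z\<in>{y}. ?ts i l x z * ?t l i' z x')"
        by (rule bmul_superset[OF _ _ band_row_finite(1)[OF bts]])
          (use yj in \<open>auto simp: trans_def split: if_splits\<close>)
      then show ?thesis using yj True by (simp add: trans_def)
    qed
    then have "(\<Sum>l<m. bmul (?ts i l) (?t l i') x x') = ?t j i' y x'" using j(1) by simp
    also have "\<dots> = (if (x', i') = (x, i) then 1 else 0)"
      using inj True yj unfolding trans_def inj_on_def by metis
    finally show ?thesis using True x by (auto simp: diag_def chi_def)
  qed
  then have "(\<lambda>i i' x x'. \<Sum>j<m. bmul (?ts i j) (?t j i') x x') = (\<lambda>i i'. if i = i' then diag (chi P i) else (\<lambda>_ _. 0))"
    by (intro HOL.ext) simp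
  then show ?thesis unfolding dproj_def PM_star[of ?t, OF bt] PM_mul[of ?ts ?t, OF bts bt] by simp
qed

text \<open>The diagonal projection is the matrix that moves each point of P to itself, so it equals
  its own adjoint and its own square by \<open>trans_star_mul\<close>.\<close>

lemma dproj_projection:
  assumes "P \<subseteq> X \<times> {..<n}" shows "(n, dproj n P) \<in> projections A"
proof -
  have "trans P (\<lambda>p. p) = (\<lambda>i j. if i = j then diag (chi P i) else (\<lambda>_ _. 0))"
    using assms by (auto simp: trans_def diag_def chi_def fun_eq_iff)
  then have t: "PM n n (trans P (\<lambda>p. p)) = dproj n P" by (simp add: dproj_def)
  have R: "\<And>p. p \<in> P \<Longrightarrow> (fst p, fst p) \<in> strip 0" using assms by (auto simp: strip_def)
  have bt: "band (trans P (\<lambda>p. p) j i)" for i j by (rule band_trans[OF R])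
  have m: "dproj n P \<in> mats A n n" unfolding t[symmetric] by (rule PM_mats[OF bt])
  have "mat_star A (dproj n P) = dproj n P"
    unfolding t[symmetric] PM_star[of "trans P (\<lambda>p. p)", OF bt]
    by (rule arg_cong[of _ _ "PM n n"]) (auto simp: trans_def fun_eq_iff)
  then show ?thesis
    unfolding projections_def
    using m trans_star_mul[of P n "\<lambda>p. p" n 0, unfolded t] assms R by auto
qed

text \<open>Bounded displacement places the moving matrix in the algebra. Its adjoint moves points
  by the inverse bijection, so \<open>trans_star_mul\<close> computes both products.\<close>

lemma dproj_mvn:
  assumes P: "P \<subseteq> X \<times> {..<n}" and Q: "Q \<subseteq> X \<times> {..<m}" and \<theta>: "bij_betw \<theta> P Q"
    and R: "\<And>p. p \<in> P \<Longrightarrow> (fst p, fst (\<theta> p)) \<in> strip R"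
  shows "((n, dproj n P), (m, dproj m Q)) \<in> mvn_rel A"
proof -
  define \<theta>' where "\<theta>' = inv_into P \<theta>"
  have \<theta>': "bij_betw \<theta>' Q P" unfolding \<theta>'_def by (rule bij_betw_inv_into[OF \<theta>])
  have inv: "\<theta>' (\<theta> p) = p" if "p \<in> P" for p
    unfolding \<theta>'_def using \<theta> that by (simp add: bij_betw_def)
  have inv': "\<theta> (\<theta>' q) = q" if "q \<in> Q" for q
    unfolding \<theta>'_def using \<theta> that by (simp add: bij_betw_inv_into_right)
  have R': "(fst q, fst (\<theta>' q)) \<in> strip R" if "q \<in> Q" for q
    using R[of "\<theta>' q"] \<theta>' that strip_sym[of "fst q" "fst (\<theta>' q)"] inv'[OF that] by (auto simp: bij_betw_def)
  have bt: "band (trans P \<theta> j i)" for i j by (rule band_trans[OF R])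
  have tt: "trans Q \<theta>' = (\<lambda>i j x y. cnj (trans P \<theta> j i y x))"
  proof (intro HOL.ext)
    fix i j x y
    have "(y, j) \<in> Q \<and> \<theta>' (y, j) = (x, i) \<longleftrightarrow> (x, i) \<in> P \<and> \<theta> (x, i) = (y, j)"
      using inv[of "(x, i)"] inv'[of "(y, j)"] \<theta> \<theta>' unfolding bij_betw_def by (metis imageI)
    then show "trans Q \<theta>' i j x y = cnj (trans P \<theta> j i y x)" by (simp add: trans_def)
  qed
  let ?v = "PM m n (trans P \<theta>)"
  have vs: "mat_star A ?v = PM n m (trans Q \<theta>')" unfolding PM_star[of "trans P \<theta>", OF bt] tt ..
  have v: "?v \<in> mats A m n" by (rule PM_mats[OF bt])
  have 1: "mat_mul A m (mat_star A ?v) ?v = dproj n P"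
    by (rule trans_star_mul[OF P _ _ R]) (use \<theta> Q in \<open>auto simp: bij_betw_def\<close>)
  have "mat_mul A n (mat_star A (PM n m (trans Q \<theta>'))) (PM n m (trans Q \<theta>')) = dproj m Q"
    by (rule trans_star_mul[OF Q _ _ R']) (use \<theta>' P in \<open>auto simp: bij_betw_def\<close>)
  then have 2: "mat_mul A n ?v (mat_star A ?v) = dproj m Q"
    unfolding vs[symmetric] A.mat_star_star[OF v] .
  show ?thesis
    by (rule A.mvn_relI[OF dproj_projection[OF P] dproj_projection[OF Q] v 1[symmetric] 2[symmetric]])
qed

section \<open>Equivalence of diagonal projections\<close>

lemma finsum_A:
  assumes "finite L" "\<And>l. l \<in> L \<Longrightarrow> f l \<in> carrier A"
  shows "finsum A f L = (\<Sum>l\<in>L. f l)"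
  using assms
proof (induction L rule: finite_induct)
  case (insert l L)
  then show ?case by (subst A.finsum_insert) (auto simp: A_ops)
qed (simp add: A_ops)

lemma mat_mul_A:
  assumes "a \<in> mats A m n" "b \<in> mats A n k"
  shows "mat_mul A n a b i j = (\<Sum>l<n. a i l o\<^sub>L b l j)"
  unfolding mat_mul_def using assms[THEN A.mats_closed]
  by (subst finsum_A) (auto simp: A_ops A_mult)

text \<open>When star(v) v is a diagonal projection, this says that v preserves the norm of vectors
  supported on it.\<close>

lemma partial_isometry_norm:
  assumes v: "v \<in> mats A m n"
  shows "(\<Sum>j<m. (norm (\<Sum>i<n. v j i (\<xi> i)))\<^sup>2)
    = (\<Sum>i<n. \<xi> i \<bullet> (\<Sum>i'<n. mat_mul A m (mat_star A v) v i i' (\<xi> i')))"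
proof -
  have vc: "v j i \<in> carrier A" for i j using v by (rule A.mats_closed)
  have "(\<Sum>j<m. (norm (\<Sum>i<n. v j i (\<xi> i)))\<^sup>2) = (\<Sum>j<m. \<Sum>i<n. \<Sum>i'<n. v j i (\<xi> i) \<bullet> v j i' (\<xi> i'))"
    unfolding power2_norm_eq_inner inner_sum_left by (simp only: inner_sum_right)
  also have "\<dots> = (\<Sum>j<m. \<Sum>i<n. \<Sum>i'<n. \<xi> i \<bullet> adjoint_op (v j i) (v j i' (\<xi> i')))"
    by (simp add: adjoint_op_real(1)[OF A_mult_i[OF vc]])
  also have "\<dots> = (\<Sum>i<n. \<Sum>j<m. \<Sum>i'<n. \<xi> i \<bullet> adjoint_op (v j i) (v j i' (\<xi> i')))"
    by (rule sum.swap)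
  also have "\<dots> = (\<Sum>i<n. \<Sum>i'<n. \<Sum>j<m. \<xi> i \<bullet> adjoint_op (v j i) (v j i' (\<xi> i')))"
    by (intro sum.cong refl sum.swap)
  also have "\<dots> = (\<Sum>i<n. \<xi> i \<bullet> (\<Sum>i'<n. mat_mul A m (mat_star A v) v i i' (\<xi> i')))"
  proof -
    have "mat_mul A m (mat_star A v) v i i' = (\<Sum>j<m. adjoint_op (v j i) o\<^sub>L v j i')" for i i'
      unfolding mat_mul_A[OF A.mat_star_mats[OF v] v] by (simp add: mat_star_def A_ops)
    then show ?thesis by (simp add: blinfun.sum_left inner_sum_right)
  qed
  finally show ?thesis .
qed

text \<open>The arrows whose source is the point x0 of X are exactly the pairs (x, x0). On this
  source fibre, a copy of X, the regular representation of a band matrix is the matrix itself, by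
  \<open>rker_iota\<close>.\<close>

definition iota :: "'a \<Rightarrow> 'a \<Rightarrow> ('a \<times> 'a) filter" where "iota x0 x = principal {(x, x0)}"

lemma iota_gam: "iota x0 x = gam (\<lambda>_. x) (principal {x0})"
  by (simp add: iota_def gam_def filtermap_principal)

lemma iota_inj: "iota x0 x = iota x0 y \<longleftrightarrow> x = y"
  by (simp add: iota_def)

lemma iota_arr: "x0 \<in> X \<Longrightarrow> x \<in> X \<Longrightarrow> iota x0 x \<in> arr"
  unfolding arr_iff iota_def
  by (auto simp: ultrafilter_principal eventually_principal strip_def)

lemma rker_iota:
  assumes "x0 \<in> X" "x \<in> X" "y \<in> X"
  shows "rker a (iota x0 x) (iota x0 y) = a x y"
proof -
  have "rker a (iota x0 x) (iota x0 y) = ext a (principal {(x, y)})"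
    using rker_gam[of "\<lambda>_. x" "principal {x0}" "\<lambda>_. y" a] iota_arr[OF assms(1)] assms
    by (simp add: iota_gam[symmetric] filtermap_principal)
  also have "\<dots> = a x y" unfolding ext_def using assms by (simp add: sc_ext_principal)
  finally show ?thesis .
qed

lemma rker_iota_nonzero:
  assumes "x0 \<in> X" "rker a g (iota x0 y) \<noteq> 0" shows "\<exists>x\<in>X. g = iota x0 x"
proof -
  have "g \<in> arr" "filtermap snd g = principal {x0}"
    using rker_nonzero_arr[OF assms(2)] by (auto simp: iota_def filtermap_principal)
  then obtain t where "g = gam t (principal {x0})" "eventually (\<lambda>x. t x \<in> X) (principal {x0})"
    using arr_translate by blast
  then show ?thesis
    by (intro bexI[of _ "t x0"]) (auto simp: iota_def gam_def filtermap_principal eventually_principal)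
qed

lemma Pi_single:
  assumes "band a" shows "ell2_apply (Pi a (single h c)) g = rker a g h * c"
  unfolding Pi_def by (rule kernel_op_single[OF band_kernel_rker[OF assms]])

lemma Pi_diag_single:
  assumes b: "band (diag w)" and x: "x0 \<in> X" "x \<in> X"
  shows "Pi (diag w) (single (iota x0 x) c) = single (iota x0 x) (w x * c)"
proof (rule ell2_eqI)
  fix g
  have "rker (diag w) g (iota x0 x) = (if g = iota x0 x then w x else 0)"
  proof (cases "rker (diag w) g (iota x0 x) = 0")
    case True
    then show ?thesis using rker_iota[OF x(1,2,2), of "diag w"] x by (auto simp: diag_def)
  next
    case False
    then obtain y where "y \<in> X" "g = iota x0 y" using rker_iota_nonzero[OF x(1)] by blast
    then show ?thesis using rker_iota[OF x(1) \<open>y \<in> X\<close> x(2), of "diag w"] x by (auto simp: diag_def iota_inj)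
  qed
  then show "ell2_apply (Pi (diag w) (single (iota x0 x) c)) g = ell2_apply (single (iota x0 x) (w x * c)) g"
    by (simp add: Pi_single[OF b] trunc_apply)
qed

lemma Pi_diag_vanish:
  assumes b: "band (diag w)" and x0: "x0 \<in> X"
    and supp: "\<And>g. ell2_apply \<zeta> g \<noteq> 0 \<Longrightarrow> \<exists>y\<in>X. g = iota x0 y \<and> w y = 0"
  shows "Pi (diag w) \<zeta> = 0"
proof (rule ell2_eqI)
  fix g
  have "rker (diag w) g h * ell2_apply \<zeta> h = 0" for h
  proof (rule ccontr)
    assume nz: "rker (diag w) g h * ell2_apply \<zeta> h \<noteq> 0"
    then obtain y where y: "y \<in> X" "h = iota x0 y" "w y = 0" using supp[of h] by auto
    then obtain x where x: "x \<in> X" "g = iota x0 x" using rker_iota_nonzero[OF x0, of "diag w" g y] nz by auto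
    have "rker (diag w) g h = diag w x y" unfolding x(2) y(2) by (rule rker_iota[OF x0 x(1) y(1)])
    then show False using nz y(3) by (auto simp: diag_def split: if_splits)
  qed
  then have "(\<Sum>h | rker (diag w) g h \<noteq> 0. rker (diag w) g h * ell2_apply \<zeta> h) = 0"
    by (intro sum.neutral) blast
  then show "ell2_apply (Pi (diag w) \<zeta>) g = ell2_apply 0 g"
    unfolding Pi_def by (simp add: kernel_op_apply[OF band_kernel_rker[OF b]])
qed

lemma dproj_entry: "dproj n P i j = (if i = j \<and> i < n then Pi (diag (chi P i)) else 0)"
  by (auto simp: dproj_def PM_def Pi_zero)

text \<open>If the partial isometry is approximated by a band matrix of width \<open>R\<close>, then the band matrix
  is still injective on finitely supported vectors, so counting dimensions yields Hall's condition.\<close>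

lemma mvn_imp_injection:
  assumes P: "P \<subseteq> X \<times> {..<n}" and Q: "Q \<subseteq> X \<times> {..<m}"
    and mvn: "((n, dproj n P), (m, dproj m Q)) \<in> mvn_rel A"
  shows "\<exists>R f. inj_on f P \<and> f ` P \<subseteq> Q \<and> (\<forall>p\<in>P. (fst p, fst (f p)) \<in> strip R)"
proof (cases "P = {}")
  case True
  then show ?thesis by auto
next
  case False
  then obtain x0 where x0: "x0 \<in> X" and n0: "n > 0" using P by auto
  obtain v where v: "v \<in> mats A m n" "dproj n P = mat_mul A m (mat_star A v) v"
    "mat_mul A m (dproj m Q) v = v"
    using mvn by (rule A.mvn_relE)
  define E where "E j = Pi (diag (chi Q j))" for j
  \<comment> \<open>A common bound for the norms of the E j; the summand 1 keeps it positive even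
    when there are none.\<close>
  define K where "K = 1 + (\<Sum>j<m. norm (E j))"
  have K: "K > 0" "norm (E j) \<le> K" if "j < m" for j
  proof -
    have "norm (E j) \<le> (\<Sum>j<m. norm (E j))" using that by (intro member_le_sum) auto
    then show "norm (E j) \<le> K" unfolding K_def by simp
    show "K > 0" unfolding K_def by (simp add: add_pos_nonneg sum_nonneg)
  qed
  have K0: "K > 0" unfolding K_def by (simp add: add_pos_nonneg sum_nonneg)
  \<comment> \<open>Chosen so that K * n * \<epsilon> = 1 / (m + 1). Each of the m components of the
    image vector will have norm at most sqrt M / (m + 1), and m / (m + 1)^2 is less than 1.\<close>
  define \<epsilon> where "\<epsilon> = 1 / (K * real n * (real m + 1))"
  have \<epsilon>: "\<epsilon> > 0" unfolding \<epsilon>_def using K0 n0 by simp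
  have "\<exists>a. band a \<and> norm (v j i - Pi a) < \<epsilon>" for i j
  proof -
    have "v j i \<in> closure BPi" using A.mats_closed[OF v(1)] A_carrier by blast
    then obtain T where "T \<in> BPi" "dist T (v j i) < \<epsilon>" using \<epsilon> unfolding closure_approachable by blast
    then show ?thesis by (auto simp: dist_norm norm_minus_commute)
  qed
  then obtain \<phi> where \<phi>: "\<And>j i. band (\<phi> j i)" "\<And>j i. norm (v j i - Pi (\<phi> j i)) < \<epsilon>" by metis
  have "\<exists>R. \<forall>x y. \<phi> j i x y \<noteq> 0 \<longrightarrow> (x, y) \<in> strip R" for j i
    using \<phi>(1)[of j i] unfolding band_def by blast
  then obtain Rf where Rf: "\<And>j i x y. \<phi> j i x y \<noteq> 0 \<Longrightarrow> (x, y) \<in> strip (Rf j i)" by metis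
  define R where "R = Max (insert 0 ((\<lambda>(j, i). Rf j i) ` ({..<m} \<times> {..<n})))"
  have R: "(x, y) \<in> strip R" if "\<phi> j i x y \<noteq> 0" "j < m" "i < n" for j i x y
  proof (rule strip_mono[OF Rf[OF that(1)]])
    have "Rf j i \<in> (\<lambda>(j, i). Rf j i) ` ({..<m} \<times> {..<n})"
      using that(2,3) by (intro image_eqI[of _ _ "(j, i)"]) auto
    then show "Rf j i \<le> R" unfolding R_def by (intro Max_ge) auto
  qed
  \<comment> \<open>The points of Q that the band approximation can reach from p.\<close>
  define nb where "nb p = {q \<in> Q. (fst p, fst q) \<in> strip R}" for p :: "'a \<times> nat"
  have nb_fin: "finite (nb p)" for p
  proof (rule finite_subset)
    show "nb p \<subseteq> mcball (fst p) R \<times> {..<m}" using Q unfolding nb_def by (auto simp: strip_def)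
    show "finite (mcball (fst p) R \<times> {..<m})" using finite_ball by blast
  qed
  have hall: "card J \<le> card (\<Union>p\<in>J. nb p)" if J: "finite J" "J \<subseteq> P" for J
  proof (rule ccontr)
    let ?T = "\<Union>p\<in>J. nb p"
    assume "\<not> card J \<le> card ?T"
    \<comment> \<open>If Hall's condition fails at J, the rows in ?T give fewer equations than there
      are points of J, so some nonzero coefficient vector on J is annihilated by all of
      them.\<close>
    then obtain c where c: "\<exists>p\<in>J. c p \<noteq> 0"
      "\<forall>q\<in>?T. (\<Sum>p\<in>J. \<phi> (snd q) (snd p) (fst q) (fst p) * c p) = 0"
      using homogeneous_system_nontrivial[of ?T J "\<lambda>q p. \<phi> (snd q) (snd p) (fst q) (fst p)"] J nb_fin by auto
    define \<xi> where "\<xi> i = (\<Sum>p\<in>J. if snd p = i then single (iota x0 (fst p)) (c p) else 0)" for i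
    have JX: "fst p \<in> X" "snd p < n" if "p \<in> J" for p using that J P by auto
    \<comment> \<open>\<eta> is the exact image of \<xi> under v, and \<zeta> its image under the
      band approximation. The former has the norm of \<xi>, while the latter will have no component
      in Q.\<close>
    define \<eta> where "\<eta> j = (\<Sum>i<n. v j i (\<xi> i))" for j
    define \<zeta> where "\<zeta> j = (\<Sum>i<n. Pi (\<phi> j i) (\<xi> i))" for j
    have \<zeta>: "ell2_apply (\<zeta> j) g = (\<Sum>p\<in>J. rker (\<phi> j (snd p)) g (iota x0 (fst p)) * c p)" for j g
    proof -
      have "ell2_apply (\<zeta> j) g = (\<Sum>i<n. \<Sum>p\<in>J. if snd p = i then rker (\<phi> j i) g (iota x0 (fst p)) * c p else 0)"
        unfolding \<zeta>_def \<xi>_def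
        by (simp add: ell2_apply_sum blinfun.sum_right if_distrib[of "blinfun_apply _"] blinfun.zero_right
            if_distrib[of "\<lambda>\<xi>. ell2_apply \<xi> g"] Pi_single[OF \<phi>(1)] cong: if_cong)
      also have "\<dots> = (\<Sum>p\<in>J. \<Sum>i<n. if snd p = i then rker (\<phi> j i) g (iota x0 (fst p)) * c p else 0)"
        by (rule sum.swap)
      also have "\<dots> = (\<Sum>p\<in>J. rker (\<phi> j (snd p)) g (iota x0 (fst p)) * c p)"
        by (intro sum.cong refl) (simp add: JX)
      finally show ?thesis .
    qed
    \<comment> \<open>A coordinate in Q where \<zeta> j is nonzero would lie within R of a point of
      J and so belong to ?T; but there c makes \<zeta> j vanish.\<close>
    have E\<zeta>: "E j (\<zeta> j) = 0" if j: "j < m" for j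
      unfolding E_def
    proof (rule Pi_diag_vanish[OF band_chi x0])
      fix g assume nz: "ell2_apply (\<zeta> j) g \<noteq> 0"
      then obtain p where p: "p \<in> J" "rker (\<phi> j (snd p)) g (iota x0 (fst p)) \<noteq> 0"
        unfolding \<zeta> by (metis (no_types, lifting) mult_zero_left sum.neutral)
      then obtain y where y: "y \<in> X" "g = iota x0 y" using rker_iota_nonzero[OF x0] by blast
      have "(y, j) \<notin> Q"
      proof
        assume yQ: "(y, j) \<in> Q"
        have zero: "ell2_apply (\<zeta> j) g = (\<Sum>p\<in>J. \<phi> j (snd p) y (fst p) * c p)"
          unfolding \<zeta> y(2) by (rule sum.cong) (simp_all add: rker_iota[OF x0 y(1)] JX)
        have "\<phi> j (snd p) y (fst p) \<noteq> 0" using p(2) unfolding y(2) using rker_iota[OF x0 y(1) JX(1)[OF p(1)]] by simp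
        then have "(y, fst p) \<in> strip R" using j JX(2)[OF p(1)] by (rule R)
        then have "(y, j) \<in> nb p" unfolding nb_def using yQ strip_sym[of y "fst p"] by simp
        then have "(y, j) \<in> ?T" using p(1) by blast
        then have "(\<Sum>p\<in>J. \<phi> j (snd p) y (fst p) * c p) = 0" using c(2) by fastforce
        then show False using zero nz by simp
      qed
      then show "\<exists>y\<in>X. g = iota x0 y \<and> chi Q j y = 0" using y by (auto simp: chi_def)
    qed
    \<comment> \<open>The range of v lies under the projection onto Q.\<close>
    have E\<eta>: "E j (\<eta> j) = \<eta> j" if j: "j < m" for j
    proof -
      have "v j i = E j o\<^sub>L v j i" for i
      proof -
        have dQ: "dproj m Q \<in> mats A m m" by (rule A.projectionsD(1)[OF dproj_projection[OF Q]])
        have "v j i = mat_mul A m (dproj m Q) v j i" using v(3) by simp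
        also have "\<dots> = (\<Sum>l<m. dproj m Q j l o\<^sub>L v l i)" by (rule mat_mul_A[OF dQ v(1)])
        also have "\<dots> = (\<Sum>l<m. if l = j then E j o\<^sub>L v j i else 0)"
          using j by (intro sum.cong refl) (auto simp: dproj_entry E_def blinfun_eqI)
        finally show ?thesis using j by simp
      qed
      then have "v j i (\<xi> i) = E j (v j i (\<xi> i))" for i by (metis blinfun_apply_blinfun_compose)
      then show ?thesis unfolding \<eta>_def by (simp add: blinfun.sum_right)
    qed
    define M where "M = (\<Sum>i<n. (norm (\<xi> i))\<^sup>2)"
    have nxi: "norm (\<xi> i) \<le> sqrt M" if "i < n" for i
    proof -
      have "(norm (\<xi> i))\<^sup>2 \<le> M" unfolding M_def using that by (intro member_le_sum) auto
      then show ?thesis by (rule real_le_rsqrt)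
    qed
    have M0: "M > 0"
    proof -
      obtain p where p: "p \<in> J" "c p \<noteq> 0" using c(1) by blast
      have "ell2_apply (\<xi> (snd p)) (iota x0 (fst p)) = (\<Sum>q\<in>J. if q = p then c p else 0)"
        unfolding \<xi>_def ell2_apply_sum
        by (intro sum.cong refl) (auto simp: trunc_apply iota_inj prod_eq_iff)
      then have "\<xi> (snd p) \<noteq> 0" using p J(1) by auto
      then have "0 < (norm (\<xi> (snd p)))\<^sup>2" by simp
      also have "\<dots> \<le> M" unfolding M_def using JX(2)[OF p(1)] by (intro member_le_sum) auto
      finally show ?thesis .
    qed
    have bound: "norm (\<eta> j) \<le> sqrt M / (real m + 1)" if j: "j < m" for j
    proof -
      \<comment> \<open>The approximation contributes nothing in Q, so \<eta> j is controlled by the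
        approximation error alone.\<close>
      have "\<eta> j = E j (\<eta> j - \<zeta> j)" using E\<eta>[OF j] E\<zeta>[OF j] by (simp add: blinfun.diff_right)
      then have "norm (\<eta> j) \<le> norm (E j) * norm (\<eta> j - \<zeta> j)" by (metis norm_blinfun)
      also have "\<dots> \<le> K * norm (\<eta> j - \<zeta> j)" using K[OF j] by (intro mult_right_mono) auto
      also have "norm (\<eta> j - \<zeta> j) \<le> (\<Sum>i<n. \<epsilon> * sqrt M)"
      proof -
        have "\<eta> j - \<zeta> j = (\<Sum>i<n. (v j i - Pi (\<phi> j i)) (\<xi> i))"
          unfolding \<eta>_def \<zeta>_def by (simp add: blinfun.diff_left sum_subtractf)
        also have "norm \<dots> \<le> (\<Sum>i<n. norm ((v j i - Pi (\<phi> j i)) (\<xi> i)))" by (rule norm_sum)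
        also have "\<dots> \<le> (\<Sum>i<n. \<epsilon> * sqrt M)"
        proof (rule sum_mono)
          fix i assume "i \<in> {..<n}"
          have "norm ((v j i - Pi (\<phi> j i)) (\<xi> i)) \<le> norm (v j i - Pi (\<phi> j i)) * norm (\<xi> i)" by (rule norm_blinfun)
          also have "\<dots> \<le> \<epsilon> * sqrt M"
            using \<phi>(2)[of j i] nxi \<open>i \<in> {..<n}\<close> \<epsilon> by (intro mult_mono) auto
          finally show "norm ((v j i - Pi (\<phi> j i)) (\<xi> i)) \<le> \<epsilon> * sqrt M" .
        qed
        finally show ?thesis .
      qed
      then have "K * norm (\<eta> j - \<zeta> j) \<le> K * (real n * (\<epsilon> * sqrt M))" using K0 by (intro mult_left_mono) auto
      also have "\<dots> = (K * real n * \<epsilon>) * sqrt M" by simp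
      also have "K * real n * \<epsilon> = 1 / (real m + 1)" unfolding \<epsilon>_def using K0 n0 by simp
      also have "1 / (real m + 1) * sqrt M = sqrt M / (real m + 1)" by simp
      finally show ?thesis .
    qed
    \<comment> \<open>\<xi> is supported on J, inside P, hence fixed by the projection, and v
      preserves its norm. Together with the bounds on \<eta> this yields M < M.\<close>
    have "M = (\<Sum>i<n. \<xi> i \<bullet> (\<Sum>i'<n. dproj n P i i' (\<xi> i')))"
      unfolding M_def power2_norm_eq_inner
    proof (rule sum.cong[OF refl])
      fix i assume i: "i \<in> {..<n}"
      have "(\<Sum>i'<n. dproj n P i i' (\<xi> i')) = (\<Sum>i'<n. if i' = i then Pi (diag (chi P i)) (\<xi> i) else 0)"
        using i by (intro sum.cong refl) (auto simp: dproj_entry)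
      also have "\<dots> = Pi (diag (chi P i)) (\<xi> i)" using i by simp
      also have "\<dots> = \<xi> i"
        unfolding \<xi>_def blinfun.sum_right
      proof (rule sum.cong[OF refl])
        fix p assume p: "p \<in> J"
        then have "snd p = i \<Longrightarrow> chi P i (fst p) = 1" using J(2) by (auto simp: chi_def)
        then show "Pi (diag (chi P i)) (if snd p = i then single (iota x0 (fst p)) (c p) else 0)
            = (if snd p = i then single (iota x0 (fst p)) (c p) else 0)"
          using Pi_diag_single[OF band_chi x0 JX(1)[OF p]] by auto
      qed
      finally show "\<xi> i \<bullet> \<xi> i = \<xi> i \<bullet> (\<Sum>i'<n. dproj n P i i' (\<xi> i'))" by simp
    qed
    also have "\<dots> = (\<Sum>j<m. (norm (\<eta> j))\<^sup>2)"
      unfolding v(2) \<eta>_def by (rule partial_isometry_norm[OF v(1), symmetric])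
    also have "\<dots> \<le> (\<Sum>j<m. (sqrt M / (real m + 1))\<^sup>2)"
      by (intro sum_mono power_mono bound) auto
    also have "\<dots> = M * (real m / (real m + 1)\<^sup>2)" using M0 by (simp add: power_divide)
    also have "\<dots> < M * 1"
    proof (rule mult_strict_left_mono[OF _ M0])
      have "real m < (real m + 1)\<^sup>2" by (simp add: power2_eq_square algebra_simps add_pos_nonneg)
      then show "real m / (real m + 1)\<^sup>2 < 1" by (simp add: divide_less_eq)
    qed
    finally show False by simp
  qed
  from hall_marriage[of P nb, OF nb_fin hall]
  obtain f where f: "inj_on f P" "\<forall>p\<in>P. f p \<in> nb p" by blast
  then show ?thesis unfolding nb_def by (intro exI[of _ R] exI[of _ f]) auto
qed

text \<open>Hall's condition produces an injection in each direction. The explicit form of the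
  Cantor-Bernstein bijection uses one of the two at each point, so its displacement stays below max
  R R'.\<close>

lemma mvn_imp_bijection:
  assumes P: "P \<subseteq> X \<times> {..<n}" and Q: "Q \<subseteq> X \<times> {..<m}"
    and mvn: "((n, dproj n P), (m, dproj m Q)) \<in> mvn_rel A"
  shows "\<exists>R \<theta>. bij_betw \<theta> P Q \<and> (\<forall>p\<in>P. (fst p, fst (\<theta> p)) \<in> strip R)"
proof -
  obtain R f where f: "inj_on f P" "f ` P \<subseteq> Q" "\<forall>p\<in>P. (fst p, fst (f p)) \<in> strip R"
    using mvn_imp_injection[OF P Q mvn] by blast
  obtain R' g where g: "inj_on g Q" "g ` Q \<subseteq> P" "\<forall>q\<in>Q. (fst q, fst (g q)) \<in> strip R'"
    using mvn_imp_injection[OF Q P A.mvn_sym[OF mvn]] by blast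
  obtain \<theta> where \<theta>: "bij_betw \<theta> P Q" "\<forall>p\<in>P. \<theta> p = f p \<or> g (\<theta> p) = p"
    using cantor_schroeder_bernstein_explicit[OF f(1,2) g(1,2)] by blast
  have "(fst p, fst (\<theta> p)) \<in> strip (max R R')" if p: "p \<in> P" for p
  proof (cases "\<theta> p = f p")
    case True
    then have "(fst p, fst (\<theta> p)) \<in> strip R" using f(3) p by simp
    then show ?thesis by (rule strip_mono) simp
  next
    case False
    then have "g (\<theta> p) = p" using \<theta>(2) p by blast
    moreover have "\<theta> p \<in> Q" using \<theta>(1) p by (auto simp: bij_betw_def)
    ultimately have "(fst (\<theta> p), fst p) \<in> strip R'" using g(3) by metis
    then have "(fst p, fst (\<theta> p)) \<in> strip R'" using strip_sym[of "fst p" "fst (\<theta> p)"] by simp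
    then show ?thesis by (rule strip_mono) simp
  qed
  then show ?thesis using \<theta>(1) by blast
qed

section \<open>Traces\<close>

text \<open>The matrix entries of an operator on the source fibre over x0, which for
  \<open>Pi a\<close> are the entries of a. Unlike a itself they make sense for norm limits.\<close>

definition coef :: "'a \<Rightarrow> ('a \<times> 'a) filter ell2 \<Rightarrow>\<^sub>L ('a \<times> 'a) filter ell2 \<Rightarrow> 'a \<Rightarrow> 'a \<Rightarrow> complex" where
  "coef x0 T x y = ell2_apply (T (single (iota x0 y) 1)) (iota x0 x)"

lemma coef_Pi: "band a \<Longrightarrow> x0 \<in> X \<Longrightarrow> x \<in> X \<Longrightarrow> y \<in> X \<Longrightarrow> coef x0 (Pi a) x y = a x y"
  unfolding coef_def by (simp add: Pi_single rker_iota)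

lemma coef_sum: "coef x0 (\<Sum>l\<in>L. f l) x y = (\<Sum>l\<in>L. coef x0 (f l) x y)"
  by (simp add: coef_def blinfun.sum_left ell2_apply_sum)

lemma bounded_linear_ell2_apply: "bounded_linear (\<lambda>\<xi>. ell2_apply \<xi> i)"
  by (rule bounded_linear_intro[of _ 1]) (simp_all add: ell2_apply_add ell2_apply_scaleR norm_ell2_apply_le)

lemma continuous_on_coef: "continuous_on UNIV (\<lambda>T. coef x0 T x y)"
  unfolding coef_def
  by (intro bounded_linear.continuous_on[OF bounded_linear_ell2_apply] continuous_intros)

lemma coef_star:
  assumes T: "T \<in> carrier A"
  shows "coef x0 (adjoint_op T) x y = cnj (coef x0 T y x)"
proof -
  have c: "c \<bullet> coef x0 (adjoint_op T) x y = T (single (iota x0 x) c) \<bullet> single (iota x0 y) 1" for c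
    unfolding coef_def inner_single[symmetric] by (simp add: adjoint_op_real(1)[OF A_mult_i[OF T]])
  have i: "single h \<i> = mult_i (single h 1)" for h :: "('a \<times> 'a) filter"
    by (rule ell2_eqI) (simp add: mult_i_apply trunc_apply)
  have "T (single (iota x0 x) \<i>) = mult_i (T (single (iota x0 x) 1))"
    unfolding i using A_mult_i[OF T] by (metis blinfun_apply_blinfun_compose)
  then have "ell2_apply (T (single (iota x0 x) \<i>)) (iota x0 y) = \<i> * coef x0 T y x"
    by (simp add: mult_i_apply coef_def)
  then have "\<i> \<bullet> coef x0 (adjoint_op T) x y = (\<i> * coef x0 T y x) \<bullet> 1"
    unfolding c by (simp add: inner_commute[of _ "single _ _"] inner_single)
  moreover have "1 \<bullet> coef x0 (adjoint_op T) x y = coef x0 T y x \<bullet> 1"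
    unfolding c by (simp add: inner_commute[of _ "single _ _"] inner_single coef_def)
  ultimately show ?thesis by (simp add: complex_eq_iff inner_complex_def)
qed

text \<open>For finite X the sum on the right is continuous in both operators, so the product rule
  for band matrices extends to the closure in one variable after the other.\<close>

lemma coef_mult:
  assumes fin: "finite X" and x0: "x0 \<in> X" and S: "S \<in> carrier A" and T: "T \<in> carrier A" and x: "x \<in> X" and z: "z \<in> X"
  shows "coef x0 (S o\<^sub>L T) x z = (\<Sum>y\<in>X. coef x0 S x y * coef x0 T y z)"
proof -
  have PP: "coef x0 (Pi a o\<^sub>L Pi b) x z = (\<Sum>y\<in>X. coef x0 (Pi a) x y * coef x0 (Pi b) y z)"
    if a: "band a" and b: "band b" for a b
  proof -
    have "bmul a b x z = (\<Sum>y\<in>X. a x y * b y z)"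
    proof (rule bmul_superset[OF fin _ band_row_finite(1)[OF a]])
      fix y assume "a x y \<noteq> 0" then show "y \<in> X" using band_outside[OF a, of x y] by blast
    qed
    then show ?thesis
      using a b x0 x z by (simp add: Pi_mult coef_Pi band_bmul)
  qed
  have "coef x0 (Pi a o\<^sub>L T) x z = (\<Sum>y\<in>X. coef x0 (Pi a) x y * coef x0 T y z)" if a: "band a" for a
    by (rule A_closed_induct[where f = "\<lambda>T. coef x0 (Pi a o\<^sub>L T) x z" and
          g = "\<lambda>T. \<Sum>y\<in>X. coef x0 (Pi a) x y * coef x0 T y z", OF T PP[OF a]])
      (auto intro!: continuous_intros continuous_on_coef continuous_on_compose2[OF continuous_on_coef[of x0 x z]])
  then show ?thesis
    by (rule A_closed_induct[where f = "\<lambda>S. coef x0 (S o\<^sub>L T) x z" and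
          g = "\<lambda>S. \<Sum>y\<in>X. coef x0 S x y * coef x0 T y z", OF S])
      (auto intro!: continuous_intros continuous_on_coef continuous_on_compose2[OF continuous_on_coef[of x0 x z]])
qed

definition tr :: "'a \<Rightarrow> nat \<times> (nat \<Rightarrow> nat \<Rightarrow> ('a \<times> 'a) filter ell2 \<Rightarrow>\<^sub>L ('a \<times> 'a) filter ell2) \<Rightarrow> complex" where
  "tr x0 p = (\<Sum>i<fst p. \<Sum>x\<in>X. coef x0 (snd p i i) x x)"

lemma coef_mat_mul:
  assumes "finite X" "x0 \<in> X" "a \<in> mats A m n" "b \<in> mats A n k" "x \<in> X" "z \<in> X"
  shows "coef x0 (mat_mul A n a b i j) x z = (\<Sum>l<n. \<Sum>y\<in>X. coef x0 (a i l) x y * coef x0 (b l j) y z)"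
  using assms A.mats_closed[OF assms(3)] A.mats_closed[OF assms(4)]
  by (simp add: mat_mul_A coef_sum coef_mult)

lemma tr_mvn:
  assumes fin: "finite X" "x0 \<in> X" and pq: "(p, q) \<in> mvn_rel A" shows "tr x0 p = tr x0 q"
proof -
  obtain n p' m q' where pq': "p = (n, p')" "q = (m, q')" by force
  obtain v where v: "v \<in> mats A m n" "p' = mat_mul A m (mat_star A v) v" "q' = mat_mul A n v (mat_star A v)"
    using pq unfolding pq' by (rule A.mvn_relE)
  note vs = A.mat_star_mats[OF v(1)]
  have "tr x0 p = (\<Sum>i<n. \<Sum>x\<in>X. \<Sum>j<m. \<Sum>y\<in>X. coef x0 (mat_star A v i j) x y * coef x0 (v j i) y x)"
    unfolding pq' tr_def v(2) by (simp add: coef_mat_mul[OF fin vs v(1)])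
  also have "\<dots> = (\<Sum>i<n. \<Sum>j<m. \<Sum>x\<in>X. \<Sum>y\<in>X. coef x0 (mat_star A v i j) x y * coef x0 (v j i) y x)"
    by (intro sum.cong refl sum.swap)
  also have "\<dots> = (\<Sum>j<m. \<Sum>i<n. \<Sum>x\<in>X. \<Sum>y\<in>X. coef x0 (mat_star A v i j) x y * coef x0 (v j i) y x)"
    by (rule sum.swap)
  also have "\<dots> = (\<Sum>j<m. \<Sum>i<n. \<Sum>y\<in>X. \<Sum>x\<in>X. coef x0 (mat_star A v i j) x y * coef x0 (v j i) y x)"
    by (intro sum.cong refl sum.swap)
  also have "\<dots> = (\<Sum>j<m. \<Sum>y\<in>X. \<Sum>i<n. \<Sum>x\<in>X. coef x0 (mat_star A v i j) x y * coef x0 (v j i) y x)"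
    by (intro sum.cong refl sum.swap)
  also have "\<dots> = tr x0 q"
    unfolding pq' tr_def v(3) by (simp add: coef_mat_mul[OF fin v(1) vs] mult.commute)
  finally show ?thesis .
qed

lemma tr_dsum:
  "tr x0 (dsum A p q) = tr x0 p + tr x0 q"
proof -
  obtain n p' m q' where pq: "p = (n, p')" "q = (m, q')" by force
  have sp: "(\<Sum>i<n + m. f i) = (\<Sum>i<n. f i) + (\<Sum>i<m. f (n + i))" for f :: "nat \<Rightarrow> complex"
    by (induction m) (simp_all add: add.assoc)
  show ?thesis unfolding pq tr_def by (simp add: sp)
qed

text \<open>The coefficients over the pairs in {..<n} \<times> X form a finite self-adjoint
  idempotent matrix with this trace.\<close>

lemma tr_nat:
  assumes fin: "finite X" "x0 \<in> X" and p: "p \<in> projections A" shows "\<exists>k::nat. tr x0 p = of_nat k"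
proof -
  obtain n p' where p': "p = (n, p')" by force
  note P = A.projectionsD[OF p[unfolded p']]
  note cl = A.mats_closed[OF P(1)]
  define e where "e s t = coef x0 (p' (fst s) (fst t)) (snd s) (snd t)" for s t
  have "\<exists>k::nat. (\<Sum>s\<in>{..<n} \<times> X. e s s) = of_nat k"
  proof (rule trace_projection_nat[where p = e])
    show "finite ({..<n} \<times> X)" using fin by simp
    fix s t assume st: "s \<in> {..<n} \<times> X" "t \<in> {..<n} \<times> X"
    have "p' (fst s) (fst t) = adjoint_op (p' (fst t) (fst s))"
      using P(2) unfolding mat_star_def A_ops by (metis)
    then show "e s t = cnj (e t s)" unfolding e_def using coef_star[OF cl] by simp
    have "(\<Sum>r\<in>{..<n} \<times> X. e s r * e r t) = (\<Sum>l<n. \<Sum>y\<in>X. e s (l, y) * e (l, y) t)"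
      by (simp add: sum.cartesian_product)
    also have "\<dots> = coef x0 (mat_mul A n p' p' (fst s) (fst t)) (snd s) (snd t)"
      using st by (subst coef_mat_mul[OF fin P(1) P(1)]) (auto simp: e_def)
    finally show "(\<Sum>r\<in>{..<n} \<times> X. e s r * e r t) = e s t" unfolding P(3) e_def .
  qed
  moreover have "tr x0 p = (\<Sum>s\<in>{..<n} \<times> X. e s s)"
    unfolding tr_def p' e_def by (simp add: sum.cartesian_product case_prod_beta)
  ultimately show ?thesis by simp
qed

lemma tr_dproj:
  assumes fin: "finite X" "x0 \<in> X" and P: "P \<subseteq> X \<times> {..<n}"
  shows "tr x0 (n, dproj n P) = of_nat (card P)"
proof -
  have finP: "finite ({..<n} \<times> X)" using fin by simp
  have "tr x0 (n, dproj n P) = (\<Sum>i<n. \<Sum>x\<in>X. chi P i x)"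
    unfolding tr_def by (simp add: dproj_entry coef_Pi band_chi fin diag_def)
  also have "\<dots> = (\<Sum>s\<in>{..<n} \<times> X. if (snd s, fst s) \<in> P then 1 else 0)"
    by (simp add: sum.cartesian_product chi_def case_prod_beta)
  also have "\<dots> = of_nat (card {s \<in> {..<n} \<times> X. (snd s, fst s) \<in> P})"
    using finP by (simp add: sum.inter_filter[symmetric])
  also have "card {s \<in> {..<n} \<times> X. (snd s, fst s) \<in> P} = card P"
    by (rule bij_betw_same_card[of prod.swap], rule bij_betw_byWitness[of _ prod.swap]) (use P in auto)
  finally show ?thesis .
qed

end

section \<open>Level sets and homologous functions\<close>

text \<open>Equal fibre cardinalities allow a bijection over the base; over X it moves no base
  point, so the displacement of composites is controlled.\<close>

lemma fibrewise_bijection: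
  assumes "\<And>x. finite {p \<in> P. g p = x}" "\<And>x. finite {s \<in> S. f s = x}"
    and card: "\<And>x. card {p \<in> P. g p = x} = card {s \<in> S. f s = x}"
  shows "\<exists>\<beta>. bij_betw \<beta> P S \<and> (\<forall>p\<in>P. f (\<beta> p) = g p)"
proof -
  have "\<exists>b. bij_betw b {p \<in> P. g p = x} {s \<in> S. f s = x}" for x
    by (rule finite_same_card_bij[OF assms])
  then obtain b where b: "\<And>x. bij_betw (b x) {p \<in> P. g p = x} {s \<in> S. f s = x}" by metis
  define \<beta> where "\<beta> p = b (g p) p" for p
  have \<beta>: "\<beta> p \<in> S \<and> f (\<beta> p) = g p" if "p \<in> P" for p
    using b[of "g p"] that unfolding \<beta>_def bij_betw_def by blast
  have "inj_on \<beta> P"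
  proof (rule inj_onI)
    fix p q assume pq: "p \<in> P" "q \<in> P" "\<beta> p = \<beta> q"
    then have "g p = g q" using \<beta> by metis
    then have "b (g p) p = b (g p) q" using pq(3) by (simp add: \<beta>_def)
    moreover have "inj_on (b (g p)) {q \<in> P. g q = g p}" using b by (rule bij_betw_imp_inj_on)
    ultimately show "p = q" using pq \<open>g p = g q\<close> by (auto dest: inj_onD)
  qed
  moreover have "\<beta> ` P = S"
  proof (intro equalityI subsetI)
    fix s assume "s \<in> S"
    then have "s \<in> b (f s) ` {p \<in> P. g p = f s}" using b[of "f s"] by (auto simp: bij_betw_def)
    then obtain p where "p \<in> P" "g p = f s" "s = b (f s) p" by blast
    then show "s \<in> \<beta> ` P" by (intro image_eqI[of _ _ p]) (simp_all add: \<beta>_def)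
  qed (use \<beta> in blast)
  ultimately show ?thesis using \<beta> unfolding bij_betw_def by blast
qed

lemma (in comm_group) div_eq_iff:
  assumes "a \<in> carrier G" "b \<in> carrier G" "c \<in> carrier G" "e \<in> carrier G"
  shows "a \<otimes> inv b = c \<otimes> inv e \<longleftrightarrow> a \<otimes> e = c \<otimes> b"
proof -
  have "a \<otimes> inv b = c \<otimes> inv e \<longleftrightarrow> a = (c \<otimes> inv e) \<otimes> b"
    using assms by (metis inv_closed m_closed inv_solve_right')
  also have "(c \<otimes> inv e) \<otimes> b = (c \<otimes> b) \<otimes> inv e" using assms by (simp add: m_ac)
  also have "a = (c \<otimes> b) \<otimes> inv e \<longleftrightarrow> a \<otimes> e = c \<otimes> b"
    using assms by (metis inv_closed m_closed inv_solve_right)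
  finally show ?thesis .
qed

lemma (in star_algebra) K0class_cong:
  assumes "(a, a') \<in> mvn_rel R" "(b, b') \<in> mvn_rel R" shows "K0class a b = K0class a' b'"
  by (simp only: K0class_def equiv_class_eq[OF mvn_equiv assms(1)] equiv_class_eq[OF mvn_equiv assms(2)])

abbreviation (in star_algebra) zero_proj :: "nat \<times> (nat \<Rightarrow> nat \<Rightarrow> 'a)" where
  "zero_proj \<equiv> (0, \<lambda>_ _. \<zero>)"

text \<open>Adding the class of b to both sides reduces this to [a] - [b] + [b] = [a], where the
  representatives differ only by zero summands.\<close>

lemma (in star_algebra) K0class_split:
  assumes "a \<in> projections R" "b \<in> projections R"
  shows "K0class a b = K0class a zero_proj \<otimes>\<^bsub>K0 R\<^esub> inv\<^bsub>K0 R\<^esub> (K0class b zero_proj)"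
proof -
  interpret K: comm_group "K0 R" by (rule K0_comm_group)
  note z = zero_projection
  have "dsum R (dsum R (dsum R a b) zero_proj) zero_proj = dsum R (dsum R a (dsum R b zero_proj)) zero_proj"
    using assms by (simp only: dsum_zero dsum_projections)
  moreover have "dsum R (dsum R (dsum R a b) zero_proj) zero_proj \<in> projections R"
    using assms z by (intro dsum_projections)
  ultimately have "(dsum R (dsum R (dsum R a b) zero_proj) zero_proj,
      dsum R (dsum R a (dsum R b zero_proj)) zero_proj) \<in> mvn_rel R"
    using mvn_refl by metis
  then have "K0class (dsum R a b) (dsum R b zero_proj) = K0class a zero_proj"
    using K0class_eq_iff[OF dsum_projections[OF assms] dsum_projections[OF assms(2) z] assms(1) z] z by blast
  then have "K0class a b \<otimes>\<^bsub>K0 R\<^esub> K0class b zero_proj = K0class a zero_proj"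
    using K0class_mult[OF assms assms(2) z] by simp
  then show ?thesis
    using K.inv_solve_right'[OF K0class_carrier[OF assms] K0class_carrier[OF assms(1) z] K0class_carrier[OF assms(2) z]]
    by simp
qed

lemma (in star_algebra) diagonal_projection:
  assumes e: "\<And>i. i < n \<Longrightarrow> e i \<in> carrier R" "\<And>i. i < n \<Longrightarrow> star R (e i) = e i" "\<And>i. i < n \<Longrightarrow> e i \<otimes> e i = e i"
  shows "(n, \<lambda>i j. if i = j \<and> i < n then e i else \<zero>) \<in> projections R"
proof -
  let ?p = "\<lambda>i j. if i = j \<and> i < n then e i else \<zero>"
  have m: "?p \<in> mats R n n" using e(1) unfolding mats_def by auto
  have "mat_star R ?p = ?p" unfolding mat_star_def using e(2) by (auto simp: fun_eq_iff)
  moreover have "mat_mul R n ?p ?p = ?p"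
  proof (rule mats_eqI[OF mat_mul_mats[OF m m] m])
    fix i j assume "i < n" "j < n"
    have "mat_mul R n ?p ?p i j = (\<Oplus>k\<in>{..<n}. if i = k then ?p k j else \<zero>)"
      unfolding mat_mul_def by (rule finsum_cong') (use e in auto)
    also have "\<dots> = ?p i j"
      using finsum_singleton[of i "{..<n}" "\<lambda>k. ?p k j"] \<open>i < n\<close> e(1) by auto
    finally show "mat_mul R n ?p ?p i j = ?p i j" .
  qed
  ultimately show ?thesis using m unfolding projections_def by auto
qed

lemma cfun_int_eventually:
  fixes f :: "'a filter \<Rightarrow> int"
  assumes "f \<in> cfun (stone_cech S)" "u \<in> topspace (stone_cech S)"
  shows "eventually (\<lambda>x. f (principal {x}) = f u) u"
  using cfun_stone_cech_tendsto[OF assms] by (simp add: tendsto_discrete)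

lemma cfun_intI:
  fixes \<phi> :: "'a \<Rightarrow> int"
  assumes "\<And>x. x \<in> S \<Longrightarrow> \<bar>\<phi> x\<bar> \<le> B"
    and "\<And>u. u \<in> topspace (stone_cech S) \<Longrightarrow> eventually (\<lambda>x. \<phi> x = h u) u"
    and "\<And>u. u \<notin> topspace (stone_cech S) \<Longrightarrow> h u = 0"
  shows "h \<in> cfun (stone_cech S)"
proof (rule cfun_stone_cechI(1)[of "{-B..B}"])
  show "compact {-B..B}" by (rule finite_imp_compact) simp
  show "\<phi> x \<in> {-B..B}" if "x \<in> S" for x using assms(1)[OF that] by auto
  show "(\<phi> \<longlongrightarrow> h u) u" if "u \<in> topspace (stone_cech S)" for u
    using assms(2)[OF that] by (rule tendsto_eventually)
qed (rule assms(3))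

lemma cfun_int_bounded:
  fixes f :: "'a filter \<Rightarrow> int"
  assumes "f \<in> cfun (stone_cech S)"
  shows "\<exists>n::nat. \<forall>u. \<bar>f u\<bar> \<le> int n"
proof -
  have fin: "finite (f ` topspace (stone_cech S))"
    by (rule compact_discrete_finite[OF cfun_stone_cech_compact_range[OF assms]])
  define n where "n = Max (insert 0 ((\<lambda>u. nat \<bar>f u\<bar>) ` topspace (stone_cech S)))"
  have fin': "finite ((\<lambda>u. nat \<bar>f u\<bar>) ` topspace (stone_cech S))"
    using finite_imageI[OF fin, of "\<lambda>z. nat \<bar>z\<bar>"] by (simp add: image_image)
  have "\<bar>f u\<bar> \<le> int n" for u
  proof (cases "u \<in> topspace (stone_cech S)")
    case True
    then have "nat \<bar>f u\<bar> \<le> n" unfolding n_def using fin' by (intro Max_ge) auto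
    then show ?thesis by simp
  next
    case False
    then show ?thesis using assms by (simp add: cfun_def)
  qed
  then show ?thesis by blast
qed

lemma cfun_int_out: "f \<in> cfun (stone_cech S) \<Longrightarrow> u \<notin> topspace (stone_cech S) \<Longrightarrow> f u = (0::int)"
  by (simp add: cfun_def)

lemma cfun_int_add:
  fixes f g :: "'a filter \<Rightarrow> int"
  assumes f: "f \<in> cfun (stone_cech S)" and g: "g \<in> cfun (stone_cech S)"
  shows "(\<lambda>u. f u + g u) \<in> cfun (stone_cech S)"
proof -
  obtain n m :: nat where nm: "\<And>u. \<bar>f u\<bar> \<le> int n" "\<And>u. \<bar>g u\<bar> \<le> int m"
    using cfun_int_bounded[OF f] cfun_int_bounded[OF g] by blast
  show ?thesis
  proof (rule cfun_intI[of _ "\<lambda>x. f (principal {x}) + g (principal {x})" "int n + int m"])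
    show "\<bar>f (principal {x}) + g (principal {x})\<bar> \<le> int n + int m" for x
      using nm(1)[of "principal {x}"] nm(2)[of "principal {x}"] by linarith
    show "eventually (\<lambda>x. f (principal {x}) + g (principal {x}) = f u + g u) u" if "u \<in> topspace (stone_cech S)" for u
      using cfun_int_eventually[OF f that] cfun_int_eventually[OF g that] by (rule eventually_elim2) simp
  qed (simp add: cfun_int_out[OF f] cfun_int_out[OF g])
qed

lemma cfun_int_uminus:
  fixes f :: "'a filter \<Rightarrow> int"
  assumes f: "f \<in> cfun (stone_cech S)"
  shows "(\<lambda>u. - f u) \<in> cfun (stone_cech S)"
proof -
  obtain n :: nat where n: "\<And>u. \<bar>f u\<bar> \<le> int n" using cfun_int_bounded[OF f] by blast
  show ?thesis
  proof (rule cfun_intI[of _ "\<lambda>x. - f (principal {x})" "int n"])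
    show "eventually (\<lambda>x. - f (principal {x}) = - f u) u" if "u \<in> topspace (stone_cech S)" for u
      using cfun_int_eventually[OF f that] by (rule eventually_mono) simp
  qed (simp_all add: n cfun_int_out[OF f])
qed

lemma cfun_group_comm_group: "comm_group (cfun_group (stone_cech S))"
proof (rule comm_groupI)
  fix f assume "f \<in> carrier (cfun_group (stone_cech S))"
  then show "\<exists>g\<in>carrier (cfun_group (stone_cech S)). g \<otimes>\<^bsub>cfun_group (stone_cech S)\<^esub> f = \<one>\<^bsub>cfun_group (stone_cech S)\<^esub>"
    by (intro bexI[of _ "\<lambda>u. - f u"]) (simp_all add: cfun_group_def cfun_int_uminus)
qed (simp_all add: cfun_group_def cfun_int_add add_ac, simp add: cfun_def)

text \<open>The maximum in \<open>rank_proj\<close> bounds f because a continuous integer function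
  on a compact space has only finitely many values.\<close>

lemma rank_proj_bound:
  fixes f :: "'a filter \<Rightarrow> int"
  assumes f: "f \<in> cfun (stone_cech S)"
  shows "\<exists>n. (\<forall>u. f u \<le> int n) \<and> rank_proj (stone_cech S) f
    = (n, \<lambda>i j. if i = j \<and> i < n then (\<lambda>u. if u \<in> topspace (stone_cech S) \<and> int i < f u then 1 else 0) else (\<lambda>_. 0))"
proof -
  define n where "n = Max (insert 0 ((\<lambda>u. nat (f u)) ` topspace (stone_cech S)))"
  have "finite (f ` topspace (stone_cech S))"
    by (rule compact_discrete_finite[OF cfun_stone_cech_compact_range[OF f]])
  then have fin': "finite ((\<lambda>u. nat (f u)) ` topspace (stone_cech S))"
    using finite_imageI[of "f ` topspace (stone_cech S)" nat] by (simp add: image_image)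
  have "f u \<le> int n" for u
  proof (cases "u \<in> topspace (stone_cech S)")
    case True
    then have "nat (f u) \<le> n" unfolding n_def using fin' by (intro Max_ge) auto
    then show ?thesis by simp
  qed (simp add: cfun_int_out[OF f])
  moreover have "rank_proj (stone_cech S) f
    = (n, \<lambda>i j. if i = j \<and> i < n then (\<lambda>u. if u \<in> topspace (stone_cech S) \<and> int i < f u then 1 else 0) else (\<lambda>_. 0))"
    unfolding rank_proj_def n_def[symmetric] Let_def by (auto simp: fun_eq_iff)
  ultimately show ?thesis by blast
qed

lemma cfun_level_indicator:
  fixes f :: "'a filter \<Rightarrow> int"
  assumes f: "f \<in> cfun (stone_cech S)"
  shows "(\<lambda>u. if u \<in> topspace (stone_cech S) \<and> k < f u then 1 else 0 :: complex) \<in> cfun (stone_cech S)"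
proof (rule cfun_stone_cechI(1)[of "{0, 1}" _ "\<lambda>x. if k < f (principal {x}) then 1 else 0"])
  show "compact {0, 1 :: complex}" by (rule finite_imp_compact) simp
  show "((\<lambda>x. if k < f (principal {x}) then 1 else 0) \<longlongrightarrow> (if u \<in> topspace (stone_cech S) \<and> k < f u then 1 else 0 :: complex)) u"
    if "u \<in> topspace (stone_cech S)" for u
  proof (rule tendsto_eventually)
    show "eventually (\<lambda>x. (if k < f (principal {x}) then 1 else 0) = (if u \<in> topspace (stone_cech S) \<and> k < f u then 1 else 0 :: complex)) u"
      using cfun_int_eventually[OF f that] by (rule eventually_mono) (use that in simp)
  qed
qed auto

section \<open>Level sets, their projections and uniformly finite homology\<close>

context coarse_space
begin

text \<open>Negative values of v contribute nothing, so only the positive part is recorded.\<close>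

definition lev :: "('a \<Rightarrow> int) \<Rightarrow> ('a \<times> nat) set" where
  "lev v = {(x, i). x \<in> X \<and> int i < v x}"

lemma lev_subset: "(\<And>x. x \<in> X \<Longrightarrow> v x \<le> int n) \<Longrightarrow> lev v \<subseteq> X \<times> {..<n}"
  unfolding lev_def by force

lemma lev_fibre: "{p \<in> lev v. fst p = x} = (if x \<in> X then {x} \<times> {..<nat (v x)} else {})"
  by (auto simp: lev_def)

lemma lev_fibre_finite: "finite {p \<in> lev v. fst p = x}"
  and lev_fibre_card: "card {p \<in> lev v. fst p = x} = (if x \<in> X then nat (v x) else 0)"
  unfolding lev_fibre by (auto simp: card_cartesian_product)

lemma fibre_finite:
  assumes "P \<subseteq> X \<times> {..<n :: nat}" shows "finite {p \<in> P. fst p = x}"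
  by (rule finite_subset[of _ "{x} \<times> {..<n}"]) (use assms in auto)

text \<open>Equal cardinalities over each point of X suffice, since the points can be matched within
  each fibre and thus with displacement zero.\<close>

lemma dproj_mvn_fibre:
  assumes P: "P \<subseteq> X \<times> {..<n}" and Q: "Q \<subseteq> X \<times> {..<m}"
    and card: "\<And>x. x \<in> X \<Longrightarrow> card {p \<in> P. fst p = x} = card {p \<in> Q. fst p = x}"
  shows "((n, dproj n P), (m, dproj m Q)) \<in> mvn_rel A"
proof -
  have "card {p \<in> P. fst p = x} = card {p \<in> Q. fst p = x}" for x
  proof (cases "x \<in> X")
    case False
    then have "{p \<in> P. fst p = x} = {}" "{p \<in> Q. fst p = x} = {}" using P Q by auto
    then show ?thesis by (simp only:)
  qed (rule card)
  from fibrewise_bijection[OF fibre_finite[OF P] fibre_finite[OF Q] this]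
  obtain \<beta> where \<beta>: "bij_betw \<beta> P Q" "\<forall>p\<in>P. fst (\<beta> p) = fst p" by blast
  show ?thesis
    by (rule dproj_mvn[OF P Q \<beta>(1), of 0]) (use \<beta>(2) P in \<open>auto simp: strip_def\<close>)
qed

definition shift :: "nat \<Rightarrow> 'a \<times> nat \<Rightarrow> 'a \<times> nat" where "shift n p = (fst p, n + snd p)"

lemma dsum_dproj:
  assumes P: "P \<subseteq> X \<times> {..<n}" and Q: "Q \<subseteq> X \<times> {..<m}"
  shows "dsum A (n, dproj n P) (m, dproj m Q) = (n + m, dproj (n + m) (P \<union> shift n ` Q))"
proof -
  have 1: "chi (P \<union> shift n ` Q) i = chi P i" if "i < n" for i
    using that by (auto simp: chi_def shift_def fun_eq_iff)
  have 2: "chi (P \<union> shift n ` Q) i = chi Q (i - n)" if "n \<le> i" for i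
  proof
    fix x
    have "(x, i) \<in> shift n ` Q \<longleftrightarrow> (x, i - n) \<in> Q"
      using that by (force simp: shift_def image_iff)
    moreover have "(x, i) \<notin> P" using P that by auto
    ultimately show "chi (P \<union> shift n ` Q) i x = chi Q (i - n) x" by (simp add: chi_def)
  qed
  show ?thesis
    by (auto simp: fun_eq_iff dproj_entry A_ops 1 2)
qed

definition Dd :: "('a \<Rightarrow> int) \<Rightarrow> nat \<Rightarrow> nat \<times> (nat \<Rightarrow> nat \<Rightarrow> ('a \<times> 'a) filter ell2 \<Rightarrow>\<^sub>L ('a \<times> 'a) filter ell2)" where
  "Dd v n = (n, dproj n (lev v))"

lemma Dd_projection: "(\<And>x. x \<in> X \<Longrightarrow> v x \<le> int n) \<Longrightarrow> Dd v n \<in> projections A"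
  unfolding Dd_def by (intro dproj_projection lev_subset)

lemma Dd_mvn:
  assumes "\<And>x. x \<in> X \<Longrightarrow> v x \<le> int n" "\<And>x. x \<in> X \<Longrightarrow> v x \<le> int m"
  shows "(Dd v n, Dd v m) \<in> mvn_rel A"
  unfolding Dd_def by (rule dproj_mvn_fibre) (use assms lev_subset in blast)+

text \<open>The direct sum puts the second level set above height n, which may leave gaps. The fibre
  over x nevertheless has v x + w x points, by nonnegativity, and only the size of the fibre
  matters.\<close>

lemma dsum_Dd:
  assumes v: "\<And>x. x \<in> X \<Longrightarrow> 0 \<le> v x" "\<And>x. x \<in> X \<Longrightarrow> v x \<le> int n"
    and w: "\<And>x. x \<in> X \<Longrightarrow> 0 \<le> w x" "\<And>x. x \<in> X \<Longrightarrow> w x \<le> int m"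
  shows "(dsum A (Dd v n) (Dd w m), Dd (\<lambda>x. v x + w x) (n + m)) \<in> mvn_rel A"
proof -
  let ?U = "lev v \<union> shift n ` lev w"
  have P: "lev v \<subseteq> X \<times> {..<n}" and Q: "lev w \<subseteq> X \<times> {..<m}" using v w by (auto intro!: lev_subset)
  have PQ: "lev (\<lambda>x. v x + w x) \<subseteq> X \<times> {..<n + m}"
  proof (rule lev_subset)
    show "v x + w x \<le> int (n + m)" if "x \<in> X" for x using v(2)[OF that] w(2)[OF that] by simp
  qed
  have U: "?U \<subseteq> X \<times> {..<n + m}" using P Q by (auto simp: shift_def)
  have "card {p \<in> ?U. fst p = x} = card {p \<in> lev (\<lambda>x. v x + w x). fst p = x}" if x: "x \<in> X" for x
  proof -
    have "{p \<in> ?U. fst p = x} = {p \<in> lev v. fst p = x} \<union> shift n ` {p \<in> lev w. fst p = x}"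
      by (auto simp: shift_def)
    moreover have "{p \<in> lev v. fst p = x} \<inter> shift n ` {p \<in> lev w. fst p = x} = {}"
      using P by (auto simp: shift_def)
    moreover have "inj_on (shift n) {p \<in> lev w. fst p = x}" by (auto simp: inj_on_def shift_def prod_eq_iff)
    ultimately have "card {p \<in> ?U. fst p = x} = nat (v x) + nat (w x)"
      using x by (simp add: card_Un_disjoint lev_fibre_finite card_image lev_fibre_card)
    then show ?thesis using x v(1)[OF x] w(1)[OF x] by (simp add: lev_fibre_card nat_add_distrib)
  qed
  from dproj_mvn_fibre[OF U PQ this] show ?thesis
    unfolding Dd_def dsum_dproj[OF P Q] .
qed

text \<open>With this, stabilising by an identity matrix amounts to adding the constant k to a
  function on X.\<close>

lemma mat_one_Dd: "(k, A.mat_one k) = Dd (\<lambda>_. int k) k"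
proof -
  have "Pi (diag (chi (lev (\<lambda>_. int k)) i)) = Pi (diag (\<lambda>_. 1))" if "i < k" for i
    by (rule Pi_cong_diag) (use that in \<open>simp add: chi_def lev_def\<close>)
  then show ?thesis unfolding Dd_def A.mat_one_def by (auto simp: fun_eq_iff dproj_entry A_ops A_one)
qed

text \<open>The difference is a boundary, with the sign convention of \<open>H0_boundaries\<close>:
  source sums minus range sums.\<close>

definition homologous :: "('a \<Rightarrow> int) \<Rightarrow> ('a \<Rightarrow> int) \<Rightarrow> bool" where
  "homologous v w \<longleftrightarrow> (\<exists>h. band h \<and> (\<forall>x\<in>X. v x - w x = colsum h x - colsum (\<lambda>x y. h y x) x))"

lemma band_intI:
  fixes h :: "'a \<Rightarrow> 'a \<Rightarrow> int"
  assumes "\<And>x y. \<bar>h x y\<bar> \<le> C" "\<And>x y. h x y \<noteq> 0 \<Longrightarrow> (x, y) \<in> strip R"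
  shows "band h"
proof -
  have "compact {-C..C}" by (rule finite_imp_compact) simp
  moreover have "h x y \<in> {-C..C}" for x y using assms(1)[of x y] by auto
  moreover have "(x, y) \<in> strip (max R 0)" if "h x y \<noteq> 0" for x y
    using assms(2)[OF that] by (rule strip_mono) simp
  ultimately show ?thesis unfolding band_def by (intro exI[of _ "{-C..C}"] exI[of _ "max R 0"]) auto
qed

lemma band_intD:
  fixes h :: "'a \<Rightarrow> 'a \<Rightarrow> int"
  assumes "band h"
  shows "\<exists>(n::nat) R. \<forall>x y. \<bar>h x y\<bar> \<le> int n \<and> (h x y \<noteq> 0 \<longrightarrow> (x, y) \<in> strip R)"
proof -
  obtain C R where C: "compact C" "\<forall>x y. h x y \<in> C \<and> (h x y \<noteq> 0 \<longrightarrow> (x, y) \<in> strip R)"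
    using assms unfolding band_def by blast
  have fin: "finite C" by (rule compact_discrete_finite[OF C(1)])
  have "\<bar>h x y\<bar> \<le> int (Max ((\<lambda>c. nat \<bar>c\<bar>) ` C))" for x y
  proof -
    have "nat \<bar>h x y\<bar> \<le> Max ((\<lambda>c. nat \<bar>c\<bar>) ` C)" using C(2) fin by (intro Max_ge) auto
    then show ?thesis by simp
  qed
  then show ?thesis using C(2) by blast
qed

lemma colsum_bounded:
  assumes "band h" shows "\<exists>n::nat. \<forall>x. \<bar>colsum h x\<bar> \<le> int n"
proof -
  obtain n :: nat and R where h: "\<And>x y. \<bar>h x y\<bar> \<le> int n" "\<And>x y. h x y \<noteq> 0 \<Longrightarrow> (x, y) \<in> strip R"
    using band_intD[OF assms] by blast
  obtain N where N: "\<forall>x\<in>X. finite (mcball x R) \<and> card (mcball x R) \<le> N" using ball_bound by blast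
  have "\<bar>colsum h x\<bar> \<le> int (N * n)" for x
  proof (cases "x \<in> X")
    case True
    have "colsum h x = (\<Sum>y\<in>mcball x R. h y x)" by (rule colsum_ball[OF h(2)])
    then have "\<bar>colsum h x\<bar> \<le> (\<Sum>y\<in>mcball x R. \<bar>h y x\<bar>)" by simp
    also have "\<dots> \<le> (\<Sum>y\<in>mcball x R. int n)" by (rule sum_mono) (rule h(1))
    also have "\<dots> = int (card (mcball x R) * n)" by simp
    also have "\<dots> \<le> int (N * n)" using N True by (intro iffD2[OF of_nat_le_iff] mult_right_mono) auto
    finally show ?thesis .
  next
    case False
    then have "mcball x R = {}" by (simp add: mcball_eq_empty)
    then show ?thesis using colsum_ball[OF h(2), where x = x] by simp
  qed
  then show ?thesis by blast
qed

lemma card_fibres: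
  assumes "finite S" "finite Y" "f ` S \<subseteq> Y" shows "card S = (\<Sum>y\<in>Y. card {s \<in> S. f s = y})"
  using sum.group[OF assms, of "\<lambda>_. 1::nat"] by simp

text \<open>The bounded bijection \<theta> of level sets is read as a chain: h a b counts the points
  over b that are moved to points over a. Points leaving x add up to v x, and points arriving at x
  to w x.\<close>

lemma mvn_imp_homologous:
  assumes v: "\<And>x. x \<in> X \<Longrightarrow> 0 \<le> v x" "\<And>x. x \<in> X \<Longrightarrow> v x \<le> int n"
    and w: "\<And>x. x \<in> X \<Longrightarrow> 0 \<le> w x" "\<And>x. x \<in> X \<Longrightarrow> w x \<le> int m"
    and mvn: "(Dd v n, Dd w m) \<in> mvn_rel A"
  shows "homologous v w"
proof -
  have P: "lev v \<subseteq> X \<times> {..<n}" and Q: "lev w \<subseteq> X \<times> {..<m}" using v w by (auto intro!: lev_subset)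
  obtain R \<theta> where \<theta>: "bij_betw \<theta> (lev v) (lev w)" and R: "\<And>p. p \<in> lev v \<Longrightarrow> (fst p, fst (\<theta> p)) \<in> strip R"
    using mvn_imp_bijection[OF P Q mvn[unfolded Dd_def]] by blast
  define S where "S a b = {p \<in> lev v. fst p = b \<and> fst (\<theta> p) = a}" for a b
  define h where "h a b = int (card (S a b))" for a b
  have Sfin: "finite (S a b)" for a b
    by (rule finite_subset[OF _ lev_fibre_finite[of v b]]) (auto simp: S_def)
  have hb: "\<bar>h a b\<bar> \<le> int n" for a b
  proof -
    have "card (S a b) \<le> card {p \<in> lev v. fst p = b}"
      by (rule card_mono[OF lev_fibre_finite]) (auto simp: S_def)
    also have "\<dots> \<le> n" using v(2)[of b] by (auto simp: lev_fibre_card nat_le_iff)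
    finally show ?thesis by (simp add: h_def)
  qed
  have hs: "(a, b) \<in> strip R" if "h a b \<noteq> 0" for a b
  proof -
    have "S a b \<noteq> {}" using that by (auto simp: h_def)
    then obtain p where "p \<in> lev v" "fst p = b" "fst (\<theta> p) = a" unfolding S_def by blast
    then show ?thesis using R[of p] strip_sym[of b a] by auto
  qed
  have band: "band h" by (rule band_intI[OF hb hs])
  have "v x - w x = colsum h x - colsum (\<lambda>x y. h y x) x" if x: "x \<in> X" for x
  proof -
    have "colsum h x = (\<Sum>y\<in>mcball x R. h y x)" by (rule colsum_ball[OF hs])
    also have "\<dots> = int (\<Sum>y\<in>mcball x R. card {p \<in> {p \<in> lev v. fst p = x}. fst (\<theta> p) = y})"
      by (simp add: h_def S_def conj_assoc)
    also have "(\<Sum>y\<in>mcball x R. card {p \<in> {p \<in> lev v. fst p = x}. fst (\<theta> p) = y}) = card {p \<in> lev v. fst p = x}"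
    proof (rule card_fibres[symmetric, OF lev_fibre_finite finite_ball])
      show "(\<lambda>p. fst (\<theta> p)) ` {p \<in> lev v. fst p = x} \<subseteq> mcball x R" using R strip_ball by auto
    qed
    finally have 1: "colsum h x = v x" using x v(1)[OF x] by (simp add: lev_fibre_card)
    have bb: "bij_betw \<theta> {p \<in> lev v. fst (\<theta> p) = x} {q \<in> lev w. fst q = x}"
    proof (rule bij_betw_subset[OF \<theta>])
      show "\<theta> ` {p \<in> lev v. fst (\<theta> p) = x} = {q \<in> lev w. fst q = x}"
      proof (intro equalityI subsetI)
        fix q assume q: "q \<in> {q \<in> lev w. fst q = x}"
        then obtain p where "p \<in> lev v" "q = \<theta> p" using \<theta> unfolding bij_betw_def by blast
        then show "q \<in> \<theta> ` {p \<in> lev v. fst (\<theta> p) = x}" using q by blast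
      qed (use \<theta> in \<open>auto simp: bij_betw_def\<close>)
    qed blast
    have "colsum (\<lambda>x y. h y x) x = (\<Sum>y\<in>mcball x R. h x y)"
      by (rule colsum_ball) (use hs strip_sym in blast)
    also have "\<dots> = int (\<Sum>y\<in>mcball x R. card {p \<in> {p \<in> lev v. fst (\<theta> p) = x}. fst p = y})"
      by (simp add: h_def S_def conj_ac)
    also have "(\<Sum>y\<in>mcball x R. card {p \<in> {p \<in> lev v. fst (\<theta> p) = x}. fst p = y}) = card {p \<in> lev v. fst (\<theta> p) = x}"
    proof (rule card_fibres[symmetric, OF _ finite_ball])
      show "finite {p \<in> lev v. fst (\<theta> p) = x}" using bij_betw_finite[OF bb] lev_fibre_finite by blast
      show "fst ` {p \<in> lev v. fst (\<theta> p) = x} \<subseteq> mcball x R"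
      proof (rule image_subsetI)
        fix p assume "p \<in> {p \<in> lev v. fst (\<theta> p) = x}"
        then have "(x, fst p) \<in> strip R" using R[of p] strip_sym[of "fst p" x] by auto
        then show "fst p \<in> mcball x R" using strip_ball by blast
      qed
    qed
    also have "card {p \<in> lev v. fst (\<theta> p) = x} = card {q \<in> lev w. fst q = x}"
      by (rule bij_betw_same_card[OF bb])
    finally have 2: "colsum (\<lambda>x y. h y x) x = w x" using x w(1)[OF x] by (simp add: lev_fibre_card)
    show ?thesis unfolding 1 2 ..
  qed
  with band show ?thesis unfolding homologous_def by blast
qed

text \<open>A nonnegative chain g is replaced by the set T with g a b copies of each pair (a, b).
  Over the first coordinate T matches the level set of the row sums, over the second that of the
  column sums, and the two coordinates of a pair are at distance at most R.\<close>

lemma row_col_mvn: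
  assumes g: "band g" "\<And>x y. 0 \<le> g x y"
    and n: "\<And>x. x \<in> X \<Longrightarrow> colsum (\<lambda>x y. g y x) x \<le> int n" and m: "\<And>x. x \<in> X \<Longrightarrow> colsum g x \<le> int m"
  shows "(Dd (colsum (\<lambda>x y. g y x)) n, Dd (colsum g) m) \<in> mvn_rel A"
proof -
  obtain R where R: "\<And>x y. g x y \<noteq> 0 \<Longrightarrow> (x, y) \<in> strip R" using g(1) unfolding band_def by blast
  define T where "T = {(a, b, k). k < nat (g a b)}"
  have row: "{t \<in> T. fst t = a} = (\<lambda>(b, k). (a, b, k)) ` (SIGMA b:mcball a R. {..<nat (g a b)})" for a
  proof (intro equalityI subsetI)
    fix t assume "t \<in> {t \<in> T. fst t = a}"
    then obtain b k where t: "t = (a, b, k)" "k < nat (g a b)" unfolding T_def by auto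
    then have "(a, b) \<in> strip R" by (intro R) auto
    then show "t \<in> (\<lambda>(b, k). (a, b, k)) ` (SIGMA b:mcball a R. {..<nat (g a b)})"
      using t strip_ball by (intro image_eqI[of _ _ "(b, k)"]) auto
  qed (auto simp: T_def)
  have col: "{t \<in> T. fst (snd t) = b} = (\<lambda>(a, k). (a, b, k)) ` (SIGMA a:mcball b R. {..<nat (g a b)})" for b
  proof (intro equalityI subsetI)
    fix t assume "t \<in> {t \<in> T. fst (snd t) = b}"
    then obtain a k where t: "t = (a, b, k)" "k < nat (g a b)" unfolding T_def by auto
    then have "(a, b) \<in> strip R" by (intro R) auto
    then have "a \<in> mcball b R" using strip_sym strip_ball by blast
    then show "t \<in> (\<lambda>(a, k). (a, b, k)) ` (SIGMA a:mcball b R. {..<nat (g a b)})"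
      using t by (intro image_eqI[of _ _ "(a, k)"]) auto
  qed (auto simp: T_def)
  have rowfin: "finite {t \<in> T. fst t = a}" and colfin: "finite {t \<in> T. fst (snd t) = a}" for a
    unfolding row col using finite_ball by auto
  have outside: "g x y = 0" if "x \<notin> X \<or> y \<notin> X" for x y
    using R[of x y] that by (auto simp: strip_def)
  have nn: "(\<Sum>y\<in>Y. nat (g' y)) = nat (\<Sum>y\<in>Y. g' y)" if "\<And>y. 0 \<le> g' y" for g' :: "'a \<Rightarrow> int" and Y
  proof -
    have "int (\<Sum>y\<in>Y. nat (g' y)) = (\<Sum>y\<in>Y. g' y)" using that by simp
    then show ?thesis by (metis nat_int)
  qed
  have rowcard: "card {p \<in> lev (colsum (\<lambda>x y. g y x)). fst p = a} = card {t \<in> T. fst t = a}" for a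
  proof -
    have "card {t \<in> T. fst t = a} = (\<Sum>b\<in>mcball a R. nat (g a b))"
      unfolding row by (subst card_image) (auto simp: inj_on_def card_SigmaI finite_ball)
    also have "\<dots> = nat (\<Sum>b\<in>mcball a R. g a b)" by (rule nn) (rule g(2))
    also have "(\<Sum>b\<in>mcball a R. g a b) = colsum (\<lambda>x y. g y x) a"
      by (rule colsum_ball[symmetric]) (use R strip_sym in blast)
    finally show ?thesis by (auto simp: lev_fibre_card colsum_def outside)
  qed
  have colcard: "card {p \<in> lev (colsum g). fst p = a} = card {t \<in> T. fst (snd t) = a}" for a
  proof -
    have "card {t \<in> T. fst (snd t) = a} = (\<Sum>b\<in>mcball a R. nat (g b a))"
      unfolding col by (subst card_image) (auto simp: inj_on_def card_SigmaI finite_ball)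
    also have "\<dots> = nat (\<Sum>b\<in>mcball a R. g b a)" by (rule nn) (rule g(2))
    also have "(\<Sum>b\<in>mcball a R. g b a) = colsum g a" by (rule colsum_ball[symmetric, OF R])
    finally show ?thesis by (auto simp: lev_fibre_card colsum_def outside)
  qed
  obtain \<beta> where \<beta>: "bij_betw \<beta> (lev (colsum (\<lambda>x y. g y x))) T" "\<forall>p\<in>lev (colsum (\<lambda>x y. g y x)). fst (\<beta> p) = fst p"
    using fibrewise_bijection[OF lev_fibre_finite rowfin rowcard] by blast
  have colcard': "card {t \<in> T. fst (snd t) = a} = card {p \<in> lev (colsum g). fst p = a}" for a
    using colcard by simp
  obtain \<gamma> where \<gamma>: "bij_betw \<gamma> T (lev (colsum g))" "\<forall>t\<in>T. fst (\<gamma> t) = fst (snd t)"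
    using fibrewise_bijection[OF colfin lev_fibre_finite colcard'] by blast
  show ?thesis unfolding Dd_def
  proof (rule dproj_mvn[OF lev_subset[OF n] lev_subset[OF m] bij_betw_trans[OF \<beta>(1) \<gamma>(1)]])
    fix p assume p: "p \<in> lev (colsum (\<lambda>x y. g y x))"
    then have T: "\<beta> p \<in> T" using \<beta>(1) by (auto simp: bij_betw_def)
    obtain a b k where t: "\<beta> p = (a, b, k)" by (metis surj_pair)
    have "g a b \<noteq> 0" using T unfolding t T_def by auto
    then have "(a, b) \<in> strip R" by (rule R)
    moreover have "fst p = a" using \<beta>(2) p t by force
    moreover have "fst (\<gamma> (\<beta> p)) = b" using \<gamma>(2) T t by simp
    ultimately show "(fst p, fst ((\<gamma> \<circ> \<beta>) p)) \<in> strip R" by simp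
  qed
qed

section \<open>The comparison map\<close>

sublocale K: comm_group "K0 (reduced_algebra (coarse_groupoid X d))"
  by (rule A.K0_comm_group)

text \<open>The \<open>K0\<close> class of the level-set projection; \<open>LEAST\<close> merely
  selects some matrix size, and by \<open>kap_eq\<close> every sufficient size gives the same
  class.\<close>

definition kap :: "('a \<Rightarrow> int) \<Rightarrow> _" where
  "kap v = A.K0class (Dd v (LEAST n. \<forall>x\<in>X. v x \<le> int n)) A.zero_proj"

lemma kap_eq:
  assumes "\<And>x. x \<in> X \<Longrightarrow> v x \<le> int n" shows "kap v = A.K0class (Dd v n) A.zero_proj"
proof -
  have "\<forall>x\<in>X. v x \<le> int (LEAST n. \<forall>x\<in>X. v x \<le> int n)"
    by (rule LeastI[of _ n]) (use assms in blast)
  then show ?thesis unfolding kap_def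
    by (intro A.K0class_cong Dd_mvn A.mvn_refl A.zero_projection) (use assms in auto)
qed

lemma kap_carrier:
  assumes "\<And>x. x \<in> X \<Longrightarrow> v x \<le> int n" shows "kap v \<in> carrier (K0 A)"
proof -
  have "kap v = A.K0class (Dd v n) A.zero_proj" by (rule kap_eq[OF assms])
  then show ?thesis using A.K0class_carrier[OF Dd_projection[of v n] A.zero_projection] assms by simp
qed

lemma lev_cong: "(\<And>x. x \<in> X \<Longrightarrow> max (v x) 0 = max (w x) 0) \<Longrightarrow> lev v = lev w"
  unfolding lev_def by force

lemma kap_max:
  assumes "\<And>x. x \<in> X \<Longrightarrow> v x \<le> int n" shows "kap v = kap (\<lambda>x. max (v x) 0)"
proof -
  have "lev (\<lambda>x. max (v x) 0) = lev v" by (rule lev_cong) simp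
  then have "Dd (\<lambda>x. max (v x) 0) n = Dd v n" by (simp add: Dd_def)
  then show ?thesis using kap_eq[OF assms] kap_eq[of "\<lambda>x. max (v x) 0" n] assms by simp
qed

lemma kap_cong:
  assumes "\<And>x. x \<in> X \<Longrightarrow> v x \<le> int n" "\<And>x. x \<in> X \<Longrightarrow> v x = w x" shows "kap v = kap w"
proof -
  have "lev v = lev w" by (rule lev_cong) (simp add: assms(2))
  then show ?thesis using kap_eq[of v n] kap_eq[of w n] assms by (simp add: Dd_def)
qed

lemma kap_add:
  assumes v: "\<And>x. x \<in> X \<Longrightarrow> 0 \<le> v x" "\<And>x. x \<in> X \<Longrightarrow> v x \<le> int n"
    and w: "\<And>x. x \<in> X \<Longrightarrow> 0 \<le> w x" "\<And>x. x \<in> X \<Longrightarrow> w x \<le> int m"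
  shows "kap (\<lambda>x. v x + w x) = kap v \<otimes>\<^bsub>K0 A\<^esub> kap w"
proof -
  have b: "v x + w x \<le> int (n + m)" if "x \<in> X" for x using v(2)[OF that] w(2)[OF that] by simp
  have "kap v \<otimes>\<^bsub>K0 A\<^esub> kap w = A.K0class (dsum A (Dd v n) (Dd w m)) (dsum A A.zero_proj A.zero_proj)"
  proof -
    have "kap v = A.K0class (Dd v n) A.zero_proj" "kap w = A.K0class (Dd w m) A.zero_proj"
      by (rule kap_eq, rule v(2), assumption, rule kap_eq, rule w(2), assumption)
    then show ?thesis
      using A.K0class_mult[OF Dd_projection[of v n] A.zero_projection Dd_projection[of w m] A.zero_projection] v w
      by simp
  qed
  also have "dsum A A.zero_proj A.zero_proj = A.zero_proj" by (rule A.dsum_zero[OF A.zero_projection])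
  also have "A.K0class (dsum A (Dd v n) (Dd w m)) A.zero_proj = A.K0class (Dd (\<lambda>x. v x + w x) (n + m)) A.zero_proj"
    by (rule A.K0class_cong[OF dsum_Dd[OF v w] A.mvn_refl[OF A.zero_projection]])
  finally show ?thesis using kap_eq[of "\<lambda>x. v x + w x", OF b] by simp
qed

text \<open>Equality of classes gives an equivalence after adding an identity of size k, that is,
  between the level sets of v + k and w + k; the constant disappears from the difference.\<close>

lemma kap_eq_imp_homologous:
  assumes v: "\<And>x. x \<in> X \<Longrightarrow> 0 \<le> v x" "\<And>x. x \<in> X \<Longrightarrow> v x \<le> int n"
    and w: "\<And>x. x \<in> X \<Longrightarrow> 0 \<le> w x" "\<And>x. x \<in> X \<Longrightarrow> w x \<le> int m"
    and eq: "kap v = kap w"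
  shows "homologous v w"
proof -
  have pv: "Dd v n \<in> projections A" by (rule Dd_projection[OF v(2)])
  have pw: "Dd w m \<in> projections A" by (rule Dd_projection[OF w(2)])
  note z = A.zero_projection
  have "A.K0class (Dd v n) A.zero_proj = A.K0class (Dd w m) A.zero_proj"
    using eq kap_eq[of v n] kap_eq[of w m] v(2) w(2) by simp
  from A.K0class_eq_mat_one[OF pv z pw z this]
  obtain k where k: "(dsum A (dsum A (Dd v n) A.zero_proj) (k, A.mat_one k),
      dsum A (dsum A (Dd w m) A.zero_proj) (k, A.mat_one k)) \<in> mvn_rel A" .
  then have "(dsum A (Dd v n) (Dd (\<lambda>_. int k) k), dsum A (Dd w m) (Dd (\<lambda>_. int k) k)) \<in> mvn_rel A"
    unfolding A.dsum_zero[OF pv] A.dsum_zero[OF pw] mat_one_Dd .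
  moreover have "(dsum A (Dd v n) (Dd (\<lambda>_. int k) k), Dd (\<lambda>x. v x + int k) (n + k)) \<in> mvn_rel A"
    by (rule dsum_Dd) (use v in auto)
  moreover have "(dsum A (Dd w m) (Dd (\<lambda>_. int k) k), Dd (\<lambda>x. w x + int k) (m + k)) \<in> mvn_rel A"
    by (rule dsum_Dd) (use w in auto)
  ultimately have "(Dd (\<lambda>x. v x + int k) (n + k), Dd (\<lambda>x. w x + int k) (m + k)) \<in> mvn_rel A"
    by (meson A.mvn_sym A.mvn_trans)
  then have "homologous (\<lambda>x. v x + int k) (\<lambda>x. w x + int k)"
    by (rule mvn_imp_homologous[rotated 4]) (use v w in auto)
  then show ?thesis by (simp add: homologous_def)
qed

lemma colsum_nonneg: "(\<And>x y. 0 \<le> g x y) \<Longrightarrow> 0 \<le> colsum g x"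
  unfolding colsum_def by (rule sum_nonneg) simp

text \<open>Reversing the negative entries of h gives a nonnegative chain g with the same boundary.
  Then v plus the row sums of g equals w plus the column sums, the row and column sums have equal
  classes by \<open>row_col_mvn\<close>, and these cancel in the group.\<close>

lemma homologous_imp_kap_eq:
  assumes v: "\<And>x. x \<in> X \<Longrightarrow> 0 \<le> v x" "\<And>x. x \<in> X \<Longrightarrow> v x \<le> int n"
    and w: "\<And>x. x \<in> X \<Longrightarrow> 0 \<le> w x" "\<And>x. x \<in> X \<Longrightarrow> w x \<le> int m"
    and hom: "homologous v w"
  shows "kap v = kap w"
proof -
  obtain h where h: "band h" "\<And>x. x \<in> X \<Longrightarrow> v x - w x = colsum h x - colsum (\<lambda>x y. h y x) x"
    using hom unfolding homologous_def by blast
  obtain C :: nat and R where C: "\<And>x y. \<bar>h x y\<bar> \<le> int C" and R: "\<And>x y. h x y \<noteq> 0 \<Longrightarrow> (x, y) \<in> strip R"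
    using band_intD[OF h(1)] by blast
  \<comment> \<open>The positive part of h plus the transposed negative part.\<close>
  define g where "g x y = max (h x y) 0 + max (- h y x) 0" for x y
  let ?gt = "\<lambda>x y. g y x"
  have g0: "0 \<le> g x y" for x y by (simp add: g_def)
  have gR: "(x, y) \<in> strip R" if "g x y \<noteq> 0" for x y
  proof -
    have "h x y \<noteq> 0 \<or> h y x \<noteq> 0" using that by (auto simp: g_def)
    then show ?thesis using R strip_sym by blast
  qed
  have gC: "\<bar>g x y\<bar> \<le> 2 * int C" for x y using C[of x y] C[of y x] by (simp add: g_def)
  have gb: "band g" by (rule band_intI[OF gC gR])
  have gtb: "band ?gt" by (rule band_swap[OF gb])
  have hR: "(x, y) \<in> strip R" if "h y x \<noteq> 0" for x y using R[OF that] strip_sym by blast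
  have gtR: "(x, y) \<in> strip R" if "g y x \<noteq> 0" for x y using gR[OF that] strip_sym by blast
  have diff: "v x + colsum ?gt x = w x + colsum g x" if x: "x \<in> X" for x
  proof -
    have "colsum g x - colsum ?gt x = (\<Sum>y\<in>mcball x R. g y x - g x y)"
      using colsum_ball[of g R x, OF gR] colsum_ball[of ?gt R x, OF gtR] by (simp add: sum_subtractf)
    also have "\<dots> = (\<Sum>y\<in>mcball x R. h y x - h x y)"
      by (rule sum.cong) (auto simp: g_def max_def)
    also have "\<dots> = colsum h x - colsum (\<lambda>x y. h y x) x"
      using colsum_ball[of h R x, OF R] colsum_ball[of "\<lambda>x y. h y x" R x, OF hR] by (simp add: sum_subtractf)
    finally show ?thesis using h(2)[OF x] by linarith
  qed
  obtain p q :: nat where p: "\<And>x. \<bar>colsum ?gt x\<bar> \<le> int p" and q: "\<And>x. \<bar>colsum g x\<bar> \<le> int q"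
    using colsum_bounded[OF gb] colsum_bounded[OF gtb] by blast
  have p': "colsum ?gt x \<le> int p" for x using p[of x] by linarith
  have q': "colsum g x \<le> int q" for x using q[of x] by linarith
  have n1: "0 \<le> colsum ?gt x" and n2: "0 \<le> colsum g x" for x by (simp_all add: colsum_nonneg g0)
  have eq: "kap (colsum ?gt) = kap (colsum g)"
    unfolding kap_eq[of "colsum ?gt" p, OF p'] kap_eq[of "colsum g" q, OF q']
    by (rule A.K0class_cong[OF row_col_mvn[OF gb g0 p' q'] A.mvn_refl[OF A.zero_projection]])
  have cv: "kap v \<in> carrier (K0 A)" and cw: "kap w \<in> carrier (K0 A)" and cg: "kap (colsum g) \<in> carrier (K0 A)"
    using kap_carrier[of v n] kap_carrier[of w m] kap_carrier[of "colsum g" q] v w q' by auto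
  have "kap v \<otimes>\<^bsub>K0 A\<^esub> kap (colsum g) = kap (\<lambda>x. v x + colsum ?gt x)"
    unfolding eq[symmetric] by (rule kap_add[symmetric]) (use v n1 p' in auto)
  also have "\<dots> = kap (\<lambda>x. w x + colsum g x)"
  proof (rule kap_cong[of _ "n + p", OF _ diff])
    show "v x + colsum ?gt x \<le> int (n + p)" if "x \<in> X" for x using v(2)[OF that] p'[of x] by simp
  qed
  also have "\<dots> = kap w \<otimes>\<^bsub>K0 A\<^esub> kap (colsum g)"
    by (rule kap_add) (use w n2 q' in auto)
  finally show ?thesis using cv cw cg by simp
qed

text \<open>The comparison map on representatives, before passing to the quotient.\<close>

definition Phi :: "('a filter \<Rightarrow> int) \<Rightarrow> _" where
  "Phi f = K0_map A (unit_inclusion G) (cfun_to_K0 (unit_space G) f)"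

abbreviation fr :: "('a filter \<Rightarrow> int) \<Rightarrow> 'a \<Rightarrow> int" where "fr f \<equiv> \<lambda>x. f (principal {x})"

sublocale H: star_hom "cfun_algebra (stone_cech X)" "reduced_algebra (coarse_groupoid X d)"
    "unit_inclusion (coarse_groupoid X d)"
  by (rule star_hom_unit_inclusion)

lemma rank_proj_image:
  fixes f :: "'a filter \<Rightarrow> int"
  assumes f: "f \<in> cfun (stone_cech X)"
  shows "\<exists>n p. rank_proj (stone_cech X) f = (n, p) \<and> (n, p) \<in> projections (cfun_algebra (stone_cech X)) \<and>
    (\<forall>u. f u \<le> int n) \<and> (n, H.mat_map p) = Dd (fr f) n"
proof -
  obtain n where n: "\<forall>u. f u \<le> int n" and rp: "rank_proj (stone_cech X) f
    = (n, \<lambda>i j. if i = j \<and> i < n then (\<lambda>u. if u \<in> bX \<and> int i < f u then 1 else 0) else (\<lambda>_. 0))"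
    using rank_proj_bound[OF f] by blast
  let ?e = "\<lambda>i u. if u \<in> bX \<and> int i < f u then 1 else 0 :: complex"
  let ?p = "\<lambda>i j. if i = j \<and> i < n then ?e i else (\<lambda>_. 0)"
  have z: "\<zero>\<^bsub>cfun_algebra (stone_cech X)\<^esub> = (\<lambda>_. 0)" by (simp add: cfun_algebra_def)
  have pr: "(n, ?p) \<in> projections (cfun_algebra (stone_cech X))"
  proof -
    have "?e i \<in> carrier (cfun_algebra (stone_cech X))" "star (cfun_algebra (stone_cech X)) (?e i) = ?e i"
      "?e i \<otimes>\<^bsub>cfun_algebra (stone_cech X)\<^esub> ?e i = ?e i" for i
      using cfun_level_indicator[OF f] by (auto simp: cfun_algebra_def fun_eq_iff)
    then show ?thesis using H.A.diagonal_projection[of n ?e] by (simp only: z)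
  qed
  have "unit_inclusion G (?e i) = Pi (diag (chi (lev (fr f)) i))" for i
    unfolding unit_inclusion_diag[OF cfun_level_indicator[OF f]]
    by (rule Pi_cong_diag) (simp add: chi_def lev_def principal_in_stone_cech)
  then have "H.mat_map ?p = dproj n (lev (fr f))"
    using H.hom_zero by (auto simp: H.mat_map_def dproj_entry fun_eq_iff z A_ops)
  then show ?thesis using n rp pr by (intro exI[of _ n] exI[of _ ?p]) (simp add: Dd_def)
qed

lemma Phi_K0class:
  assumes f: "f \<in> cfun (stone_cech X)"
  shows "\<exists>n m. (\<forall>u. f u \<le> int n) \<and> (\<forall>u. - f u \<le> int m) \<and>
    Phi f = A.K0class (Dd (fr f) n) (Dd (\<lambda>x. - fr f x) m)"
proof -
  obtain n p where p: "rank_proj (stone_cech X) f = (n, p)" "(n, p) \<in> projections (cfun_algebra (stone_cech X))"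
    "\<forall>u. f u \<le> int n" "(n, H.mat_map p) = Dd (fr f) n" using rank_proj_image[OF f] by blast
  obtain m q where q: "rank_proj (stone_cech X) (\<lambda>u. - f u) = (m, q)" "(m, q) \<in> projections (cfun_algebra (stone_cech X))"
    "\<forall>u. - f u \<le> int m" "(m, H.mat_map q) = Dd (\<lambda>x. - fr f x) m"
    using rank_proj_image[OF cfun_int_uminus[OF f]] by blast
  have "cfun_to_K0 (stone_cech X) f = H.A.K0class (n, p) (m, q)"
    unfolding cfun_to_K0_def H.A.K0class_def p(1) q(1) ..
  then have "Phi f = A.K0class (n, H.mat_map p) (m, H.mat_map q)"
    unfolding Phi_def G_simps by (simp only: H.K0_map_K0class[OF p(2) q(2)])
  then show ?thesis using p q by auto
qed

lemma fr_bounds: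
  assumes f: "f \<in> cfun (stone_cech X)"
  obtains n where "\<And>x. fr f x \<le> int n" "\<And>x. - fr f x \<le> int n"
proof -
  obtain n :: nat where n: "\<And>u. \<bar>f u\<bar> \<le> int n" using cfun_int_bounded[OF f] by blast
  show ?thesis
  proof (rule that)
    show "fr f x \<le> int n" "- fr f x \<le> int n" for x using n[of "principal {x}"] by linarith+
  qed
qed

lemma Phi_kap:
  assumes f: "f \<in> cfun (stone_cech X)"
  shows "Phi f = kap (\<lambda>x. max (fr f x) 0) \<otimes>\<^bsub>K0 A\<^esub> inv\<^bsub>K0 A\<^esub> kap (\<lambda>x. max (- fr f x) 0)"
proof -
  obtain n m where nm: "\<forall>u. f u \<le> int n" "\<forall>u. - f u \<le> int m"
    "Phi f = A.K0class (Dd (fr f) n) (Dd (\<lambda>x. - fr f x) m)" using Phi_K0class[OF f] by blast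
  have 1: "fr f x \<le> int n" and 2: "- fr f x \<le> int m" for x using nm by auto
  have "Phi f = A.K0class (Dd (fr f) n) A.zero_proj \<otimes>\<^bsub>K0 A\<^esub> inv\<^bsub>K0 A\<^esub> A.K0class (Dd (\<lambda>x. - fr f x) m) A.zero_proj"
    unfolding nm(3) by (rule A.K0class_split) (intro Dd_projection 1 2)+
  then show ?thesis
    using kap_eq[of "fr f" n, OF 1] kap_eq[of "\<lambda>x. - fr f x" m, OF 2]
      kap_max[of "fr f" n, OF 1] kap_max[of "\<lambda>x. - fr f x" m, OF 2] by simp
qed

lemma Phi_carrier:
  assumes f: "f \<in> cfun (stone_cech X)" shows "Phi f \<in> carrier (K0 A)"
proof -
  obtain n m where nm: "\<forall>u. f u \<le> int n" "\<forall>u. - f u \<le> int m"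
    "Phi f = A.K0class (Dd (fr f) n) (Dd (\<lambda>x. - fr f x) m)" using Phi_K0class[OF f] by blast
  show ?thesis unfolding nm(3) by (intro A.K0class_carrier Dd_projection) (use nm in auto)
qed

text \<open>Positive and negative parts are not additive, but (f + g)+ + f- + g- = f+ + g+ + (f +
  g)-. Both sides are sums of nonnegative functions, on which \<open>kap\<close> is
  additive.\<close>

lemma Phi_add:
  assumes f: "f \<in> cfun (stone_cech X)" and g: "g \<in> cfun (stone_cech X)"
  shows "Phi (\<lambda>u. f u + g u) = Phi f \<otimes>\<^bsub>K0 A\<^esub> Phi g"
proof -
  obtain n where n: "\<And>x. fr f x \<le> int n" "\<And>x. - fr f x \<le> int n" by (rule fr_bounds[OF f]) blast
  obtain m where m: "\<And>x. fr g x \<le> int m" "\<And>x. - fr g x \<le> int m" by (rule fr_bounds[OF g]) blast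
  define p where "p v x = max (v x) 0" for v :: "'a \<Rightarrow> int" and x
  let ?F = "fr f" and ?G = "fr g" and ?S = "\<lambda>x. fr f x + fr g x"
  let ?nF = "\<lambda>x. - fr f x" and ?nG = "\<lambda>x. - fr g x" and ?nS = "\<lambda>x. - (fr f x + fr g x)"
  have p0: "0 \<le> p v x" for v x by (simp add: p_def)
  have bF: "p ?F x \<le> int n" "p ?nF x \<le> int n" and bG: "p ?G x \<le> int m" "p ?nG x \<le> int m"
    and bS: "p ?S x \<le> int (n + m)" "p ?nS x \<le> int (n + m)" for x
    using n[of x] m[of x] by (simp_all add: p_def)
  note k = kap_carrier[of "p ?F" n, OF bF(1)] kap_carrier[of "p ?nF" n, OF bF(2)]
    kap_carrier[of "p ?G" m, OF bG(1)] kap_carrier[of "p ?nG" m, OF bG(2)]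
    kap_carrier[of "p ?S" "n + m", OF bS(1)] kap_carrier[of "p ?nS" "n + m", OF bS(2)]
  have aG: "kap (\<lambda>x. p ?nF x + p ?nG x) = kap (p ?nF) \<otimes>\<^bsub>K0 A\<^esub> kap (p ?nG)"
    by (rule kap_add[OF p0 bF(2) p0 bG(2)])
  have aF: "kap (\<lambda>x. p ?F x + p ?G x) = kap (p ?F) \<otimes>\<^bsub>K0 A\<^esub> kap (p ?G)"
    by (rule kap_add[OF p0 bF(1) p0 bG(1)])
  have b1: "p ?nF x + p ?nG x \<le> int (n + m)" and b2: "p ?F x + p ?G x \<le> int (n + m)" for x
    using bF[of x] bG[of x] by simp_all
  have 1: "kap (\<lambda>x. p ?S x + (p ?nF x + p ?nG x)) = kap (p ?S) \<otimes>\<^bsub>K0 A\<^esub> (kap (p ?nF) \<otimes>\<^bsub>K0 A\<^esub> kap (p ?nG))"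
    unfolding aG[symmetric]
    by (rule kap_add[where n = "n + m" and m = "n + m"]) (use p0 bS b1 in \<open>auto simp del: of_nat_add intro: add_nonneg_nonneg\<close>)
  have 2: "kap (\<lambda>x. (p ?F x + p ?G x) + p ?nS x) = (kap (p ?F) \<otimes>\<^bsub>K0 A\<^esub> kap (p ?G)) \<otimes>\<^bsub>K0 A\<^esub> kap (p ?nS)"
    unfolding aF[symmetric]
    by (rule kap_add[where n = "n + m" and m = "n + m"]) (use p0 bS b2 in \<open>auto simp del: of_nat_add intro: add_nonneg_nonneg\<close>)
  have "(\<lambda>x. p ?S x + (p ?nF x + p ?nG x)) = (\<lambda>x. (p ?F x + p ?G x) + p ?nS x)"
    by (auto simp: p_def max_def fun_eq_iff)
  then have eq: "kap (p ?S) \<otimes>\<^bsub>K0 A\<^esub> (kap (p ?nF) \<otimes>\<^bsub>K0 A\<^esub> kap (p ?nG))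
      = (kap (p ?F) \<otimes>\<^bsub>K0 A\<^esub> kap (p ?G)) \<otimes>\<^bsub>K0 A\<^esub> kap (p ?nS)" using 1 2 by simp
  have "Phi (\<lambda>u. f u + g u) = kap (p ?S) \<otimes>\<^bsub>K0 A\<^esub> inv\<^bsub>K0 A\<^esub> kap (p ?nS)"
    unfolding Phi_kap[OF cfun_int_add[OF f g]] p_def ..
  also have "\<dots> = (kap (p ?F) \<otimes>\<^bsub>K0 A\<^esub> kap (p ?G)) \<otimes>\<^bsub>K0 A\<^esub> inv\<^bsub>K0 A\<^esub> (kap (p ?nF) \<otimes>\<^bsub>K0 A\<^esub> kap (p ?nG))"
    using eq k by (subst K.div_eq_iff) auto
  also have "\<dots> = (kap (p ?F) \<otimes>\<^bsub>K0 A\<^esub> inv\<^bsub>K0 A\<^esub> kap (p ?nF)) \<otimes>\<^bsub>K0 A\<^esub> (kap (p ?G) \<otimes>\<^bsub>K0 A\<^esub> inv\<^bsub>K0 A\<^esub> kap (p ?nG))"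
    using k by (simp add: K.inv_mult K.m_ac)
  also have "\<dots> = Phi f \<otimes>\<^bsub>K0 A\<^esub> Phi g" unfolding Phi_kap[OF f] Phi_kap[OF g] p_def ..
  finally show ?thesis .
qed

text \<open>The class is trivial iff the positive and negative parts of f have equal
  \<open>kap\<close>, and for nonnegative functions that is being homologous.\<close>

lemma Phi_one_iff:
  assumes f: "f \<in> cfun (stone_cech X)"
  shows "Phi f = \<one>\<^bsub>K0 A\<^esub> \<longleftrightarrow> homologous (fr f) (\<lambda>_. 0)"
proof -
  obtain n where n: "\<And>x. fr f x \<le> int n" "\<And>x. - fr f x \<le> int n" by (rule fr_bounds[OF f]) blast
  let ?p = "\<lambda>x. max (fr f x) 0" and ?q = "\<lambda>x. max (- fr f x) 0"
  have b: "?p x \<le> int n" "?q x \<le> int n" "0 \<le> ?p x" "0 \<le> ?q x" for x using n[of x] by simp_all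
  have k: "kap ?p \<in> carrier (K0 A)" "kap ?q \<in> carrier (K0 A)"
    using kap_carrier[of ?p n, OF b(1)] kap_carrier[of ?q n, OF b(2)] by auto
  have "Phi f = \<one>\<^bsub>K0 A\<^esub> \<longleftrightarrow> kap ?p \<otimes>\<^bsub>K0 A\<^esub> inv\<^bsub>K0 A\<^esub> kap ?q = \<one>\<^bsub>K0 A\<^esub> \<otimes>\<^bsub>K0 A\<^esub> inv\<^bsub>K0 A\<^esub> \<one>\<^bsub>K0 A\<^esub>"
    unfolding Phi_kap[OF f] by simp
  also have "\<dots> \<longleftrightarrow> kap ?p = kap ?q"
    using k by (subst K.div_eq_iff) auto
  also have "\<dots> \<longleftrightarrow> homologous ?p ?q"
    by (rule iffI, erule kap_eq_imp_homologous[rotated 4, of ?p ?q n n], (rule b)+,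
        erule homologous_imp_kap_eq[rotated 4, of ?p ?q n n], (rule b)+)
  also have "\<dots> \<longleftrightarrow> homologous (fr f) (\<lambda>_. 0)"
  proof -
    have "?p x - ?q x = fr f x - 0" for x by simp
    then show ?thesis unfolding homologous_def by presburger
  qed
  finally show ?thesis .
qed

abbreviation Z where "Z \<equiv> cfun_group (stone_cech X)"

lemma Z_simps: "carrier Z = cfun (stone_cech X)" "f \<otimes>\<^bsub>Z\<^esub> g = (\<lambda>u. f u + g u)" "\<one>\<^bsub>Z\<^esub> = (\<lambda>_. 0)"
  by (simp_all add: cfun_group_def)

lemma Phi_hom: "Phi \<in> hom Z (K0 A)"
  by (rule homI) (simp_all add: Z_simps Phi_carrier Phi_add)

sublocale P: group_hom "cfun_group (stone_cech X)" "K0 (reduced_algebra (coarse_groupoid X d))" Phi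
  using Phi_hom cfun_group_comm_group comm_group.axioms(2) K.is_group
  by (auto simp: group_hom_def group_hom_axioms_def)

lemma sc_ext_colsum:
  fixes h :: "'a \<Rightarrow> 'a \<Rightarrow> int"
  assumes "band h" shows "sc_ext X (colsum h) \<in> cfun (stone_cech X)"
proof -
  obtain n :: nat where n: "\<forall>x. \<bar>colsum h x\<bar> \<le> int n" using colsum_bounded[OF assms] by blast
  show ?thesis
  proof (rule sc_ext_cfun[of "{-int n..int n}"])
    show "compact {-int n..int n}" by (rule finite_imp_compact) simp
    show "colsum h x \<in> {-int n..int n}" for x using n[rule_format, of x] by auto
  qed
qed

text \<open>Boundaries die in \<open>K0\<close> and nothing else does: the first makes the
  comparison map well defined on \<open>H0 G\<close>, the second makes it injective.\<close>

lemma kernel_Phi: "kernel Z (K0 A) Phi = H0_boundaries G"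
proof (intro equalityI subsetI)
  fix f assume "f \<in> kernel Z (K0 A) Phi"
  then have f: "f \<in> cfun (stone_cech X)" "Phi f = \<one>\<^bsub>K0 A\<^esub>" by (auto simp: kernel_def Z_simps)
  then obtain h where h: "band h" "\<And>x. x \<in> X \<Longrightarrow> fr f x - 0 = colsum h x - colsum (\<lambda>x y. h y x) x"
    using Phi_one_iff[OF f(1)] unfolding homologous_def by blast
  let ?b = "\<lambda>u. sc_ext X (colsum h) u - sc_ext X (colsum (\<lambda>x y. h y x)) u"
  have "?b \<in> cfun (stone_cech X)"
    using cfun_int_add[OF sc_ext_colsum[OF h(1)] cfun_int_uminus[OF sc_ext_colsum[OF band_swap[OF h(1)]]]] by simp
  then have "f = ?b"
    by (rule cfun_stone_cech_eqI[OF f(1)]) (use h(2) in \<open>simp add: sc_ext_principal\<close>)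
  then show "f \<in> H0_boundaries G" unfolding H0_boundaries_coarse using h(1) by blast
next
  fix f assume "f \<in> H0_boundaries G"
  then obtain h where h: "band h" "f = (\<lambda>u. sc_ext X (colsum h) u - sc_ext X (colsum (\<lambda>x y. h y x)) u)"
    unfolding H0_boundaries_coarse by blast
  have f: "f \<in> cfun (stone_cech X)" unfolding h(2)
    using cfun_int_add[OF sc_ext_colsum[OF h(1)] cfun_int_uminus[OF sc_ext_colsum[OF band_swap[OF h(1)]]]] by simp
  have "homologous (fr f) (\<lambda>_. 0)"
    unfolding homologous_def h(2) using h(1) by (intro exI[of _ h]) (simp add: sc_ext_principal)
  then show "f \<in> kernel Z (K0 A) Phi" using f Phi_one_iff[OF f] by (simp add: kernel_def Z_simps)
qed

lemma H0_eq: "H0 G = Z Mod kernel Z (K0 A) Phi"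
  unfolding kernel_Phi H0_def G_simps ..

lemma comparison_map_eq: "comparison_map G = (\<lambda>c. the_elem (Phi ` c))"
  unfolding comparison_map_def Phi_def ..

lemma comparison_map_hom: "comparison_map G \<in> hom (H0 G) (K0 A)"
  unfolding H0_eq comparison_map_eq by (rule P.FactGroup_hom)

lemma comparison_map_inj: "inj_on (comparison_map G) (carrier (H0 G))"
  unfolding H0_eq comparison_map_eq by (rule P.FactGroup_inj_on)

lemma comparison_map_coset:
  assumes f: "f \<in> cfun (stone_cech X)"
  shows "kernel Z (K0 A) Phi #>\<^bsub>Z\<^esub> f \<in> carrier (H0 G)" "comparison_map G (kernel Z (K0 A) Phi #>\<^bsub>Z\<^esub> f) = Phi f"
proof -
  let ?N = "kernel Z (K0 A) Phi"
  have fc: "f \<in> carrier Z" using f by (simp add: Z_simps)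
  show "?N #>\<^bsub>Z\<^esub> f \<in> carrier (H0 G)"
    unfolding H0_eq FactGroup_def using fc by (auto simp: RCOSETS_def)
  have "Phi ` (?N #>\<^bsub>Z\<^esub> f) = {Phi f}"
  proof (intro equalityI subsetI)
    fix y assume "y \<in> Phi ` (?N #>\<^bsub>Z\<^esub> f)"
    then obtain k where k: "k \<in> ?N" "y = Phi (k \<otimes>\<^bsub>Z\<^esub> f)" unfolding r_coset_def by blast
    then show "y \<in> {Phi f}" using fc by (simp add: kernel_def)
  next
    fix y assume "y \<in> {Phi f}"
    moreover have "f \<in> ?N #>\<^bsub>Z\<^esub> f" using P.subgroup_kernel fc by (rule P.rcos_self[rotated])
    ultimately show "y \<in> Phi ` (?N #>\<^bsub>Z\<^esub> f)" by blast
  qed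
  then show "comparison_map G (?N #>\<^bsub>Z\<^esub> f) = Phi f" unfolding comparison_map_eq by simp
qed

lemma H0_cases:
  assumes "c \<in> carrier (H0 G)"
  obtains f where "f \<in> cfun (stone_cech X)" "c = kernel Z (K0 A) Phi #>\<^bsub>Z\<^esub> f"
  using assms unfolding H0_eq FactGroup_def by (auto simp: RCOSETS_def Z_simps)

lemma comparison_map_image: "comparison_map G ` carrier (H0 G) = Phi ` carrier Z"
proof (intro equalityI subsetI)
  fix y assume "y \<in> comparison_map G ` carrier (H0 G)"
  then obtain c where c: "c \<in> carrier (H0 G)" "y = comparison_map G c" by blast
  obtain f where "f \<in> cfun (stone_cech X)" "c = kernel Z (K0 A) Phi #>\<^bsub>Z\<^esub> f" by (rule H0_cases[OF c(1)])
  then show "y \<in> Phi ` carrier Z" using c(2) comparison_map_coset(2) by (simp add: Z_simps)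
next
  fix y assume "y \<in> Phi ` carrier Z"
  then obtain f where "f \<in> cfun (stone_cech X)" "y = Phi f" by (auto simp: Z_simps)
  then show "y \<in> comparison_map G ` carrier (H0 G)"
    using comparison_map_coset[of f] by (metis imageI)
qed

lemma H0_group: "group (H0 G)"
  unfolding H0_eq by (rule normal.factorgroup_is_group[OF P.normal_kernel])

text \<open>Injectivity identifies \<open>H0 G\<close> with the image of \<open>Phi\<close>, so a
  retraction onto the image can be followed by the inverse of the comparison map.\<close>

lemma split_of_retraction:
  assumes r: "r \<in> hom (K0 A) (K0 A)" "\<And>x. x \<in> carrier (K0 A) \<Longrightarrow> r x \<in> Phi ` carrier Z"
    "\<And>f. f \<in> carrier Z \<Longrightarrow> r (Phi f) = Phi f"
  shows "\<exists>\<rho> \<in> hom (K0 A) (H0 G). \<forall>c \<in> carrier (H0 G). \<rho> (comparison_map G c) = c"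
proof -
  interpret HG: group "H0 G" by (rule H0_group)
  let ?c = "comparison_map G"
  define \<rho> where "\<rho> x = inv_into (carrier (H0 G)) ?c (r x)" for x
  have im: "r x \<in> ?c ` carrier (H0 G)" if "x \<in> carrier (K0 A)" for x
    using r(2)[OF that] comparison_map_image by simp
  have \<rho>c: "\<rho> x \<in> carrier (H0 G)" and c\<rho>: "?c (\<rho> x) = r x" if "x \<in> carrier (K0 A)" for x
    unfolding \<rho>_def using inv_into_into[OF im[OF that]] f_inv_into_f[OF im[OF that]] by auto
  have "\<rho> \<in> hom (K0 A) (H0 G)"
  proof (rule homI)
    fix x y assume xy: "x \<in> carrier (K0 A)" "y \<in> carrier (K0 A)"
    show "\<rho> x \<in> carrier (H0 G)" by (rule \<rho>c[OF xy(1)])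
    have "?c (\<rho> x \<otimes>\<^bsub>H0 G\<^esub> \<rho> y) = ?c (\<rho> x) \<otimes>\<^bsub>K0 A\<^esub> ?c (\<rho> y)"
      by (rule hom_mult[OF comparison_map_hom \<rho>c[OF xy(1)] \<rho>c[OF xy(2)]])
    also have "\<dots> = r (x \<otimes>\<^bsub>K0 A\<^esub> y)" using c\<rho> xy hom_mult[OF r(1) xy] by simp
    also have "\<dots> = ?c (\<rho> (x \<otimes>\<^bsub>K0 A\<^esub> y))" using c\<rho> xy by simp
    finally show "\<rho> (x \<otimes>\<^bsub>K0 A\<^esub> y) = \<rho> x \<otimes>\<^bsub>H0 G\<^esub> \<rho> y"
      using inj_onD[OF comparison_map_inj] \<rho>c xy by (metis HG.m_closed K.m_closed)
  qed
  moreover have "\<rho> (?c c) = c" if c: "c \<in> carrier (H0 G)" for c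
  proof -
    obtain f where f: "f \<in> carrier Z" "?c c = Phi f" using c comparison_map_image by blast
    then have "r (?c c) = ?c c" using r(3) by simp
    then show ?thesis unfolding \<rho>_def using comparison_map_inj c by simp
  qed
  ultimately show ?thesis by blast
qed

section \<open>Splitting\<close>

text \<open>The boundary operator with the summation range fixed to a ball. It is linear in h
  without any bound on the coefficients, as the chains for finite subproblems require.\<close>

definition bd :: "real \<Rightarrow> ('a \<Rightarrow> 'a \<Rightarrow> int) \<Rightarrow> 'a \<Rightarrow> int" where
  "bd R h x = (\<Sum>y\<in>mcball x R. h y x - h x y)"

lemma bd_colsum:
  assumes "\<And>x y. h x y \<noteq> 0 \<Longrightarrow> (x, y) \<in> strip R"
  shows "colsum h x - colsum (\<lambda>x y. h y x) x = bd R h x"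
proof -
  have t: "(x, y) \<in> strip R" if "h y x \<noteq> 0" for x y using assms[OF that] strip_sym by blast
  show ?thesis
    using colsum_ball[of h R x, OF assms] colsum_ball[of "\<lambda>x y. h y x" R x, OF t]
    by (simp add: bd_def sum_subtractf)
qed

lemma bd_add: "bd R (\<lambda>a b. h a b + c * k a b) x = bd R h x + c * bd R k x"
  unfolding bd_def by (simp add: sum_distrib_left sum.distrib[symmetric] algebra_simps)

lemma bd_edge:
  assumes ab: "(a, b) \<in> strip R"
  shows "bd R (\<lambda>s t. if s = b \<and> t = a then 1 else 0) x = (if x = a then 1 else 0) - (if x = b then 1 else 0)"
proof -
  have "bd R (\<lambda>s t. if s = b \<and> t = a then 1 else 0) x
      = (\<Sum>y\<in>mcball x R. (if y = b then (if x = a then 1 else 0) else 0)) - (\<Sum>y\<in>mcball x R. (if y = a then (if x = b then 1 else 0) else 0))"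
    unfolding bd_def sum_subtractf[symmetric] by (rule sum.cong) auto
  also have "\<dots> = (if b \<in> mcball x R then (if x = a then 1 else 0) else 0) - (if a \<in> mcball x R then (if x = b then 1 else 0) else 0)"
    by (simp only: sum.delta[OF finite_ball])
  also have "\<dots> = (if x = a then 1 else 0) - (if x = b then 1 else 0)"
    using ab strip_sym[of a b R] by (auto simp: strip_def)
  finally show ?thesis .
qed

lemma path_flow:
  assumes "\<And>i. i \<le> N \<Longrightarrow> p i \<in> X" "\<And>i. i < N \<Longrightarrow> d (p i) (p (Suc i)) \<le> R"
  shows "\<exists>h. (\<forall>s t. h s t \<noteq> 0 \<longrightarrow> (s, t) \<in> strip R) \<and>
    (\<forall>x. bd R h x = (if x = p 0 then 1 else 0) - (if x = p N then 1 else 0))"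
  using assms
proof (induction N)
  case 0
  then show ?case by (intro exI[of _ "\<lambda>_ _. 0"]) (simp add: bd_def)
next
  case (Suc N)
  obtain h where h: "\<forall>s t. h s t \<noteq> 0 \<longrightarrow> (s, t) \<in> strip R"
    "\<forall>x. bd R h x = (if x = p 0 then 1 else 0) - (if x = p N then 1 else 0)"
    using Suc by fastforce
  have e: "(p N, p (Suc N)) \<in> strip R" using Suc.prems by (simp add: strip_def)
  let ?e = "\<lambda>s t. if s = p (Suc N) \<and> t = p N then 1 else 0 :: int"
  have "\<forall>x. bd R (\<lambda>s t. h s t + 1 * ?e s t) x = (if x = p 0 then 1 else 0) - (if x = p (Suc N) then 1 else 0)"
    unfolding bd_add bd_edge[OF e] using h(2) by simp
  moreover have "\<forall>s t. h s t + 1 * ?e s t \<noteq> 0 \<longrightarrow> (s, t) \<in> strip R"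
    using h(1) e strip_sym[of "p N" "p (Suc N)" R] by auto
  ultimately show ?case by (intro exI conjI)
qed

text \<open>The points of F are corrected one at a time by pushing the defect along a path to a
  point outside F, which exists because X is infinite. The coefficients may grow with F.\<close>

lemma solve_finite:
  assumes inf: "infinite X" and conn: "\<And>x y. x \<in> X \<Longrightarrow> y \<in> X \<Longrightarrow>
      \<exists>h. (\<forall>s t. h s t \<noteq> 0 \<longrightarrow> (s, t) \<in> strip R) \<and> (\<forall>z. bd R h z = (if z = x then 1 else 0) - (if z = y then 1 else 0))"
    and F: "finite F" "F \<subseteq> X"
  shows "\<exists>h. (\<forall>s t. h s t \<noteq> 0 \<longrightarrow> (s, t) \<in> strip R) \<and> (\<forall>x\<in>F. bd R h x = v x)"
  using F
proof (induction F rule: finite_induct)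
  case empty
  then show ?case by (intro exI[of _ "\<lambda>_ _. 0"]) simp
next
  case (insert a F)
  obtain h where h: "\<forall>s t. h s t \<noteq> 0 \<longrightarrow> (s, t) \<in> strip R" "\<forall>x\<in>F. bd R h x = v x"
    using insert by auto
  obtain y where y: "y \<in> X" "y \<notin> insert a F"
    using inf insert.hyps(1) by (metis finite_insert finite_subset subsetI)
  have "a \<in> X" using insert.prems by simp
  from conn[OF this y(1)] obtain k where k: "\<forall>s t. k s t \<noteq> 0 \<longrightarrow> (s, t) \<in> strip R"
    "\<forall>z. bd R k z = (if z = a then 1 else 0) - (if z = y then 1 else 0)"
    by (elim exE conjE)
  \<comment> \<open>The multiple of the path from a to y that makes the value at a correct; values
    on F are unchanged since neither end of the path lies in F.\<close>
  let ?h = "\<lambda>s t. h s t + (v a - bd R h a) * k s t"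
  have "\<forall>x\<in>insert a F. bd R ?h x = v x"
    unfolding bd_add using h(2) k(2) y(2) insert.hyps(2) by auto
  moreover have "(s, t) \<in> strip R" if nz: "?h s t \<noteq> 0" for s t
  proof -
    have "h s t \<noteq> 0 \<or> k s t \<noteq> 0" using nz by auto
    then show ?thesis using h(1) k(1) by blast
  qed
  ultimately show ?case by (intro exI conjI allI impI)
qed

text \<open>Modulo \<open>n\<close> the bounding chains of the finite subproblems can be taken with coefficients in
  \<open>{0..<n}\<close>, so that compactness applies.\<close>

lemma divisible:
  assumes cc: "coarsely_connected X d" and inf: "infinite X \<or> X = {}" and n: "n > 0"
    and v: "\<And>x. \<bar>v x\<bar> \<le> int B"
  shows "\<exists>g B'. (\<forall>x. \<bar>g x\<bar> \<le> int B') \<and> homologous v (\<lambda>x. int n * g x)"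
proof (cases "X = {}")
  case True
  have "band (\<lambda>_ _. 0 :: int)" by (rule band_intI[of _ 0 0]) auto
  then have "homologous v (\<lambda>x. int n * 0)" unfolding homologous_def
  proof (intro exI conjI ballI)
    fix x assume "x \<in> X"
    then show "v x - int n * 0 = colsum (\<lambda>_ _. 0) x - colsum (\<lambda>x y. 0) x" using True by blast
  qed
  then show ?thesis by (intro exI[of _ "\<lambda>_. 0"] exI[of _ 0]) simp
next
  case False
  then have infX: "infinite X" using inf by blast
  obtain R where R: "R \<ge> 0" "\<forall>x\<in>X. \<forall>y\<in>X. \<exists>(n::nat) (p::nat \<Rightarrow> 'a).
        p 0 = x \<and> p (Suc n) = y \<and> (\<forall>i\<le>Suc n. p i \<in> X) \<and> (\<forall>i\<le>n. d (p i) (p (Suc i)) \<le> R)"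
    using cc unfolding coarsely_connected_def by blast
  have conn: "\<exists>h. (\<forall>s t. h s t \<noteq> 0 \<longrightarrow> (s, t) \<in> strip R) \<and> (\<forall>z. bd R h z = (if z = x then 1 else 0) - (if z = y then 1 else 0))"
    if xy: "x \<in> X" "y \<in> X" for x y
  proof -
    obtain N :: nat and p where p: "p 0 = x" "p (Suc N) = y" "\<forall>i\<le>Suc N. p i \<in> X" "\<forall>i\<le>N. d (p i) (p (Suc i)) \<le> R"
      using R(2)[rule_format, OF xy] by blast
    from path_flow[of "Suc N" p R] p show ?thesis by auto
  qed
  have "\<exists>h. finite F \<longrightarrow> F \<subseteq> X \<longrightarrow> (\<forall>s t. h s t \<noteq> 0 \<longrightarrow> (s, t) \<in> strip R) \<and> (\<forall>x\<in>F. bd R h x = v x)" for F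
  proof (cases "finite F \<and> F \<subseteq> X")
    case True
    then have "\<exists>h. (\<forall>s t. h s t \<noteq> 0 \<longrightarrow> (s, t) \<in> strip R) \<and> (\<forall>x\<in>F. bd R h x = v x)"
      by (intro solve_finite[OF infX conn]) simp_all
    then show ?thesis by (elim exE) (intro exI impI)
  qed simp
  then obtain h where h: "\<And>F s t. finite F \<Longrightarrow> F \<subseteq> X \<Longrightarrow> h F s t \<noteq> 0 \<Longrightarrow> (s, t) \<in> strip R"
    "\<And>F x. finite F \<Longrightarrow> F \<subseteq> X \<Longrightarrow> x \<in> F \<Longrightarrow> bd R (h F) x = v x" by metis
  \<comment> \<open>The chains h F have no common bound as F grows, but their residues do, and
    divisibility by n only depends on residues.\<close>
  define q where "q F e = h F (fst e) (snd e) mod int n" for F e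
  have qV: "q F e \<in> {0..<int n}" for F e using n by (simp add: q_def)
  obtain k where k: "\<And>e. k e \<in> {0..<int n}"
    and lim: "\<And>D F0. finite D \<Longrightarrow> finite F0 \<Longrightarrow> F0 \<subseteq> X \<Longrightarrow>
      \<exists>F. finite F \<and> F0 \<subseteq> F \<and> F \<subseteq> X \<and> (\<forall>e\<in>D. k e = q F e)"
    using finite_solutions_limit[of "{0..<int n}" q X, OF _ qV] by auto
  define K where "K s t = k (s, t)" for s t
  \<comment> \<open>The residue of zero is zero, so a nonzero entry of the limit comes from a
    nonzero entry of some h F.\<close>
  have KR: "(s, t) \<in> strip R" if nz: "K s t \<noteq> 0" for s t
  proof -
    obtain F where F: "finite F" "F \<subseteq> X" "k (s, t) = q F (s, t)" using lim[of "{(s, t)}" "{}"] by auto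
    then have "h F s t \<noteq> 0" using nz by (auto simp: K_def q_def)
    then show ?thesis by (rule h(1)[OF F(1,2)])
  qed
  have Kn: "\<bar>K s t\<bar> \<le> int n" for s t using k[of "(s, t)"] by (simp add: K_def)
  have Kb: "band K" by (rule band_intI[OF Kn KR])
  \<comment> \<open>The boundary at x involves only the finitely many entries in ?D. Some F
    containing x agrees there with the limit modulo n, and for that F the boundary at x is exactly v
    x.\<close>
  have dvd: "int n dvd v x - bd R K x" if x: "x \<in> X" for x
  proof -
    let ?D = "{x} \<times> mcball x R \<union> mcball x R \<times> {x}"
    have "finite ?D" using finite_ball by simp
    then obtain F where F: "finite F" "x \<in> F" "F \<subseteq> X" "\<forall>e\<in>?D. k e = q F e"
      using lim[of ?D "{x}"] x by auto
    have "v x - bd R K x = (\<Sum>y\<in>mcball x R. (h F y x - h F x y) - (K y x - K x y))"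
      unfolding h(2)[OF F(1,3,2), symmetric] by (simp add: bd_def sum_subtractf)
    also have "int n dvd \<dots>"
    proof (rule dvd_sum)
      fix y assume "y \<in> mcball x R"
      then have e: "K y x = h F y x mod int n" "K x y = h F x y mod int n"
        using F(4) by (auto simp: K_def q_def)
      have "(h F y x - h F x y) - (K y x - K x y) = (h F y x - h F y x mod int n) - (h F x y - h F x y mod int n)"
        unfolding e by simp
      then show "int n dvd (h F y x - h F x y) - (K y x - K x y)"
        by (metis dvd_diff dvd_minus_mod)
    qed
    finally show ?thesis .
  qed
  define g where "g x = (if x \<in> X then (v x - bd R K x) div int n else 0)" for x
  have gn: "int n * g x = v x - bd R K x" if "x \<in> X" for x
    using dvd[OF that] that by (simp add: g_def)
  obtain p p' :: nat where p: "\<And>x. \<bar>colsum K x\<bar> \<le> int p" "\<And>x. \<bar>colsum (\<lambda>x y. K y x) x\<bar> \<le> int p'"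
    using colsum_bounded[OF Kb] colsum_bounded[OF band_swap[OF Kb]] by blast
  have "\<bar>g x\<bar> \<le> int (B + p + p')" for x
  proof (cases "x \<in> X")
    case True
    \<comment> \<open>As n is at least 1, g is no larger than n g, which is v minus the boundary of
      a bounded chain.\<close>
    have "\<bar>g x\<bar> \<le> \<bar>int n * g x\<bar>" using n by (simp add: abs_mult mult_le_cancel_right1)
    also have "\<dots> = \<bar>v x - (colsum K x - colsum (\<lambda>x y. K y x) x)\<bar>"
      using gn[OF True] bd_colsum[of K R x, OF KR] by simp
    also have "\<dots> \<le> int (B + p + p')" using v[of x] p(1)[of x] p(2)[of x] by simp
    finally show ?thesis .
  qed (simp add: g_def)
  moreover have "homologous v (\<lambda>x. int n * g x)"
    unfolding homologous_def
  proof (intro exI[of _ K] conjI ballI Kb)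
    fix x assume "x \<in> X"
    then show "v x - int n * g x = colsum K x - colsum (\<lambda>x y. K y x) x"
      using gn bd_colsum[of K R x, OF KR] by simp
  qed
  ultimately show ?thesis by (intro exI conjI allI)
qed

lemma Phi_eqI:
  assumes f: "f \<in> cfun (stone_cech X)" and g: "g \<in> cfun (stone_cech X)"
    and hom: "homologous (fr f) (fr g)"
  shows "Phi f = Phi g"
proof -
  let ?h = "\<lambda>u. f u + - g u"
  have h: "?h \<in> cfun (stone_cech X)" by (rule cfun_int_add[OF f cfun_int_uminus[OF g]])
  have "homologous (fr ?h) (\<lambda>_. 0)" using hom unfolding homologous_def by simp
  then have "Phi ?h = \<one>\<^bsub>K0 A\<^esub>" using Phi_one_iff[OF h] by blast
  moreover have "f = (\<lambda>u. ?h u + g u)" by simp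
  ultimately show ?thesis using Phi_add[OF h g] Phi_carrier[OF g] by simp
qed

lemma Phi_pow:
  assumes f: "f \<in> cfun (stone_cech X)"
  shows "(\<lambda>u. int n * f u) \<in> cfun (stone_cech X) \<and> Phi (\<lambda>u. int n * f u) = Phi f [^]\<^bsub>K0 A\<^esub> n"
proof (induction n)
  case 0
  have "(\<lambda>_. 0 :: int) \<in> cfun (stone_cech X)" by (simp add: cfun_def)
  moreover have "Phi (\<lambda>_. 0) = \<one>\<^bsub>K0 A\<^esub>" using P.hom_one by (simp add: Z_simps)
  ultimately show ?case by simp
next
  case (Suc n)
  have e: "(\<lambda>u. int (Suc n) * f u) = (\<lambda>u. int n * f u + f u)" by (auto simp: fun_eq_iff algebra_simps)
  show ?case unfolding e using Suc cfun_int_add[OF _ f] Phi_add[OF _ f] by simp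
qed

lemma sc_ext_int_cfun:
  fixes v :: "'a \<Rightarrow> int"
  assumes "\<And>x. \<bar>v x\<bar> \<le> int B" shows "sc_ext X v \<in> cfun (stone_cech X)"
proof (rule sc_ext_cfun[of "{-int B..int B}"])
  show "compact {-int B..int B}" by (rule finite_imp_compact) simp
  show "v x \<in> {-int B..int B}" for x using assms[of x] by auto
qed

text \<open>If f is homologous to n g, then \<open>Phi\<close> of the extension of g is an n-th root
  of \<open>Phi f\<close> within the image; this is the divisibility that
  \<open>divisible_subgroup_retract\<close> asks for.\<close>

lemma split_infinite:
  assumes cc: "coarsely_connected X d" and inf: "infinite X \<or> X = {}"
  shows "\<exists>\<rho> \<in> hom (K0 A) (H0 G). \<forall>c \<in> carrier (H0 G). \<rho> (comparison_map G c) = c"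
proof -
  have "\<exists>b\<in>Phi ` carrier Z. b [^]\<^bsub>K0 A\<^esub> n = a" if "a \<in> Phi ` carrier Z" "0 < n" for a and n :: nat
  proof -
    obtain f where f: "f \<in> cfun (stone_cech X)" "a = Phi f" using \<open>a \<in> Phi ` carrier Z\<close> by (auto simp: Z_simps)
    obtain B :: nat where B: "\<And>u. \<bar>f u\<bar> \<le> int B" using cfun_int_bounded[OF f(1)] by blast
    obtain g B' where g: "\<And>x. \<bar>g x\<bar> \<le> int B'" "homologous (fr f) (\<lambda>x. int n * g x)"
      using divisible[OF cc inf \<open>0 < n\<close>, of "fr f" B] B by blast
    have gc: "sc_ext X g \<in> cfun (stone_cech X)" by (rule sc_ext_int_cfun[OF g(1)])
    have "homologous (fr f) (fr (\<lambda>u. int n * sc_ext X g u))"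
      using g(2) unfolding homologous_def by (simp add: sc_ext_principal)
    then have "Phi f = Phi (\<lambda>u. int n * sc_ext X g u)"
      using Phi_eqI[OF f(1)] Phi_pow[OF gc] by blast
    then have "Phi (sc_ext X g) [^]\<^bsub>K0 A\<^esub> n = a" using Phi_pow[OF gc] f(2) by simp
    then show ?thesis using gc by (intro bexI[of _ "Phi (sc_ext X g)"]) (simp_all add: Z_simps)
  qed
  from K.divisible_subgroup_retract[OF P.img_is_subgroup this]
  obtain r where "r \<in> hom (K0 A) (K0 A)" "\<forall>x\<in>carrier (K0 A). r x \<in> Phi ` carrier Z" "\<forall>a\<in>Phi ` carrier Z. r a = a"
    by blast
  then show ?thesis by (intro split_of_retraction[of r]) auto
qed

text \<open>Integrality of the trace on projections lets it take values in the integers, so that it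
  can later be used as a weight of an integral function.\<close>

lemma trace_hom:
  assumes fin: "finite X" and x0: "x0 \<in> X"
  shows "\<exists>T :: _ \<Rightarrow> int. (\<forall>a\<in>projections A. \<forall>b\<in>projections A. of_int (T (A.K0class a b)) = tr x0 a - tr x0 b) \<and>
    (\<forall>x\<in>carrier (K0 A). \<forall>y\<in>carrier (K0 A). T (x \<otimes>\<^bsub>K0 A\<^esub> y) = T x + T y)"
proof -
  have "\<exists>z::int. p \<in> projections A \<longrightarrow> tr x0 p = of_int z" for p
    using tr_nat[OF fin x0, of p] by (metis of_int_of_nat_eq)
  then obtain t :: "_ \<Rightarrow> int" where t: "\<And>p. p \<in> projections A \<Longrightarrow> tr x0 p = of_int (t p)" by metis
  have wd: "t a - t b = t a' - t b'"
    if p: "a \<in> projections A" "b \<in> projections A" "a' \<in> projections A" "b' \<in> projections A"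
    and eq: "A.K0class a b = A.K0class a' b'" for a b a' b'
  proof -
    obtain c where c: "c \<in> projections A" "(dsum A (dsum A a b') c, dsum A (dsum A a' b) c) \<in> mvn_rel A"
      using A.K0class_eq_iff[OF p] eq by blast
    from tr_mvn[OF fin x0 c(2)] have "tr x0 a + tr x0 b' = tr x0 a' + tr x0 b" by (simp add: tr_dsum)
    then have "(of_int (t a + t b') :: complex) = of_int (t a' + t b)" using t p by simp
    then have "t a + t b' = t a' + t b" by (simp only: of_int_eq_iff)
    then show ?thesis by simp
  qed
  \<comment> \<open>Independence of the choice is \<open>wd\<close>: equality in \<open>K0\<close>
    is equivalence after adding projections, and the trace is additive and invariant under
    equivalence.\<close>
  define T where "T x = (SOME z. \<exists>a\<in>projections A. \<exists>b\<in>projections A. x = A.K0class a b \<and> z = t a - t b)" for x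
  have T: "T (A.K0class a b) = t a - t b" if p: "a \<in> projections A" "b \<in> projections A" for a b
  proof -
    have "\<exists>a'\<in>projections A. \<exists>b'\<in>projections A. A.K0class a b = A.K0class a' b' \<and> T (A.K0class a b) = t a' - t b'"
      unfolding T_def by (rule someI[of _ "t a - t b"]) (use p in blast)
    then obtain a' b' where "a' \<in> projections A" "b' \<in> projections A" "A.K0class a b = A.K0class a' b'"
      "T (A.K0class a b) = t a' - t b'" by blast
    then show ?thesis using wd[OF p] by simp
  qed
  have add: "t (dsum A a b) = t a + t b" if "a \<in> projections A" "b \<in> projections A" for a b
  proof -
    have "(of_int (t (dsum A a b)) :: complex) = of_int (t a + t b)"
      using t[OF A.dsum_projections[OF that]] t[OF that(1)] t[OF that(2)] by (simp add: tr_dsum)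
    then show ?thesis by (simp only: of_int_eq_iff)
  qed
  have "T (x \<otimes>\<^bsub>K0 A\<^esub> y) = T x + T y" if xy: "x \<in> carrier (K0 A)" "y \<in> carrier (K0 A)" for x y
  proof -
    obtain a b where x: "a \<in> projections A" "b \<in> projections A" "x = A.K0class a b" by (rule A.K0_cases[OF xy(1)])
    obtain a' b' where y: "a' \<in> projections A" "b' \<in> projections A" "y = A.K0class a' b'" by (rule A.K0_cases[OF xy(2)])
    show ?thesis
      unfolding x(3) y(3) A.K0class_mult[OF x(1,2) y(1,2)]
      using x y by (simp add: T add A.dsum_projections)
  qed
  moreover have "of_int (T (A.K0class a b)) = tr x0 a - tr x0 b" if "a \<in> projections A" "b \<in> projections A" for a b
    using T[OF that] t that by simp
  ultimately show ?thesis by blast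
qed

lemma card_lev:
  assumes fin: "finite X" and n: "\<And>x. x \<in> X \<Longrightarrow> v x \<le> int n"
  shows "int (card (lev v)) = (\<Sum>x\<in>X. max (v x) 0)"
proof -
  have s: "lev v \<subseteq> X \<times> {..<n}" by (rule lev_subset[OF n])
  have "card (lev v) = (\<Sum>x\<in>X. card {p \<in> lev v. fst p = x})"
    by (rule card_fibres[OF _ fin]) (use s fin in \<open>auto intro: finite_subset\<close>)
  also have "\<dots> = (\<Sum>x\<in>X. nat (v x))" by (rule sum.cong) (simp_all add: lev_fibre_card)
  finally have "int (card (lev v)) = (\<Sum>x\<in>X. int (nat (v x)))" by (simp only: of_nat_sum)
  also have "\<dots> = (\<Sum>x\<in>X. max (v x) 0)" by (rule sum.cong) auto
  finally show ?thesis .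
qed

text \<open>On a finite space every f is homologous to its total mass placed at x0, and the total
  mass is the trace of \<open>Phi f\<close>. Hence placing the trace at x0 and applying
  \<open>Phi\<close> fixes the image.\<close>

lemma split_finite:
  assumes fin: "finite X" and x0: "x0 \<in> X"
  shows "\<exists>\<rho> \<in> hom (K0 A) (H0 G). \<forall>c \<in> carrier (H0 G). \<rho> (comparison_map G c) = c"
proof -
  obtain T :: "_ \<Rightarrow> int" where
    T: "\<And>a b. a \<in> projections A \<Longrightarrow> b \<in> projections A \<Longrightarrow> of_int (T (A.K0class a b)) = tr x0 a - tr x0 b"
    and Tadd: "\<And>x y. x \<in> carrier (K0 A) \<Longrightarrow> y \<in> carrier (K0 A) \<Longrightarrow> T (x \<otimes>\<^bsub>K0 A\<^esub> y) = T x + T y"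
    using trace_hom[OF fin x0] by blast
  define dl where "dl z = sc_ext X (\<lambda>y. if y = x0 then z else (0::int))" for z
  have dlc: "dl z \<in> cfun (stone_cech X)" for z
    unfolding dl_def by (rule sc_ext_int_cfun[of _ "nat \<bar>z\<bar>"]) simp
  have dlf: "dl z (principal {x}) = (if x = x0 then z else 0)" if "x \<in> X" for z x
    unfolding dl_def using that by (simp add: sc_ext_principal)
  have dla: "dl (z + w) = (\<lambda>u. dl z u + dl w u)" for z w
    by (rule cfun_stone_cech_eqI[OF dlc cfun_int_add[OF dlc dlc]]) (simp add: dlf)
  define r where "r x = Phi (dl (T x))" for x
  show ?thesis
  proof (rule split_of_retraction[of r])
    show "r \<in> hom (K0 A) (K0 A)"
      by (rule homI) (simp_all add: r_def Phi_carrier dlc Tadd dla Phi_add)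
    show "r x \<in> Phi ` carrier Z" for x unfolding r_def using dlc by (simp add: Z_simps)
    fix f assume "f \<in> carrier Z"
    then have f: "f \<in> cfun (stone_cech X)" by (simp add: Z_simps)
    obtain n m where nm: "\<forall>u. f u \<le> int n" "\<forall>u. - f u \<le> int m"
      "Phi f = A.K0class (Dd (fr f) n) (Dd (\<lambda>x. - fr f x) m)" using Phi_K0class[OF f] by blast
    have n: "fr f x \<le> int n" and m: "- fr f x \<le> int m" for x using nm by auto
    let ?s = "\<Sum>x\<in>X. fr f x"
    have "of_int (T (Phi f)) = (of_nat (card (lev (fr f))) - of_nat (card (lev (\<lambda>x. - fr f x))) :: complex)"
      unfolding nm(3) using T[OF Dd_projection[OF n] Dd_projection[OF m]]
        tr_dproj[OF fin x0 lev_subset[OF n]] tr_dproj[OF fin x0 lev_subset[OF m]] by (simp add: Dd_def)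
    also have "\<dots> = of_int (int (card (lev (fr f))) - int (card (lev (\<lambda>x. - fr f x))))" by simp
    also have "int (card (lev (fr f))) - int (card (lev (\<lambda>x. - fr f x))) = ?s"
      unfolding card_lev[OF fin n] card_lev[OF fin m] sum_subtractf[symmetric] by (rule sum.cong) auto
    finally have Ts: "T (Phi f) = ?s" by (simp only: of_int_eq_iff)
    obtain B :: nat where B: "\<And>u. \<bar>f u\<bar> \<le> int B" using cfun_int_bounded[OF f] by blast
    \<comment> \<open>A star-shaped chain joining each b to x0 with weight f b: its column sums are
      the values of f, and its row sums vanish away from x0, where the sum is the total
      mass.\<close>
    define h where "h a b = (if a = x0 \<and> b \<in> X then fr f b else 0)" for a b
    \<comment> \<open>The diameter of the finite space, so every pair of points lies in the
      strip.\<close>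
    define R where "R = Max ((\<lambda>(a, b). d a b) ` (X \<times> X))"
    have hR: "(a, b) \<in> strip R" if "h a b \<noteq> 0" for a b
    proof -
      have ab: "a \<in> X" "b \<in> X" using that x0 by (auto simp: h_def split: if_splits)
      have "d a b \<le> R" unfolding R_def
        by (rule Max_ge) (use fin ab in \<open>auto intro!: image_eqI[of _ _ "(a, b)"]\<close>)
      then show ?thesis using ab by (simp add: strip_def)
    qed
    have hB: "\<bar>h a b\<bar> \<le> int B" for a b using B by (simp add: h_def)
    have hb: "band h" by (rule band_intI[OF hB hR])
    have "homologous (fr f) (fr (dl ?s))"
      unfolding homologous_def
    proof (intro exI[of _ h] conjI ballI hb)
      fix x assume x: "x \<in> X"
      have "colsum h x = (\<Sum>y\<in>X. h y x)"
        unfolding colsum_def by (rule sum.mono_neutral_left) (use fin x0 in \<open>auto simp: h_def\<close>)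
      also have "\<dots> = fr f x" using fin x x0 by (simp add: h_def)
      finally have 1: "colsum h x = fr f x" .
      have "colsum (\<lambda>x y. h y x) x = (\<Sum>y\<in>X. h x y)"
        unfolding colsum_def by (rule sum.mono_neutral_left) (use fin in \<open>auto simp: h_def\<close>)
      also have "\<dots> = (if x = x0 then ?s else 0)" by (auto simp: h_def)
      finally have 2: "colsum (\<lambda>x y. h y x) x = (if x = x0 then ?s else 0)" .
      show "fr f x - fr (dl ?s) x = colsum h x - colsum (\<lambda>x y. h y x) x"
        unfolding 1 2 using dlf[OF x] by simp
    qed
    then show "r (Phi f) = Phi f" unfolding r_def Ts using Phi_eqI[OF f dlc] by simp
  qed
qed

end

theorem theoremB:
  fixes X :: "'a set" and d :: "'a \<Rightarrow> 'a \<Rightarrow> real"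
    and G :: "(('a \<times> 'a) filter, 'a filter) top_groupoid"
  assumes metric: "Metric_space X d"
    and ulf: "uniformly_locally_finite X d"
    and G: "G = coarse_groupoid X d"
  shows "comparison_map G \<in> hom (H0 G) (K0 (reduced_algebra G))
    \<and> inj_on (comparison_map G) (carrier (H0 G))
    \<and> (coarsely_connected X d \<longrightarrow>
         (\<exists>\<rho> \<in> hom (K0 (reduced_algebra G)) (H0 G).
            \<forall>c \<in> carrier (H0 G). \<rho> (comparison_map G c) = c))"
proof -
  interpret coarse_space X d
    by (intro coarse_space.intro coarse_space_axioms.intro metric ulf)
  have "\<exists>\<rho> \<in> hom (K0 (reduced_algebra G)) (H0 G). \<forall>c \<in> carrier (H0 G). \<rho> (comparison_map G c) = c"
    if "coarsely_connected X d"
  proof (cases "infinite X \<or> X = {}")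
    \<comment> \<open>The empty space goes with the infinite ones: divisibility is trivial there,
      while the base point demanded by the finite case does not exist.\<close>
    case True
    from split_infinite[OF that this] show ?thesis unfolding G .
  next
    case False
    then obtain x0 where "finite X" "x0 \<in> X" by blast
    from split_finite[OF this] show ?thesis unfolding G .
  qed
  then show ?thesis using comparison_map_hom comparison_map_inj unfolding G by blast
qed

end
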